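(* Let $\alpha,\beta>0$ with $\alpha+\beta>1$, $m\in\mathbb{N}$, $0<R\le\infty$, $G\in\mathcal{G}^{1,m}_R$. Let $\omega_i,\tau_i\in\mathcal{W}(\Omega)$ and let $f_i:\Omega\to(-R,R)$ be such that $\int_\Omega\left|\frac{\partial^{\boldsymbol\lambda}f_i(\boldsymbol x)}{\Delta\boldsymbol x^{\boldsymbol\lambda}}\right|^{\alpha+\beta}\tau_i(\boldsymbol x)\Delta\boldsymbol x<R$ for $i=1,\dots,m$. If $f_i\in\mathcal{L}^{\alpha+\beta}_{\boldsymbol a}(\Omega,\tau_i,\boldsymbol\lambda)$ for all $i=1,\dots,m$ and $$K_\Omega:=\left[\int_\Omega\left(\sum_{i=1}^m[D_iG(V_1(\boldsymbol x),\dots,V_m(\boldsymbol x))]^{\frac{\alpha(\alpha+\beta-1)}{\beta}}\omega_i^{\frac{\alpha+\beta}{\beta}}(\boldsymbol x)\tau_i^{-\frac{\alpha}{\beta}}(\boldsymbol x)\right)\Delta\boldsymbol x\right]^{\frac{\beta}{\alpha+\beta}}<\infty,$$ where $$V_i(\boldsymbol x):=\int_{\Omega_{\boldsymbol x}}\big(H_{\boldsymbol\lambda}(\boldsymbol x,\boldsymbol t)\big)^{\frac{\alpha+\beta}{\alpha+\beta-1}}(\tau_i(\boldsymbol t))^{\frac{1}{1-\alpha-\beta}}\Delta\boldsymbol t,\qquad\boldsymbol x\in\Omega,\ i=1,\dots,m,$$ then $$\int_\Omega\left(\sum_{i=1}^m[D_iG(|f_1(\boldsymbol x)|,\dots,|f_m(\boldsymbol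 x)|)]^\alpha\left|\frac{\partial^{\boldsymbol\lambda}f_i(\boldsymbol x)}{\Delta\boldsymbol x^{\boldsymbol\lambda}}\right|^\alpha\omega_i(\boldsymbol x)\right)\Delta\boldsymbol x$$ $$\le K_\Omega\left[G\left(\int_\Omega\left|\frac{\partial^{\boldsymbol\lambda}f_1(\boldsymbol x)}{\Delta\boldsymbol x^{\boldsymbol\lambda}}\right|^{\alpha+\beta}\tau_1(\boldsymbol x)\Delta\boldsymbol x,\dots,\int_\Omega\left|\frac{\partial^{\boldsymbol\lambda}f_m(\boldsymbol x)}{\Delta\boldsymbol x^{\boldsymbol\lambda}}\right|^{\alpha+\beta}\tau_m(\boldsymbol x)\Delta\boldsymbol x\right)\right]^{\frac{\alpha}{\alpha+\beta}}.$$
   Context: Let $n\in\mathbb{N}$, let $\mathbb{T}_1,\dots,\mathbb{T}_n$ be time scales (nonempty closed subsets of $\mathbb{R}$) with forward and backward jump operators $\sigma_j,\rho_j$, and $\Lambda^n=\mathbb{T}_1\times\cdots\times\mathbb{T}_n$. Put $\rho_j^0(x_j)=x_j$ and $\rho_j^k=\rho_j\circ\rho_j^{k-1}$. Inequalities between vectors are componentwise ($\boldsymbol x<\boldsymbol y$ means $x_j<y_j$ for all $j$). $\boldsymbol\lambda=(\lambda_1,\dots,\lambda_n)$ is a multi-index with $\boldsymbol\lambda\ge\boldsymbol 1=(1,\dots,1)$; $\boldsymbol a,\boldsymbol b\in\Lambda^n$ satisfy $\boldsymbol a<\boldsymbol\rho^{\boldsymbol\lambda-\boldsymbol 1}(\boldsymbol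 b)=(\rho_1^{\lambda_1-1}(b_1),\dots,\rho_n^{\lambda_n-1}(b_n))$. $\Omega=\{\boldsymbol x\in\Lambda^n:\boldsymbol a\le\boldsymbol x\le\boldsymbol b\}$ and, for $\boldsymbol x\in\Omega$, $\Omega_{\boldsymbol x}=\{\boldsymbol t\in\Lambda^n:\boldsymbol a\le\boldsymbol t\le\boldsymbol x\}$. Integrals over these sets are $n$-fold iterated delta integrals, $\int_\Omega=\int_{a_1}^{b_1}\cdots\int_{a_n}^{b_n}$, $\int_{\Omega_{\boldsymbol x}}=\int_{a_1}^{x_1}\cdots\int_{a_n}^{x_n}$. The partial delta derivative $\frac{\partial f(\boldsymbol x)}{\Delta_jx_j}$ is $\lim_{t_j\to x_j,\ t_j\ne\sigma_j(x_j)}\frac{f(x_1,\dots,\sigma_j(x_j),\dots,x_n)-f(x_1,\dots,t_j,\dots,x_n)}{\sigma_j(x_j)-t_j}$; higher-order ones are defined by iteration; $\frac{\partial^{\boldsymbol\lambda}f}{\Delta\boldsymbol x^{\boldsymbol\lambda}}=\frac{\partial^{\lambda_1+\cdots+\lambda_n}f}{\Delta_1x_1^{\lambda_1}\cdots\Delta_nx_n^{\lambda_n}}$. $\mathcal{W}(\Omega)$ is the set of positive-valued rd-continuous functions (weights) on $\Omega$. $C^{n\boldsymbol\lambda}_{\rm rd}(\Omega)$ is the set of $f:\Omega\to\mathbb{R}$ having rd-continuous derivatives $\frac{\partial^{k_1+\cdots+k_j}f}{\Delta_1x_1^{k_1}\cdots\Delta_jx_j^{k_j}}$ for $1\le k_j\le\lambda_j$,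 $j=1,\dots,n$. For $p\ge1$, $\tau\in\mathcal{W}(\Omega)$, $\mathcal{L}^p_{\boldsymbol a}(\Omega,\tau,\boldsymbol\lambda)$ is the set of $f\in C^{n\boldsymbol\lambda}_{\rm rd}(\Omega)$ with $\frac{\partial^{k_j}f(\boldsymbol x)}{\Delta_jx_j^{k_j}}\big|_{x_j=a_j}=0$ for $0\le k_j\le\lambda_j-1$, $j=1,\dots,n$, and $\int_\Omega\left|\frac{\partial^{\boldsymbol\lambda}f(\boldsymbol x)}{\Delta\boldsymbol x^{\boldsymbol\lambda}}\right|^p\tau(\boldsymbol x)\Delta\boldsymbol x<\infty$. $H_{\boldsymbol\lambda}(\boldsymbol x,\boldsymbol t)=\prod_{j=1}^n h^{(j)}_{\lambda_j-1}(x_j,\sigma_j(t_j))$, where $h^{(j)}_0\equiv1$ and $h^{(j)}_{k+1}(t,s)=\int_s^th^{(j)}_k(u,s)\Delta u$ for $t,s\in\mathbb{T}_j$. $\mathcal{G}^{1,m}_R$ is the class of all $G:(-R,R)^m\to\mathbb{R}$ such that (i) $G\in C^1((-R,R)^m)$; (ii) $G(0,\dots,0)=0$; (iii) for conjugate exponents $p,q$ ($1/p+1/q=1$), if $x_i\le y_i^{1/p}z_i^{1/q}$ with $0<x_i,y_i,z_i<R$ for $i=1,\dots,m$, then $0\le D_iG(x_1,\dots,x_m)\le[D_iG(y_1,\dots,y_m)]^{1/p}[D_iG(z_1,\dots,z_m)]^{1/q}$ for each $i$, where $D_i=\partial/\partial t_i$. The finiteness hypothesis on $K_\Omega$ includes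 that it is well defined, i.e. that the arguments $V_i(\boldsymbol x)$ lie in the domain of $G$. *)

theory Defs
  imports "HOL-Analysis.Analysis"
begin

section \<open>Time scales\<close>

definition time_scale :: "real set \<Rightarrow> bool" where
  "time_scale T \<longleftrightarrow> T \<noteq> {} \<and> closed T"

text \<open>The usual conventions \<open>inf {} = sup T\<close> and \<open>sup {} = inf T\<close> make a largest (smallest)
  point of \<open>T\<close> a fixed point of the forward (backward) jump operator.\<close>

definition fwd_jump :: "real set \<Rightarrow> real \<Rightarrow> real" where
  "fwd_jump T t = (if \<exists>s\<in>T. t < s then Inf {s \<in> T. t < s} else t)"

definition bwd_jump :: "real set \<Rightarrow> real \<Rightarrow> real" where
  "bwd_jump T t = (if \<exists>s\<in>T. s < t then Sup {s \<in> T. s < t} else t)"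

definition right_dense :: "real set \<Rightarrow> real \<Rightarrow> bool" where
  "right_dense T t \<longleftrightarrow> t \<in> T \<and> (\<exists>s\<in>T. t < s) \<and> fwd_jump T t = t"

definition left_dense :: "real set \<Rightarrow> real \<Rightarrow> bool" where
  "left_dense T t \<longleftrightarrow> t \<in> T \<and> (\<exists>s\<in>T. s < t) \<and> bwd_jump T t = t"

section \<open>The delta integral\<close>

text \<open>The Lebesgue delta-measure on \<open>[a,b) \<inter> T\<close>: the Caratheodory extension of
  \<open>[c,d) \<inter> T \<mapsto> d - c\<close> for \<open>c \<le> d\<close> in \<open>T\<close>. Since \<open>extend_measure\<close> falls back to the zero
  measure when no extension exists, the lemma below records that it does exist.\<close>

definition delta_measure :: "real set \<Rightarrow> real \<Rightarrow> real \<Rightarrow> real measure" where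
  "delta_measure T a b =
     extend_measure (T \<inter> {a..<b}) {(c, d). c \<in> T \<and> d \<in> T \<and> a \<le> c \<and> c \<le> d \<and> d \<le> b}
       (\<lambda>(c, d). T \<inter> {c..<d}) (\<lambda>(c, d). ennreal (d - c))"

lemma emeasure_delta_measure:
  assumes T: "time_scale T" and a: "a \<in> T" and b: "b \<in> T"
    and cd: "c \<in> T" "d \<in> T" "a \<le> c" "c \<le> d" "d \<le> b"
  shows "emeasure (delta_measure T a b) (T \<inter> {c..<d}) = ennreal (d - c)"
proof -
  let ?I = "{(c, d). c \<in> T \<and> d \<in> T \<and> a \<le> c \<and> c \<le> d \<and> d \<le> b}"
  let ?G = "\<lambda>(c, d). T \<inter> {c..<d}"
  let ?M = "delta_measure T a b"
  define p where "p s = Sup (T \<inter> {..s})" for s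
  have cl: "closed T" using T by (simp add: time_scale_def)
  have pT: "p s \<in> T \<inter> {..s}" if "a \<le> s" for s
    unfolding p_def
  proof (rule closed_contains_Sup)
    show "T \<inter> {..s} \<noteq> {}" using that a by blast
    show "bdd_above (T \<inter> {..s})" by (rule bdd_aboveI[of _ s]) simp
    show "closed (T \<inter> {..s})" using cl by (simp add: closed_Int)
  qed
  have pge: "c \<le> p s" if "c \<in> T" "c \<le> s" for c s
    unfolding p_def
  proof (rule cSup_upper)
    show "c \<in> T \<inter> {..s}" using that by simp
    show "bdd_above (T \<inter> {..s})" by (rule bdd_aboveI[of _ s]) simp
  qed
  have sets: "sets ?M = sigma_sets (T \<inter> {a..<b}) (?G ` ?I)"
    unfolding delta_measure_def by (subst sets_extend_measure) auto
  have space: "space ?M = T \<inter> {a..<b}"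
    unfolding delta_measure_def by (subst space_extend_measure) auto
  have vimg: "p -` (T \<inter> {c..<d}) \<inter> {a..<b} = {c..<d}"
    if "c \<in> T" "d \<in> T" "a \<le> c" "c \<le> d" "d \<le> b" for c d
  proof (intro equalityI subsetI)
    fix s assume s: "s \<in> p -` (T \<inter> {c..<d}) \<inter> {a..<b}"
    then have "a \<le> s" "c \<le> p s" "p s < d" by auto
    with pT[of s] pge[OF that(2), of s] show "s \<in> {c..<d}" by (simp, linarith)
  next
    fix s assume "s \<in> {c..<d}"
    with that pT[of s] pge[OF that(1), of s] show "s \<in> p -` (T \<inter> {c..<d}) \<inter> {a..<b}" by simp
  qed
  let ?R = "restrict_space lborel {a..<b}"
  have meas: "p \<in> measurable ?R ?M"
  proof (rule measurable_sigma_sets[OF sets])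
    show "p \<in> space ?R \<rightarrow> T \<inter> {a..<b}"
    proof
      fix s assume "s \<in> space ?R"
      then have s: "a \<le> s" "s < b" by (auto simp: space_restrict_space)
      with pT[OF s(1)] pge[OF a s(1)] show "p s \<in> T \<inter> {a..<b}" by simp
    qed
    fix y assume "y \<in> ?G ` ?I"
    then obtain c d where "c \<in> T" "d \<in> T" "a \<le> c" "c \<le> d" "d \<le> b" "y = T \<inter> {c..<d}" by auto
    then have "p -` y \<inter> space ?R = {c..<d}" and "{c..<d} \<subseteq> {a..<b}"
      using vimg[of c d] by (simp_all add: space_restrict_space)
    then show "p -` y \<inter> space ?R \<in> sets ?R"
      by (simp add: sets_restrict_space_iff)
  qed auto
  let ?D = "distr ?R ?M p"
  have val: "emeasure ?D (T \<inter> {c..<d}) = ennreal (d - c)"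
    if "c \<in> T" "d \<in> T" "a \<le> c" "c \<le> d" "d \<le> b" for c d
  proof -
    have "T \<inter> {c..<d} \<in> sets ?M"
      unfolding sets using that by (intro sigma_sets.Basic) auto
    then have "emeasure ?D (T \<inter> {c..<d}) = emeasure ?R (p -` (T \<inter> {c..<d}) \<inter> space ?R)"
      by (rule emeasure_distr[OF meas])
    also have "\<dots> = emeasure lborel {c..<d}"
    proof -
      have "p -` (T \<inter> {c..<d}) \<inter> space ?R = {c..<d}" and "{c..<d} \<subseteq> {a..<b}"
        using vimg[OF that] that by (simp_all add: space_restrict_space)
      then show ?thesis by (simp add: emeasure_restrict_space)
    qed
    finally show ?thesis using that by simp
  qed
  have pos: "positive (sets ?M) (emeasure ?D)" by (simp add: positive_def)
  have ca: "countably_additive (sets ?M) (emeasure ?D)"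
    using emeasure_countably_additive[of ?D] by simp
  show ?thesis
  proof (rule emeasure_extend_measure_Pair[OF delta_measure_def _ _ pos ca])
    show "emeasure ?D (T \<inter> {c..<d}) = ennreal (d - c)"
      if "c \<in> T \<and> d \<in> T \<and> a \<le> c \<and> c \<le> d \<and> d \<le> b" for c d
      using that by (intro val) simp_all
  qed (use cd in auto)
qed

definition delta_integral :: "real set \<Rightarrow> real \<Rightarrow> real \<Rightarrow> (real \<Rightarrow> real) \<Rightarrow> real" where
  "delta_integral T a b g =
     (if a \<le> b then integral\<^sup>L (delta_measure T a b) g else - integral\<^sup>L (delta_measure T b a) g)"

primrec ts_monomial :: "real set \<Rightarrow> nat \<Rightarrow> real \<Rightarrow> real \<Rightarrow> real" where
  "ts_monomial T 0 = (\<lambda>t s. 1)"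
| "ts_monomial T (Suc k) = (\<lambda>t s. delta_integral T s t (\<lambda>u. ts_monomial T k u s))"

section \<open>Boxes in a product of time scales\<close>

text \<open>A point of \<open>\<Lambda>\<^sup>n\<close> is an extensional function on \<open>{1..n}\<close>, and the time scales are
  \<open>T 1, \<dots>, T n\<close>.\<close>

definition ts_prod :: "nat \<Rightarrow> (nat \<Rightarrow> real set) \<Rightarrow> (nat \<Rightarrow> real) set" where
  "ts_prod n T = PiE {1..n} T"

definition ts_box :: "nat \<Rightarrow> (nat \<Rightarrow> real set) \<Rightarrow> (nat \<Rightarrow> real) \<Rightarrow> (nat \<Rightarrow> real) \<Rightarrow> (nat \<Rightarrow> real) set" where
  "ts_box n T a b = {x \<in> ts_prod n T. \<forall>j\<in>{1..n}. a j \<le> x j \<and> x j \<le> b j}"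

text \<open>Iterated delta integral of a nonnegative function, the head of the list being the outermost
  variable. It takes the value \<open>\<infinity>\<close> exactly when the integral diverges.\<close>

primrec iter_integral ::
  "(nat \<Rightarrow> real set) \<Rightarrow> (nat \<Rightarrow> real) \<Rightarrow> (nat \<Rightarrow> real) \<Rightarrow> nat list \<Rightarrow> ((nat \<Rightarrow> real) \<Rightarrow> ennreal)
    \<Rightarrow> (nat \<Rightarrow> real) \<Rightarrow> ennreal" where
  "iter_integral T a b [] F x = F x"
| "iter_integral T a b (j # js) F x =
     (\<integral>\<^sup>+ t. iter_integral T a b js F (x(j := t)) \<partial>delta_measure (T j) (a j) (b j))"

definition box_integral ::
  "nat \<Rightarrow> (nat \<Rightarrow> real set) \<Rightarrow> (nat \<Rightarrow> real) \<Rightarrow> (nat \<Rightarrow> real) \<Rightarrow> ((nat \<Rightarrow> real) \<Rightarrow> ennreal) \<Rightarrow> ennreal" where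
  "box_integral n T a b F = iter_integral T a b [1..<Suc n] F (\<lambda>_. undefined)"

section \<open>Partial delta derivatives\<close>

text \<open>A real function defined only on part of \<open>\<Lambda>\<^sup>n\<close> is a pair of its domain and a total function
  that is irrelevant off the domain.\<close>

type_synonym pfun = "(nat \<Rightarrow> real) set \<times> ((nat \<Rightarrow> real) \<Rightarrow> real)"

text \<open>The filter of the limit \<open>t \<rightarrow> x\<^sub>j\<close>, \<open>t \<noteq> \<sigma>\<^sub>j(x\<^sub>j)\<close>, with \<open>t\<close> restricted to where the function is
  defined. Unlike in the filter \<open>at (x j) within S\<close>, the point \<open>t = x\<^sub>j\<close> is admitted when
  \<open>\<sigma>\<^sub>j(x\<^sub>j) \<noteq> x\<^sub>j\<close>; at isolated points it is the only one.\<close>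

definition delta_filter :: "(nat \<Rightarrow> real set) \<Rightarrow> nat \<Rightarrow> (nat \<Rightarrow> real) set \<Rightarrow> (nat \<Rightarrow> real) \<Rightarrow> real filter" where
  "delta_filter T j A x =
     inf (nhds (x j)) (principal {t. x(j := t) \<in> A \<and> t \<noteq> fwd_jump (T j) (x j)})"

definition delta_quot :: "(nat \<Rightarrow> real set) \<Rightarrow> nat \<Rightarrow> ((nat \<Rightarrow> real) \<Rightarrow> real) \<Rightarrow> (nat \<Rightarrow> real) \<Rightarrow> real \<Rightarrow> real" where
  "delta_quot T j g x t =
     (g (x(j := fwd_jump (T j) (x j))) - g (x(j := t))) / (fwd_jump (T j) (x j) - t)"

text \<open>The points at which the defining limit of the derivative makes sense for a function with
  domain \<open>A\<close>. Starting from a box \<open>\<Omega>\<close>, the first derivative makes sense unless \<open>\<sigma>\<^sub>j(x\<^sub>j)\<close> leaves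
  \<open>\<Omega>\<close> or \<open>x\<^sub>j = b\<^sub>j\<close> is left-scattered.\<close>

definition delta_dom :: "(nat \<Rightarrow> real set) \<Rightarrow> nat \<Rightarrow> (nat \<Rightarrow> real) set \<Rightarrow> (nat \<Rightarrow> real) set" where
  "delta_dom T j A = {x \<in> A. x(j := fwd_jump (T j) (x j)) \<in> A \<and> delta_filter T j A x \<noteq> bot}"

definition delta_differentiable :: "(nat \<Rightarrow> real set) \<Rightarrow> nat \<Rightarrow> pfun \<Rightarrow> bool" where
  "delta_differentiable T j P \<longleftrightarrow>
     (\<forall>x\<in>delta_dom T j (fst P). \<exists>l. (delta_quot T j (snd P) x \<longlongrightarrow> l) (delta_filter T j (fst P) x))"

text \<open>Off its domain the derivative is set to \<open>0\<close>, so that integrals over \<open>\<Omega>\<close> of expressions in a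
  derivative only see the points where that derivative makes sense.\<close>

definition delta_deriv :: "(nat \<Rightarrow> real set) \<Rightarrow> nat \<Rightarrow> pfun \<Rightarrow> pfun" where
  "delta_deriv T j P =
     (delta_dom T j (fst P),
      \<lambda>x. if x \<in> delta_dom T j (fst P)
           then Lim (delta_filter T j (fst P) x) (delta_quot T j (snd P) x) else 0)"

text \<open>\<open>mixed_deriv T k j P\<close> differentiates \<open>k 1\<close> times in the first variable, then \<open>k 2\<close> times in the
  second, and so on up to the \<open>j\<close>-th variable.\<close>

primrec mixed_deriv :: "(nat \<Rightarrow> real set) \<Rightarrow> (nat \<Rightarrow> nat) \<Rightarrow> nat \<Rightarrow> pfun \<Rightarrow> pfun" where
  "mixed_deriv T k 0 P = P"
| "mixed_deriv T k (Suc j) P = (delta_deriv T (Suc j) ^^ k (Suc j)) (mixed_deriv T k j P)"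

definition full_deriv ::
  "nat \<Rightarrow> (nat \<Rightarrow> real set) \<Rightarrow> (nat \<Rightarrow> real) \<Rightarrow> (nat \<Rightarrow> real) \<Rightarrow> (nat \<Rightarrow> nat)
    \<Rightarrow> ((nat \<Rightarrow> real) \<Rightarrow> real) \<Rightarrow> (nat \<Rightarrow> real) \<Rightarrow> real" where
  "full_deriv n T a b lam f = snd (mixed_deriv T lam n (ts_box n T a b, f))"

section \<open>Function classes\<close>

text \<open>Rd-continuity of a function of several variables is rd-continuity in each variable
  separately.\<close>

definition rd_continuous :: "nat \<Rightarrow> (nat \<Rightarrow> real set) \<Rightarrow> pfun \<Rightarrow> bool" where
  "rd_continuous n T P \<longleftrightarrow>
     (\<forall>j\<in>{1..n}. \<forall>x\<in>fst P.
        (right_dense (T j) (x j) \<longrightarrow>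
           ((\<lambda>t. snd P (x(j := t))) \<longlongrightarrow> snd P x) (at (x j) within {t. x(j := t) \<in> fst P})) \<and>
        (left_dense (T j) (x j) \<longrightarrow>
           (\<exists>l. ((\<lambda>t. snd P (x(j := t))) \<longlongrightarrow> l) (at (x j) within {t. x(j := t) \<in> fst P \<and> t < x j}))))"

definition weights ::
  "nat \<Rightarrow> (nat \<Rightarrow> real set) \<Rightarrow> (nat \<Rightarrow> real) \<Rightarrow> (nat \<Rightarrow> real) \<Rightarrow> ((nat \<Rightarrow> real) \<Rightarrow> real) set" where
  "weights n T a b =
     {w. rd_continuous n T (ts_box n T a b, w) \<and> (\<forall>x\<in>ts_box n T a b. 0 < w x)}"

definition Crd_class ::
  "nat \<Rightarrow> (nat \<Rightarrow> real set) \<Rightarrow> (nat \<Rightarrow> real) \<Rightarrow> (nat \<Rightarrow> real) \<Rightarrow> (nat \<Rightarrow> nat)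
    \<Rightarrow> ((nat \<Rightarrow> real) \<Rightarrow> real) set" where
  "Crd_class n T a b lam =
     {f. \<forall>j\<in>{1..n}. \<forall>k. (\<forall>i\<in>{1..j}. 1 \<le> k i \<and> k i \<le> lam i) \<longrightarrow>
           delta_differentiable T j
             ((delta_deriv T j ^^ (k j - 1)) (mixed_deriv T k (j - 1) (ts_box n T a b, f))) \<and>
           rd_continuous n T (mixed_deriv T k j (ts_box n T a b, f))}"

definition Lp_class ::
  "nat \<Rightarrow> (nat \<Rightarrow> real set) \<Rightarrow> (nat \<Rightarrow> real) \<Rightarrow> (nat \<Rightarrow> real) \<Rightarrow> (nat \<Rightarrow> nat) \<Rightarrow> real
    \<Rightarrow> ((nat \<Rightarrow> real) \<Rightarrow> real) \<Rightarrow> ((nat \<Rightarrow> real) \<Rightarrow> real) set" where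
  "Lp_class n T a b lam p \<tau> =
     {f \<in> Crd_class n T a b lam.
        (\<forall>j\<in>{1..n}. \<forall>k<lam j.
           (\<forall>i<k. delta_differentiable T j ((delta_deriv T j ^^ i) (ts_box n T a b, f))) \<and>
           (\<forall>x\<in>ts_box n T a b. x j = a j \<longrightarrow> snd ((delta_deriv T j ^^ k) (ts_box n T a b, f)) x = 0)) \<and>
        box_integral n T a b (\<lambda>x. ennreal (\<bar>full_deriv n T a b lam f x\<bar> powr p * \<tau> x)) < \<infinity>}"

definition H_kernel ::
  "nat \<Rightarrow> (nat \<Rightarrow> real set) \<Rightarrow> (nat \<Rightarrow> nat) \<Rightarrow> (nat \<Rightarrow> real) \<Rightarrow> (nat \<Rightarrow> real) \<Rightarrow> real" where
  "H_kernel n T lam x t = (\<Prod>j=1..n. ts_monomial (T j) (lam j - 1) (x j) (fwd_jump (T j) (t j)))"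

definition open_cube :: "ereal \<Rightarrow> (real ^ 'm) set" where
  "open_cube R = {x. \<forall>i. - R < ereal (x $ i) \<and> ereal (x $ i) < R}"

definition coord_line :: "(real ^ 'm \<Rightarrow> real) \<Rightarrow> 'm \<Rightarrow> real ^ 'm \<Rightarrow> real \<Rightarrow> real" where
  "coord_line G i x s = G (\<chi> k. if k = i then s else x $ k)"

definition pderiv_at :: "'m \<Rightarrow> (real ^ 'm \<Rightarrow> real) \<Rightarrow> real ^ 'm \<Rightarrow> real" where
  "pderiv_at i G x = deriv (coord_line G i x) (x $ i)"

definition C1_on_cube :: "ereal \<Rightarrow> (real ^ 'm::finite \<Rightarrow> real) \<Rightarrow> bool" where
  "C1_on_cube R G \<longleftrightarrow>
     (\<forall>i. (\<forall>x\<in>open_cube R. coord_line G i x field_differentiable at (x $ i)) \<and>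
          continuous_on (open_cube R) (pderiv_at i G))"

definition G_class :: "ereal \<Rightarrow> (real ^ 'm::finite \<Rightarrow> real) set" where
  "G_class R =
     {G. C1_on_cube R G \<and> G 0 = 0 \<and>
         (\<forall>p q. 1 < p \<and> 1 < q \<and> 1 / p + 1 / q = 1 \<longrightarrow>
           (\<forall>x y z. (\<forall>i. 0 < x $ i \<and> ereal (x $ i) < R \<and> 0 < y $ i \<and> ereal (y $ i) < R \<and>
                          0 < z $ i \<and> ereal (z $ i) < R \<and>
                          x $ i \<le> (y $ i) powr (1 / p) * (z $ i) powr (1 / q)) \<longrightarrow>
              (\<forall>i. 0 \<le> pderiv_at i G x \<and>
                   pderiv_at i G x \<le> pderiv_at i G y powr (1 / p) * pderiv_at i G z powr (1 / q))))}"

end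

theory Submission
  imports Defs
begin

text \<open>Since the derivatives of \<open>f\<close> vanish at \<open>x\<^sub>j = a\<^sub>j\<close>, Taylor's formula applied in one variable after the other gives
  \<open>|f(x)| \<le> \<integral> H(x, t) |D f(t)|\<close> over \<open>\<Omega>\<^sub>x\<close>, hence \<open>|f\<^sub>i| \<le> Y\<^sub>i\<^sup>1\<^sup>/\<^sup>p V\<^sub>i\<^sup>1\<^sup>/\<^sup>q\<close> by Hoelder, where \<open>p = \<alpha> + \<beta>\<close> and
  \<open>Y\<^sub>i(x)\<close> is the integral of \<open>|D f\<^sub>i|\<^sup>p \<tau>\<^sub>i\<close> over \<open>\<Omega>\<^sub>x\<close>. Condition (iii) on \<open>G\<close> and Hoelder with exponents \<open>p/\<beta>\<close> and \<open>p/\<alpha>\<close>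
  split off the factor \<open>K\<close> and leave \<open>\<integral> \<Sum>\<^sub>i D\<^sub>i G(Y) |D f\<^sub>i|\<^sup>p \<tau>\<^sub>i\<close>. As \<open>D\<^sub>i G\<close> is increasing, \<open>Y\<close> may be enlarged to a function of
  \<open>x\<^sub>1\<close> alone, after which the integral is that of a derivative and is at most \<open>G(U)\<close>.

  Taylor's formula in the \<open>j\<close>-th variable needs the zero data for \<open>f\<close> differentiated in the earlier variables, whereas the
  hypothesis gives it for \<open>f\<close> itself. Mixed derivatives in the other order need not exist, so this transfer is a separate
  argument, by Baire category.\<close>

section \<open>Delta measures\<close>

text \<open>What shapes the transfer is that rd-continuity is separate in each variable, so a limit
  in \<open>x j\<close> cannot be interchanged with derivatives in the lower variables. Evaluation
  at a fixed value of \<open>x j\<close> can be, and so can finite combinations of values. The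
  argument therefore compares growth along a sequence tending from the right to a right-dense point:
  a nonzero derivative of order \<open>l + 1\<close> forces growth like the monomial of that order,
  whereas finitely many values of \<open>f\<close> are of smaller order. Right-scattered coordinates
  need no limit, since a derivative there is a difference quotient.

  Every delta measure lives on a half-open interval, so the points with \<open>x i = b i\<close>,
  where derivatives may fail to make sense, lie outside the measure space and can be excluded. Below
  \<open>x\<close> the strict inequality \<open>t < x\<close> gives
  \<open>fwd_jump T t \<le> x\<close>, which keeps the monomials nonnegative.

  At the end, a chain rule for \<open>G\<close> along a function of \<open>n\<close> variables would
  involve mixed derivatives of order \<open>n\<close>, while \<open>G\<close> is only of class C1.
  With \<open>x 1\<close> as the single parameter, first-order increments of \<open>G\<close> are
  enough.\<close>

lemma closed_Sup_atMost:
  fixes T :: "real set"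
  assumes "closed T" "t \<in> T" "t \<le> c"
  shows "Sup (T \<inter> {..c}) \<in> T" "t \<le> Sup (T \<inter> {..c})" "Sup (T \<inter> {..c}) \<le> c"
proof -
  have bd: "bdd_above (T \<inter> {..c})" by (rule bdd_aboveI[of _ c]) simp
  have "Sup (T \<inter> {..c}) \<in> T \<inter> {..c}"
    using assms bd by (intro closed_contains_Sup closed_Int) auto
  then show "Sup (T \<inter> {..c}) \<in> T" "Sup (T \<inter> {..c}) \<le> c" by auto
  show "t \<le> Sup (T \<inter> {..c})" using assms bd by (intro cSup_upper) auto
qed

lemma closed_Inf_atLeast:
  fixes T :: "real set"
  assumes "closed T" "t \<in> T" "c \<le> t"
  shows "Inf (T \<inter> {c..}) \<in> T" "Inf (T \<inter> {c..}) \<le> t" "c \<le> Inf (T \<inter> {c..})"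
proof -
  have bd: "bdd_below (T \<inter> {c..})" by (rule bdd_belowI[of _ c]) simp
  have "Inf (T \<inter> {c..}) \<in> T \<inter> {c..}"
    using assms bd by (intro closed_contains_Inf closed_Int) auto
  then show "Inf (T \<inter> {c..}) \<in> T" "c \<le> Inf (T \<inter> {c..})" by auto
  show "Inf (T \<inter> {c..}) \<le> t" using assms bd by (intro cInf_lower) auto
qed

lemma
  assumes "closed T" "t \<in> T"
  shows fwd_jump_in: "fwd_jump T t \<in> T" and fwd_jump_ge: "t \<le> fwd_jump T t"
    and fwd_jump_gap: "s \<in> T \<Longrightarrow> t < s \<Longrightarrow> fwd_jump T t \<le> s"
proof -
  have bd: "bdd_below {s \<in> T. t < s}" by (rule bdd_belowI[of _ t]) simp
  show ge: "t \<le> fwd_jump T t"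
    unfolding fwd_jump_def by (auto intro!: cInf_greatest)
  show "s \<in> T \<Longrightarrow> t < s \<Longrightarrow> fwd_jump T t \<le> s"
    unfolding fwd_jump_def using bd by (auto intro!: cInf_lower)
  show "fwd_jump T t \<in> T"
  proof (cases "\<exists>s\<in>T. t < s")
    case True
    then have ne: "{s \<in> T. t < s} \<noteq> {}" by auto
    have "Inf {s \<in> T. t < s} \<in> closure {s \<in> T. t < s}"
      by (rule closure_contains_Inf[OF ne bd])
    also have "\<dots> \<subseteq> T" by (rule closure_minimal) (use assms in auto)
    finally show ?thesis using True by (simp add: fwd_jump_def)
  next
    case False then show ?thesis using assms by (simp add: fwd_jump_def)
  qed
qed

text \<open>The larger point \<open>s\<close> rules out the maximum of \<open>T\<close>, which the
  convention for \<open>fwd_jump\<close> also makes a fixed point.\<close>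

lemma right_dense_limit:
  assumes "closed T" "t \<in> T" "fwd_jump T t = t" "s \<in> T" "t < s" "0 < e"
  obtains r where "r \<in> T" "t < r" "r < s" "r < t + e"
proof -
  have ne: "{s \<in> T. t < s} \<noteq> {}" using assms by auto
  have bd: "bdd_below {s \<in> T. t < s}" by (rule bdd_belowI[of _ t]) simp
  have "Inf {s \<in> T. t < s} = t" using assms by (auto simp: fwd_jump_def split: if_splits)
  then have "Inf {s \<in> T. t < s} < min s (t + e)" using assms by simp
  then obtain r where "r \<in> {s \<in> T. t < s}" "r < min s (t + e)" 
    using cInf_less_iff[OF ne bd] by blast
  then show ?thesis using that by auto
qed

lemma space_delta_measure [simp]: "space (delta_measure T a b) = T \<inter> {a..<b}"
  unfolding delta_measure_def by (subst space_extend_measure) auto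

lemma sets_delta_measure_sigma:
  "sets (delta_measure T a b) = sigma_sets (T \<inter> {a..<b})
     {T \<inter> {c..<d} | c d. c \<in> T \<and> d \<in> T \<and> a \<le> c \<and> c \<le> d \<and> d \<le> b}"
proof -
  have "sets (delta_measure T a b) = sigma_sets (T \<inter> {a..<b})
     ((\<lambda>(c, d). T \<inter> {c..<d}) ` {(c, d). c \<in> T \<and> d \<in> T \<and> a \<le> c \<and> c \<le> d \<and> d \<le> b})"
    unfolding delta_measure_def by (subst sets_extend_measure) auto
  also have "(\<lambda>(c, d). T \<inter> {c..<d}) ` {(c, d). c \<in> T \<and> d \<in> T \<and> a \<le> c \<and> c \<le> d \<and> d \<le> b} =
    {T \<inter> {c..<d} | c d. c \<in> T \<and> d \<in> T \<and> a \<le> c \<and> c \<le> d \<and> d \<le> b}" by auto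
  finally show ?thesis .
qed

lemma sets_delta_measure:
  assumes T: "closed T" and a: "a \<in> T" and b: "b \<in> T"
  shows "sets (delta_measure T a b) = sets (restrict_space borel (T \<inter> {a..<b}))"
proof (rule antisym)
  have Tb: "T \<in> sets borel" using T by simp
  let ?S = "T \<inter> {a..<b}"
  have S: "?S \<in> sets borel" using Tb by auto
  show "sets (delta_measure T a b) \<subseteq> sets (restrict_space borel ?S)"
    unfolding sets_delta_measure_sigma
  proof (rule sigma_sets_le_sets_iff[THEN iffD2, rotated] | rule sets.sigma_sets_subset')+
    show "?S \<in> sets (restrict_space borel ?S)" using S by (simp add: sets_restrict_space_iff)
    show "{T \<inter> {c..<d} |c d. c \<in> T \<and> d \<in> T \<and> a \<le> c \<and> c \<le> d \<and> d \<le> b} \<subseteq> sets (restrict_space borel ?S)"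
      using S Tb by (auto simp: sets_restrict_space_iff)
  qed
  have "sets (restrict_space borel ?S) = sigma_sets ?S ((\<inter>) ?S ` range lessThan)"
  proof -
    have "restrict_space borel ?S = restrict_space (sigma UNIV (range lessThan)) ?S"
      by (simp add: borel_Iio)
    have "sets (borel :: real measure) = sigma_sets UNIV (range lessThan)"
      by (subst borel_Iio) (simp)
    then have "sets (restrict_space borel ?S) = (\<inter>) ?S ` sigma_sets UNIV (range lessThan)"
      by (simp add: sets_restrict_space)
    also have "\<dots> = sigma_sets ?S ((\<inter>) ?S ` range lessThan)"
      using sigma_sets_Int[of ?S UNIV "range lessThan"] S \<open>sets (borel :: real measure) = _\<close> 
      by (simp add: image_def Int_commute) 
    finally show ?thesis .
  qed
  also have "\<dots> \<subseteq> sets (delta_measure T a b)"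
  proof (rule sets.sigma_sets_subset')
    show "T \<inter> {a..<b} \<in> sets (delta_measure T a b)"
      using sets.top[of "delta_measure T a b"] by simp
    show "(\<inter>) ?S ` range lessThan \<subseteq> sets (delta_measure T a b)"
    proof safe
      fix s :: real
      consider "s \<le> a" | "b \<le> s" | "a < s" "s < b" by linarith
      then show "?S \<inter> {..<s} \<in> sets (delta_measure T a b)"
      proof cases
        case 1 then have "?S \<inter> {..<s} = {}" by auto
        then show ?thesis by simp
      next
        case 2 then have "?S \<inter> {..<s} = ?S" by auto
        then show ?thesis using sets.top[of "delta_measure T a b"] by simp
      next
        case 3
        define d where "d = Inf (T \<inter> {s..})"
        have d: "d \<in> T" "d \<le> b" "s \<le> d"
          unfolding d_def using closed_Inf_atLeast[OF T b, of s] 3 by auto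
        have "t < s \<longleftrightarrow> t < d" if "t \<in> T" for t
          using closed_Inf_atLeast(2)[OF T that, of s] d by (fold d_def) force
        then have "?S \<inter> {..<s} = T \<inter> {a..<d}" using 3 d by auto
        moreover have "T \<inter> {a..<d} \<in> {T \<inter> {c..<d} | c d. c \<in> T \<and> d \<in> T \<and> a \<le> c \<and> c \<le> d \<and> d \<le> b}"
          using a d 3 by fastforce
        ultimately show ?thesis unfolding sets_delta_measure_sigma by (simp add: sigma_sets.Basic)
      qed
    qed
  qed
  finally show "sets (restrict_space borel ?S) \<subseteq> sets (delta_measure T a b)" .
qed

lemma emeasure_delta_measure_Icc:
  assumes T: "closed T" and cd: "c \<in> T" "d \<in> T" "a \<le> c" "c \<le> d" "d \<le> b" and ab: "a \<in> T" "b \<in> T"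
  shows "emeasure (delta_measure T a b) (T \<inter> {c..<d}) = ennreal (d - c)"
  using emeasure_delta_measure[OF _ ab cd] T cd by (auto simp: time_scale_def)

lemma emeasure_space_delta_measure:
  assumes "closed T" "a \<in> T" "b \<in> T" "a \<le> b"
  shows "emeasure (delta_measure T a b) (T \<inter> {a..<b}) = ennreal (b - a)"
  using emeasure_delta_measure_Icc[of T a b a b] assms by simp

lemma finite_measure_delta_measure:
  assumes "closed T" "a \<in> T" "b \<in> T"
  shows "finite_measure (delta_measure T a b)"
proof (cases "a \<le> b")
  case True
  then show ?thesis using emeasure_space_delta_measure[OF assms True] by (intro finite_measureI) simp
next
  case False
  then have "T \<inter> {a..<b} = {}" by auto
  then show ?thesis by (intro finite_measureI) simp
qed

text \<open>Both sides agree on the half-open intervals inside \<open>{c..<d}\<close> with ends in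
  \<open>T\<close>, which generate the sigma-algebra and are stable under intersection.\<close>

lemma delta_measure_restrict:
  assumes T: "closed T" and cd: "c \<in> T" "d \<in> T" "a \<le> c" "c \<le> d" "d \<le> b" and ab: "a \<in> T" "b \<in> T"
  shows "delta_measure T c d = restrict_space (delta_measure T a b) {c..<d}"
proof -
  let ?E = "{T \<inter> {c'..<d'} | c' d'. c' \<in> T \<and> d' \<in> T \<and> c \<le> c' \<and> c' \<le> d' \<and> d' \<le> d}"
  have sub: "T \<inter> {a..<b} \<inter> {c..<d} = T \<inter> {c..<d}" using cd by auto
  have Tb: "T \<in> sets borel" using T by simp
  have meas: "{c..<d} \<inter> space (delta_measure T a b) \<in> sets (delta_measure T a b)"
    unfolding sets_delta_measure[OF T ab] using Tb by (auto simp: sets_restrict_space_iff)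
  show ?thesis
  proof (rule measure_eqI_generator_eq[where E = ?E and \<Omega> = "T \<inter> {c..<d}" and A = "\<lambda>_. T \<inter> {c..<d}"])
    show "Int_stable ?E"
    proof (rule Int_stableI)
      fix X Y assume "X \<in> ?E" "Y \<in> ?E"
      then obtain c1 d1 c2 d2 where X: "X = T \<inter> {c1..<d1}" "c1 \<in> T" "d1 \<in> T" "c \<le> c1" "c1 \<le> d1" "d1 \<le> d"
        and Y: "Y = T \<inter> {c2..<d2}" "c2 \<in> T" "d2 \<in> T" "c \<le> c2" "c2 \<le> d2" "d2 \<le> d" by auto
      \<comment> \<open>The outer maximum keeps the endpoints ordered when the two intervals are
        disjoint; the intersection is then the empty interval at \<open>max c1 c2\<close>.\<close>
      have eq: "X \<inter> Y = T \<inter> {max c1 c2..<max (max c1 c2) (min d1 d2)}" unfolding X(1) Y(1) by auto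
      have "max c1 c2 \<in> T" "max (max c1 c2) (min d1 d2) \<in> T" using X Y by (auto simp: max_def min_def)
      moreover have "c \<le> max c1 c2" "max (max c1 c2) (min d1 d2) \<le> d" using X Y by auto
      ultimately show "X \<inter> Y \<in> ?E" unfolding eq by fastforce
    qed
    show "?E \<subseteq> Pow (T \<inter> {c..<d})" by auto
    show "sets (delta_measure T c d) = sigma_sets (T \<inter> {c..<d}) ?E" by (rule sets_delta_measure_sigma)
    have "sets (restrict_space (delta_measure T a b) {c..<d}) = sets (delta_measure T c d)"
      unfolding sets_delta_measure[OF T cd(1,2)]
      using sets_restrict_restrict_space[of borel "T \<inter> {a..<b}" "{c..<d}"] sub
      by (simp add: sets_restrict_space sets_delta_measure[OF T ab])
    then show "sets (restrict_space (delta_measure T a b) {c..<d}) = sigma_sets (T \<inter> {c..<d}) ?E"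
      unfolding sets_delta_measure_sigma .
    show "emeasure (delta_measure T c d) X = emeasure (restrict_space (delta_measure T a b) {c..<d}) X"
      if "X \<in> ?E" for X
    proof -
      from that obtain c1 d1 where X: "X = T \<inter> {c1..<d1}" "c1 \<in> T" "d1 \<in> T" "c \<le> c1" "c1 \<le> d1" "d1 \<le> d"
        by auto
      have "emeasure (restrict_space (delta_measure T a b) {c..<d}) X = emeasure (delta_measure T a b) X"
        using X meas by (intro emeasure_restrict_space) auto
      also have "\<dots> = ennreal (d1 - c1)" unfolding X(1)
        using X cd ab by (intro emeasure_delta_measure_Icc T) auto
      also have "\<dots> = emeasure (delta_measure T c d) X" unfolding X(1)
        using X cd ab by (intro emeasure_delta_measure_Icc[symmetric] T) auto
      finally show ?thesis by simp
    qed
    show "range (\<lambda>_. T \<inter> {c..<d}) \<subseteq> ?E" using cd by auto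
    show "(\<Union>i. T \<inter> {c..<d}) = T \<inter> {c..<d}" by simp
    show "emeasure (delta_measure T c d) (T \<inter> {c..<d}) \<noteq> \<infinity>"
      using emeasure_space_delta_measure[OF T cd(1,2,4)] by simp
  qed
qed

lemma nn_integral_delta_measure_restrict:
  assumes T: "closed T" and cd: "c \<in> T" "d \<in> T" "a \<le> c" "c \<le> d" "d \<le> b" and ab: "a \<in> T" "b \<in> T"
  shows "(\<integral>\<^sup>+t. F t \<partial>delta_measure T c d) = (\<integral>\<^sup>+t. F t * indicator {c..<d} t \<partial>delta_measure T a b)"
proof -
  have Tb: "T \<in> sets borel" using T by simp
  have meas: "{c..<d} \<inter> space (delta_measure T a b) \<in> sets (delta_measure T a b)"
    unfolding sets_delta_measure[OF T ab] using Tb by (auto simp: sets_restrict_space_iff)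
  show ?thesis unfolding delta_measure_restrict[OF assms]
    by (rule nn_integral_restrict_space[OF meas])
qed

lemma measurable_delta_measure_borel:
  assumes "closed T" "a \<in> T" "b \<in> T"
  shows "(\<lambda>t. t) \<in> borel_measurable (delta_measure T a b)"
  by (subst measurable_cong_sets[OF sets_delta_measure[OF assms] refl])
    (rule measurable_restrict_space1, simp)

section \<open>Delta derivatives in one variable\<close>

text \<open>One-variable counterpart of \<open>delta_filter\<close>. Partial derivatives are reduced
  to the one-variable notions defined here by freezing all coordinates but one, see
  \<open>delta_deriv_line\<close>.\<close>

definition delta_nhds :: "real set \<Rightarrow> real set \<Rightarrow> real \<Rightarrow> real filter" where
  "delta_nhds T A t = inf (nhds t) (principal {s \<in> A. s \<noteq> fwd_jump T t})"

definition ddom :: "real set \<Rightarrow> real set \<Rightarrow> real set" where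
  "ddom T A = {t \<in> A. fwd_jump T t \<in> A \<and> delta_nhds T A t \<noteq> bot}"

definition dquot :: "real set \<Rightarrow> (real \<Rightarrow> real) \<Rightarrow> real \<Rightarrow> real \<Rightarrow> real" where
  "dquot T v t s = (v (fwd_jump T t) - v s) / (fwd_jump T t - s)"

definition dder :: "real set \<Rightarrow> real set \<Rightarrow> (real \<Rightarrow> real) \<Rightarrow> real \<Rightarrow> real" where
  "dder T A v t = (if t \<in> ddom T A then Lim (delta_nhds T A t) (dquot T v t) else 0)"

primrec dders :: "real set \<Rightarrow> real set \<Rightarrow> nat \<Rightarrow> (real \<Rightarrow> real) \<Rightarrow> real \<Rightarrow> real" where
  "dders T A 0 v = v"
| "dders T A (Suc k) v = dder T ((ddom T ^^ k) A) (dders T A k v)"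

definition ddiff :: "real set \<Rightarrow> real set \<Rightarrow> (real \<Rightarrow> real) \<Rightarrow> bool" where
  "ddiff T A v \<longleftrightarrow> (\<forall>t\<in>ddom T A. \<exists>l. (dquot T v t \<longlongrightarrow> l) (delta_nhds T A t))"

text \<open>Inductions on the order apply their hypothesis to \<open>dder T A v\<close>, so the
  innermost derivative has to be split off instead of the outermost.\<close>

lemma dders_Suc_shift: "dders T A (Suc k) v = dders T (ddom T A) k (dder T A v)"
  by (induction k) (simp_all add: funpow_swap1)

lemma ddom_subset: "ddom T A \<subseteq> A"
  by (auto simp: ddom_def)

lemma ddom_funpow_subset: "(ddom T ^^ k) A \<subseteq> A"
  by (induction k) (use ddom_subset in fastforce)+

lemma ddom_funpow_antimono: "i \<le> k \<Longrightarrow> (ddom T ^^ k) A \<subseteq> (ddom T ^^ i) A"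
proof (induction k rule: dec_induct)
  case (step k) then show ?case using ddom_subset[of T "(ddom T ^^ k) A"] by auto
qed simp

lemma dder_tendsto:
  assumes "ddiff T A v" "t \<in> ddom T A"
  shows "(dquot T v t \<longlongrightarrow> dder T A v t) (delta_nhds T A t)"
proof -
  obtain l where l: "(dquot T v t \<longlongrightarrow> l) (delta_nhds T A t)"
    using assms by (auto simp: ddiff_def)
  have "delta_nhds T A t \<noteq> bot" using assms by (auto simp: ddom_def)
  then have "Lim (delta_nhds T A t) (dquot T v t) = l" using l by (rule tendsto_Lim)
  then show ?thesis using l assms by (simp add: dder_def)
qed

lemma eventually_delta_nhds:
  "eventually P (delta_nhds T A t) \<longleftrightarrow>
    (\<exists>d>0. \<forall>s\<in>A. s \<noteq> fwd_jump T t \<longrightarrow> \<bar>s - t\<bar> < d \<longrightarrow> P s)"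
  unfolding delta_nhds_def eventually_inf_principal eventually_nhds_metric dist_real_def by auto

text \<open>At a right-scattered \<open>t\<close> every set of the filter contains \<open>t\<close>
  itself, so the limit can only be the quotient at \<open>s = t\<close>.\<close>

lemma dder_scattered:
  assumes "ddiff T A v" "t \<in> ddom T A" "fwd_jump T t \<noteq> t"
  shows "dder T A v t = (v (fwd_jump T t) - v t) / (fwd_jump T t - t)"
proof (rule ccontr)
  define l where "l = dder T A v t"
  assume ne: "dder T A v t \<noteq> (v (fwd_jump T t) - v t) / (fwd_jump T t - t)"
  then have "\<bar>dquot T v t t - l\<bar> > 0" by (simp add: dquot_def l_def)
  then have "eventually (\<lambda>s. dist (dquot T v t s) l < \<bar>dquot T v t t - l\<bar>) (delta_nhds T A t)"
    using dder_tendsto[OF assms(1,2)] unfolding l_def by (rule tendstoD[rotated])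
  then obtain d where "d > 0"
    "\<forall>s\<in>A. s \<noteq> fwd_jump T t \<longrightarrow> \<bar>s - t\<bar> < d \<longrightarrow> dist (dquot T v t s) l < \<bar>dquot T v t t - l\<bar>"
    unfolding eventually_delta_nhds by auto
  moreover have "t \<in> A" using assms ddom_subset by auto
  ultimately have "dist (dquot T v t t) l < \<bar>dquot T v t t - l\<bar>" using assms by auto
  then show False by (simp add: dist_real_def)
qed

lemma dder_dense:
  assumes "ddiff T A v" "t \<in> ddom T A" "fwd_jump T t = t" "0 < e"
  obtains d where "d > 0" "\<And>s. s \<in> A \<Longrightarrow> \<bar>s - t\<bar> < d \<Longrightarrow> \<bar>v s - v t - dder T A v t * (s - t)\<bar> \<le> e * \<bar>s - t\<bar>"
proof -
  define l where "l = dder T A v t"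
  have "eventually (\<lambda>s. dist (dquot T v t s) l < e) (delta_nhds T A t)"
    using dder_tendsto[OF assms(1,2)] \<open>0 < e\<close> unfolding l_def by (rule tendstoD)
  then obtain d where d: "d > 0"
    "\<forall>s\<in>A. s \<noteq> t \<longrightarrow> \<bar>s - t\<bar> < d \<longrightarrow> dist (dquot T v t s) l < e"
    unfolding eventually_delta_nhds using assms by auto
  show ?thesis
  proof (rule that[OF d(1)])
    fix s assume s: "s \<in> A" "\<bar>s - t\<bar> < d"
    show "\<bar>v s - v t - dder T A v t * (s - t)\<bar> \<le> e * \<bar>s - t\<bar>"
    proof (cases "s = t")
      case False
      then have "\<bar>(v t - v s) / (t - s) - l\<bar> < e"
        using d s assms by (auto simp: dquot_def dist_real_def)
      then have "\<bar>(v t - v s) / (t - s) - l\<bar> * \<bar>s - t\<bar> \<le> e * \<bar>s - t\<bar>"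
        by (intro mult_right_mono) auto
      moreover have "((v t - v s) / (t - s) - l) * (s - t) = v s - v t - l * (s - t)"
        using False by (simp add: field_simps)
      ultimately show ?thesis by (simp add: l_def abs_mult[symmetric])
    qed simp
  qed
qed

lemma dder_continuous:
  assumes "ddiff T A v" "t \<in> ddom T A"  "0 < e"
  obtains d where "d > 0" "\<And>s. s \<in> A \<Longrightarrow> \<bar>s - t\<bar> < d \<Longrightarrow> \<bar>v s - v t\<bar> < e"
proof (cases "fwd_jump T t = t")
  case True
  define l where "l = dder T A v t"
  obtain d where d: "d > 0" "\<And>s. s \<in> A \<Longrightarrow> \<bar>s - t\<bar> < d \<Longrightarrow> \<bar>v s - v t - l * (s - t)\<bar> \<le> 1 * \<bar>s - t\<bar>"
    unfolding l_def using dder_dense[OF assms(1,2) True zero_less_one] by blast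
  define d' where "d' = min d (e / (\<bar>l\<bar> + 1))"
  show ?thesis
  proof (rule that)
    show "d' > 0" using d assms by (simp add: d'_def)
    fix s assume s: "s \<in> A" "\<bar>s - t\<bar> < d'"
    then have "\<bar>v s - v t - l * (s - t)\<bar> \<le> \<bar>s - t\<bar>" using d by (auto simp: d'_def)
    then have "\<bar>v s - v t\<bar> \<le> \<bar>l * (s - t)\<bar> + \<bar>s - t\<bar>" by linarith
    also have "\<dots> = (\<bar>l\<bar> + 1) * \<bar>s - t\<bar>" by (simp add: abs_mult distrib_right)
    also have "\<dots> < e" using s by (simp add: d'_def field_simps)
    finally show "\<bar>v s - v t\<bar> < e" .
  qed
next
  case False
  let ?g = "fwd_jump T t"
  have lim: "(dquot T v t \<longlongrightarrow> (v ?g - v t) / (?g - t)) (delta_nhds T A t)"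
    using dder_tendsto[OF assms(1,2)] dder_scattered[OF assms(1,2) False] by simp
  have id: "((\<lambda>s. s) \<longlongrightarrow> t) (delta_nhds T A t)"
    unfolding delta_nhds_def by (rule tendsto_mono[OF inf_le1]) (rule filterlim_ident)
  \<comment> \<open>Solving the quotient for \<open>v s\<close> turns its convergence into
    convergence of \<open>v s\<close> to \<open>v t\<close>.\<close>
  have "((\<lambda>s. v ?g - dquot T v t s * (?g - s)) \<longlongrightarrow> v ?g - (v ?g - v t) / (?g - t) * (?g - t)) (delta_nhds T A t)"
    by (intro tendsto_intros lim id)
  then have "((\<lambda>s. v ?g - dquot T v t s * (?g - s)) \<longlongrightarrow> v t) (delta_nhds T A t)"
    using False by simp
  then have "eventually (\<lambda>s. dist (v ?g - dquot T v t s * (?g - s)) (v t) < e) (delta_nhds T A t)"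
    using assms by (intro tendstoD)
  then obtain d where d: "d > 0" "\<forall>s\<in>A. s \<noteq> ?g \<longrightarrow> \<bar>s - t\<bar> < d \<longrightarrow> dist (v ?g - dquot T v t s * (?g - s)) (v t) < e"
    unfolding eventually_delta_nhds by auto
  show ?thesis
  proof (rule that)
    show "min d \<bar>?g - t\<bar> > 0" using d False by simp
    fix s assume s: "s \<in> A" "\<bar>s - t\<bar> < min d \<bar>?g - t\<bar>"
    then have "s \<noteq> ?g" by auto
    then have "dist (v ?g - dquot T v t s * (?g - s)) (v t) < e" using d s by auto
    moreover have "v ?g - dquot T v t s * (?g - s) = v s" using \<open>s \<noteq> ?g\<close> by (simp add: dquot_def)
    ultimately show "\<bar>v s - v t\<bar> < e" by (simp add: dist_real_def)
  qed
qed

text \<open>Domains of functions of one variable, closed under passing to smaller points of the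
  time scale above \<open>a\<close>; repeated differentiation only removes points at the upper end.\<close>

definition down_closed :: "real set \<Rightarrow> real \<Rightarrow> real set \<Rightarrow> bool" where
  "down_closed T a A \<longleftrightarrow> A \<subseteq> T \<inter> {a..} \<and> (\<forall>t\<in>A. T \<inter> {a..t} \<subseteq> A)"

lemma down_closedD:
  assumes "down_closed T a A" "t \<in> A"
  shows "t \<in> T" "a \<le> t" "r \<in> T \<Longrightarrow> a \<le> r \<Longrightarrow> r \<le> t \<Longrightarrow> r \<in> A"
  using assms by (fastforce simp: down_closed_def)+

text \<open>A point below another point of the domain survives differentiation: its jump is still at
  most \<open>t\<close>, and the filter is nontrivial because it sees points of \<open>T\<close> to
  the right of a right-dense \<open>s\<close>, or \<open>s\<close> itself if \<open>s\<close> is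
  scattered.\<close>

lemma down_closed_ddomI:
  assumes T: "closed T" and A: "down_closed T a A" and s: "s \<in> T" "a \<le> s" "s < t" "t \<in> A"
  shows "s \<in> ddom T A"
proof -
  have sA: "s \<in> A" and tT: "t \<in> T" and AT: "\<And>r. r \<in> T \<Longrightarrow> a \<le> r \<Longrightarrow> r \<le> t \<Longrightarrow> r \<in> A" 
    using down_closedD[OF A s(4)] s by auto
  have g: "fwd_jump T s \<in> T" "s \<le> fwd_jump T s" "fwd_jump T s \<le> t"
    using fwd_jump_in[OF T] fwd_jump_ge[OF T] fwd_jump_gap[OF T] s tT by auto
  have "fwd_jump T s \<in> A" using AT g s by auto
  moreover have "delta_nhds T A s \<noteq> bot"
  proof
    assume "delta_nhds T A s = bot"
    then have "eventually (\<lambda>_. False) (delta_nhds T A s)" by simp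
    then obtain d where d: "d > 0" "\<forall>r\<in>A. r \<noteq> fwd_jump T s \<longrightarrow> \<bar>r - s\<bar> < d \<longrightarrow> False"
      unfolding eventually_delta_nhds by auto
    show False
    proof (cases "fwd_jump T s = s")
      case True
      obtain r where "r \<in> T" "s < r" "r < t" "r < s + d"
        using right_dense_limit[OF T s(1) True tT s(3) d(1)] by blast
      then show False using d True AT[of r] s by auto
    next
      case False then show False using d sA by auto
    qed
  qed
  ultimately show ?thesis using sA by (simp add: ddom_def)
qed

lemma down_closed_ddom:
  assumes "closed T" "down_closed T a A"
  shows "down_closed T a (ddom T A)"
  unfolding down_closed_def
proof (intro conjI ballI subsetI)
  fix s assume "s \<in> ddom T A" then show "s \<in> T \<inter> {a..}"
    using down_closedD[OF assms(2), of s] ddom_subset[of T A] by auto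
next
  fix t s assume t: "t \<in> ddom T A" and s: "s \<in> T \<inter> {a..t}"
  show "s \<in> ddom T A"
  proof (cases "s = t")
    case False
    then show ?thesis using s t ddom_subset by (intro down_closed_ddomI[OF assms, of s t]) auto
  qed (use t in simp)
qed

lemma down_closed_ddom_funpow:
  "closed T \<Longrightarrow> down_closed T a A \<Longrightarrow> down_closed T a ((ddom T ^^ k) A)"
  by (induction k) (auto intro: down_closed_ddom)

lemma down_closed_atLeastAtMost: "down_closed T a (T \<inter> {a..b})"
  by (auto simp: down_closed_def)

text \<open>Each differentiation keeps all points strictly below a given point of the domain, and to
  the right of a right-dense \<open>s\<close> there is always another such point.\<close>

lemma right_dense_in_ddom_funpow:
  assumes T: "closed T" and A: "down_closed T a A"
    and s: "s \<in> T" "a \<le> s" "s < t" "t \<in> A" "fwd_jump T s = s"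
  shows "\<exists>r. s < r \<and> r \<le> t \<and> r \<in> (ddom T ^^ k) A"
proof (induction k)
  case 0 then show ?case using s by auto
next
  case (Suc k)
  then obtain r where r: "s < r" "r \<le> t" "r \<in> (ddom T ^^ k) A" by auto
  have dc: "down_closed T a ((ddom T ^^ k) A)" using T A by (rule down_closed_ddom_funpow)
  then have "r \<in> T" using r by (auto simp: down_closed_def)
  then obtain r' where r': "r' \<in> T" "s < r'" "r' < r"
    using right_dense_limit[OF T s(1,5) _ r(1) zero_less_one] by blast
  then have "r' \<in> ddom T ((ddom T ^^ k) A)" using s r by (intro down_closed_ddomI[OF T dc _ _ r'(3) r(3)]) auto
  then show ?case using r r' by (intro exI[of _ r']) auto
qed

text \<open>This replaces the mean value theorem. For fixed \<open>e\<close>, take the supremum of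
  the points up to which \<open>\<phi> r \<ge> \<phi> c - e * (r - c)\<close> holds:
  \<open>L\<close> carries the bound to the supremum, and \<open>R\<close> pushes past it unless it
  is \<open>d\<close>. Then \<open>e\<close> tends to 0. Since \<open>R\<close> only asks for slack
  proportional to the length, first-order expansions at right-dense points are enough.\<close>

lemma time_scale_monotone:
  fixes \<phi> :: "real \<Rightarrow> real"
  assumes T: "closed T" and c: "c \<in> T" and d: "d \<in> T" and cd: "c \<le> d"
    and R: "\<And>t e. t \<in> T \<Longrightarrow> c \<le> t \<Longrightarrow> t < d \<Longrightarrow> 0 < e \<Longrightarrow>
      \<exists>s\<in>T. t < s \<and> s \<le> d \<and> (\<forall>r\<in>T. t < r \<longrightarrow> r \<le> s \<longrightarrow> \<phi> r \<ge> \<phi> t - e * (r - t))"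
    and L: "\<And>t e. t \<in> T \<Longrightarrow> c < t \<Longrightarrow> t \<le> d \<Longrightarrow> 0 < e \<Longrightarrow>
      \<exists>\<delta>>0. \<forall>r\<in>T. c \<le> r \<longrightarrow> r < t \<longrightarrow> t - \<delta> < r \<longrightarrow> \<phi> r \<le> \<phi> t + e"
  shows "\<phi> c \<le> \<phi> d"
proof -
  have *: "\<phi> d \<ge> \<phi> c - e * (d - c)" if e: "e > 0" for e
  proof -
    define S where "S = {t \<in> T. c \<le> t \<and> t \<le> d \<and> (\<forall>r\<in>T. c \<le> r \<longrightarrow> r \<le> t \<longrightarrow> \<phi> r \<ge> \<phi> c - e * (r - c))}"
    have cS: "c \<in> S" using c cd by (auto simp: S_def) 
    have bd: "bdd_above S" by (rule bdd_aboveI[of _ d]) (simp add: S_def)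
    define s where "s = Sup S"
    have cs: "c \<le> s" unfolding s_def using cS bd by (rule cSup_upper)
    have sd: "s \<le> d" unfolding s_def using cS by (intro cSup_least) (auto simp: S_def)
    have sT: "s \<in> T"
    proof -
      have "s \<in> closure S" unfolding s_def using cS bd by (intro closure_contains_Sup) auto
      also have "\<dots> \<subseteq> T" by (rule closure_minimal) (use T in \<open>auto simp: S_def\<close>)
      finally show ?thesis .
    qed
    have below: "\<phi> r \<ge> \<phi> c - e * (r - c)" if "r \<in> T" "c \<le> r" "r < s" for r
    proof -
      from that(3) obtain t where "t \<in> S" "r < t"
        unfolding s_def using less_cSup_iff[OF _ bd] cS by auto
      then show ?thesis using that by (auto simp: S_def)
    qed
    have sS: "\<phi> s \<ge> \<phi> c - e * (s - c)"
    proof (cases "s \<in> S")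
      case True then show ?thesis using sT cs by (auto simp: S_def)
    next
      case False
      then have cs': "c < s" using cS cs by (cases "c = s") auto
      show ?thesis
      proof (rule field_le_epsilon)
        fix e' :: real assume "e' > 0"
        then obtain \<delta> where \<delta>: "\<delta> > 0" "\<forall>r\<in>T. c \<le> r \<longrightarrow> r < s \<longrightarrow> s - \<delta> < r \<longrightarrow> \<phi> r \<le> \<phi> s + e'"
          using L[OF sT cs' sd] by blast
        have "s - \<delta> < Sup S" using \<delta> by (simp add: s_def)
        then obtain r where r: "r \<in> S" "s - \<delta> < r" using less_cSup_iff[OF _ bd] cS by blast
        have "r \<le> s" unfolding s_def using r bd by (intro cSup_upper)
        with False r have "r < s" by (cases "r = s") auto
        have rT: "r \<in> T" "c \<le> r" using r by (auto simp: S_def)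
        have "\<phi> c - e * (s - c) \<le> \<phi> c - e * (r - c)" using e \<open>r < s\<close> by simp
        also have "\<dots> \<le> \<phi> r" using below rT \<open>r < s\<close> by auto
        also have "\<dots> \<le> \<phi> s + e'" using \<delta> rT r \<open>r < s\<close> by auto
        finally show "\<phi> c - e * (s - c) \<le> \<phi> s + e'" .
      qed
    qed
    have "s = d"
    proof (rule ccontr)
      assume "s \<noteq> d"
      then have "s < d" using sd by simp
      then obtain s' where s': "s' \<in> T" "s < s'" "s' \<le> d" "\<forall>r\<in>T. s < r \<longrightarrow> r \<le> s' \<longrightarrow> \<phi> r \<ge> \<phi> s - e * (r - s)"
        using R[OF sT cs _ e] by blast
      have "s' \<in> S" unfolding S_def
      proof (intro CollectI conjI ballI impI)
        show "s' \<in> T" "c \<le> s'" "s' \<le> d" using s' cs by auto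
        fix r assume r: "r \<in> T" "c \<le> r" "r \<le> s'"
        consider "r < s" | "r = s" | "s < r" by linarith
        then show "\<phi> r \<ge> \<phi> c - e * (r - c)"
        proof cases
          case 3
          then have "\<phi> r \<ge> \<phi> s - e * (r - s)" using s' r by auto
          with sS show ?thesis by (simp add: algebra_simps)
        qed (use below[of r] sS r in auto)
      qed
      then have "s' \<le> s" unfolding s_def using bd by (rule cSup_upper)
      then show False using s' by simp
    qed
    then show ?thesis using sS by simp
  qed
  show ?thesis
  proof (rule field_le_epsilon)
    fix e :: real assume e: "e > 0"
    \<comment> \<open>The summand 1 in the denominator covers \<open>c = d\<close>.\<close>
    have "e / (d - c + 1) * (d - c) \<le> e" using e cd by (simp add: field_simps)
    then show "\<phi> c \<le> \<phi> d + e" using *[of "e / (d - c + 1)"] e cd by simp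
  qed
qed

text \<open>At a right-scattered \<open>t\<close> the condition is vacuous for small
  \<open>d\<close>. It is the part of rd-continuity on which measurability and the growth estimates
  rest; \<open>s < b\<close> matches the half-open support of the delta measure.\<close>

definition right_cont_on :: "real set \<Rightarrow> real \<Rightarrow> real \<Rightarrow> (real \<Rightarrow> real) \<Rightarrow> bool" where
  "right_cont_on T a b \<phi> \<longleftrightarrow> (\<forall>t\<in>T. a \<le> t \<longrightarrow> t < b \<longrightarrow>
     (\<forall>e>0. \<exists>d>0. \<forall>s\<in>T. t < s \<longrightarrow> s < b \<longrightarrow> s < t + d \<longrightarrow> \<bar>\<phi> s - \<phi> t\<bar> < e))"

lemma right_cont_onD:
  assumes "right_cont_on T a b \<phi>" "t \<in> T" "a \<le> t" "t < b" "0 < e"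
  obtains d where "d > 0" "\<And>s. s \<in> T \<Longrightarrow> t < s \<Longrightarrow> s < b \<Longrightarrow> s < t + d \<Longrightarrow> \<bar>\<phi> s - \<phi> t\<bar> < e"
  using assms unfolding right_cont_on_def by metis

lemma right_cont_on_mono: "right_cont_on T a b \<phi> \<Longrightarrow> a \<le> a' \<Longrightarrow> b' \<le> b \<Longrightarrow> right_cont_on T a' b' \<phi>"
  unfolding right_cont_on_def by (meson less_le_trans order_trans)

text \<open>A right-continuous function is the pointwise limit of its compositions with the step functions
  \<open>t \<mapsto> grid_pt T a b k \<lfloor>(k + 1) t\<rfloor>\<close>, which approach \<open>t\<close> from the right within the time scale.\<close>

definition grid_pt :: "real set \<Rightarrow> real \<Rightarrow> real \<Rightarrow> nat \<Rightarrow> int \<Rightarrow> real" where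
  "grid_pt T a b k m = (let c = (of_int m + 1) / (real k + 1) in
     if a \<le> c \<and> c < b then Sup (T \<inter> {..c}) else a)"

lemma grid_pt_in:
  assumes "closed T" "a \<in> T" "a < b"
  shows "grid_pt T a b k m \<in> T \<inter> {a..<b}"
  using closed_Sup_atMost[OF assms(1,2)] assms by (fastforce simp: grid_pt_def Let_def)

lemma grid_pt_limit:
  assumes T: "closed T" and \<phi>: "\<And>e. 0 < e \<Longrightarrow> \<exists>d>0. \<forall>s\<in>T. t < s \<longrightarrow> s < b \<longrightarrow> s < t + d \<longrightarrow> \<bar>\<phi> s - \<phi> t\<bar> < e"
    and t: "t \<in> T" "a \<le> t" "t < b"
  shows "(\<lambda>k. \<phi> (grid_pt T a b k \<lfloor>(real k + 1) * t\<rfloor>)) \<longlonglongrightarrow> (\<phi> t :: real)"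
proof (rule LIMSEQ_I)
  fix e :: real assume "e > 0"
  then obtain d where d: "d > 0" "\<forall>s\<in>T. t < s \<longrightarrow> s < b \<longrightarrow> s < t + d \<longrightarrow> \<bar>\<phi> s - \<phi> t\<bar> < e"
    using \<phi> by blast
  obtain N where N: "1 / (real N + 1) < min d (b - t)"
    using reals_Archimedean[of "min d (b - t)"] d t by (auto simp: field_simps)
  show "\<exists>N. \<forall>k\<ge>N. norm (\<phi> (grid_pt T a b k \<lfloor>(real k + 1) * t\<rfloor>) - \<phi> t) < e"
  proof (intro exI allI impI)
    fix k assume k: "k \<ge> N"
    define c where "c = (of_int \<lfloor>(real k + 1) * t\<rfloor> + 1) / (real k + 1)"
    have "1 / (real k + 1) \<le> 1 / (real N + 1)" using k by (simp add: field_simps)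
    then have k1: "1 / (real k + 1) < d" "1 / (real k + 1) < b - t" using N by auto
    have "of_int \<lfloor>(real k + 1) * t\<rfloor> \<le> (real k + 1) * t" "(real k + 1) * t < of_int \<lfloor>(real k + 1) * t\<rfloor> + 1"
      by linarith+
    moreover have "t + 1 / (real k + 1) = ((real k + 1) * t + 1) / (real k + 1)"
      by (simp add: add_divide_distrib)
    ultimately have "t < c" "c \<le> t + 1 / (real k + 1)"
      by (simp_all add: c_def pos_less_divide_eq divide_right_mono mult.commute)
    then have c: "a \<le> c" "c < b" "t \<le> c" "c < t + d" using k1 t by auto
    have g: "grid_pt T a b k \<lfloor>(real k + 1) * t\<rfloor> = Sup (T \<inter> {..c})"
      using c by (simp add: grid_pt_def Let_def c_def)
    have S: "Sup (T \<inter> {..c}) \<in> T" "t \<le> Sup (T \<inter> {..c})" "Sup (T \<inter> {..c}) \<le> c"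
      using closed_Sup_atMost[OF T t(1) c(3)] by auto
    show "norm (\<phi> (grid_pt T a b k \<lfloor>(real k + 1) * t\<rfloor>) - \<phi> t) < e"
      unfolding g using S c d \<open>e > 0\<close> by (cases "Sup (T \<inter> {..c}) = t") auto
  qed
qed

lemma measurable_right_cont_on:
  assumes T: "closed T" "a \<in> T" "b \<in> T" and \<phi>: "right_cont_on T a b \<phi>"
  shows "\<phi> \<in> borel_measurable (delta_measure T a b)"
proof (rule borel_measurable_LIMSEQ_metric)
  have [measurable]: "(\<lambda>t. t) \<in> borel_measurable (delta_measure T a b)"
    by (rule measurable_delta_measure_borel[OF T])
  show "(\<lambda>t. \<phi> (grid_pt T a b k \<lfloor>(real k + 1) * t\<rfloor>)) \<in> borel_measurable (delta_measure T a b)" for k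
    by (rule measurable_compose_countable[where f = "\<lambda>m t. \<phi> (grid_pt T a b k m)"]) measurable
  show "(\<lambda>k. \<phi> (grid_pt T a b k \<lfloor>(real k + 1) * t\<rfloor>)) \<longlonglongrightarrow> \<phi> t"
    if "t \<in> space (delta_measure T a b)" for t
    using that \<phi> by (intro grid_pt_limit[OF T(1)]) (auto simp: right_cont_on_def)
qed

text \<open>An inequality takes the place of the fundamental theorem of calculus: with
  \<open>F\<close> the integral of the absolute value of the derivative, both \<open>F + v\<close>
  and \<open>F - v\<close> are nondecreasing by \<open>time_scale_monotone\<close>. If the integral
  is infinite the claim is trivial, so no boundedness of the derivative is involved.\<close>

lemma increment_le_nn_integral_dder:
  assumes T: "closed T" "a \<in> T" and A: "down_closed T a A" and v: "ddiff T A v" and x: "x \<in> ddom T A"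
    and rc: "right_cont_on T a x (dder T A v)"
  shows "ennreal \<bar>v x - v a\<bar> \<le> (\<integral>\<^sup>+t. ennreal \<bar>dder T A v t\<bar> \<partial>delta_measure T a x)"
proof (cases "(\<integral>\<^sup>+t. ennreal \<bar>dder T A v t\<bar> \<partial>delta_measure T a x) = \<infinity>")
  case fin: False
  define w where "w = dder T A v"
  define M where "M = delta_measure T a x"
  have xA: "x \<in> A" using x ddom_subset by auto
  have xT: "x \<in> T" "a \<le> x" by (fact down_closedD(1,2)[OF A xA])+
  have inA: "t \<in> A" if "t \<in> T" "a \<le> t" "t \<le> x" for t using that by (intro down_closedD(3)[OF A xA])
  have indom: "t \<in> ddom T A" if "t \<in> T" "a \<le> t" "t \<le> x" for t
    using that by (intro down_closedD(3)[OF down_closed_ddom[OF T(1) A] x])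
  have wm[measurable]: "w \<in> borel_measurable M"
    unfolding w_def M_def by (rule measurable_right_cont_on[OF T xT(1) rc])
  have idm[measurable]: "(\<lambda>t. t) \<in> borel_measurable M"
    unfolding M_def by (rule measurable_delta_measure_borel[OF T xT(1)])
  define J where "J c d = (\<integral>\<^sup>+u. ennreal \<bar>w u\<bar> * indicator {c..<d} u \<partial>M)" for c d
  have Jfin: "J c d < \<infinity>" for c d
  proof -
    have "J c d \<le> (\<integral>\<^sup>+u. ennreal \<bar>w u\<bar> \<partial>M)" unfolding J_def
      by (intro nn_integral_mono) (simp split: split_indicator)
    then show ?thesis using fin by (simp add: M_def w_def less_top top_unique)
  qed
  define F where "F t = enn2real (J a t)" for t
  have Fadd: "F s = F t + enn2real (J t s)" if "a \<le> t" "t \<le> s" for t s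
  proof -
    have "J a s = J a t + J t s" unfolding J_def
    proof (subst nn_integral_add[symmetric])
      show "(\<integral>\<^sup>+u. ennreal \<bar>w u\<bar> * indicator {a..<s} u \<partial>M) =
        (\<integral>\<^sup>+u. ennreal \<bar>w u\<bar> * indicator {a..<t} u + ennreal \<bar>w u\<bar> * indicator {t..<s} u \<partial>M)"
        using that by (intro nn_integral_cong) (auto split: split_indicator)
    qed measurable
    then show ?thesis using Jfin by (simp add: F_def enn2real_plus)
  qed
  \<comment> \<open>The bound \<open>m\<close> may be negative: it is used with
    \<open>\<bar>w t\<bar> - e/2\<close> at right-dense points.\<close>
  have Fge: "F s - F t \<ge> m * (s - t)"
    if ts: "t \<in> T" "s \<in> T" "a \<le> t" "t \<le> s" "s \<le> x" and m: "\<And>u. u \<in> T \<Longrightarrow> t \<le> u \<Longrightarrow> u < s \<Longrightarrow> m \<le> \<bar>w u\<bar>"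
    for m t s
  proof (cases "0 \<le> m")
    case True
    have meas: "T \<inter> {t..<s} \<in> sets M"
    proof -
      have "T \<inter> {t..<s} = {u \<in> space M. t \<le> u \<and> u < s}" using ts by (auto simp: M_def)
      also have "\<dots> \<in> sets M" by measurable
      finally show ?thesis .
    qed
    have "ennreal (m * (s - t)) = ennreal m * emeasure M (T \<inter> {t..<s})"
      unfolding M_def using emeasure_delta_measure_Icc[OF T(1) ts(1,2,3,4,5) T(2) xT(1)] True ts
      by (simp add: ennreal_mult)
    also have "\<dots> = (\<integral>\<^sup>+u. ennreal m * indicator (T \<inter> {t..<s}) u \<partial>M)"
      using meas by (simp add: nn_integral_cmult_indicator)
    also have "\<dots> \<le> J t s" unfolding J_def
      using m by (intro nn_integral_mono) (auto split: split_indicator)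
    finally have "m * (s - t) \<le> enn2real (J t s)"
      using Jfin[of t s] by (metis True diff_ge_0_iff_ge enn2real_ennreal enn2real_mono infinity_ennreal_def mult_nonneg_nonneg that(4))
    then show ?thesis using Fadd[of t s] ts by simp
  next
    case False
    then have "m * (s - t) \<le> 0" using ts by (simp add: mult_nonpos_nonneg)
    also have "0 \<le> F s - F t" using Fadd[of t s] ts by simp
    finally show ?thesis .
  qed
  \<comment> \<open>The factor \<open>\<sigma>\<close> treats \<open>v\<close> and
    \<open>- v\<close> together, which gives the absolute value in the conclusion.\<close>
  have main: "F a + \<sigma> * v a \<le> F x + \<sigma> * v x" if \<sigma>: "\<sigma> = 1 \<or> \<sigma> = -1" for \<sigma> :: real
  proof (rule time_scale_monotone[where \<phi> = "\<lambda>t. F t + \<sigma> * v t", OF T xT])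
    fix t e :: real assume t: "t \<in> T" "a \<le> t" "t < x" and e: "0 < e"
    have td: "t \<in> ddom T A" using indom t by auto
    show "\<exists>s\<in>T. t < s \<and> s \<le> x \<and> (\<forall>r\<in>T. t < r \<longrightarrow> r \<le> s \<longrightarrow> F t + \<sigma> * v t - e * (r - t) \<le> F r + \<sigma> * v r)"
    proof (cases "fwd_jump T t = t")
      case False
      define s where "s = fwd_jump T t"
      have s: "s \<in> T" "t < s" "s \<le> x" "\<And>r. r \<in> T \<Longrightarrow> t < r \<Longrightarrow> s \<le> r"
        using fwd_jump_in[OF T(1) t(1)] fwd_jump_ge[OF T(1) t(1)] fwd_jump_gap[OF T(1) t(1)] False t xT
        by (auto simp: s_def)
      have "F s - F t \<ge> \<bar>w t\<bar> * (s - t)"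
      proof (rule Fge)
        fix u assume "u \<in> T" "t \<le> u" "u < s"
        then have "u = t" using s(4)[of u] by (cases "u = t") auto
        then show "\<bar>w t\<bar> \<le> \<bar>w u\<bar>" by simp
      qed (use t s in auto)
      moreover have "v s - v t = w t * (s - t)"
        using dder_scattered[OF v td False] s(2) by (simp add: w_def s_def)
      then have "\<sigma> * v s - \<sigma> * v t = (\<sigma> * w t) * (s - t)" by (metis mult.assoc right_diff_distrib)
      moreover have "- (\<sigma> * w t) * (s - t) \<le> \<bar>w t\<bar> * (s - t)"
        using \<sigma> s by (intro mult_right_mono) auto
      moreover have "0 \<le> e * (s - t)" using e s by simp
      ultimately have "F t + \<sigma> * v t - e * (s - t) \<le> F s + \<sigma> * v s" by simp
      then show ?thesis using s by (intro bexI[of _ s]) (auto dest: s(4))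
    next
      case True
      obtain d1 where d1: "d1 > 0" "\<And>s. s \<in> A \<Longrightarrow> \<bar>s - t\<bar> < d1 \<Longrightarrow> \<bar>v s - v t - w t * (s - t)\<bar> \<le> e/2 * \<bar>s - t\<bar>"
        unfolding w_def using dder_dense[OF v td True, of "e/2"] e by auto
      obtain d2 where d2: "d2 > 0" "\<And>s. s \<in> T \<Longrightarrow> t < s \<Longrightarrow> s < x \<Longrightarrow> s < t + d2 \<Longrightarrow> \<bar>w s - w t\<bar> < e/2"
        using right_cont_onD[OF rc t, of "e/2"] e unfolding w_def by auto
      obtain s where s: "s \<in> T" "t < s" "s < x" "s < t + min d1 d2"
        using right_dense_limit[OF T(1) t(1) True xT(1) t(3), of "min d1 d2"] d1 d2 by auto
      show ?thesis
      proof (intro bexI[OF _ s(1)] conjI ballI impI)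
        fix r assume r: "r \<in> T" "t < r" "r \<le> s"
        have rA: "r \<in> A" using inA r t s by auto
        have "F r - F t \<ge> (\<bar>w t\<bar> - e/2) * (r - t)"
        proof (rule Fge)
          fix u assume "u \<in> T" "t \<le> u" "u < r"
          then have "\<bar>w u - w t\<bar> < e/2"
            using d2(2)[of u] s r e by (cases "u = t") auto
          then show "\<bar>w t\<bar> - e/2 \<le> \<bar>w u\<bar>" by linarith
        qed (use t r s in auto)
        moreover have "\<sigma> * (v r - v t) \<ge> \<sigma> * (w t * (r - t)) - e/2 * (r - t)"
        proof -
        have "\<bar>v r - v t - w t * (r - t)\<bar> \<le> e/2 * (r - t)" using d1(2)[OF rA] r s by auto
        moreover have "\<sigma> * X \<ge> \<sigma> * Y - E" if "\<bar>X - Y\<bar> \<le> E" for X Y E :: real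
          using \<sigma> that by (elim disjE) (simp_all add: abs_le_iff)
        ultimately have "\<sigma> * (v r - v t) \<ge> \<sigma> * (w t * (r - t)) - e/2 * (r - t)" by blast
        then show ?thesis .
        qed
        moreover have "- (\<sigma> * w t) * (r - t) \<le> \<bar>w t\<bar> * (r - t)"
          using \<sigma> r by (intro mult_right_mono) auto
        ultimately show "F t + \<sigma> * v t - e * (r - t) \<le> F r + \<sigma> * v r"
          by (simp add: algebra_simps diff_divide_distrib)
      qed (use s in auto)
    qed
  next
    fix t e :: real assume t: "t \<in> T" "a < t" "t \<le> x" and e: "0 < e"
    then have td: "t \<in> ddom T A" using indom by auto
    obtain d where d: "d > 0" "\<And>s. s \<in> A \<Longrightarrow> \<bar>s - t\<bar> < d \<Longrightarrow> \<bar>v s - v t\<bar> < e"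
      using dder_continuous[OF v td e] by blast
    \<comment> \<open>From the left only continuity of \<open>v\<close> matters, because
      \<open>F\<close> is nondecreasing.\<close>
    show "\<exists>\<delta>>0. \<forall>r\<in>T. a \<le> r \<longrightarrow> r < t \<longrightarrow> t - \<delta> < r \<longrightarrow> F r + \<sigma> * v r \<le> F t + \<sigma> * v t + e"
    proof (intro exI[of _ d] conjI ballI impI d)
      fix r assume r: "r \<in> T" "a \<le> r" "r < t" "t - d < r"
      then have "\<bar>v r - v t\<bar> < e" using d inA t by auto
      moreover have "F r \<le> F t" using Fadd[of r t] r by simp
      ultimately show "F r + \<sigma> * v r \<le> F t + \<sigma> * v t + e" using \<sigma> by auto
    qed
  qed
  have "F a = 0" by (simp add: F_def J_def)
  then have "\<bar>v x - v a\<bar> \<le> F x" using main[of 1] main[of "-1"] by auto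
  then have "ennreal \<bar>v x - v a\<bar> \<le> ennreal (F x)" by (rule ennreal_leI)
  also have "\<dots> = J a x" using Jfin[of a x] by (simp add: F_def)
  also have "\<dots> = (\<integral>\<^sup>+u. ennreal \<bar>w u\<bar> \<partial>M)"
    unfolding J_def by (intro nn_integral_cong) (simp add: M_def)
  finally show ?thesis by (simp add: M_def w_def)
qed simp

section \<open>Taylor's formula\<close>

lemma nn_integral_delta_measure_split:
  assumes T: "closed T" and abc: "a \<in> T" "b \<in> T" "c \<in> T" "a \<le> b" "b \<le> c"
    and f: "f \<in> borel_measurable (delta_measure T a c)"
  shows "(\<integral>\<^sup>+u. f u \<partial>delta_measure T a c) = (\<integral>\<^sup>+u. f u \<partial>delta_measure T a b) + (\<integral>\<^sup>+u. f u \<partial>delta_measure T b c)"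
proof -
  have [measurable]: "(\<lambda>t. t) \<in> borel_measurable (delta_measure T a c)"
    by (rule measurable_delta_measure_borel[OF T abc(1,3)])
  note [measurable] = f
  have "(\<integral>\<^sup>+u. f u \<partial>delta_measure T a c) = (\<integral>\<^sup>+u. f u * indicator {a..<b} u + f u * indicator {b..<c} u \<partial>delta_measure T a c)"
    using abc by (intro nn_integral_cong) (auto split: split_indicator)
  also have "\<dots> = (\<integral>\<^sup>+u. f u * indicator {a..<b} u \<partial>delta_measure T a c) + (\<integral>\<^sup>+u. f u * indicator {b..<c} u \<partial>delta_measure T a c)"
    by (rule nn_integral_add) measurable
  also have "\<dots> = (\<integral>\<^sup>+u. f u \<partial>delta_measure T a b) + (\<integral>\<^sup>+u. f u \<partial>delta_measure T b c)"
    using abc by (simp add: nn_integral_delta_measure_restrict[OF T, of a b a c] nn_integral_delta_measure_restrict[OF T, of b c a c])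
  finally show ?thesis .
qed

section \<open>Generalised monomials: sign, monotonicity and increments\<close>

lemma nn_integral_delta_measure_const:
  assumes "closed T" "a \<in> T" "b \<in> T" "a \<le> b" "0 \<le> m"
  shows "(\<integral>\<^sup>+u. ennreal m \<partial>delta_measure T a b) = ennreal (m * (b - a))"
  using emeasure_space_delta_measure[of T a b] assms by (simp add: ennreal_mult)

text \<open>The monomials are Bochner integrals, which default to 0 without integrability.
  Monotonicity of order \<open>k\<close> bounds the integrand by its value at the upper end, so the
  integral is genuine and agrees with the nonnegative integral; the increment bounds follow from
  additivity over intervals.\<close>

lemma ts_monomial_step:
  assumes T: "closed T" and s: "s \<in> T"
    and nn: "\<And>t. t \<in> T \<Longrightarrow> s \<le> t \<Longrightarrow> 0 \<le> ts_monomial T k t s"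
    and mono: "\<And>t r. t \<in> T \<Longrightarrow> r \<in> T \<Longrightarrow> s \<le> t \<Longrightarrow> t \<le> r \<Longrightarrow> ts_monomial T k t s \<le> ts_monomial T k r s"
    and rc: "\<And>b. b \<in> T \<Longrightarrow> right_cont_on T s b (\<lambda>t. ts_monomial T k t s)"
  shows "\<And>t. t \<in> T \<Longrightarrow> s \<le> t \<Longrightarrow> 0 \<le> ts_monomial T (Suc k) t s \<and>
       ennreal (ts_monomial T (Suc k) t s) = (\<integral>\<^sup>+u. ennreal (ts_monomial T k u s) \<partial>delta_measure T s t)"
    and "\<And>t r m. t \<in> T \<Longrightarrow> r \<in> T \<Longrightarrow> s \<le> t \<Longrightarrow> t \<le> r \<Longrightarrow> (\<And>u. u \<in> T \<Longrightarrow> t \<le> u \<Longrightarrow> u < r \<Longrightarrow> ts_monomial T k u s \<le> m) \<Longrightarrow> 0 \<le> m \<Longrightarrow>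
      ts_monomial T (Suc k) r s - ts_monomial T (Suc k) t s \<le> m * (r - t)"
    and "\<And>t r. t \<in> T \<Longrightarrow> r \<in> T \<Longrightarrow> s \<le> t \<Longrightarrow> t \<le> r \<Longrightarrow>
      ts_monomial T k t s * (r - t) \<le> ts_monomial T (Suc k) r s - ts_monomial T (Suc k) t s"
proof -
  let ?h = "\<lambda>u. ts_monomial T k u s" and ?H = "\<lambda>u. ts_monomial T (Suc k) u s"
  have meas: "?h \<in> borel_measurable (delta_measure T s t)" if "t \<in> T" for t
    using measurable_right_cont_on[OF T s that rc[OF that]] .
  show 1: "0 \<le> ?H t \<and> ennreal (?H t) = (\<integral>\<^sup>+u. ennreal (?h u) \<partial>delta_measure T s t)" if t: "t \<in> T" "s \<le> t" for t
  proof -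
    have "(\<integral>\<^sup>+u. ennreal (?h u) \<partial>delta_measure T s t) \<le> (\<integral>\<^sup>+u. ennreal (?h t) \<partial>delta_measure T s t)"
      using t mono by (intro nn_integral_mono ennreal_leI) auto
    also have "\<dots> < \<infinity>" using nn_integral_delta_measure_const[OF T s t nn[OF t]] by simp
    finally have fin: "(\<integral>\<^sup>+u. ennreal (?h u) \<partial>delta_measure T s t) < \<infinity>" .
    have "?H t = integral\<^sup>L (delta_measure T s t) ?h" using t by (simp add: delta_integral_def)
    also have "\<dots> = enn2real (\<integral>\<^sup>+u. ennreal (?h u) \<partial>delta_measure T s t)"
      using nn by (intro integral_eq_nn_integral meas t) (auto intro!: AE_I2)
    finally show ?thesis using fin by simp
  qed
  have split: "ennreal (?H r) = ennreal (?H t) + (\<integral>\<^sup>+u. ennreal (?h u) \<partial>delta_measure T t r)"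
    if "t \<in> T" "r \<in> T" "s \<le> t" "t \<le> r" for t r
  proof -
    have "(\<lambda>u. ennreal (?h u)) \<in> borel_measurable (delta_measure T s r)" using meas[OF that(2)] by measurable
    from nn_integral_delta_measure_split[OF T s that(1,2,3,4) this]
    show ?thesis using 1 that by auto
  qed
  show "?H r - ?H t \<le> m * (r - t)"
    if t: "t \<in> T" "r \<in> T" "s \<le> t" "t \<le> r" and m: "\<And>u. u \<in> T \<Longrightarrow> t \<le> u \<Longrightarrow> u < r \<Longrightarrow> ?h u \<le> m" and m0: "0 \<le> m" for t r m
  proof -
    have "(\<integral>\<^sup>+u. ennreal (?h u) \<partial>delta_measure T t r) \<le> (\<integral>\<^sup>+u. ennreal m \<partial>delta_measure T t r)"
      using m by (intro nn_integral_mono ennreal_leI) auto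
    also have "\<dots> = ennreal (m * (r - t))" by (rule nn_integral_delta_measure_const[OF T t(1,2,4) m0])
    finally have "ennreal (?H r) \<le> ennreal (?H t) + ennreal (m * (r - t))"
      unfolding split[OF t] by (rule add_left_mono)
    also have "\<dots> = ennreal (?H t + m * (r - t))" using 1[of t] t m0 by simp
    finally show ?thesis using 1[of t] t m0 by (subst (asm) ennreal_le_iff) auto
  qed
  show "?h t * (r - t) \<le> ?H r - ?H t" if t: "t \<in> T" "r \<in> T" "s \<le> t" "t \<le> r" for t r
  proof -
    have "ennreal (?h t * (r - t)) = (\<integral>\<^sup>+u. ennreal (?h t) \<partial>delta_measure T t r)"
      by (rule nn_integral_delta_measure_const[OF T t(1,2,4) nn, symmetric]) (use t in auto)
    also have "\<dots> \<le> (\<integral>\<^sup>+u. ennreal (?h u) \<partial>delta_measure T t r)"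
      using mono t by (intro nn_integral_mono ennreal_leI) auto
    finally have "ennreal (?H t) + ennreal (?h t * (r - t)) \<le> ennreal (?H r)"
      unfolding split[OF t] by (rule add_left_mono)
    moreover have "ennreal (?H t) + ennreal (?h t * (r - t)) = ennreal (?H t + ?h t * (r - t))" 
      using 1[of t] t nn[of t] by simp
    ultimately have "ennreal (?H t + ?h t * (r - t)) \<le> ennreal (?H r)" by (simp only:)
    then have "?H t + ?h t * (r - t) \<le> ?H r" using 1[of r] t by (subst (asm) ennreal_le_iff) auto
    then show ?thesis by simp
  qed
qed

text \<open>The three properties need one common induction: integrability at the next order rests on
  measurability, sign and monotonicity at the present one.\<close>

lemma
  assumes T: "closed T" and s: "s \<in> T"
  shows ts_monomial_nonneg: "\<And>t. t \<in> T \<Longrightarrow> s \<le> t \<Longrightarrow> 0 \<le> ts_monomial T k t s"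
    and ts_monomial_mono: "\<And>t r. t \<in> T \<Longrightarrow> r \<in> T \<Longrightarrow> s \<le> t \<Longrightarrow> t \<le> r \<Longrightarrow> ts_monomial T k t s \<le> ts_monomial T k r s"
    and ts_monomial_right_cont: "\<And>b. b \<in> T \<Longrightarrow> right_cont_on T s b (\<lambda>t. ts_monomial T k t s)"
proof (induction k)
  case 0
  { case 1 show ?case by simp next case 2 show ?case by simp 
    next case 3 show ?case by (auto simp: right_cont_on_def intro: exI[of _ 1]) }
next
  case (Suc k)
  note st = ts_monomial_step[OF T s Suc(1) Suc(2) Suc(3)]
  { case 1 then show ?case using st(1) by blast
  next
    case 2
    then have "0 \<le> ts_monomial T k t s * (r - t)" using Suc(1)[of t] by simp
    also have "\<dots> \<le> ts_monomial T (Suc k) r s - ts_monomial T (Suc k) t s" using 2 by (intro st(3))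
    finally show ?case by simp
  next
    case (3 b)
    show ?case unfolding right_cont_on_def
    proof (intro ballI impI allI)
      fix t e :: real assume t: "t \<in> T" "s \<le> t" "t < b" and e: "0 < e"
      \<comment> \<open>By monotonicity the monomial of order \<open>k\<close> is at most
        \<open>C\<close> up to \<open>b\<close>, so \<open>C\<close> is a Lipschitz constant for
        order \<open>k + 1\<close>; the summand 1 makes it positive.\<close>
      define C where "C = ts_monomial T k b s + 1"
      have C: "C > 0" using Suc(1)[of b] t 3 by (simp add: C_def)
      show "\<exists>d>0. \<forall>r\<in>T. t < r \<longrightarrow> r < b \<longrightarrow> r < t + d \<longrightarrow> \<bar>ts_monomial T (Suc k) r s - ts_monomial T (Suc k) t s\<bar> < e"
      proof (intro exI[of _ "e / C"] conjI ballI impI)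
        show "e / C > 0" using e C by simp
        fix r assume r: "r \<in> T" "t < r" "r < b" "r < t + e / C"
        have "ts_monomial T (Suc k) r s - ts_monomial T (Suc k) t s \<le> C * (r - t)"
        proof (rule st(2))
          fix u assume "u \<in> T" "t \<le> u" "u < r"
          then show "ts_monomial T k u s \<le> C" using Suc(2)[of u b] t r 3 by (auto simp: C_def)
        qed (use t r C in auto)
        also have "\<dots> < e" using r C by (simp add: field_simps)
        finally have "ts_monomial T (Suc k) r s - ts_monomial T (Suc k) t s < e" .
        moreover have "0 \<le> ts_monomial T k t s * (r - t)" using Suc(1)[of t] t r by simp
        then have "0 \<le> ts_monomial T (Suc k) r s - ts_monomial T (Suc k) t s"
          using st(3)[of t r] t r by auto
        ultimately show "\<bar>ts_monomial T (Suc k) r s - ts_monomial T (Suc k) t s\<bar> < e" by simp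
      qed
    qed }
qed

lemma ennreal_ts_monomial_Suc:
  assumes T: "closed T" and s: "s \<in> T" and t: "t \<in> T" "s \<le> t"
  shows "ennreal (ts_monomial T (Suc k) t s) = (\<integral>\<^sup>+u. ennreal (ts_monomial T k u s) \<partial>delta_measure T s t)"
  using ts_monomial_step(1)[OF T s ts_monomial_nonneg[OF T s] ts_monomial_mono[OF T s] ts_monomial_right_cont[OF T s] t] by blast

lemma ts_monomial_increment_le:
  assumes T: "closed T" and s: "s \<in> T" and tr: "t \<in> T" "r \<in> T" "s \<le> t" "t \<le> r"
    and m: "\<And>u. u \<in> T \<Longrightarrow> t \<le> u \<Longrightarrow> u < r \<Longrightarrow> ts_monomial T k u s \<le> m" "0 \<le> m"
  shows "ts_monomial T (Suc k) r s - ts_monomial T (Suc k) t s \<le> m * (r - t)"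
  by (rule ts_monomial_step(2)[OF T s ts_monomial_nonneg[OF T s] ts_monomial_mono[OF T s] ts_monomial_right_cont[OF T s] tr m])

lemma ts_monomial_increment_ge:
  assumes T: "closed T" and s: "s \<in> T" and tr: "t \<in> T" "r \<in> T" "s \<le> t" "t \<le> r"
  shows "ts_monomial T k t s * (r - t) \<le> ts_monomial T (Suc k) r s - ts_monomial T (Suc k) t s"
  by (rule ts_monomial_step(3)[OF T s ts_monomial_nonneg[OF T s] ts_monomial_mono[OF T s] ts_monomial_right_cont[OF T s] tr])

lemma ts_monomial_self:
  assumes "0 < k"
  shows "ts_monomial T k s s = 0"
proof -
  obtain i where i: "k = Suc i" using assms by (cases k) auto
  have "space (delta_measure T s s) = {}" by simp
  then have "integral\<^sup>L (delta_measure T s s) g = 0" for g :: "real \<Rightarrow> real"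
    using Bochner_Integration.integral_cong[of "delta_measure T s s" _ g "\<lambda>_. 0"] by (simp del: space_delta_measure)
  then show ?thesis by (simp add: i delta_integral_def)
qed

text \<open>A point \<open>r\<close> of the time scale strictly between \<open>s\<close> and
  \<open>t\<close> gives the increment from \<open>r\<close> to \<open>t\<close> a positive factor.
  At a scattered \<open>s\<close> this breaks down: the monomial of order 2 vanishes at the next
  point.\<close>

lemma ts_monomial_pos:
  assumes T: "closed T" and s: "s \<in> T" "fwd_jump T s = s" and t: "t \<in> T" "s < t"
  shows "0 < ts_monomial T k t s"
  using t
proof (induction k arbitrary: t)
  case (Suc k)
  obtain r where r: "r \<in> T" "s < r" "r < t"
    using right_dense_limit[OF T s Suc.prems zero_less_one] by blast
  have "0 < ts_monomial T k r s * (t - r)" using Suc.IH[OF r(1,2)] r by simp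
  also have "\<dots> \<le> ts_monomial T (Suc k) t s - ts_monomial T (Suc k) r s"
    using r Suc.prems by (intro ts_monomial_increment_ge T s) auto
  also have "\<dots> \<le> ts_monomial T (Suc k) t s" using ts_monomial_nonneg[OF T s(1), of r "Suc k"] r by simp
  finally show ?case .
qed simp

text \<open>The monomial at \<open>fwd_jump T s\<close>, written as an integral against a fixed
  measure with the limits moved into an indicator. In \<open>ts_monomial\<close> the measure itself
  depends on both arguments, which would obstruct joint measurability and Tonelli's theorem.\<close>

primrec mker :: "real set \<Rightarrow> real measure \<Rightarrow> nat \<Rightarrow> real \<Rightarrow> real \<Rightarrow> ennreal" where
  "mker T M 0 r s = 1"
| "mker T M (Suc k) r s = (\<integral>\<^sup>+u. mker T M k u s * indicator {fwd_jump T s..<r} u \<partial>M)"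

lemma ennreal_ts_monomial_eq_mker:
  assumes T: "closed T" and ab: "a \<in> T" "b \<in> T"
    and s: "s \<in> T" "a \<le> s" and r: "fwd_jump T s \<le> r" "r \<in> T" "r \<le> b"
  shows "ennreal (ts_monomial T k r (fwd_jump T s)) = mker T (delta_measure T a b) k r s"
  using r
proof (induction k arbitrary: r)
  case (Suc k)
  have fs: "fwd_jump T s \<in> T" "a \<le> fwd_jump T s"
    using fwd_jump_in[OF T s(1)] fwd_jump_ge[OF T s(1)] s by auto
  have "ennreal (ts_monomial T (Suc k) r (fwd_jump T s)) =
     (\<integral>\<^sup>+u. ennreal (ts_monomial T k u (fwd_jump T s)) \<partial>delta_measure T (fwd_jump T s) r)"
    by (rule ennreal_ts_monomial_Suc[OF T fs(1) Suc.prems(2,1)])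
  also have "\<dots> = (\<integral>\<^sup>+u. ennreal (ts_monomial T k u (fwd_jump T s)) * indicator {fwd_jump T s..<r} u \<partial>delta_measure T a b)"
    by (rule nn_integral_delta_measure_restrict[OF T fs(1) Suc.prems(2) fs(2) Suc.prems(1,3) ab])
  also have "\<dots> = mker T (delta_measure T a b) (Suc k) r s"
    unfolding mker.simps using Suc by (intro nn_integral_cong) (auto split: split_indicator)
  finally show ?case .
qed simp

lemma mono_fwd_jump: "mono (fwd_jump T)"
proof (rule monoI)
  fix s t :: real assume st: "s \<le> t"
  have bd: "bdd_below {r \<in> T. s < r}" by (rule bdd_belowI[of _ s]) simp
  show "fwd_jump T s \<le> fwd_jump T t"
  proof (cases "\<exists>r\<in>T. s < r")
    case True
    then obtain r where r: "r \<in> T" "s < r" by auto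
    show ?thesis
    proof (cases "\<exists>r\<in>T. t < r")
      case True
      then show ?thesis using st r bd by (auto simp: fwd_jump_def intro!: cInf_superset_mono)
    next
      case False
      then have "r \<le> t" using r by force
      moreover have "Inf {r \<in> T. s < r} \<le> r" using bd r by (intro cInf_lower) auto
      ultimately show ?thesis using False r by (auto simp: fwd_jump_def)
    qed
  next
    case False
    then have "\<not> (\<exists>r\<in>T. t < r)" using st by force
    then show ?thesis using False st by (simp add: fwd_jump_def)
  qed
qed

lemma measurable_mker:
  assumes T: "closed T" and ab: "a \<in> T" "b \<in> T"
  defines "M \<equiv> delta_measure T a b"
  shows "(\<lambda>(r, s). mker T M k r s) \<in> borel_measurable (M \<Otimes>\<^sub>M M)"
proof (induction k)
  case 0 show ?case by simp
next
  case (Suc k)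
  interpret finite_measure M unfolding M_def by (rule finite_measure_delta_measure[OF T ab])
  have [measurable]: "(\<lambda>t. t) \<in> borel_measurable M"
    unfolding M_def by (rule measurable_delta_measure_borel[OF T ab])
  have [measurable]: "fwd_jump T \<in> borel_measurable borel" by (rule borel_measurable_mono[OF mono_fwd_jump])
  note [measurable] = Suc
  have "(\<lambda>x. \<integral>\<^sup>+u. mker T M k u (snd x) * indicator {w. fwd_jump T (snd x) \<le> w \<and> w < fst x} u \<partial>M) \<in> borel_measurable (M \<Otimes>\<^sub>M M)"
    unfolding indicator_def by measurable
  moreover have "{w. fwd_jump T s \<le> w \<and> w < r} = {fwd_jump T s..<r}" for s r by auto
  ultimately show ?case by (simp add: case_prod_beta)
qed

declare ts_monomial.simps(2) [simp del]

text \<open>The increment inequality bounds \<open>v\<close> by the integral of its first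
  derivative, to which the induction hypothesis applies on the smaller domain. Exchanging the two
  integrals by Tonelli's theorem raises the order of the kernel by one.\<close>

lemma taylor_bound:
  assumes T: "closed T" "a \<in> T"
  shows "down_closed T a A \<Longrightarrow> x \<in> ddom T A \<Longrightarrow>
    (\<And>i. i \<le> k \<Longrightarrow> ddiff T ((ddom T ^^ i) A) (dders T A i v)) \<Longrightarrow>
    (\<And>i. i \<le> k \<Longrightarrow> dders T A i v a = 0) \<Longrightarrow>
    (\<And>i. i \<le> k \<Longrightarrow> right_cont_on T a x (dders T A (Suc i) v)) \<Longrightarrow>
    ennreal \<bar>v x\<bar> \<le> (\<integral>\<^sup>+s. ennreal (ts_monomial T k x (fwd_jump T s) * \<bar>dders T A (Suc k) v s\<bar>) \<partial>delta_measure T a x)"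
proof (induction k arbitrary: A v x)
  case 0
  then show ?case
    using increment_le_nn_integral_dder[OF T 0(1), of v x] 0(3)[of 0] 0(4)[of 0] 0(5)[of 0] by simp
next
  case (Suc k)
  note A = Suc.prems(1) and x = Suc.prems(2)
  have dA: "down_closed T a (ddom T A)" by (rule down_closed_ddom[OF T(1) A])
  have xT: "x \<in> T" "a \<le> x" using down_closedD(1,2)[OF dA x] by auto
  define M where "M = delta_measure T a x"
  define W where "W s = ennreal \<bar>dders T A (Suc (Suc k)) v s\<bar>" for s
  interpret M: finite_measure M unfolding M_def by (rule finite_measure_delta_measure[OF T xT(1)])
  interpret MM: pair_sigma_finite M M by standard
  have idm[measurable]: "(\<lambda>t. t) \<in> borel_measurable M"
    unfolding M_def by (rule measurable_delta_measure_borel[OF T xT(1)])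
  have "dders T A (Suc (Suc k)) v \<in> borel_measurable M"
    unfolding M_def by (rule measurable_right_cont_on[OF T xT(1) Suc.prems(5)]) simp
  then have Wm[measurable]: "W \<in> borel_measurable M" unfolding W_def by measurable
  note mk[measurable] = measurable_mker[OF T xT(1), of k, folded M_def]
  have d0: "dders T A (Suc 0) v = dder T A v" by simp
  have IH: "ennreal \<bar>dder T A v u\<bar> \<le> (\<integral>\<^sup>+s. mker T M k u s * indicator {w. w < u} s * W s \<partial>M)"
    if u: "u \<in> T" "a \<le> u" "u < x" for u
  proof -
    have ud: "u \<in> ddom T (ddom T A)" by (rule down_closed_ddomI[OF T(1) dA u x])
    have "ennreal \<bar>dder T A v u\<bar> \<le>
      (\<integral>\<^sup>+s. ennreal (ts_monomial T k u (fwd_jump T s) * \<bar>dders T (ddom T A) (Suc k) (dder T A v) s\<bar>) \<partial>delta_measure T a u)"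
    proof (rule Suc.IH[OF dA ud])
      fix i assume i: "i \<le> k"
      show "ddiff T ((ddom T ^^ i) (ddom T A)) (dders T (ddom T A) i (dder T A v))"
        using Suc.prems(3)[of "Suc i"] i
        by (simp only: dders_Suc_shift) (simp add: funpow_swap1)
      show "dders T (ddom T A) i (dder T A v) a = 0"
        using Suc.prems(4)[of "Suc i"] i by (simp only: dders_Suc_shift)
      show "right_cont_on T a u (dders T (ddom T A) (Suc i) (dder T A v))"
        using Suc.prems(5)[of "Suc i"] i u
        by (intro right_cont_on_mono[of T a x _ a u]) (simp_all only: dders_Suc_shift[of _ _ "Suc i"])
    qed
    also have "\<dots> = (\<integral>\<^sup>+s. ennreal (ts_monomial T k u (fwd_jump T s)) * W s \<partial>delta_measure T a u)"
    proof (rule nn_integral_cong)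
      fix s assume "s \<in> space (delta_measure T a u)"
      then have s: "s \<in> T" "a \<le> s" "s < u" by auto
      have "0 \<le> ts_monomial T k u (fwd_jump T s)"
        using s u fwd_jump_in[OF T(1) s(1)] fwd_jump_gap[OF T(1) s(1) u(1) s(3)]
        by (intro ts_monomial_nonneg T) auto
      then show "ennreal (ts_monomial T k u (fwd_jump T s) * \<bar>dders T (ddom T A) (Suc k) (dder T A v) s\<bar>)
         = ennreal (ts_monomial T k u (fwd_jump T s)) * W s"
        by (simp only: W_def dders_Suc_shift[symmetric] ennreal_mult abs_ge_zero)
    qed
    also have "\<dots> = (\<integral>\<^sup>+s. ennreal (ts_monomial T k u (fwd_jump T s)) * W s * indicator {a..<u} s \<partial>M)"
      unfolding M_def using u xT T by (intro nn_integral_delta_measure_restrict[OF T(1)]) auto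
    also have "\<dots> = (\<integral>\<^sup>+s. mker T M k u s * indicator {w. w < u} s * W s \<partial>M)"
    proof (rule nn_integral_cong)
      fix s assume "s \<in> space M"
      then have s: "s \<in> T" "a \<le> s" "s < x" by (auto simp: M_def)
      show "ennreal (ts_monomial T k u (fwd_jump T s)) * W s * indicator {a..<u} s = mker T M k u s * indicator {w. w < u} s * W s"
      proof (cases "s < u")
        case True
        have "ennreal (ts_monomial T k u (fwd_jump T s)) = mker T M k u s"
          unfolding M_def using s u True xT fwd_jump_gap[OF T(1) s(1) u(1) True]
          by (intro ennreal_ts_monomial_eq_mker T) auto
        then show ?thesis using s True by (simp add: mult.commute)
      qed simp
    qed
    finally show ?thesis .
  qed
  have "ennreal \<bar>v x\<bar> \<le> (\<integral>\<^sup>+u. ennreal \<bar>dder T A v u\<bar> \<partial>M)"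
    using increment_le_nn_integral_dder[OF T A _ x, of v] Suc.prems(3)[of 0] Suc.prems(4)[of 0] Suc.prems(5)[of 0]
    by (simp add: M_def)
  also have "\<dots> \<le> (\<integral>\<^sup>+u. (\<integral>\<^sup>+s. mker T M k u s * indicator {w. w < u} s * W s \<partial>M) \<partial>M)"
    using IH by (intro nn_integral_mono) (auto simp: M_def)
  also have "\<dots> = (\<integral>\<^sup>+s. (\<integral>\<^sup>+u. mker T M k u s * indicator {w. w < u} s * W s \<partial>M) \<partial>M)"
    unfolding indicator_def by (rule MM.Fubini'[symmetric]) measurable
  also have "\<dots> \<le> (\<integral>\<^sup>+s. ennreal (ts_monomial T (Suc k) x (fwd_jump T s) * \<bar>dders T A (Suc (Suc k)) v s\<bar>) \<partial>M)"
  proof (rule nn_integral_mono)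
    fix s assume "s \<in> space M"
    then have s: "s \<in> T" "a \<le> s" "s < x" by (auto simp: M_def)
    have fs: "fwd_jump T s \<in> T" "fwd_jump T s \<le> x" using fwd_jump_in[OF T(1) s(1)] fwd_jump_gap[OF T(1) s(1) xT(1) s(3)] by auto
    have sm: "(\<lambda>u. mker T M k u s) \<in> borel_measurable M"
      using measurable_Pair2[OF mk, of s] \<open>s \<in> space M\<close> by simp 
    \<comment> \<open>Among points of \<open>T\<close>, \<open>s < u\<close> is the same as
      \<open>fwd_jump T s \<le> u\<close>; this is where the forward jump in the kernel comes
      from.\<close>
    have "(\<integral>\<^sup>+u. mker T M k u s * indicator {w. w < u} s * W s \<partial>M) \<le> (\<integral>\<^sup>+u. mker T M k u s * indicator {fwd_jump T s..<x} u * W s \<partial>M)"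
      using s by (intro nn_integral_mono) (auto simp: M_def split: split_indicator intro: fwd_jump_gap[OF T(1)] dest: fwd_jump_gap[OF T(1) s(1)])
    also have "\<dots> = mker T M (Suc k) x s * W s"
      unfolding mker.simps
      by (intro nn_integral_multc borel_measurable_times_ennreal sm Wm
        measurable_compose[OF idm borel_measurable_indicator]) simp
    also have "mker T M (Suc k) x s = ennreal (ts_monomial T (Suc k) x (fwd_jump T s))"
      unfolding M_def using s fs xT by (intro ennreal_ts_monomial_eq_mker[symmetric] T) auto
    also have "\<dots> * W s = ennreal (ts_monomial T (Suc k) x (fwd_jump T s) * \<bar>dders T A (Suc (Suc k)) v s\<bar>)"
      unfolding W_def by (intro ennreal_mult[symmetric] ts_monomial_nonneg T fs xT) simp
    finally show "(\<integral>\<^sup>+u. mker T M k u s * indicator {w. w < u} s * W s \<partial>M) \<le> \<dots>" .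
  qed
  finally show ?case by (simp only: M_def)
qed

text \<open>Taylor's theorem in Peano form at a right-dense point: the derivative of order
  \<open>l + 1\<close> enters only through its value at \<open>z\<close>. The base case is its
  definition as a limit; the induction step integrates the bound for \<open>dder T D w\<close>, as
  \<open>w\<close> minus \<open>\<kappa>\<close> times the monomial is nondecreasing near
  \<open>z\<close>. No sign of \<open>\<kappa>\<close> is assumed, and both signs occur
  later.\<close>

lemma peano_lower_bound:
  assumes T: "closed T" and z: "z \<in> T" "fwd_jump T z = z"
  shows "down_closed T a D \<Longrightarrow> z \<in> D \<Longrightarrow> r \<in> D \<Longrightarrow> z < r \<Longrightarrow>
    (\<And>i. i \<le> l \<Longrightarrow> ddiff T ((ddom T ^^ i) D) (dders T D i w)) \<Longrightarrow>
    (\<And>i. i \<le> l \<Longrightarrow> dders T D i w z = 0) \<Longrightarrow> \<kappa> < dders T D (Suc l) w z \<Longrightarrow>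
    \<exists>d>0. \<forall>y\<in>T. z < y \<longrightarrow> y < z + d \<longrightarrow> \<kappa> * ts_monomial T (Suc l) y z \<le> w y"
proof (induction l arbitrary: D w r)
  case 0
  note D = 0(1)
  have az: "a \<le> z" using down_closedD(2)[OF D 0(2)] .
  have zd: "z \<in> ddom T D" by (rule down_closed_ddomI[OF T D z(1) az 0(4,3)])
  have w: "ddiff T D w" using 0(5)[of 0] by simp
  define e where "e = dder T D w z - \<kappa>"
  have e: "e > 0" using 0(7) by (simp add: e_def)
  obtain d where d: "d > 0" "\<And>s. s \<in> D \<Longrightarrow> \<bar>s - z\<bar> < d \<Longrightarrow> \<bar>w s - w z - dder T D w z * (s - z)\<bar> \<le> e * \<bar>s - z\<bar>"
    using dder_dense[OF w zd z(2) e] by blast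
  show ?case
  proof (intro exI[of _ "min d (r - z)"] conjI ballI impI)
    show "0 < min d (r - z)" using d 0 by simp
    fix y assume y: "y \<in> T" "z < y" "y < z + min d (r - z)"
    have "y \<in> D" using y az by (intro down_closedD(3)[OF D 0(3)]) auto
    then have b: "\<bar>w y - w z - dder T D w z * (y - z)\<bar> \<le> e * (y - z)" using d(2)[of y] y by auto
    have "w y \<ge> (dder T D w z - e) * (y - z)" using b 0(6)[of 0] by (simp add: algebra_simps)
    then have "\<kappa> * (y - z) \<le> w y" by (simp add: e_def)
    moreover have "ts_monomial T (Suc 0) y z = y - z"
      using ts_monomial_increment_ge[OF T z(1), of z y 0] ts_monomial_increment_le[OF T z(1), of z y 0 1]
        ts_monomial_self[of "Suc 0" T z] y z by simp
    ultimately show "\<kappa> * ts_monomial T (Suc 0) y z \<le> w y" by simp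
  qed
next
  case (Suc l)
  note D = Suc.prems(1)
  have az: "a \<le> z" using down_closedD(2)[OF D Suc.prems(2)] .
  have dD: "down_closed T a (ddom T D)" by (rule down_closed_ddom[OF T D])
  have zd: "z \<in> ddom T D" by (rule down_closed_ddomI[OF T D z(1) az Suc.prems(4,3)])
  have w: "ddiff T D w" using Suc.prems(5)[of 0] by simp
  obtain r' where r': "z < r'" "r' \<le> r" "r' \<in> ddom T D"
    using right_dense_in_ddom_funpow[OF T D z(1) az Suc.prems(4,3) z(2), of 1] by auto
  let ?h = "\<lambda>u. ts_monomial T (Suc l) u z" and ?H = "\<lambda>u. ts_monomial T (Suc (Suc l)) u z"
  have "\<exists>d>0. \<forall>y\<in>T. z < y \<longrightarrow> y < z + d \<longrightarrow> \<kappa> * ?h y \<le> dder T D w y"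
  proof (rule Suc.IH[OF dD zd r'(3,1)])
    fix i assume i: "i \<le> l"
    show "ddiff T ((ddom T ^^ i) (ddom T D)) (dders T (ddom T D) i (dder T D w))"
      using Suc.prems(5)[of "Suc i"] i
        by (simp only: dders_Suc_shift) (simp add: funpow_swap1)
    show "dders T (ddom T D) i (dder T D w) z = 0"
      using Suc.prems(6)[of "Suc i"] i by (simp only: dders_Suc_shift)
  next
    show "\<kappa> < dders T (ddom T D) (Suc l) (dder T D w) z"
      using Suc.prems(7) by (simp only: dders_Suc_shift[of _ _ "Suc l"])
  qed
  then obtain d where d: "d > 0" "\<And>y. y \<in> T \<Longrightarrow> z < y \<Longrightarrow> y < z + d \<Longrightarrow> \<kappa> * ?h y \<le> dder T D w y" by auto
  have wz: "w z = 0" "dder T D w z = 0" using Suc.prems(6)[of 0] Suc.prems(6)[of 1] by auto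
  have hz: "?h z = 0" "?H z = 0" by (rule ts_monomial_self; simp)+
  show ?case
  proof (intro exI[of _ "min d (r' - z)"] conjI ballI impI)
    show "0 < min d (r' - z)" using d r' by simp
    fix y assume y: "y \<in> T" "z < y" "y < z + min d (r' - z)"
    have indom: "t \<in> ddom T D" if "t \<in> T" "z \<le> t" "t \<le> y" for t
      using that az y by (intro down_closedD(3)[OF dD r'(3)]) auto
    have w': "\<kappa> * ?h t \<le> dder T D w t" if "t \<in> T" "z \<le> t" "t \<le> y" for t
      using d(2)[of t] that y wz hz by (cases "t = z") auto
    have "w z - \<kappa> * ?H z \<le> w y - \<kappa> * ?H y"
    proof (rule time_scale_monotone[where \<phi> = "\<lambda>t. w t - \<kappa> * ?H t", OF T z(1) y(1)])
      show "z \<le> y" using y by simp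
      fix t e :: real assume t: "t \<in> T" "z \<le> t" "t < y" and e: "0 < e"
      have td: "t \<in> ddom T D" using indom t by auto
      show "\<exists>s\<in>T. t < s \<and> s \<le> y \<and> (\<forall>r\<in>T. t < r \<longrightarrow> r \<le> s \<longrightarrow> w t - \<kappa> * ?H t - e * (r - t) \<le> w r - \<kappa> * ?H r)"
      proof (cases "fwd_jump T t = t")
        case False
        define s where "s = fwd_jump T t"
        have s: "s \<in> T" "t < s" "s \<le> y" "\<And>r. r \<in> T \<Longrightarrow> t < r \<Longrightarrow> s \<le> r"
          using fwd_jump_in[OF T(1) t(1)] fwd_jump_ge[OF T(1) t(1)] fwd_jump_gap[OF T(1) t(1)] False t y
          by (auto simp: s_def)
        have "?H s - ?H t \<le> ?h t * (s - t)"
        proof (rule ts_monomial_increment_le[OF T z(1)])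
          fix u assume "u \<in> T" "t \<le> u" "u < s"
          then have "u = t" using s(4)[of u] by (cases "u = t") auto
          then show "?h u \<le> ?h t" by simp
        qed (use t s ts_monomial_nonneg[OF T z(1)] in auto)
        moreover have "?h t * (s - t) \<le> ?H s - ?H t"
          by (rule ts_monomial_increment_ge[OF T z(1)]) (use t s in auto)
        ultimately have "\<kappa> * (?H s - ?H t) = \<kappa> * ?h t * (s - t)" by simp
        also have "\<dots> \<le> dder T D w t * (s - t)" using w'[of t] t s by (intro mult_right_mono) auto
        also have "\<dots> = w s - w t"
          using dder_scattered[OF w td False] s(2) by (simp add: s_def)
        finally have "\<kappa> * (?H s - ?H t) \<le> w s - w t" .
        moreover have "0 \<le> e * (s - t)" using e s by simp
        ultimately have "w t - \<kappa> * ?H t - e * (s - t) \<le> w s - \<kappa> * ?H s" by (simp add: right_diff_distrib)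
        then show ?thesis using s by (intro bexI[of _ s]) (auto dest: s(4))
      next
        case True
        \<comment> \<open>Allowed variation of the monomial of order \<open>l + 1\<close> near
          \<open>t\<close>: multiplied by \<open>\<bar>\<kappa>\<bar>\<close> it uses half of the
          slack \<open>e\<close>, and the expansion of \<open>w\<close> uses the other half.\<close>
        define e' where "e' = e / 2 / (\<bar>\<kappa>\<bar> + 1)"
        have e': "e' > 0" "\<bar>\<kappa>\<bar> * e' \<le> e / 2" using e by (auto simp: e'_def field_simps)
        obtain d1 where d1: "d1 > 0" "\<And>s. s \<in> D \<Longrightarrow> \<bar>s - t\<bar> < d1 \<Longrightarrow> \<bar>w s - w t - dder T D w t * (s - t)\<bar> \<le> e/2 * \<bar>s - t\<bar>"
          using dder_dense[OF w td True, of "e/2"] e by auto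
        obtain d2 where d2: "d2 > 0" "\<And>s. s \<in> T \<Longrightarrow> t < s \<Longrightarrow> s < y \<Longrightarrow> s < t + d2 \<Longrightarrow> \<bar>?h s - ?h t\<bar> < e'"
          using right_cont_onD[OF ts_monomial_right_cont[OF T z(1) y(1)] t e'(1)] by blast
        obtain s where s: "s \<in> T" "t < s" "s < y" "s < t + min d1 d2"
          using right_dense_limit[OF T(1) t(1) True y(1) t(3), of "min d1 d2"] d1 d2 by auto
        show ?thesis
        proof (intro bexI[OF _ s(1)] conjI ballI impI)
          fix r assume r: "r \<in> T" "t < r" "r \<le> s"
          have rD: "r \<in> D" using indom[of r] ddom_subset r t s by auto
          have hr: "\<bar>?h r - ?h t\<bar> < e'" using d2(2)[of r] r s by auto
          have "?H r - ?H t \<le> ?h r * (r - t)"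
            using r t s ts_monomial_nonneg[OF T z(1)] by (intro ts_monomial_increment_le[OF T z(1)] ts_monomial_mono[OF T z(1)]) auto
          also have "\<dots> \<le> (?h t + e') * (r - t)" using hr r by (intro mult_right_mono) auto
          finally have "?H r - ?H t - ?h t * (r - t) \<le> e' * (r - t)" by (simp add: algebra_simps)
          moreover have "?h t * (r - t) \<le> ?H r - ?H t"
            by (rule ts_monomial_increment_ge[OF T z(1)]) (use t r in auto)
          ultimately have "\<bar>?H r - ?H t - ?h t * (r - t)\<bar> \<le> e' * (r - t)" by simp
          then have "\<bar>\<kappa>\<bar> * \<bar>?H r - ?H t - ?h t * (r - t)\<bar> \<le> \<bar>\<kappa>\<bar> * (e' * (r - t))" by (rule mult_left_mono) simp
          also have "\<dots> \<le> e/2 * (r - t)" using e'(2) r by (metis mult.assoc mult_right_mono diff_ge_0_iff_ge less_imp_le)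
          finally have 1: "\<kappa> * (?H r - ?H t - ?h t * (r - t)) \<le> e/2 * (r - t)"
            by (metis abs_ge_self abs_mult order_trans)
          have 2: "\<bar>w r - w t - dder T D w t * (r - t)\<bar> \<le> e/2 * (r - t)" using d1(2)[OF rD] r s by auto
          have 3: "\<kappa> * ?h t * (r - t) \<le> dder T D w t * (r - t)" using w'[of t] t r by (intro mult_right_mono) auto
          show "w t - \<kappa> * ?H t - e * (r - t) \<le> w r - \<kappa> * ?H r"
          proof -
            have "- (e/2 * (r - t)) \<le> w r - w t - dder T D w t * (r - t)" using 2 by (rule abs_le_D2[THEN minus_le_iff[THEN iffD1]])
            moreover have "\<kappa> * (?H r - ?H t - ?h t * (r - t)) = \<kappa> * ?H r - \<kappa> * ?H t - \<kappa> * ?h t * (r - t)"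
              by (simp add: algebra_simps)
            moreover have "e * (r - t) = e/2 * (r - t) + e/2 * (r - t)" by simp
            ultimately show ?thesis using 1 3 by linarith
          qed
        qed (use s in auto)
      qed
    next
      fix t e :: real assume t: "t \<in> T" "z < t" "t \<le> y" and e: "0 < e"
      then have td: "t \<in> ddom T D" using indom by auto
      obtain d1 where d1: "d1 > 0" "\<And>s. s \<in> D \<Longrightarrow> \<bar>s - t\<bar> < d1 \<Longrightarrow> \<bar>w s - w t\<bar> < e/2"
        using dder_continuous[OF w td, of "e/2"] e by auto
      \<comment> \<open>Bounds \<open>\<kappa>\<close> times the increment quotient of the higher
        monomial on the interval from \<open>z\<close> to \<open>y\<close>; the summands 1 keep it
        positive.\<close>
      define C where "C = (\<bar>\<kappa>\<bar> + 1) * (?h y + 1)"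
      have hy: "0 \<le> ?h y" using ts_monomial_nonneg[OF T z(1)] y by auto
      have C: "C > 0" unfolding C_def using hy by (intro mult_pos_pos) auto
      show "\<exists>\<delta>>0. \<forall>r\<in>T. z \<le> r \<longrightarrow> r < t \<longrightarrow> t - \<delta> < r \<longrightarrow> w r - \<kappa> * ?H r \<le> w t - \<kappa> * ?H t + e"
      proof (intro exI[of _ "min d1 (e / 2 / C)"] conjI ballI impI)
        show "0 < min d1 (e / 2 / C)" using d1 e C by simp
        fix r assume r: "r \<in> T" "z \<le> r" "r < t" "t - min d1 (e / 2 / C) < r"
        have "r \<in> D" using indom[of r] ddom_subset r t by auto
        then have 1: "\<bar>w r - w t\<bar> < e/2" using d1 r t by auto
        have "?H t - ?H r \<le> ?h y * (t - r)"
        proof (rule ts_monomial_increment_le[OF T z(1)])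
          fix u assume u: "u \<in> T" "r \<le> u" "u < t"
          then show "?h u \<le> ?h y"
            by (intro ts_monomial_mono[OF T z(1)]) (use t r y in auto)
        qed (use t r hy in auto)
        also have "\<dots> \<le> (?h y + 1) * (t - r)" using r by (intro mult_right_mono) auto
        finally have a1: "?H t - ?H r \<le> (?h y + 1) * (t - r)" .
        have "?H r \<le> ?H t" by (rule ts_monomial_mono[OF T z(1)]) (use r t in auto)
        then have "\<kappa> * (?H t - ?H r) \<le> (\<bar>\<kappa>\<bar> + 1) * (?H t - ?H r)" by (intro mult_right_mono) auto
        also have "\<dots> \<le> (\<bar>\<kappa>\<bar> + 1) * ((?h y + 1) * (t - r))" using a1 by (intro mult_left_mono) auto
        also have "\<dots> = C * (t - r)" by (simp add: C_def)
        also have "\<dots> \<le> e/2"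
        proof -
          have "t - r \<le> e / 2 / C" using r by auto
          then show ?thesis using C by (simp add: field_simps)
        qed
        finally show "w r - \<kappa> * ?H r \<le> w t - \<kappa> * ?H t + e"
          using 1 unfolding right_diff_distrib by linarith
      qed
    qed
    then show "\<kappa> * ?H y \<le> w y" using wz hz by simp
  qed
qed

declare One_nat_def [simp del]

section \<open>Partial derivatives on boxes\<close>

definition lincomb :: "(real \<times> real) list \<Rightarrow> (real \<Rightarrow> real) \<Rightarrow> real" where
  "lincomb L v = (\<Sum>(c, p)\<leftarrow>L. c * v p)"

lemma lincomb_simps [simp]:
  "lincomb [] v = 0" "lincomb ((c, p) # L) v = c * v p + lincomb L v" "lincomb (L @ L') v = lincomb L v + lincomb L' v"
  by (simp_all add: lincomb_def)

lemma lincomb_cong: "(\<And>c p. (c, p) \<in> set L \<Longrightarrow> v p = w p) \<Longrightarrow> lincomb L v = lincomb L w"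
  unfolding lincomb_def by (intro arg_cong[where f = sum_list] map_cong) auto

lemma tendsto_lincomb:
  "(\<And>c p. (c, p) \<in> set L \<Longrightarrow> ((\<lambda>s. u p s) \<longlongrightarrow> l p) F) \<Longrightarrow> ((\<lambda>s. lincomb L (\<lambda>p. u p s)) \<longlongrightarrow> lincomb L l) F"
proof (induction L)
  case (Cons q L)
  then show ?case by (cases q) (auto intro!: tendsto_intros)
qed simp

text \<open>Convergence of the quotients of \<open>v\<close> is a conclusion here. Agreement on
  \<open>A\<close> is enough because the filter and the jump of \<open>t\<close> stay in
  \<open>A\<close>.\<close>

lemma ddiff_lincomb:
  assumes v: "\<And>s. s \<in> A \<Longrightarrow> v s = lincomb L (\<lambda>p. u p s)"
    and u: "\<And>c p. (c, p) \<in> set L \<Longrightarrow> ddiff T A (u p)" and t: "t \<in> ddom T A"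
  shows "(dquot T v t \<longlongrightarrow> lincomb L (\<lambda>p. dder T A (u p) t)) (delta_nhds T A t)"
    and "dder T A v t = lincomb L (\<lambda>p. dder T A (u p) t)"
proof -
  have q: "dquot T v t s = lincomb L (\<lambda>p. dquot T (u p) t s)" if "s \<in> A" for s
  proof -
    have "fwd_jump T t \<in> A" using t by (simp add: ddom_def)
    moreover have "(lincomb L f - lincomb L g) / d = lincomb L (\<lambda>p. (f p - g p) / d)" for f g and d :: real
      by (induction L) (auto simp: algebra_simps add_divide_distrib diff_divide_distrib)
    ultimately show ?thesis using v that by (simp add: dquot_def)
  qed
  have ev: "eventually (\<lambda>s. lincomb L (\<lambda>p. dquot T (u p) t s) = dquot T v t s) (delta_nhds T A t)"
    unfolding eventually_delta_nhds using q by (intro exI[of _ 1]) auto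
  have "((\<lambda>s. lincomb L (\<lambda>p. dquot T (u p) t s)) \<longlongrightarrow> lincomb L (\<lambda>p. dder T A (u p) t)) (delta_nhds T A t)"
    by (rule tendsto_lincomb) (rule dder_tendsto[OF u t])
  from tendsto_cong[OF ev, THEN iffD1, OF this]
  show 1: "(dquot T v t \<longlongrightarrow> lincomb L (\<lambda>p. dder T A (u p) t)) (delta_nhds T A t)" .
  have "delta_nhds T A t \<noteq> bot" using t by (auto simp: ddom_def)
  then show "dder T A v t = lincomb L (\<lambda>p. dder T A (u p) t)" using tendsto_Lim[OF _ 1] t by (simp add: dder_def)
qed

text \<open>The lines in direction \<open>j\<close> through a product set, on which partial delta derivatives are
  one-dimensional ones.\<close>

definition on_line :: "nat \<Rightarrow> nat \<Rightarrow> (nat \<Rightarrow> real set) \<Rightarrow> (nat \<Rightarrow> real) \<Rightarrow> bool" where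
  "on_line n j B x \<longleftrightarrow> x \<in> extensional {1..n} \<and> (\<forall>i\<in>{1..n}. i \<noteq> j \<longrightarrow> x i \<in> B i)"

context
  fixes n j :: nat
  assumes j: "j \<in> {1..n}"
begin

lemma on_line_upd: "on_line n j B x \<Longrightarrow> x(j := t) \<in> PiE {1..n} B \<longleftrightarrow> t \<in> B j"
  using j by (auto simp: on_line_def PiE_iff extensional_def)

lemma PiE_on_line: "x \<in> PiE {1..n} B \<Longrightarrow> on_line n j B x"
  by (auto simp: on_line_def PiE_iff)

lemma on_line_cong: "on_line n j B x \<Longrightarrow> (\<And>i. i \<noteq> j \<Longrightarrow> B i = B' i) \<Longrightarrow> on_line n j B' x"
  by (auto simp: on_line_def)

lemma on_line_fun_upd [simp]: "on_line n j (B(j := C)) x = on_line n j B x"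
  "on_line n j B (x(j := t)) = on_line n j B x"
  using j by (auto simp: on_line_def extensional_def)

lemma delta_filter_line:
  "on_line n j B x \<Longrightarrow> delta_filter T j (PiE {1..n} B) (x(j := t)) = delta_nhds (T j) (B j) t"
  by (simp add: delta_filter_def delta_nhds_def on_line_upd)

lemma delta_quot_line: "delta_quot T j g (x(j := t)) = dquot (T j) (\<lambda>s. g (x(j := s))) t"
  by (simp add: delta_quot_def dquot_def fun_eq_iff)

lemma delta_dom_line:
  "on_line n j B x \<Longrightarrow> x(j := t) \<in> delta_dom T j (PiE {1..n} B) \<longleftrightarrow> t \<in> ddom (T j) (B j)"
  by (simp add: delta_dom_def ddom_def on_line_upd delta_filter_line)

text \<open>Differentiation shrinks the factor \<open>j\<close> alone, so every domain that arises
  from a box is again a product.\<close>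

lemma delta_dom_PiE: "delta_dom T j (PiE {1..n} B) = PiE {1..n} (B(j := ddom (T j) (B j)))"
proof (intro set_eqI)
  fix x
  show "x \<in> delta_dom T j (PiE {1..n} B) \<longleftrightarrow> x \<in> PiE {1..n} (B(j := ddom (T j) (B j)))"
  proof (cases "on_line n j B x")
    case True
    then have "x \<in> delta_dom T j (PiE {1..n} B) \<longleftrightarrow> x j \<in> ddom (T j) (B j)"
      using delta_dom_line[OF True, where T = T and t = "x j"] by (simp only: fun_upd_triv)
    also have "\<dots> \<longleftrightarrow> x \<in> PiE {1..n} (B(j := ddom (T j) (B j)))"
      using on_line_upd[where B = "B(j := ddom (T j) (B j))" and x = x and t = "x j"] True
      by (simp only: on_line_fun_upd fun_upd_triv fun_upd_same)
    finally show ?thesis .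
  next
    case False
    moreover from this have "x \<notin> delta_dom T j (PiE {1..n} B)"
      unfolding delta_dom_def using PiE_on_line by blast
    moreover from False have "x \<notin> PiE {1..n} (B(j := ddom (T j) (B j)))"
      using PiE_on_line on_line_fun_upd(1) by blast
    ultimately show ?thesis by blast
  qed
qed

lemma delta_deriv_line:
  "on_line n j B x \<Longrightarrow> snd (delta_deriv T j (PiE {1..n} B, g)) (x(j := t)) = dder (T j) (B j) (\<lambda>s. g (x(j := s))) t"
  by (simp add: delta_deriv_def dder_def delta_dom_line delta_filter_line delta_quot_line)

lemma fst_delta_deriv_PiE: "fst P = PiE {1..n} B \<Longrightarrow> fst (delta_deriv T j P) = PiE {1..n} (B(j := ddom (T j) (B j)))"
  by (simp add: delta_deriv_def delta_dom_PiE)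

lemma fst_delta_deriv_funpow:
  "fst P = PiE {1..n} B \<Longrightarrow> fst ((delta_deriv T j ^^ k) P) = PiE {1..n} (B(j := (ddom (T j) ^^ k) (B j)))"
proof (induction k)
  case (Suc k)
  from fst_delta_deriv_PiE[OF Suc.IH[OF Suc.prems], of T] show ?case
    by (simp only: funpow.simps o_apply fun_upd_upd fun_upd_same)
qed simp

lemma delta_deriv_funpow_line:
  assumes "on_line n j B x" "fst P = PiE {1..n} B"
  shows "snd ((delta_deriv T j ^^ k) P) (x(j := t)) = dders (T j) (B j) k (\<lambda>s. snd P (x(j := s))) t"
proof (induction k arbitrary: t)
  case (Suc k)
  let ?Q = "(delta_deriv T j ^^ k) P" and ?B = "B(j := (ddom (T j) ^^ k) (B j))"
  have Q: "?Q = (PiE {1..n} ?B, snd ?Q)"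
    using fst_delta_deriv_funpow[OF assms(2), where T = T and k = k] by (metis prod.collapse)
  have "snd ((delta_deriv T j ^^ Suc k) P) (x(j := t)) = snd (delta_deriv T j (PiE {1..n} ?B, snd ?Q)) (x(j := t))"
    using Q by simp
  also have "\<dots> = dder (T j) (?B j) (\<lambda>s. snd ?Q (x(j := s))) t"
    by (rule delta_deriv_line) (use assms in simp)
  also have "\<dots> = dders (T j) (B j) (Suc k) (\<lambda>s. snd P (x(j := s))) t"
    unfolding dders.simps Suc.IH by simp
  finally show ?case .
qed simp

lemma delta_differentiable_line:
  assumes "delta_differentiable T j P" "on_line n j B x" "fst P = PiE {1..n} B"
  shows "ddiff (T j) (B j) (\<lambda>s. snd P (x(j := s)))"
  unfolding ddiff_def
proof
  fix t assume "t \<in> ddom (T j) (B j)"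
  then have "x(j := t) \<in> delta_dom T j (fst P)" using assms by (simp add: delta_dom_line)
  then have "\<exists>l. (delta_quot T j (snd P) (x(j := t)) \<longlongrightarrow> l) (delta_filter T j (fst P) (x(j := t)))"
    using assms(1) by (auto simp: delta_differentiable_def)
  then show "\<exists>l. (dquot (T j) (\<lambda>s. snd P (x(j := s))) t \<longlongrightarrow> l) (delta_nhds (T j) (B j) t)"
    using assms by (simp add: delta_quot_line delta_filter_line)
qed

lemma delta_differentiable_funpow_line:
  assumes "delta_differentiable T j ((delta_deriv T j ^^ k) P)" "on_line n j B x" "fst P = PiE {1..n} B"
  shows "ddiff (T j) ((ddom (T j) ^^ k) (B j)) (dders (T j) (B j) k (\<lambda>s. snd P (x(j := s))))"
proof -
  have "on_line n j (B(j := (ddom (T j) ^^ k) (B j))) x" using assms(2) by (simp only: on_line_fun_upd)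
  then have "ddiff (T j) ((B(j := (ddom (T j) ^^ k) (B j))) j) (\<lambda>s. snd ((delta_deriv T j ^^ k) P) (x(j := s)))"
    by (rule delta_differentiable_line[OF assms(1) _ fst_delta_deriv_funpow[OF assms(3)]])
  moreover have "(\<lambda>s. snd ((delta_deriv T j ^^ k) P) (x(j := s))) = dders (T j) (B j) k (\<lambda>s. snd P (x(j := s)))"
    by (rule ext) (rule delta_deriv_funpow_line[OF assms(2,3)])
  ultimately show ?thesis by (simp only: fun_upd_same)
qed

end

text \<open>\<open>P\<^sub>1\<close> is, where \<open>y i \<in> S\<close>, the combination of the values of \<open>P\<^sub>2\<close> at \<open>y(i := p)\<close> given by \<open>L\<close>. Such a
  relation passes to derivatives in the other variables, in which it is linear.\<close>

definition line_rel :: "nat \<Rightarrow> nat \<Rightarrow> real set \<Rightarrow> (real \<times> real) list \<Rightarrow> pfun \<Rightarrow> pfun \<Rightarrow> bool" where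
  "line_rel n i S L P1 P2 \<longleftrightarrow> (\<exists>B1 B2. fst P1 = PiE {1..n} B1 \<and> fst P2 = PiE {1..n} B2 \<and>
     (\<forall>k. k \<noteq> i \<longrightarrow> B1 k = B2 k) \<and> snd ` set L \<subseteq> B2 i \<and>
     (\<forall>y\<in>PiE {1..n} B1. y i \<in> S \<longrightarrow> snd P1 y = lincomb L (\<lambda>p. snd P2 (y(i := p)))))"

lemma line_relD:
  assumes "line_rel n i S L P1 P2" "y \<in> fst P1" "y i \<in> S"
  shows "snd P1 y = lincomb L (\<lambda>p. snd P2 (y(i := p)))"
  using assms unfolding line_rel_def by auto

text \<open>Updating coordinate \<open>j\<close> commutes with updating coordinate \<open>i\<close>,
  and difference quotients in direction \<open>j\<close> are linear. If the relation holds on the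
  whole domain of \<open>P1\<close>, differentiability passes from \<open>P2\<close> to
  \<open>P1\<close> as well.\<close>

lemma line_rel_delta_deriv:
  assumes ij: "i \<in> {1..n}" "j \<in> {1..n}" "j \<noteq> i"
    and rel: "line_rel n i S L P1 P2" and P2: "delta_differentiable T j P2"
  shows "line_rel n i S L (delta_deriv T j P1) (delta_deriv T j P2)"
    and "(\<And>y. y \<in> fst P1 \<Longrightarrow> y i \<in> S) \<Longrightarrow> delta_differentiable T j P1"
proof -
  obtain B1 B2 where B: "fst P1 = PiE {1..n} B1" "fst P2 = PiE {1..n} B2" "\<And>k. k \<noteq> i \<Longrightarrow> B1 k = B2 k"
    "\<And>c p. (c, p) \<in> set L \<Longrightarrow> p \<in> B2 i"
    "\<And>y. y \<in> PiE {1..n} B1 \<Longrightarrow> y i \<in> S \<Longrightarrow> snd P1 y = lincomb L (\<lambda>p. snd P2 (y(i := p)))"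
  proof -
    obtain B1 B2 where *: "fst P1 = PiE {1..n} B1" "fst P2 = PiE {1..n} B2" "\<forall>k. k \<noteq> i \<longrightarrow> B1 k = B2 k" "snd ` set L \<subseteq> B2 i"
      "\<forall>y\<in>PiE {1..n} B1. y i \<in> S \<longrightarrow> snd P1 y = lincomb L (\<lambda>p. snd P2 (y(i := p)))"
      using rel unfolding line_rel_def by (elim exE conjE)
    show ?thesis
    proof (rule that[OF *(1,2)])
      show "\<And>c p. (c, p) \<in> set L \<Longrightarrow> p \<in> B2 i" using *(4) by force
    qed (use *(3,5) in blast)+
  qed
  have P1e: "P1 = (PiE {1..n} B1, snd P1)" and P2e: "P2 = (PiE {1..n} B2, snd P2)" by (simp_all only: B(1,2)[symmetric] prod.collapse)
  have Bj: "B1 j = B2 j" using B(3) ij by auto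
  have key: "(delta_quot T j (snd P1) y \<longlongrightarrow> lincomb L (\<lambda>p. snd (delta_deriv T j P2) (y(i := p)))) (delta_filter T j (fst P1) y)
    \<and> snd (delta_deriv T j P1) y = lincomb L (\<lambda>p. snd (delta_deriv T j P2) (y(i := p)))"
    if y: "y \<in> PiE {1..n} (B1(j := ddom (T j) (B1 j)))" "y i \<in> S" for y
  proof -
    have ol: "on_line n j B1 y" using PiE_on_line[OF ij(2) y(1)] on_line_fun_upd[OF ij(2)] by simp
    have ol2: "on_line n j B2 (y(i := p))" if "(c, p) \<in> set L" for c p
      using ol B(3) B(4)[OF that] ij by (auto simp: on_line_def extensional_def)
    have t: "y j \<in> ddom (T j) (B1 j)" using PiE_mem[OF y(1) ij(2)] by (simp only: fun_upd_same)
    let ?v = "\<lambda>s. snd P1 (y(j := s))" and ?u = "\<lambda>p s. snd P2 (y(i := p, j := s))"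
    have v: "?v s = lincomb L (\<lambda>p. ?u p s)" if "s \<in> B1 j" for s
    proof -
      have "y(j := s) \<in> PiE {1..n} B1" using that on_line_upd[OF ij(2) ol] by simp
      moreover have "(y(j := s)) i \<in> S" using ij y by simp
      ultimately have "?v s = lincomb L (\<lambda>p. snd P2 (y(j := s, i := p)))" by (rule B(5))
      then show ?thesis using ij by (simp add: fun_upd_twist)
    qed
    have u: "ddiff (T j) (B1 j) (?u p)" if "(c, p) \<in> set L" for c p
      unfolding Bj by (rule delta_differentiable_line[OF ij(2) P2 ol2[OF that] B(2)])
    have d: "snd (delta_deriv T j P2) (y(i := p)) = dder (T j) (B1 j) (?u p) (y j)" if "(c, p) \<in> set L" for c p
      using delta_deriv_line[OF ij(2) ol2[OF that], of T "snd P2" "y j"] ij unfolding P2e[symmetric] Bj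
      by (simp add: fun_upd_idem)
    have d1: "snd (delta_deriv T j P1) y = dder (T j) (B1 j) ?v (y j)"
      using delta_deriv_line[OF ij(2) ol, of T "snd P1" "y j"] unfolding P1e[symmetric] by simp
    have q: "delta_quot T j (snd P1) y = dquot (T j) ?v (y j)"
      using delta_quot_line[OF ij(2), of T "snd P1" y "y j"] by simp
    have f: "delta_filter T j (fst P1) y = delta_nhds (T j) (B1 j) (y j)"
      using delta_filter_line[OF ij(2) ol, of T "y j"] B(1) by simp
    have l: "lincomb L (\<lambda>p. snd (delta_deriv T j P2) (y(i := p))) = lincomb L (\<lambda>p. dder (T j) (B1 j) (?u p) (y j))"
      by (rule lincomb_cong) (rule d)
    show ?thesis unfolding l d1 q f by (intro conjI; rule ddiff_lincomb[OF v u t]; assumption)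
  qed
  show "line_rel n i S L (delta_deriv T j P1) (delta_deriv T j P2)"
    unfolding line_rel_def
  proof (intro exI conjI)
    show "fst (delta_deriv T j P1) = PiE {1..n} (B1(j := ddom (T j) (B1 j)))"
      "fst (delta_deriv T j P2) = PiE {1..n} (B2(j := ddom (T j) (B2 j)))"
      using fst_delta_deriv_PiE[OF ij(2)] B by blast+
    show "\<forall>k. k \<noteq> i \<longrightarrow> (B1(j := ddom (T j) (B1 j))) k = (B2(j := ddom (T j) (B2 j))) k" using B(3) Bj by simp
    show "snd ` set L \<subseteq> (B2(j := ddom (T j) (B2 j))) i" using B(4) ij by auto
  qed (use key in blast)
  show "delta_differentiable T j P1" if S: "\<And>y. y \<in> fst P1 \<Longrightarrow> y i \<in> S"
    unfolding delta_differentiable_def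
  proof
    fix y assume y: "y \<in> delta_dom T j (fst P1)"
    then have "y \<in> fst P1" by (auto simp: delta_dom_def)
    then have "y i \<in> S" by (rule S)
    then show "\<exists>l. (delta_quot T j (snd P1) y \<longlongrightarrow> l) (delta_filter T j (fst P1) y)"
      using key[of y] y delta_dom_PiE[OF ij(2)] B(1) by auto
  qed
qed

lemma line_rel_funpow:
  assumes ij: "i \<in> {1..n}" "j \<in> {1..n}" "j \<noteq> i"
    and rel: "line_rel n i S L P1 P2"
  shows "(\<And>\<kappa>. \<kappa> < k \<Longrightarrow> delta_differentiable T j ((delta_deriv T j ^^ \<kappa>) P2)) \<Longrightarrow>
    line_rel n i S L ((delta_deriv T j ^^ k) P1) ((delta_deriv T j ^^ k) P2)"
proof (induction k)
  case (Suc k)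
  then show ?case using line_rel_delta_deriv(1)[OF ij, of S L "(delta_deriv T j ^^ k) P1"] by simp
qed (use rel in simp)

text \<open>Derivatives are defined through \<open>Lim\<close>, which says nothing when a limit is
  missing. This predicate records that all limits met on the way to
  \<open>mixed_deriv T k m P\<close> exist.\<close>

definition diff_chain :: "(nat \<Rightarrow> real set) \<Rightarrow> (nat \<Rightarrow> nat) \<Rightarrow> nat \<Rightarrow> pfun \<Rightarrow> bool" where
  "diff_chain T k m P \<longleftrightarrow> (\<forall>i\<in>{1..m}. \<forall>\<kappa><k i. delta_differentiable T i ((delta_deriv T i ^^ \<kappa>) (mixed_deriv T k (i - 1) P)))"

text \<open>The condition \<open>i \<le> m0 \<or> m < i\<close> says that variable \<open>i\<close>
  is not among those differentiated between the stages \<open>m0\<close> and \<open>m\<close>; in it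
  the relation is not linear but a change of base points.\<close>

lemma line_rel_mixed:
  assumes i: "i \<in> {1..n}" and m: "m0 \<le> m" "m \<le> n" and out: "i \<le> m0 \<or> m < i"
    and rel: "line_rel n i S L (mixed_deriv T k1 m0 P1) (mixed_deriv T k2 m0 P2)"
    and k: "\<And>l. m0 < l \<Longrightarrow> l \<le> m \<Longrightarrow> k1 l = k2 l"
    and P2: "diff_chain T k2 m P2"
  shows "line_rel n i S L (mixed_deriv T k1 m P1) (mixed_deriv T k2 m P2)"
  using m(1) m(2) out k P2
proof (induction m rule: dec_induct)
  case base show ?case by (rule rel)
next
  case (step m)
  have "line_rel n i S L (mixed_deriv T k1 m P1) (mixed_deriv T k2 m P2)"
    using step by (intro step.IH) (auto simp: diff_chain_def)
  moreover have "Suc m \<noteq> i" using step by auto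
  moreover have "k1 (Suc m) = k2 (Suc m)" using step by auto
  ultimately show ?case
    using step.prems(4) step.prems(1) i
    by (fastforce simp: diff_chain_def intro!: line_rel_funpow)
qed

lemma mixed_deriv_fst_mem:
  assumes "i \<in> {1..n}" "m \<le> n" "m < i" "fst P = PiE {1..n} B"
  shows "y \<in> fst (mixed_deriv T k m P) \<Longrightarrow> y i \<in> B i"
proof -
  have "\<exists>B'. fst (mixed_deriv T k m P) = PiE {1..n} B' \<and> B' i = B i"
    using assms
  proof (induction m)
    case (Suc m)
    then obtain B' where B': "fst (mixed_deriv T k m P) = PiE {1..n} B'" "B' i = B i" by auto
    have "Suc m \<in> {1..n}" using Suc.prems by auto
    from fst_delta_deriv_funpow[OF this B'(1), where T = T and k = "k (Suc m)"] show ?case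
      unfolding mixed_deriv.simps using B'(2) Suc.prems by (intro exI conjI) (assumption, simp)
  qed auto
  then show "y \<in> fst (mixed_deriv T k m P) \<Longrightarrow> y i \<in> B i" using assms(1) by (metis PiE_mem)
qed

text \<open>Before stage \<open>i\<close> the coordinate \<open>y i\<close> still ranges over
  \<open>B i\<close>, where the relation holds without restriction, so differentiability is
  inherited from \<open>P2\<close> at every stage.\<close>

lemma diff_chain_line_rel:
  assumes i: "i \<in> {1..n}" and m: "m \<le> n" "m < i" and P1: "fst P1 = PiE {1..n} B"
    and rel: "line_rel n i (B i) L P1 P2"
    and P2: "diff_chain T k m P2"
  shows "diff_chain T k m P1"
  unfolding diff_chain_def
proof (intro ballI allI impI)
  fix l \<kappa> assume l: "l \<in> {1..m}" and \<kappa>: "\<kappa> < k l"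
  have dd: "delta_differentiable T l ((delta_deriv T l ^^ \<kappa>') (mixed_deriv T k (l - 1) P2))" if "\<kappa>' < k l" for \<kappa>'
    using P2 l that unfolding diff_chain_def by auto
  have "line_rel n i (B i) L (mixed_deriv T k (l - 1) P1) (mixed_deriv T k (l - 1) P2)"
  proof (rule line_rel_mixed[OF i, of 0])
    show "diff_chain T k (l - 1) P2" using P2 l unfolding diff_chain_def by auto
    show "line_rel n i (B i) L (mixed_deriv T k 0 P1) (mixed_deriv T k 0 P2)" using rel by simp
  qed (use l m in auto)
  then have r: "line_rel n i (B i) L ((delta_deriv T l ^^ \<kappa>) (mixed_deriv T k (l - 1) P1)) ((delta_deriv T l ^^ \<kappa>) (mixed_deriv T k (l - 1) P2))"
    using l m \<kappa> by (intro line_rel_funpow[OF i _ _ _ dd]) auto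
  show "delta_differentiable T l ((delta_deriv T l ^^ \<kappa>) (mixed_deriv T k (l - 1) P1))"
  proof (rule line_rel_delta_deriv(2)[OF i _ _ r dd[OF \<kappa>]])
    show "l \<in> {1..n}" "l \<noteq> i" using l m by auto
    fix y assume y: "y \<in> fst ((delta_deriv T l ^^ \<kappa>) (mixed_deriv T k (l - 1) P1))"
    have "(delta_deriv T l ^^ \<kappa>) (mixed_deriv T k (l - 1) P1) = mixed_deriv T (k(l := \<kappa>)) l P1"
    proof -
      have "mixed_deriv T (k(l := \<kappa>)) q P1 = mixed_deriv T k q P1" if "q < l" for q
        using that by (induction q) auto
      then show ?thesis using l by (cases l) auto
    qed
    then show "y i \<in> B i" using mixed_deriv_fst_mem[OF i _ _ P1, of l y T "k(l := \<kappa>)"] y l m by auto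
  qed
qed

section \<open>Baire category and functionals detecting a derivative\<close>

text \<open>If no \<open>C q\<close> contained such an interval, the complements would be dense and
  relatively open with empty intersection, against Baire's theorem. Rational ends keep the families
  of boxes in \<open>Baire_box\<close> countable.\<close>

lemma countable_closed_cover_interval:
  fixes C :: "'q \<Rightarrow> real set"
  assumes uv: "u < v" and Q: "countable Q" and cl: "\<And>q. q \<in> Q \<Longrightarrow> closed (C q)" and cov: "{u..v} \<subseteq> (\<Union>q\<in>Q. C q)"
  obtains l r :: rat and q where "q \<in> Q" "u \<le> of_rat l" "l < r" "of_rat r \<le> v" "{of_rat l..of_rat r} \<subseteq> C q"
proof (rule ccontr)
  note result = that
  assume neg: "\<not> thesis"
  have dense: "{u..v} \<subseteq> closure ({u..v} - C q)" if q: "q \<in> Q" for q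
  proof
    fix x assume x: "x \<in> {u..v}"
    show "x \<in> closure ({u..v} - C q)"
      unfolding closure_approachable
    proof (intro allI impI, rule ccontr)
      fix e :: real assume e: "0 < e" and n: "\<not> (\<exists>y\<in>{u..v} - C q. dist y x < e)"
      have "max u (x - e) < min v (x + e)" using x e uv by auto
      then obtain l where l: "max u (x - e) < of_rat l" "of_rat l < min v (x + e)" using of_rat_dense by blast
      from l(2) obtain r where r: "of_rat l < (of_rat r :: real)" "of_rat r < min v (x + e)" using of_rat_dense by blast
      have "{of_rat l..of_rat r} \<subseteq> C q"
      proof
        fix y :: real assume y: "y \<in> {of_rat l..of_rat r}"
        then have "y \<in> {u..v}" "dist y x < e" using l r by (auto simp: dist_real_def)
        then show "y \<in> C q" using n by blast
      qed
      then show False using neg result[OF q, of l r] l r by (auto simp: of_rat_less)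
    qed
  qed
  have "{u..v} \<subseteq> closure (\<Inter>((\<lambda>q. {u..v} - C q) ` Q))"
  proof (rule Baire)
    show "countable ((\<lambda>q. {u..v} - C q) ` Q)" using Q by simp
    fix X assume "X \<in> (\<lambda>q. {u..v} - C q) ` Q"
    then obtain q where q: "q \<in> Q" "X = {u..v} - C q" by auto
    have "openin (top_of_set {u..v}) ({u..v} \<inter> - C q)" using cl[OF q(1)] by (intro openin_open_Int) auto
    moreover have "{u..v} \<inter> - C q = X" using q by auto
    ultimately show "openin (top_of_set {u..v}) X \<and> {u..v} \<subseteq> closure X" using dense[OF q(1)] q by simp
  qed simp
  moreover have "\<Inter>((\<lambda>q. {u..v} - C q) ` Q) = {}"
  proof (rule equals0I)
    fix x assume x: "x \<in> \<Inter>((\<lambda>q. {u..v} - C q) ` Q)"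
    have "u \<in> {u..v}" using uv by simp
    then have "u \<in> (\<Union>q\<in>Q. C q)" using cov by blast
    then have "x \<in> {u..v}" using x by blast
    then have "x \<in> (\<Union>q\<in>Q. C q)" using cov by blast
    then show False using x by blast
  qed
  ultimately show False using uv by simp
qed

text \<open>Separate continuity suffices for a Baire category argument on boxes: it is applied to one
  coordinate at a time, with boxes of rational corners in the other coordinates.\<close>

lemma Baire_box:
  fixes l r c :: "nat \<Rightarrow> real" and P :: "nat \<Rightarrow> (nat \<Rightarrow> real) \<Rightarrow> bool"
  assumes Q: "\<And>y. Q y \<longleftrightarrow> (\<forall>i\<in>S0. l i \<le> y i \<and> y i \<le> r i) \<and> (\<forall>i. i \<notin> S0 \<longrightarrow> y i = c i)"
    and op: "\<And>y i. Q y \<Longrightarrow> U y \<Longrightarrow> i \<in> S0 \<Longrightarrow> y i < r i \<Longrightarrow> \<exists>u>y i. u \<le> r i \<and> (\<forall>s\<in>{y i..u}. U (y(i := s)))"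
    and cl: "\<And>y i N. Q y \<Longrightarrow> i \<in> S0 \<Longrightarrow> closed {s \<in> {l i..r i}. P N (y(i := s))}"
    and ex: "\<And>y. Q y \<Longrightarrow> U y \<Longrightarrow> \<exists>N. P N y"
  shows "finite S \<Longrightarrow> S \<subseteq> S0 \<Longrightarrow> Q y0 \<Longrightarrow> U y0 \<Longrightarrow> (\<forall>i\<in>S. y0 i < r i) \<Longrightarrow>
    \<exists>N. \<exists>p\<in>PiE S (\<lambda>_. UNIV :: (rat \<times> rat) set).
      (\<forall>i\<in>S. l i \<le> of_rat (fst (p i)) \<and> fst (p i) < snd (p i) \<and> of_rat (snd (p i)) \<le> r i) \<and>
      (\<forall>y. (\<forall>i\<in>S. of_rat (fst (p i)) \<le> y i \<and> y i \<le> of_rat (snd (p i))) \<and> (\<forall>i. i \<notin> S \<longrightarrow> y i = y0 i) \<longrightarrow> P N y)"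
proof (induction S arbitrary: y0 rule: finite_induct)
  case empty
  obtain N where N: "P N y0" using ex empty by blast
  show ?case
  proof (intro exI[of _ N] bexI[of _ "\<lambda>_. undefined"])
    have "y = y0" if "\<forall>i. i \<notin> {} \<longrightarrow> y i = y0 i" for y using that by auto
    then show "(\<forall>i\<in>{}. l i \<le> of_rat (fst undefined) \<and> fst undefined < (snd undefined :: rat) \<and> of_rat (snd undefined) \<le> r i) \<and>
      (\<forall>y. (\<forall>i\<in>{}. of_rat (fst undefined) \<le> y i \<and> y i \<le> of_rat (snd undefined)) \<and> (\<forall>i. i \<notin> {} \<longrightarrow> y i = y0 i) \<longrightarrow> P N y)"
      using N by blast
  qed simp
next
  case (insert i S)
  have i: "i \<in> S0" "y0 i < r i" using insert by auto
  have iS: "i \<notin> S" by fact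
  then have ne: "k \<noteq> i" if "k \<in> S" for k using that by blast
  obtain u where u: "u > y0 i" "u \<le> r i" "\<forall>s\<in>{y0 i..u}. U (y0(i := s))" using op[of y0 i] i insert.prems by blast
  define good where "good p \<longleftrightarrow> (\<forall>i\<in>S. l i \<le> of_rat (fst (p i)) \<and> fst (p i) < snd (p i) \<and> of_rat (snd (p i)) \<le> r i)"
    for p :: "nat \<Rightarrow> rat \<times> rat"
  define Y where "Y p = {y. (\<forall>i\<in>S. of_rat (fst (p i)) \<le> y i \<and> y i \<le> of_rat (snd (p i))) \<and> (\<forall>i'. i' \<notin> S \<longrightarrow> y i' = y0 i')}"
    for p :: "nat \<Rightarrow> rat \<times> rat"
  \<comment> \<open>For a pair of a threshold and a rational box in the coordinates
    \<open>S\<close>, the values of coordinate \<open>i\<close> for which the threshold works on the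
    whole box. As an intersection over the other coordinates, this set is closed although
    \<open>P\<close> is only separately closed; the induction hypothesis at each fixed value shows
    that countably many such sets cover.\<close>
  define C where "C q = {l i..r i} \<inter> (\<Inter>y\<in>Y (snd q). {s \<in> {l i..r i}. P (fst q) (y(i := s))})" for q :: "nat \<times> (nat \<Rightarrow> rat \<times> rat)"
  define QQ where "QQ = (UNIV :: nat set) \<times> {p \<in> PiE S (\<lambda>_. UNIV :: (rat \<times> rat) set). good p}"
  have li: "l i \<le> y0 i" using insert i Q by auto
  have "countable (PiE S (\<lambda>_. UNIV :: (rat \<times> rat) set))" using insert by (intro countable_PiE) auto
  then have "countable {p \<in> PiE S (\<lambda>_. UNIV :: (rat \<times> rat) set). good p}" by (rule countable_subset[rotated]) auto
  then have cQ: "countable QQ" unfolding QQ_def by (intro countable_SIGMA) auto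
  have YQ: "Q y" if "y \<in> Y p" "good p" for y p
    unfolding Q
  proof (intro conjI ballI allI impI)
    fix i' assume i': "i' \<in> S0"
    show "l i' \<le> y i'" "y i' \<le> r i'"
      using that i' insert.prems(2) unfolding Y_def good_def Q by (cases "i' \<in> S"; fastforce)+
  next
    fix i' assume "i' \<notin> S0" then show "y i' = c i'" using that insert.prems unfolding Y_def Q by auto
  qed
  have clC: "closed (C q)" if "q \<in> QQ" for q
    unfolding C_def using that YQ cl[OF _ i(1)] by (intro closed_Int closed_INT) (auto simp: QQ_def)
  have covC: "{y0 i..u} \<subseteq> (\<Union>q\<in>QQ. C q)"
  proof
    fix s assume s: "s \<in> {y0 i..u}"
    have 1: "Q (y0(i := s))" using insert.prems(2) s u i li unfolding Q by auto
    have 2: "U (y0(i := s))" using u s by auto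
    have 3: "\<forall>i'\<in>S. (y0(i := s)) i' < r i'" using insert.prems iS by auto
    have 4: "S \<subseteq> S0" using insert.prems by auto
    obtain N p where p: "p \<in> PiE S (\<lambda>_. UNIV)" "good p"
      "\<forall>y. (\<forall>i\<in>S. of_rat (fst (p i)) \<le> y i \<and> y i \<le> of_rat (snd (p i))) \<and> (\<forall>i'. i' \<notin> S \<longrightarrow> y i' = (y0(i := s)) i') \<longrightarrow> P N y"
      using insert.IH[OF 4 1 2 3] unfolding good_def by (elim exE bexE conjE)
    have "P N (y(i := s))" if "y \<in> Y p" for y
    proof -
      have "(\<forall>k\<in>S. of_rat (fst (p k)) \<le> (y(i := s)) k \<and> (y(i := s)) k \<le> of_rat (snd (p k))) \<and> (\<forall>i'. i' \<notin> S \<longrightarrow> (y(i := s)) i' = (y0(i := s)) i')"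
        using that unfolding Y_def by (simp add: ne)
      then show ?thesis using p(3) by blast
    qed
    then have "s \<in> C (N, p)" using s u li unfolding C_def by auto
    then show "s \<in> (\<Union>q\<in>QQ. C q)" using p unfolding QQ_def by blast
  qed
  obtain l' r' q where q: "q \<in> QQ" "y0 i \<le> of_rat l'" "l' < r'" "of_rat r' \<le> u" "{of_rat l'..of_rat r'} \<subseteq> C q"
    by (rule countable_closed_cover_interval[OF u(1) cQ clC covC])
  obtain N p where qe: "q = (N, p)" by (cases q)
  have p: "p \<in> PiE S (\<lambda>_. UNIV)" "good p" using q(1) by (auto simp: QQ_def qe)
  show ?case
  proof (intro exI[of _ N] bexI[of _ "p(i := (l', r'))"] conjI ballI allI impI)
    show "p(i := (l', r')) \<in> PiE (insert i S) (\<lambda>_. UNIV)" using p by (intro PiE_fun_upd) auto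
    fix i' assume i': "i' \<in> insert i S"
    show "l i' \<le> of_rat (fst ((p(i := (l', r'))) i'))" "fst ((p(i := (l', r'))) i') < snd ((p(i := (l', r'))) i')"
      "of_rat (snd ((p(i := (l', r'))) i')) \<le> r i'"
      using i' p(2) q(2,3,4) u(2) li iS unfolding good_def by (cases "i' = i"; simp)+
  next
    fix y assume y: "(\<forall>i'\<in>insert i S. of_rat (fst ((p(i := (l', r'))) i')) \<le> y i' \<and> y i' \<le> of_rat (snd ((p(i := (l', r'))) i'))) \<and> (\<forall>i'. i' \<notin> insert i S \<longrightarrow> y i' = y0 i')"
    have "y(i := y0 i) \<in> Y p" unfolding Y_def using y iS by auto
    moreover have "y i \<in> C q" using q(5) y by auto
    ultimately have "P N ((y(i := y0 i))(i := y i))" unfolding C_def qe by auto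
    then show "P N y" by simp
  qed
qed

text \<open>An iterated forward difference, estimated by the mean value theorem. The nodes and
  \<open>\<delta>\<close> are fixed before \<open>v\<close>, so one functional serves all slices of
  a function of several variables.\<close>

lemma difference_functional:
  "(l :: real) < r \<Longrightarrow> \<exists>L \<delta>. 0 < \<delta> \<and> snd ` set L \<subseteq> {l<..<r} \<and>
    (\<forall>v \<epsilon>. (\<forall>i<\<kappa>. \<forall>t\<in>{l<..<r}. (v i has_real_derivative v (Suc i) t) (at t)) \<and> (\<forall>t\<in>{l<..<r}. \<epsilon> \<le> v \<kappa> t)
      \<longrightarrow> \<delta> * \<epsilon> \<le> lincomb L (v 0))"
proof (induction \<kappa> arbitrary: r)
  case 0
  show ?case
    by (rule exI[of _ "[(1, (l + r) / 2)]"], rule exI[of _ 1]) (use 0 in auto)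
next
  case (Suc \<kappa>)
  \<comment> \<open>Half the length leaves room for the shift: the nodes found in the left half and
    their translates by \<open>\<eta>\<close> all lie between \<open>l\<close> and
    \<open>r\<close>.\<close>
  define \<eta> where "\<eta> = (r - l) / 2"
  have \<eta>: "\<eta> > 0" "l < l + \<eta>" "l + \<eta> + \<eta> = r" using Suc.prems by (auto simp: \<eta>_def)
  obtain L \<delta> where L: "0 < \<delta>" "snd ` set L \<subseteq> {l<..<l + \<eta>}" 
    "\<forall>v \<epsilon>. (\<forall>i<\<kappa>. \<forall>t\<in>{l<..<l + \<eta>}. (v i has_real_derivative v (Suc i) t) (at t)) \<and> (\<forall>t\<in>{l<..<l + \<eta>}. \<epsilon> \<le> v \<kappa> t)
      \<longrightarrow> \<delta> * \<epsilon> \<le> lincomb L (v 0)"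
    using Suc.IH[OF \<eta>(2)] by (elim exE conjE)
  define L' where "L' = map (\<lambda>(c, p). (c, p + \<eta>)) L @ map (\<lambda>(c, p). (- c, p)) L"
  have L': "lincomb L' v = lincomb L (\<lambda>p. v (p + \<eta>) - v p)" for v
    unfolding L'_def lincomb_simps by (induction L) (simp_all add: split_beta lincomb_def right_diff_distrib)
  show ?case
  proof (rule exI[of _ L'], rule exI[of _ "\<delta> * \<eta>"], intro conjI allI impI)
    show "0 < \<delta> * \<eta>" using L(1) \<eta>(1) by simp
    show "snd ` set L' \<subseteq> {l<..<r}" 
    proof -
      have "p \<in> {l<..<r}" "p + \<eta> \<in> {l<..<r}" if "(c, p) \<in> set L" for c p
      proof -
        have "p \<in> {l<..<l + \<eta>}" using that L(2) by force
        then show "p \<in> {l<..<r}" "p + \<eta> \<in> {l<..<r}" using \<eta> by auto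
      qed
      then show ?thesis by (auto simp: L'_def)
    qed
    fix v :: "nat \<Rightarrow> real \<Rightarrow> real" and \<epsilon> :: real
    assume v: "(\<forall>i<Suc \<kappa>. \<forall>t\<in>{l<..<r}. (v i has_real_derivative v (Suc i) t) (at t)) \<and> (\<forall>t\<in>{l<..<r}. \<epsilon> \<le> v (Suc \<kappa>) t)"
    have D: "(v i has_real_derivative v (Suc i) t) (at t)" if "i < Suc \<kappa>" "l < t" "t < r" for i t using v that by auto
    define w where "w i t = v i (t + \<eta>) - v i t" for i t
    have we: "w i = (\<lambda>t. v i (t + \<eta>) - v i t)" for i by (rule ext) (simp add: w_def)
    have "\<delta> * (\<eta> * \<epsilon>) \<le> lincomb L (w 0)"
    proof (rule L(3)[THEN spec, THEN spec, THEN mp], intro conjI)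
      show "\<forall>i<\<kappa>. \<forall>t\<in>{l<..<l + \<eta>}. (w i has_real_derivative w (Suc i) t) (at t)"
      proof (intro allI impI ballI)
        fix i t assume "i < \<kappa>" "t \<in> {l<..<l + \<eta>}"
        then have "(v i has_real_derivative v (Suc i) (t + \<eta>)) (at (t + \<eta>))" "(v i has_real_derivative v (Suc i) t) (at t)"
          using \<eta> by (auto intro!: D)
        from DERIV_diff[OF DERIV_shift[THEN iffD1, OF this(1)] this(2)]
        show "(w i has_real_derivative w (Suc i) t) (at t)" by (simp only: we)
      qed
      show "\<forall>t\<in>{l<..<l + \<eta>}. \<eta> * \<epsilon> \<le> w \<kappa> t"
      proof
        fix t assume t: "t \<in> {l<..<l + \<eta>}"
        have "\<exists>z. t < z \<and> z < t + \<eta> \<and> v \<kappa> (t + \<eta>) - v \<kappa> t = (t + \<eta> - t) * v (Suc \<kappa>) z"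
          using t \<eta> by (intro MVT2 D) auto
        then obtain z where z: "t < z" "z < t + \<eta>" "v \<kappa> (t + \<eta>) - v \<kappa> t = \<eta> * v (Suc \<kappa>) z" by auto
        have "z \<in> {l<..<r}" using z(1,2) t \<eta> by auto
        then have "\<epsilon> \<le> v (Suc \<kappa>) z" using v by blast
        then show "\<eta> * \<epsilon> \<le> w \<kappa> t" unfolding w_def z(3) using \<eta> by simp
      qed
    qed
    then show "\<delta> * \<eta> * \<epsilon> \<le> lincomb L' (v 0)" unfolding L' w_def by (simp add: mult.assoc)
  qed
qed

text \<open>An interior point of the domain is right-dense and its delta filter is the ordinary
  punctured neighbourhood filter.\<close>

lemma dder_DERIV:
  assumes AT: "A \<subseteq> T" "closed T" and v: "ddiff T A v" and t: "t \<in> ddom T A" "t \<in> interior A"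
  shows "(v has_real_derivative dder T A v t) (at t)"
proof -
  obtain e where e: "e > 0" "ball t e \<subseteq> A" using t(2) by (auto simp: mem_interior)
  have tT: "t \<in> T" using t AT interior_subset by auto
  have f: "fwd_jump T t = t"
  proof (rule ccontr)
    assume "fwd_jump T t \<noteq> t"
    then have g: "t < fwd_jump T t" using fwd_jump_ge[OF AT(2) tT] by simp
    define s where "s = min ((t + fwd_jump T t) / 2) (t + e / 2)"
    have s: "t < s" "s < fwd_jump T t" "s < t + e" using g e by (auto simp: s_def min_def)
    then have "s \<in> T" using e AT by (auto simp: subset_eq dist_real_def)
    then show False using fwd_jump_gap[OF AT(2) tT, of s] s by auto
  qed
  have "delta_nhds T A t = at t within A"
    unfolding delta_nhds_def f at_within_def by (rule arg_cong[where f = "\<lambda>X. inf (nhds t) (principal X)"]) auto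
  also have "\<dots> = at t" by (rule at_within_interior[OF t(2)])
  finally have "(dquot T v t \<longlongrightarrow> dder T A v t) (at t)" using dder_tendsto[OF v t(1)] by simp
  moreover have "dquot T v t = (\<lambda>s. (v s - v t) / (s - t))"
    unfolding dquot_def f by (rule ext) (metis minus_diff_eq minus_divide_divide)
  ultimately show ?thesis by (simp add: has_field_derivative_iff)
qed

text \<open>A lower bound for the derivative of order \<open>\<kappa>\<close> on the cell \<open>C\<close> is detected by finitely many values of the function,
  about which something is known in the limit \<open>x j \<rightarrow> A\<close> even when nothing is known about the derivatives.\<close>

definition cell_functional ::
  "real set \<Rightarrow> real set \<Rightarrow> nat \<Rightarrow> real set \<Rightarrow> (real \<times> real) list \<Rightarrow> real \<Rightarrow> bool" where
  "cell_functional T B \<kappa> C L \<delta> \<longleftrightarrow> 0 < \<delta> \<and> snd ` set L \<subseteq> B \<and> C \<subseteq> (ddom T ^^ \<kappa>) B \<and>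
    (\<forall>v \<epsilon>. (\<forall>i<\<kappa>. ddiff T ((ddom T ^^ i) B) (dders T B i v)) \<longrightarrow> (\<forall>t\<in>C. \<epsilon> \<le> dders T B \<kappa> v t)
      \<longrightarrow> \<delta> * \<epsilon> \<le> lincomb L v)"

lemma cell_functional_scattered:
  assumes "closed T" "B \<subseteq> T" "t \<in> ddom T B" "fwd_jump T t \<noteq> t"
  shows "\<exists>L \<delta>. cell_functional T B 1 {t} L \<delta>"
proof -
  define \<mu> where "\<mu> = fwd_jump T t - t"
  have tB: "t \<in> B" "fwd_jump T t \<in> B" using assms by (auto simp: ddom_def)
  have "cell_functional T B 1 {t} [(1 / \<mu>, fwd_jump T t), (- 1 / \<mu>, t)] 1"
    unfolding cell_functional_def
  proof (intro conjI allI impI)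
    fix v \<epsilon> assume "\<forall>i<1. ddiff T ((ddom T ^^ i) B) (dders T B i v)" and e: "\<forall>t\<in>{t}. \<epsilon> \<le> dders T B 1 v t"
    then have "ddiff T B v" by simp
    then have "dders T B 1 v t = lincomb [(1 / \<mu>, fwd_jump T t), (- 1 / \<mu>, t)] v"
      using dder_scattered[of T B v t] assms by (simp add: \<mu>_def diff_divide_distrib One_nat_def)
    then show "1 * \<epsilon> \<le> lincomb [(1 / \<mu>, fwd_jump T t), (- 1 / \<mu>, t)] v" using e by simp
  qed (use assms tB in \<open>auto simp: One_nat_def\<close>)
  then show ?thesis by blast
qed

lemma cell_functional_interval:
  assumes T: "closed T" and B: "down_closed T a B" and lr: "l < r" "{l..r} \<subseteq> T" "a \<le> l" "r \<in> B" "{l..r} \<subseteq> (ddom T ^^ \<kappa>) B"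
  shows "\<exists>L \<delta>. cell_functional T B \<kappa> {l..r} L \<delta>"
proof -
  obtain L \<delta> where L: "0 < \<delta>" "snd ` set L \<subseteq> {l<..<r}" 
    "\<forall>v \<epsilon>. (\<forall>i<\<kappa>. \<forall>t\<in>{l<..<r}. (v i has_real_derivative v (Suc i) t) (at t)) \<and> (\<forall>t\<in>{l<..<r}. \<epsilon> \<le> v \<kappa> t)
      \<longrightarrow> \<delta> * \<epsilon> \<le> lincomb L (v 0)"
    using difference_functional[OF lr(1), of \<kappa>] by (elim exE conjE)
  have sub: "{l..r} \<subseteq> (ddom T ^^ i) B" if "i \<le> \<kappa>" for i
    using lr(5) ddom_funpow_antimono[OF that] by blast
  have "cell_functional T B \<kappa> {l..r} L \<delta>"
    unfolding cell_functional_def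
  proof (intro conjI allI impI)
    have "{l<..<r} \<subseteq> B" using sub[of 0] by (auto simp: subset_eq)
    then show "snd ` set L \<subseteq> B" using L(2) by (rule order_trans[rotated])
    fix v \<epsilon> assume v: "\<forall>i<\<kappa>. ddiff T ((ddom T ^^ i) B) (dders T B i v)" and e: "\<forall>t\<in>{l..r}. \<epsilon> \<le> dders T B \<kappa> v t"
    have "\<delta> * \<epsilon> \<le> lincomb L (dders T B 0 v)"
    proof (rule L(3)[THEN spec, THEN spec, THEN mp], intro conjI)
      show "\<forall>i<\<kappa>. \<forall>t\<in>{l<..<r}. (dders T B i v has_real_derivative dders T B (Suc i) v t) (at t)"
      proof (intro allI impI ballI)
        fix i t assume i: "i < \<kappa>" and t: "t \<in> {l<..<r}"
        let ?A = "(ddom T ^^ i) B"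
        have "(dders T B i v has_real_derivative dder T ?A (dders T B i v) t) (at t)"
        proof (rule dder_DERIV[OF _ T])
          show "?A \<subseteq> T" by (intro subsetI) (rule down_closedD(1)[OF down_closed_ddom_funpow[OF T B]])
          show "ddiff T ?A (dders T B i v)" using v i by auto
          show "t \<in> ddom T ?A" using sub[of "Suc i"] i t by auto
          have "{l<..<r} \<subseteq> interior ?A" using sub[of i] i by (intro interior_maximal) auto
          then show "t \<in> interior ?A" using t by auto
        qed
        then show "(dders T B i v has_real_derivative dders T B (Suc i) v t) (at t)" by simp
      qed
    qed (use e in auto)
    then show "\<delta> * \<epsilon> \<le> lincomb L v" by simp
  qed (use L(1) lr(5) in auto)
  then show ?thesis by blast
qed

definition mixed_dom :: "(nat \<Rightarrow> real set) \<Rightarrow> (nat \<Rightarrow> nat) \<Rightarrow> nat \<Rightarrow> (nat \<Rightarrow> real set) \<Rightarrow> nat \<Rightarrow> real set" where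
  "mixed_dom T k m B i = (if 1 \<le> i \<and> i \<le> m then (ddom (T i) ^^ k i) (B i) else B i)"

lemma fst_mixed_deriv:
  "m \<le> n \<Longrightarrow> fst P = PiE {1..n} B \<Longrightarrow> fst (mixed_deriv T k m P) = PiE {1..n} (mixed_dom T k m B)"
proof (induction m)
  case 0 
  have "mixed_dom T k 0 B = B" by (auto simp: mixed_dom_def fun_eq_iff)
  then show ?case using 0 by (simp only: mixed_deriv.simps)
next
  case (Suc m)
  have "Suc m \<in> {1..n}" using Suc.prems by auto
  moreover have "fst (mixed_deriv T k m P) = PiE {1..n} (mixed_dom T k m B)" using Suc by auto
  ultimately have "fst ((delta_deriv T (Suc m) ^^ k (Suc m)) (mixed_deriv T k m P)) =
     PiE {1..n} ((mixed_dom T k m B)(Suc m := (ddom (T (Suc m)) ^^ k (Suc m)) (mixed_dom T k m B (Suc m))))"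
    by (rule fst_delta_deriv_funpow)
  moreover have "(mixed_dom T k m B)(Suc m := (ddom (T (Suc m)) ^^ k (Suc m)) (mixed_dom T k m B (Suc m))) = mixed_dom T k (Suc m) B"
    by (auto simp: mixed_dom_def fun_eq_iff)
  ultimately show ?case by (simp only: mixed_deriv.simps)
qed

definition pt_lincomb :: "(real \<times> (nat \<Rightarrow> real)) list \<Rightarrow> ((nat \<Rightarrow> real) \<Rightarrow> real) \<Rightarrow> real" where
  "pt_lincomb W u = (\<Sum>(c, q)\<leftarrow>W. c * u q)"

lemma pt_lincomb_simps [simp]:
  "pt_lincomb [] u = 0" "pt_lincomb ((c, q) # W) u = c * u q + pt_lincomb W u"
  "pt_lincomb (W @ W') u = pt_lincomb W u + pt_lincomb W' u"
  by (simp_all add: pt_lincomb_def)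

lemma mixed_deriv_slice:
  assumes m: "Suc m \<le> n" and P: "fst P = PiE {1..n} B" and x: "on_line n (Suc m) (mixed_dom T k m B) x"
  shows "snd (mixed_deriv T k (Suc m) P) (x(Suc m := t)) =
      dders (T (Suc m)) (B (Suc m)) (k (Suc m)) (\<lambda>s. snd (mixed_deriv T k m P) (x(Suc m := s))) t"
    and "diff_chain T k (Suc m) P \<Longrightarrow> \<kappa> < k (Suc m) \<Longrightarrow> ddiff (T (Suc m)) ((ddom (T (Suc m)) ^^ \<kappa>) (B (Suc m)))
      (dders (T (Suc m)) (B (Suc m)) \<kappa> (\<lambda>s. snd (mixed_deriv T k m P) (x(Suc m := s))))"
proof -
  have j: "Suc m \<in> {1..n}" using m by auto
  have B: "mixed_dom T k m B (Suc m) = B (Suc m)" by (simp add: mixed_dom_def)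
  have f: "fst (mixed_deriv T k m P) = PiE {1..n} (mixed_dom T k m B)" by (rule fst_mixed_deriv[OF _ P]) (use m in simp)
  show "snd (mixed_deriv T k (Suc m) P) (x(Suc m := t)) =
      dders (T (Suc m)) (B (Suc m)) (k (Suc m)) (\<lambda>s. snd (mixed_deriv T k m P) (x(Suc m := s))) t"
    using delta_deriv_funpow_line[OF j x f, of "k (Suc m)" T t] unfolding B mixed_deriv.simps .
  assume "diff_chain T k (Suc m) P" "\<kappa> < k (Suc m)"
  then have "delta_differentiable T (Suc m) ((delta_deriv T (Suc m) ^^ \<kappa>) (mixed_deriv T k m P))"
    unfolding diff_chain_def using j by fastforce
  from delta_differentiable_funpow_line[OF j this x f]
  show "ddiff (T (Suc m)) ((ddom (T (Suc m)) ^^ \<kappa>) (B (Suc m)))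
      (dders (T (Suc m)) (B (Suc m)) \<kappa> (\<lambda>s. snd (mixed_deriv T k m P) (x(Suc m := s))))"
    unfolding B .
qed

text \<open>A tensor product of the one-variable functionals of the cells. Since each of them
  consists of point values, it can be applied in its own variable before the derivatives in the
  lower variables are taken.\<close>

lemma box_functional:
  assumes y0: "y0 \<in> PiE {1..n} B"
  shows "m \<le> n \<Longrightarrow> \<forall>i\<in>{1..m}. \<exists>L \<delta>. cell_functional (T i) (B i) (k i) (C i) L \<delta> \<Longrightarrow>
    \<exists>W \<delta>. 0 < \<delta> \<and> (\<forall>q\<in>snd ` set W. q \<in> PiE {1..n} B) \<and>
     (\<forall>u \<epsilon>. diff_chain T k m (PiE {1..n} B, u) \<longrightarrow>
       (\<forall>y. (\<forall>i\<in>{1..m}. y i \<in> C i) \<longrightarrow> (\<forall>i. i \<notin> {1..m} \<longrightarrow> y i = y0 i) \<longrightarrow> \<epsilon> \<le> snd (mixed_deriv T k m (PiE {1..n} B, u)) y)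
      \<longrightarrow> \<delta> * \<epsilon> \<le> pt_lincomb W u)"
proof (induction m)
  case 0
  show ?case
    by (rule exI[of _ "[(1, y0)]"], rule exI[of _ 1]) (use y0 in auto)
next
  case (Suc m)
  define j where "j = Suc m"
  have j: "j \<in> {1..n}" using Suc.prems by (auto simp: j_def)
  have cf: "\<forall>i\<in>{1..m}. \<exists>L \<delta>. cell_functional (T i) (B i) (k i) (C i) L \<delta>"
    using Suc.prems(2) by auto
  have mn1: "m \<le> n" using Suc.prems by simp
  obtain W \<delta> where W: "0 < \<delta>" "\<forall>q\<in>snd ` set W. q \<in> PiE {1..n} B"
     "\<forall>u \<epsilon>. diff_chain T k m (PiE {1..n} B, u) \<longrightarrow>
       (\<forall>y. (\<forall>i\<in>{1..m}. y i \<in> C i) \<longrightarrow> (\<forall>i. i \<notin> {1..m} \<longrightarrow> y i = y0 i) \<longrightarrow> \<epsilon> \<le> snd (mixed_deriv T k m (PiE {1..n} B, u)) y)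
      \<longrightarrow> \<delta> * \<epsilon> \<le> pt_lincomb W u"
    using Suc.IH[OF mn1 cf] by (elim exE conjE)
  have "j \<in> {1..Suc m}" by (simp add: j_def)
  from bspec[OF Suc.prems(2) this] obtain L \<delta>' where L: "cell_functional (T j) (B j) (k j) (C j) L \<delta>'" by blast
  note L' = L[unfolded cell_functional_def, THEN conjunct1] L[unfolded cell_functional_def, THEN conjunct2, THEN conjunct1]
    L[unfolded cell_functional_def, THEN conjunct2, THEN conjunct2, THEN conjunct2, THEN spec, THEN spec, THEN mp, THEN mp]
  have Cd: "C i \<subseteq> (ddom (T i) ^^ k i) (B i)" if "i \<in> {1..Suc m}" for i
    using bspec[OF Suc.prems(2) that] unfolding cell_functional_def by (elim exE conjE)
  \<comment> \<open>Each node of \<open>W\<close> is combined with each node of \<open>L\<close> in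
    coordinate \<open>j\<close>, and the coefficients are multiplied.\<close>
  define W' where "W' = concat (map (\<lambda>(c, q). map (\<lambda>(c', p). (c * c', q(j := p))) L) W)"
  have W': "pt_lincomb W' u = pt_lincomb W (\<lambda>q. lincomb L (\<lambda>p. u (q(j := p))))" for u
  proof -
    have "pt_lincomb (map (\<lambda>(c', p). (c * c', q(j := p))) L) u = c * lincomb L (\<lambda>p. u (q(j := p)))" for c q
      by (induction L) (auto simp: algebra_simps)
    then show ?thesis unfolding W'_def by (induction W) (auto simp: algebra_simps)
  qed
  show ?case
  proof (rule exI[of _ W'], rule exI[of _ "\<delta> * \<delta>'"], intro conjI allI impI)
    show "0 < \<delta> * \<delta>'" using W(1) L'(1) by simp
    show "\<forall>q\<in>snd ` set W'. q \<in> PiE {1..n} B"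
    proof
      fix q' assume "q' \<in> snd ` set W'"
      then obtain e where e: "e \<in> set W'" "q' = snd e" by blast
      then obtain z where z: "z \<in> set W" "e \<in> set ((\<lambda>(c, q). map (\<lambda>(c', p). (c * c', q(j := p))) L) z)"
        unfolding W'_def set_concat set_map by blast
      obtain c q where cq: "z = (c, q)" by (cases z)
      from z(2) obtain l where l: "l \<in> set L" "e = (\<lambda>(c', p). (c * c', q(j := p))) l"
        unfolding cq case_prod_conv set_map by blast
      obtain c' p where cp: "l = (c', p)" by (cases l)
      have q: "(c, q) \<in> set W" "(c', p) \<in> set L" "q' = q(j := p)"
        using z(1) l e(2) unfolding cq cp by (simp_all only: case_prod_conv snd_conv)
      have "q \<in> snd ` set W" "p \<in> snd ` set L" using imageI[OF q(1), of snd] imageI[OF q(2), of snd] by (simp_all only: snd_conv)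
      then have qB: "q \<in> PiE {1..n} B" and pB: "p \<in> B j" using bspec[OF W(2)] subsetD[OF L'(2)] by (simp_all only:)
      show "q' \<in> PiE {1..n} B" unfolding q(3) on_line_upd[OF j PiE_on_line[OF j qB]] by (rule pB)
    qed
    fix u \<epsilon> assume dc: "diff_chain T k (Suc m) (PiE {1..n} B, u)"
      and ge: "\<forall>y. (\<forall>i\<in>{1..Suc m}. y i \<in> C i) \<longrightarrow> (\<forall>i. i \<notin> {1..Suc m} \<longrightarrow> y i = y0 i) \<longrightarrow> \<epsilon> \<le> snd (mixed_deriv T k (Suc m) (PiE {1..n} B, u)) y"
    \<comment> \<open>By \<open>line_rel\<close>, the lower derivatives of \<open>u'\<close> are the
      combination \<open>L\<close> of those of \<open>u\<close>. The cell functional bounds that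
      combination below by \<open>\<delta>' * \<epsilon>\<close>, so the induction hypothesis
      applies to \<open>u'\<close>.\<close>
    define u' where "u' y = lincomb L (\<lambda>p. u (y(j := p)))" for y
    have dcm: "diff_chain T k m (PiE {1..n} B, u)" using dc unfolding diff_chain_def by auto
    have rel: "line_rel n j (B j) L (PiE {1..n} B, u') (PiE {1..n} B, u)"
      unfolding line_rel_def by (intro exI[of _ B] conjI) (use L'(2) in \<open>auto simp: u'_def\<close>)
    have mn: "m \<le> n" "m < j" using Suc.prems by (auto simp: j_def)
    have dc': "diff_chain T k m (PiE {1..n} B, u')"
      by (rule diff_chain_line_rel[where i = j and B = B and L = L, OF j mn fst_conv rel dcm])
    have rel': "line_rel n j (B j) L (mixed_deriv T k m (PiE {1..n} B, u')) (mixed_deriv T k m (PiE {1..n} B, u))"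
      by (rule line_rel_mixed[OF j, of 0]) (use mn rel dcm in auto)
    have "\<delta> * (\<delta>' * \<epsilon>) \<le> pt_lincomb W u'"
    proof (rule W(3)[THEN spec, THEN spec, THEN mp, OF dc', THEN mp], intro allI impI)
      fix y assume y: "\<forall>i\<in>{1..m}. y i \<in> C i" "\<forall>i. i \<notin> {1..m} \<longrightarrow> y i = y0 i"
      have ydom: "y \<in> PiE {1..n} (mixed_dom T k m B)"
      proof (rule PiE_I)
        fix i assume i: "i \<in> {1..n}"
        show "y i \<in> mixed_dom T k m B i"
        proof (cases "i \<in> {1..m}")
          case True then show ?thesis using y(1) Cd[of i] by (auto simp: mixed_dom_def)
        next
          case False
          then have "y i = y0 i" using y(2) by blast
          then show ?thesis using False PiE_mem[OF y0 i] by (auto simp: mixed_dom_def)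
        qed
      next
        fix i assume i: "i \<notin> {1..n}"
        then have "y i = y0 i" using y(2) mn by auto
        then show "y i = undefined" using PiE_arb[OF y0 i] by simp
      qed
      then have yf: "y \<in> fst (mixed_deriv T k m (PiE {1..n} B, u'))"
        using fst_mixed_deriv[of m n "(PiE {1..n} B, u')" B] mn by auto
      have yj: "y j \<in> B j" using PiE_mem[OF ydom j] by (simp add: mixed_dom_def j_def)
      have ol: "on_line n (Suc m) (mixed_dom T k m B) y" using PiE_on_line[OF j ydom] by (simp add: j_def)
      have eq: "snd (mixed_deriv T k m (PiE {1..n} B, u')) y = lincomb L (\<lambda>p. snd (mixed_deriv T k m (PiE {1..n} B, u)) (y(j := p)))"
        by (rule line_relD[OF rel' yf yj])
      show "\<delta>' * \<epsilon> \<le> snd (mixed_deriv T k m (PiE {1..n} B, u')) y"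
        unfolding eq
      proof (rule L'(3))
        show "\<forall>i<k j. ddiff (T j) ((ddom (T j) ^^ i) (B j)) (dders (T j) (B j) i (\<lambda>p. snd (mixed_deriv T k m (PiE {1..n} B, u)) (y(j := p))))"
          unfolding j_def
          by (intro allI impI mixed_deriv_slice(2)[OF Suc.prems(1) _ ol dc]) auto
        show "\<forall>t\<in>C j. \<epsilon> \<le> dders (T j) (B j) (k j) (\<lambda>p. snd (mixed_deriv T k m (PiE {1..n} B, u)) (y(j := p))) t"
        proof
          fix t assume t: "t \<in> C j"
          have "\<forall>i\<in>{1..Suc m}. (y(j := t)) i \<in> C i" using y(1) t by (auto simp: j_def le_Suc_eq)
          moreover have "\<forall>i. i \<notin> {1..Suc m} \<longrightarrow> (y(j := t)) i = y0 i" using y(2) by (auto simp: j_def)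
          ultimately have "\<epsilon> \<le> snd (mixed_deriv T k (Suc m) (PiE {1..n} B, u)) (y(j := t))" using ge by blast
          also have "\<dots> = dders (T j) (B j) (k j) (\<lambda>p. snd (mixed_deriv T k m (PiE {1..n} B, u)) (y(j := p))) t"
            unfolding j_def by (rule mixed_deriv_slice(1)[OF Suc.prems(1) _ ol]) simp
          finally show "\<epsilon> \<le> dders (T j) (B j) (k j) (\<lambda>p. snd (mixed_deriv T k m (PiE {1..n} B, u)) (y(j := p))) t" .
        qed
      qed
    qed
    then show "\<delta> * \<delta>' * \<epsilon> \<le> pt_lincomb W' u" unfolding W' u'_def by (simp add: mult.assoc)
  qed
qed

section \<open>Transfer of the zero data to mixed derivatives\<close>

lemma mixed_deriv_cong: "(\<And>i. i \<in> {1..m} \<Longrightarrow> k i = k' i) \<Longrightarrow> mixed_deriv T k m P = mixed_deriv T k' m P"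
proof (induction m)
  case (Suc m)
  then have "mixed_deriv T k m P = mixed_deriv T k' m P" "k (Suc m) = k' (Suc m)" by auto
  then show ?case by simp
qed simp

lemma diff_chain_cong:
  assumes "\<And>i. i \<in> {1..m} \<Longrightarrow> k i = k' i"
  shows "diff_chain T k m P \<longleftrightarrow> diff_chain T k' m P"
proof -
  have "mixed_deriv T k (i - 1) P = mixed_deriv T k' (i - 1) P" if "i \<in> {1..m}" for i
    using assms that by (intro mixed_deriv_cong) auto
  then show ?thesis using assms unfolding diff_chain_def by auto
qed

lemma dders_cmult:
  assumes "\<And>i. i < k \<Longrightarrow> ddiff T ((ddom T ^^ i) A) (dders T A i v)"
  shows "i \<le> k \<Longrightarrow> dders T A i (\<lambda>t. c * v t) = (\<lambda>t. c * dders T A i v t)"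
    and "i < k \<Longrightarrow> ddiff T ((ddom T ^^ i) A) (dders T A i (\<lambda>t. c * v t))"
proof -
  have step: "dder T D (\<lambda>t. c * w t) = (\<lambda>t. c * dder T D w t) \<and> ddiff T D (\<lambda>t. c * w t)" if w: "ddiff T D w" for D w
  proof -
    have t: "(dquot T (\<lambda>t. c * w t) t \<longlongrightarrow> c * dder T D w t) (delta_nhds T D t)"
       "dder T D (\<lambda>t. c * w t) t = c * dder T D w t" if "t \<in> ddom T D" for t
      \<comment> \<open>The node 0 is a dummy, as \<open>u\<close> ignores its argument.\<close>
      using ddiff_lincomb[where u = "\<lambda>p. w" and L = "[(c, 0)]" and A = D and T = T, OF _ _ that] w by auto
    have "dder T D (\<lambda>t. c * w t) t = c * dder T D w t" for t
      using t(2)[of t] by (cases "t \<in> ddom T D") (auto simp: dder_def)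
    moreover have "ddiff T D (\<lambda>t. c * w t)" unfolding ddiff_def using t(1) by blast
    ultimately show ?thesis by auto
  qed
  show eq: "i \<le> k \<Longrightarrow> dders T A i (\<lambda>t. c * v t) = (\<lambda>t. c * dders T A i v t)" for i
  proof (induction i)
    case (Suc i)
    then have "ddiff T ((ddom T ^^ i) A) (dders T A i v)" using assms by auto
    from step[OF this] Suc show ?case by simp
  qed simp
  show "i < k \<Longrightarrow> ddiff T ((ddom T ^^ i) A) (dders T A i (\<lambda>t. c * v t))"
    using eq[of i] step[OF assms[of i]] by simp
qed

lemma rd_continuous_right_dense:
  assumes "rd_continuous n T P" "y \<in> fst P" "i \<in> {1..n}" "right_dense (T i) (y i)" "0 < e"
  obtains d where "d > 0" "\<And>s. y(i := s) \<in> fst P \<Longrightarrow> \<bar>s - y i\<bar> < d \<Longrightarrow> \<bar>snd P (y(i := s)) - snd P y\<bar> < e"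
proof -
  have "((\<lambda>t. snd P (y(i := t))) \<longlongrightarrow> snd P y) (at (y i) within {t. y(i := t) \<in> fst P})"
    using assms unfolding rd_continuous_def by blast
  then have "eventually (\<lambda>t. dist (snd P (y(i := t))) (snd P y) < e) (at (y i) within {t. y(i := t) \<in> fst P})"
    using assms(5) by (rule tendstoD)
  then obtain d where d: "d > 0" "\<And>s. y(i := s) \<in> fst P \<Longrightarrow> s \<noteq> y i \<Longrightarrow> dist s (y i) < d \<Longrightarrow> dist (snd P (y(i := s))) (snd P y) < e"
    unfolding eventually_at by auto
  show ?thesis
  proof (rule that[OF d(1)])
    fix s assume "y(i := s) \<in> fst P" "\<bar>s - y i\<bar> < d"
    then show "\<bar>snd P (y(i := s)) - snd P y\<bar> < e"
      using d(2)[of s] assms(5) by (cases "s = y i") (auto simp: dist_real_def)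
  qed
qed

text \<open>If no interval starting at \<open>t\<close> lies in \<open>T\<close>, some point
  \<open>x\<close> close to \<open>t\<close> is missing, and the last point of \<open>T\<close>
  before \<open>x\<close> is scattered; it differs from \<open>t\<close>, which is not.\<close>

lemma right_dense_scattered_or_interval:
  assumes T: "closed T" and t: "t \<in> T" "fwd_jump T t = t" and b: "b \<in> T" "t < b" and e: "0 < e"
  shows "(\<exists>s\<in>T. t < s \<and> s < t + e \<and> s < b \<and> fwd_jump T s \<noteq> s) \<or> (\<exists>r>t. r < t + e \<and> r < b \<and> {t..r} \<subseteq> T)"
proof (rule disjCI)
  assume no: "\<not> (\<exists>r>t. r < t + e \<and> r < b \<and> {t..r} \<subseteq> T)"
  define r where "r = min (t + e / 2) ((t + b) / 2)"
  have r: "t < r" "r < t + e" "r < b" using b e by (auto simp: r_def min_def)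
  then obtain x where x: "t \<le> x" "x \<le> r" "x \<notin> T" using no by fastforce
  define p where "p = Sup (T \<inter> {..x})"
  have p: "p \<in> T" "t \<le> p" "p \<le> x" unfolding p_def using closed_Sup_atMost[OF T t(1) x(1)] by auto
  have px: "p < x" using p x by (cases "p = x") auto
  have "fwd_jump T p \<noteq> p"
  proof
    assume f: "fwd_jump T p = p"
    obtain q where q: "q \<in> T" "p < q" "q < p + (x - p)"
      using right_dense_limit[OF T p(1) f b(1), of "x - p"] px x r by auto
    then have "q \<le> p" unfolding p_def using closed_Sup_atMost(2)[OF T q(1), of x] by simp
    then show False using q by simp
  qed
  moreover have "p \<noteq> t" using calculation t by auto
  ultimately show "\<exists>s\<in>T. t < s \<and> s < t + e \<and> s < b \<and> fwd_jump T s \<noteq> s"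
    using p px x r by (intro bexI[of _ p]) auto
qed

text \<open>If a scattered point jumped to \<open>b\<close>, then \<open>b\<close> would be isolated
  in the interval from the left. The filter at \<open>b\<close> excludes \<open>b\<close> itself
  once \<open>b\<close> is its own jump, and so would be trivial.\<close>

lemma fwd_jump_below_end:
  assumes T: "closed T" and t: "t \<in> T" "t \<noteq> fwd_jump T t" and b: "fwd_jump T t \<in> T \<inter> {a..b}"
    and d: "fwd_jump T t \<in> ddom T (T \<inter> {a..b})"
  shows "fwd_jump T t < b"
proof (rule ccontr)
  assume "\<not> fwd_jump T t < b"
  then have e: "fwd_jump T t = b" using b by auto
  have lt: "t < b" using fwd_jump_ge[OF T t(1)] t(2) e by auto
  have "fwd_jump T b \<in> T \<inter> {a..b}" and ne: "delta_nhds T (T \<inter> {a..b}) b \<noteq> bot" using d e by (auto simp: ddom_def)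
  moreover have "b \<in> T" using b e by auto
  ultimately have fb: "fwd_jump T b = b" using fwd_jump_ge[OF T, of b] by force
  have "eventually (\<lambda>_. False) (delta_nhds T (T \<inter> {a..b}) b)"
    unfolding eventually_delta_nhds fb
  proof (intro exI[of _ "b - t"] conjI ballI impI)
    fix s assume s: "s \<in> T \<inter> {a..b}" "s \<noteq> b" "\<bar>s - b\<bar> < b - t"
    then have "t < s" by auto
    then have "b \<le> s" using fwd_jump_gap[OF T t(1), of s] s e by auto
    then show False using s by auto
  qed (use lt in simp)
  then show False using ne by (simp add: eventually_False)
qed

lemma pt_lincomb_eventually_le:
  assumes "\<And>q. q \<in> snd ` set W \<Longrightarrow> \<exists>N. \<forall>m\<ge>N. \<bar>F m q\<bar> \<le> e * h m"
  shows "\<exists>N. \<forall>m\<ge>(N::nat). pt_lincomb W (F m) \<le> (\<Sum>(c, q)\<leftarrow>W. \<bar>c\<bar>) * (e * h m)"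
  using assms
proof (induction W)
  case (Cons w W)
  obtain c q where w: "w = (c, q)" by (cases w)
  obtain N1 where N1: "\<forall>m\<ge>N1. pt_lincomb W (F m) \<le> (\<Sum>(c, q)\<leftarrow>W. \<bar>c\<bar>) * (e * h m)" using Cons by auto
  obtain N2 where N2: "\<forall>m\<ge>N2. \<bar>F m q\<bar> \<le> e * h m" using Cons.prems[of q] w by auto
  have "pt_lincomb (w # W) (F m) \<le> (\<Sum>(c, q)\<leftarrow>w # W. \<bar>c\<bar>) * (e * h m)" if "m \<ge> max N1 N2" for m
  proof -
    have "c * F m q \<le> \<bar>c\<bar> * \<bar>F m q\<bar>" by (metis abs_ge_self abs_mult)
    also have "\<dots> \<le> \<bar>c\<bar> * (e * h m)" using N2 that by (intro mult_left_mono) auto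
    finally show ?thesis using N1 that by (simp add: w distrib_right add_mono)
  qed
  then show ?case by blast
qed simp

locale time_box =
  fixes n :: nat and T :: "nat \<Rightarrow> real set" and a b :: "nat \<Rightarrow> real"
  assumes T: "\<And>i. i \<in> {1..n} \<Longrightarrow> closed (T i)"
    and ab: "\<And>i. i \<in> {1..n} \<Longrightarrow> a i \<in> T i \<and> b i \<in> T i \<and> a i < b i"
begin

abbreviation "BB i \<equiv> T i \<inter> {a i..b i}"
abbreviation "Om \<equiv> PiE {1..n} BB"
lemma Om_eq: "ts_box n T a b = Om"
proof (rule set_eqI)
  fix x
  have "x \<in> ts_box n T a b \<longleftrightarrow> x \<in> extensional {1..n} \<and> (\<forall>i\<in>{1..n}. x i \<in> T i) \<and> (\<forall>i\<in>{1..n}. a i \<le> x i \<and> x i \<le> b i)"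
    unfolding ts_box_def ts_prod_def mem_Collect_eq PiE_iff by blast
  also have "\<dots> \<longleftrightarrow> x \<in> Om" unfolding PiE_iff by (simp only: Int_iff atLeastAtMost_iff) blast
  finally show "x \<in> ts_box n T a b \<longleftrightarrow> x \<in> Om" .
qed

end

locale rd_box = time_box +
  fixes lam :: "nat \<Rightarrow> nat" and f :: "(nat \<Rightarrow> real) \<Rightarrow> real"
  assumes f: "f \<in> Crd_class n T a b lam"
begin

lemma Crd_facts:
  assumes "m \<in> {1..n}" "\<forall>i\<in>{1..m}. 1 \<le> k i \<and> k i \<le> lam i"
  shows "rd_continuous n T (mixed_deriv T k m (Om, f))" "diff_chain T k m (Om, f)"
proof -
  show "rd_continuous n T (mixed_deriv T k m (Om, f))"
    using f assms unfolding Crd_class_def Om_eq by blast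
  show "diff_chain T k m (Om, f)"
    unfolding diff_chain_def
  proof (intro ballI allI impI)
    fix i \<kappa> assume i: "i \<in> {1..m}" and \<kappa>: "\<kappa> < k i"
    \<comment> \<open>The class asserts differentiability only for the last differentiation of an
      order vector; lowering entry \<open>i\<close> to \<open>Suc \<kappa>\<close> makes the step of
      order \<open>\<kappa>\<close> the last one.\<close>
    let ?k = "k(i := Suc \<kappa>)"
    have "Suc \<kappa> \<le> lam i" using \<kappa> bspec[OF assms(2) i] by linarith
    then have "\<forall>i'\<in>{1..i}. 1 \<le> ?k i' \<and> ?k i' \<le> lam i'" using assms(2) i \<kappa> by auto
    moreover have "i \<in> {1..n}" using i assms(1) by auto
    ultimately have "delta_differentiable T i ((delta_deriv T i ^^ (?k i - 1)) (mixed_deriv T ?k (i - 1) (Om, f)))"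
      using f unfolding Crd_class_def Om_eq by blast
    moreover have "mixed_deriv T ?k (i - 1) (Om, f) = mixed_deriv T k (i - 1) (Om, f)"
      using i by (intro mixed_deriv_cong) auto
    ultimately show "delta_differentiable T i ((delta_deriv T i ^^ \<kappa>) (mixed_deriv T k (i - 1) (Om, f)))" by simp
  qed
qed

end

text \<open>The heart of the matter: the derivatives in the variable \<open>j\<close> that vanish at \<open>x j = A\<close> still vanish after
  differentiating in the variables below \<open>j\<close>, although these derivatives are only separately rd-continuous
  and the class of \<open>f\<close> does not contain the mixed derivatives in the other order.\<close>

locale mixed_zero_data = rd_box +
  fixes j :: nat
  assumes j: "2 \<le> j" "j \<le> n"
begin

abbreviation "GG k \<equiv> mixed_deriv T k (j - 1) (Om, f)"
abbreviation "CC k l \<equiv> (delta_deriv T j ^^ l) (GG k)"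
text \<open>Orders start at 1 because \<open>Crd_class\<close> speaks only of derivatives in which
  every earlier variable occurs.\<close>

abbreviation "adm k \<equiv> (\<forall>i\<in>{1..<j}. 1 \<le> k i \<and> k i \<le> lam i)"

lemma jn: "j \<in> {1..n}" "j - 1 \<le> n" "Suc (j - 1) = j" using j by auto

lemma CC_mixed: "CC k l = mixed_deriv T (k(j := l)) j (Om, f)"
proof -
  have "mixed_deriv T (k(j := l)) (j - 1) (Om, f) = mixed_deriv T k (j - 1) (Om, f)"
    by (rule mixed_deriv_cong) (use j in auto)
  moreover have "mixed_deriv T (k(j := l)) (Suc (j - 1)) (Om, f) = (delta_deriv T j ^^ l) (mixed_deriv T (k(j := l)) (j - 1) (Om, f))"
    unfolding mixed_deriv.simps using jn(3) by simp
  ultimately show ?thesis by (simp only: jn(3))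
qed

lemma GG_facts:
  assumes "adm k"
  shows "rd_continuous n T (GG k)" "diff_chain T k (j - 1) (Om, f)"
proof -
  have "j - 1 \<in> {1..n}" "\<forall>i\<in>{1..j - 1}. 1 \<le> k i \<and> k i \<le> lam i" using assms j by auto
  from Crd_facts[OF this] show "rd_continuous n T (GG k)" "diff_chain T k (j - 1) (Om, f)" .
qed

lemma CC_facts:
  assumes "adm k" "l \<le> lam j"
  shows "rd_continuous n T (CC k l)" "diff_chain T (k(j := l)) j (Om, f)"
proof -
  have *: "rd_continuous n T (CC k l) \<and> diff_chain T (k(j := l)) j (Om, f)"
  proof (cases "l = 0")
    case True
    have "diff_chain T (k(j := 0)) (j - 1) (Om, f) \<longleftrightarrow> diff_chain T k (j - 1) (Om, f)"
      by (rule diff_chain_cong) (use j in auto)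
    then have d: "diff_chain T (k(j := 0)) (j - 1) (Om, f)" using GG_facts[OF assms(1)] by simp
    have "diff_chain T (k(j := 0)) j (Om, f)"
      unfolding diff_chain_def
    proof (intro ballI allI impI)
      fix i \<kappa> assume i: "i \<in> {1..j}" "\<kappa> < (k(j := 0)) i"
      then have "i \<noteq> j" by auto
      then have "i \<in> {1..j - 1}" using i by auto
      then show "delta_differentiable T i ((delta_deriv T i ^^ \<kappa>) (mixed_deriv T (k(j := 0)) (i - 1) (Om, f)))"
        using d i(2) unfolding diff_chain_def by blast
    qed
    then show ?thesis using True GG_facts[OF assms(1)] by (simp add: fun_upd_def)
  next
    case False
    have "\<forall>i\<in>{1..j}. 1 \<le> (k(j := l)) i \<and> (k(j := l)) i \<le> lam i" using assms False by (auto simp: le_less)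
    from Crd_facts[OF jn(1) this] show ?thesis unfolding CC_mixed by blast
  qed
  then show "rd_continuous n T (CC k l)" "diff_chain T (k(j := l)) j (Om, f)" by auto
qed

lemma fst_GG: "fst (GG k) = PiE {1..n} (mixed_dom T k (j - 1) BB)"
  by (rule fst_mixed_deriv[OF jn(2)]) simp

lemma mixed_dom_j: "mixed_dom T k (j - 1) BB j = BB j"
  using j by (auto simp: mixed_dom_def)

lemma fst_CC: "fst (CC k l) = PiE {1..n} (mixed_dom T (k(j := l)) j BB)"
  unfolding CC_mixed by (rule fst_mixed_deriv[OF j(2)]) simp

lemma fst_CC': "fst (CC k l) = PiE {1..n} ((mixed_dom T k (j - 1) BB)(j := (ddom (T j) ^^ l) (BB j)))"
  using fst_delta_deriv_funpow[OF jn(1) fst_GG, where T = T and k = l] unfolding mixed_dom_j .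

lemma mem_CC:
  assumes "y \<in> fst (CC k l)"
  shows "on_line n j (mixed_dom T k (j - 1) BB) y" "y j \<in> (ddom (T j) ^^ l) (BB j)"
proof -
  have y: "y \<in> PiE {1..n} ((mixed_dom T k (j - 1) BB)(j := (ddom (T j) ^^ l) (BB j)))"
    using assms unfolding fst_CC' .
  show "on_line n j (mixed_dom T k (j - 1) BB) y"
    using PiE_on_line[OF jn(1) y] unfolding on_line_fun_upd(1)[OF jn(1)] .
  show "y j \<in> (ddom (T j) ^^ l) (BB j)" using PiE_mem[OF y jn(1)] unfolding fun_upd_same .
qed

lemma CC_slice:
  assumes "on_line n j (mixed_dom T k (j - 1) BB) x"
  shows "snd (CC k l) (x(j := t)) = dders (T j) (BB j) l (\<lambda>s. snd (GG k) (x(j := s))) t"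
  using delta_deriv_funpow_line[OF jn(1) assms fst_GG, of l T t] unfolding mixed_dom_j .

lemma CC_slice_diff:
  assumes "on_line n j (mixed_dom T k (j - 1) BB) x" "adm k" "l < lam j"
  shows "ddiff (T j) ((ddom (T j) ^^ l) (BB j)) (dders (T j) (BB j) l (\<lambda>s. snd (GG k) (x(j := s))))"
proof -
  have "diff_chain T (k(j := Suc l)) j (Om, f)" using assms by (intro CC_facts) auto
  then have "delta_differentiable T j ((delta_deriv T j ^^ l) (mixed_deriv T (k(j := Suc l)) (j - 1) (Om, f)))"
    unfolding diff_chain_def using jn by auto
  also have "mixed_deriv T (k(j := Suc l)) (j - 1) (Om, f) = GG k" by (rule mixed_deriv_cong) (use j in auto)
  finally have d: "delta_differentiable T j (CC k l)" .
  show ?thesis using delta_differentiable_funpow_line[OF jn(1) d assms(1) fst_GG] unfolding mixed_dom_j .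
qed

text \<open>For order 0 in \<open>x j\<close> the transfer is immediate: vanishing on the slice is a
  \<open>line_rel\<close> with the empty combination, and the lower derivatives stay within the
  slice.\<close>

lemma GG_zero:
  assumes "adm k" "\<And>x. x \<in> Om \<Longrightarrow> x j = A \<Longrightarrow> f x = 0" "y \<in> fst (GG k)" "y j = A"
  shows "snd (GG k) y = 0"
proof -
  have r: "line_rel n j {A} [] (Om, f) (Om, f)"
    unfolding line_rel_def by (intro exI[of _ BB]) (use assms in auto)
  have "line_rel n j {A} [] (GG k) (GG k)"
    by (rule line_rel_mixed[OF jn(1), of 0]) (use r GG_facts[OF assms(1)] j in auto)
  from line_relD[OF this assms(3)] assms(4) show ?thesis by simp
qed

end

lemma lincomb_quotient: "lincomb [(1 / d, p), (- 1 / d, q)] v = (v p - v q) / d"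
  by (simp add: diff_divide_distrib)

section \<open>Right-dense points inside the domains of all derivatives\<close>

context time_box
begin

lemma down_closed_BB: "down_closed (T i) (a i) (BB i)"
  by (rule down_closed_atLeastAtMost)

lemma right_dense_dom:
  assumes "i \<in> {1..n}" "t \<in> T i" "a i \<le> t" "t < b i" "fwd_jump (T i) t = t"
  obtains r where "t < r" "r \<le> b i" "r \<in> (ddom (T i) ^^ \<kappa>) (BB i)"
proof -
  have "b i \<in> BB i" using ab[OF assms(1)] by auto
  from right_dense_in_ddom_funpow[OF T[OF assms(1)] down_closed_BB assms(2,3,4) this assms(5), of \<kappa>] that
  show ?thesis by auto
qed

lemma right_dense_mem_dom:
  assumes "i \<in> {1..n}" "t \<in> T i" "a i \<le> t" "t < b i" "fwd_jump (T i) t = t"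
  shows "t \<in> (ddom (T i) ^^ \<kappa>) (BB i)"
proof -
  obtain r where r: "t < r" "r \<le> b i" "r \<in> (ddom (T i) ^^ \<kappa>) (BB i)" by (rule right_dense_dom[OF assms])
  show ?thesis
    using assms r(1) by (intro down_closedD(3)[OF down_closed_ddom_funpow[OF T[OF assms(1)] down_closed_BB] r(3)]) auto
qed

lemma right_denseI:
  assumes "i \<in> {1..n}" "t \<in> T i" "t < b i" "fwd_jump (T i) t = t"
  shows "right_dense (T i) t"
  using assms ab[OF assms(1)] unfolding right_dense_def by auto

end

section \<open>Moving to points with cell functionals, and lowering orders at scattered
  coordinates\<close>

context mixed_zero_data
begin

lemma CC_dom_below:
  assumes "i \<in> {1..<j}"
  shows "mixed_dom T (k(j := l)) j BB i = (ddom (T i) ^^ k i) (BB i)"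
  using assms by (auto simp: mixed_dom_def)

lemma CC_coord:
  assumes "y \<in> fst (CC k l)" "i \<in> {1..<j}"
  shows "y i \<in> (ddom (T i) ^^ k i) (BB i)" "y i \<in> BB i" "y i \<in> T i"
proof -
  have i: "i \<in> {1..n}" using assms j by auto
  show 1: "y i \<in> (ddom (T i) ^^ k i) (BB i)"
    using PiE_mem[OF assms(1)[unfolded fst_CC] i] unfolding CC_dom_below[OF assms(2)] .
  then show "y i \<in> BB i" using ddom_funpow_subset by blast
  then show "y i \<in> T i" by blast
qed

lemma CC_upd:
  assumes "y \<in> fst (CC k l)" "i \<in> {1..<j}"
  shows "y(i := t) \<in> fst (CC k l) \<longleftrightarrow> t \<in> (ddom (T i) ^^ k i) (BB i)"
proof -
  have i: "i \<in> {1..n}" using assms j by auto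
  show ?thesis unfolding fst_CC on_line_upd[OF i PiE_on_line[OF i assms(1)[unfolded fst_CC]]] CC_dom_below[OF assms(2)] ..
qed

text \<open>The values of a coordinate around which a cell functional can be built: a scattered
  point, where the derivative is a quotient, or the left end of an interval contained in the time
  scale.\<close>

definition "nice i t \<longleftrightarrow> fwd_jump (T i) t \<noteq> t \<or> (\<exists>r>t. r < b i \<and> {t..r} \<subseteq> T i)"

text \<open>A right-dense coordinate that is not nice has scattered points arbitrarily close on its
  right, and rd-continuity in that coordinate preserves the strict inequality under a small move.
  The coordinates are treated one after the other.\<close>

lemma nice_point:
  assumes k: "adm k" "l \<le> lam j" and y: "y \<in> fst (CC k l)" "\<And>i. i \<in> {1..<j} \<Longrightarrow> y i < b i" "\<epsilon> < s * snd (CC k l) y"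
  shows "m \<le> j \<Longrightarrow> \<exists>y'\<in>fst (CC k l). y' j = y j \<and> (\<forall>i\<in>{1..<j}. y' i < b i) \<and> \<epsilon> < s * snd (CC k l) y' \<and> (\<forall>i\<in>{1..<m}. nice i (y' i))"
proof (induction m)
  case 0
  show ?case using y by (intro bexI[OF _ y(1)]) auto
next
  case (Suc m)
  then obtain y' where y': "y' \<in> fst (CC k l)" "y' j = y j" "\<And>i. i \<in> {1..<j} \<Longrightarrow> y' i < b i" "\<epsilon> < s * snd (CC k l) y'"
    "\<And>i. i \<in> {1..<m} \<Longrightarrow> nice i (y' i)" by auto
  show ?case
  proof (cases "m = 0 \<or> nice m (y' m)")
    case True
    have "nice i (y' i)" if "i \<in> {1..<Suc m}" for i
      using True y'(5)[of i] that by (cases "i = m") auto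
    then show ?thesis using y'(1-4) by (intro bexI[OF _ y'(1)]) auto
  next
    case False
    then have m: "m \<in> {1..<j}" and nn: "\<not> nice m (y' m)" using Suc.prems by auto
    have mn: "m \<in> {1..n}" using m j by auto
    define t where "t = y' m"
    have fj: "fwd_jump (T m) t = t" using nn by (simp add: nice_def t_def)
    have tT: "t \<in> T m" "a m \<le> t" "t < b m" using CC_coord(2)[OF y'(1) m] y'(3)[OF m] by (auto simp: t_def)
    have rd: "right_dense (T m) (y' m)" using right_denseI[OF mn tT(1,3) fj] by (simp add: t_def)
    \<comment> \<open>The excess over \<open>\<epsilon>\<close>, divided so that a change of the
      derivative by less than \<open>e\<close>, multiplied by \<open>s\<close>, cannot use it
      up.\<close>
    define e where "e = (s * snd (CC k l) y' - \<epsilon>) / (\<bar>s\<bar> + 1)"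
    have e: "e > 0" using y'(4) by (simp add: e_def)
    obtain d where d: "d > 0" "\<And>u. y'(m := u) \<in> fst (CC k l) \<Longrightarrow> \<bar>u - y' m\<bar> < d \<Longrightarrow> \<bar>snd (CC k l) (y'(m := u)) - snd (CC k l) y'\<bar> < e"
      using rd_continuous_right_dense[OF CC_facts(1)[OF k] y'(1) mn rd e] by blast
    obtain r where r: "t < r" "r \<le> b m" "r \<in> (ddom (T m) ^^ k m) (BB m)"
      by (rule right_dense_dom[OF mn tT fj])
    have bT: "b m \<in> T m" using ab[OF mn] by auto
    have "\<not> (\<exists>r>t. r < t + min d (r - t) \<and> r < b m \<and> {t..r} \<subseteq> T m)"
      using nn unfolding nice_def t_def by blast
    moreover have "0 < min d (r - t)" using d(1) r(1) by auto
    ultimately obtain u where u: "u \<in> T m" "t < u" "u < t + min d (r - t)" "u < b m" "fwd_jump (T m) u \<noteq> u"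
      using right_dense_scattered_or_interval[OF T[OF mn] tT(1) fj bT tT(3), of "min d (r - t)"] nn
      unfolding nice_def t_def by blast
    have "u \<in> (ddom (T m) ^^ k m) (BB m)"
      using u r tT by (intro down_closedD(3)[OF down_closed_ddom_funpow[OF T[OF mn] down_closed_BB] r(3)]) auto
    then have mem: "y'(m := u) \<in> fst (CC k l)" using CC_upd[OF y'(1) m] by blast
    have "\<bar>snd (CC k l) (y'(m := u)) - snd (CC k l) y'\<bar> < e" using u by (intro d(2)[OF mem]) (auto simp: t_def)
    then have "\<bar>s\<bar> * \<bar>snd (CC k l) (y'(m := u)) - snd (CC k l) y'\<bar> \<le> \<bar>s\<bar> * e" by (intro mult_left_mono) auto
    also have "\<dots> < (\<bar>s\<bar> + 1) * e" using e by (simp add: distrib_right)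
    also have "\<dots> = s * snd (CC k l) y' - \<epsilon>" by (simp add: e_def)
    finally have "\<bar>s * (snd (CC k l) (y'(m := u)) - snd (CC k l) y')\<bar> < s * snd (CC k l) y' - \<epsilon>" by (simp add: abs_mult)
    then have gt: "\<epsilon> < s * snd (CC k l) (y'(m := u))" unfolding right_diff_distrib by linarith
    show ?thesis
    proof (intro bexI[OF _ mem] conjI ballI)
      show "(y'(m := u)) j = y j" using y'(2) m by simp
      show "\<epsilon> < s * snd (CC k l) (y'(m := u))" by (rule gt)
      fix i assume i: "i \<in> {1..<j}" then show "(y'(m := u)) i < b i" using y'(3)[OF i] u by simp
    next
      fix i assume i: "i \<in> {1..<Suc m}"
      show "nice i ((y'(m := u)) i)"
      proof (cases "i = m")
        case True then show ?thesis using u by (simp add: nice_def)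
      next
        case False then show ?thesis using i y'(5)[of i] by simp
      qed
    qed
  qed
qed

text \<open>At a scattered coordinate one of the derivatives is a difference quotient, which
  expresses the value through two values of lower total order. An order of at least 2 is required so
  that the lowered orders remain admissible.\<close>

lemma scattered_reduce:
  assumes k: "adm k" "l \<le> lam j" and i: "i \<in> {1..<j}" "2 \<le> k i" and y: "y \<in> fst (CC k l)" "fwd_jump (T i) (y i) \<noteq> y i"
  defines "k' \<equiv> k(i := k i - 1)" and "\<sigma> \<equiv> fwd_jump (T i) (y i)"
  shows "adm k'" "y \<in> fst (CC k' l)" "y(i := \<sigma>) \<in> fst (CC k' l)" "\<sigma> < b i"
    "snd (CC k l) y = (snd (CC k' l) (y(i := \<sigma>)) - snd (CC k' l) y) / (\<sigma> - y i)"
proof -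
  have il: "i \<in> {1..n}" "i \<noteq> j" using i j by auto
  obtain i0 where i0: "i = Suc i0" using i by (cases i) auto
  obtain \<kappa> where \<kappa>: "k i = Suc \<kappa>" "1 \<le> \<kappa>" using i by (cases "k i") auto
  have k'i: "k' i = \<kappa>" "\<And>q. q \<noteq> i \<Longrightarrow> k' q = k q" by (auto simp: k'_def \<kappa>)
  have ki: "1 \<le> k i \<and> k i \<le> lam i" using bspec[OF k(1) i(1)] .
  show ad: "adm k'"
  proof
    fix q assume "q \<in> {1..<j}"
    then show "1 \<le> k' q \<and> k' q \<le> lam q" using bspec[OF k(1), of q] k'i \<kappa> ki by (cases "q = i") auto
  qed
  have t: "y i \<in> ddom (T i) ((ddom (T i) ^^ \<kappa>) (BB i))" using CC_coord(1)[OF y(1) i(1)] by (simp add: \<kappa>)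
  then have s: "\<sigma> \<in> (ddom (T i) ^^ \<kappa>) (BB i)" and t': "y i \<in> (ddom (T i) ^^ \<kappa>) (BB i)" by (auto simp: ddom_def \<sigma>_def)
  have dom: "fst (CC k' l) = PiE {1..n} ((mixed_dom T (k(j := l)) j BB)(i := (ddom (T i) ^^ \<kappa>) (BB i)))"
  proof -
    have "mixed_dom T (k'(j := l)) j BB = (mixed_dom T (k(j := l)) j BB)(i := (ddom (T i) ^^ \<kappa>) (BB i))"
      using i(1) k'i(1) by (auto simp: mixed_dom_def fun_eq_iff k'_def)
    then show ?thesis unfolding fst_CC by (simp only:)
  qed
  have ol: "on_line n i (mixed_dom T (k(j := l)) j BB) y" using PiE_on_line[OF il(1) y(1)[unfolded fst_CC]] .
  have mem: "y(i := u) \<in> fst (CC k' l) \<longleftrightarrow> u \<in> (ddom (T i) ^^ \<kappa>) (BB i)" for u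
  proof -
    have "on_line n i ((mixed_dom T (k(j := l)) j BB)(i := (ddom (T i) ^^ \<kappa>) (BB i))) y" using ol unfolding on_line_fun_upd[OF il(1)] .
    from on_line_upd[OF il(1) this, of u] show ?thesis unfolding dom fun_upd_same .
  qed
  show m1: "y(i := \<sigma>) \<in> fst (CC k' l)" using mem s by blast
  show m2: "y \<in> fst (CC k' l)" using mem[of "y i"] t' by (simp only: fun_upd_triv)
  \<comment> \<open>The lowered order is still at least 1, so \<open>\<sigma>\<close> lies in the
    domain of a first derivative and cannot be \<open>b i\<close>. The induction on total order
    needs the strict bound at the new point.\<close>
  show "\<sigma> < b i"
  proof -
    have "(ddom (T i) ^^ \<kappa>) (BB i) \<subseteq> (ddom (T i) ^^ 1) (BB i)" using \<kappa>(2) by (rule ddom_funpow_antimono)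
    then have "\<sigma> \<in> ddom (T i) (BB i)" using s by (auto simp: One_nat_def)
    moreover have "\<sigma> \<in> BB i" using s ddom_funpow_subset by blast
    ultimately show ?thesis unfolding \<sigma>_def
      using fwd_jump_below_end[OF T[OF il(1)], of "y i" "a i" "b i"] CC_coord(3)[OF y(1) i(1)] y(2) by auto
  qed
  define L where "L = [(1 / (\<sigma> - y i), \<sigma>), (- 1 / (\<sigma> - y i), y i)]"
  have lk: "mixed_deriv T k' i0 (Om, f) = mixed_deriv T k i0 (Om, f)"
    by (rule mixed_deriv_cong) (auto simp: k'_def i0)
  have Bi: "mixed_dom T q i0 BB i = BB i" for q by (simp add: mixed_dom_def i0)
  have dc: "diff_chain T (k(j := l)) j (Om, f)" by (rule CC_facts[OF k])
  have dci: "diff_chain T k (Suc i0) (Om, f)"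
  proof -
    have "diff_chain T (k(j := l)) (Suc i0) (Om, f)" using dc i unfolding diff_chain_def i0 by auto
    then show ?thesis using diff_chain_cong[of "Suc i0" "k(j := l)" k T "(Om, f)"] i i0 by auto
  qed
  have rel: "line_rel n i {y i} L (mixed_deriv T k i (Om, f)) (mixed_deriv T k' i (Om, f))"
    unfolding line_rel_def
  proof (intro exI conjI)
    have "i \<le> n" using il by auto
    then show "fst (mixed_deriv T k i (Om, f)) = PiE {1..n} (mixed_dom T k i BB)"
      "fst (mixed_deriv T k' i (Om, f)) = PiE {1..n} (mixed_dom T k' i BB)" by (rule fst_mixed_deriv[OF _ fst_conv])+
    show "\<forall>q. q \<noteq> i \<longrightarrow> mixed_dom T k i BB q = mixed_dom T k' i BB q" using k'i(2) by (auto simp: mixed_dom_def)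
    have "mixed_dom T k' i BB i = (ddom (T i) ^^ \<kappa>) (BB i)" using i k'i by (auto simp: mixed_dom_def)
    then show "snd ` set L \<subseteq> mixed_dom T k' i BB i" using s t' by (auto simp: L_def)
    show "\<forall>x\<in>PiE {1..n} (mixed_dom T k i BB). x i \<in> {y i} \<longrightarrow>
      snd (mixed_deriv T k i (Om, f)) x = lincomb L (\<lambda>p. snd (mixed_deriv T k' i (Om, f)) (x(i := p)))"
    proof (intro ballI impI)
      fix x assume x: "x \<in> PiE {1..n} (mixed_dom T k i BB)" and xi: "x i \<in> {y i}"
      have ox: "on_line n i (mixed_dom T k i BB) x" by (rule PiE_on_line[OF il(1) x])
      have ox': "on_line n (Suc i0) (mixed_dom T k i0 BB) x" unfolding i0[symmetric]
        by (rule on_line_cong[OF il(1) ox]) (auto simp: mixed_dom_def i0)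
      have ox'': "on_line n (Suc i0) (mixed_dom T k' i0 BB) x" unfolding i0[symmetric]
        by (rule on_line_cong[OF il(1) ox]) (auto simp: mixed_dom_def i0 k'i(2))
      have n0: "Suc i0 \<le> n" using il i0 by auto
      let ?v = "\<lambda>u. snd (mixed_deriv T k i0 (Om, f)) (x(i := u))"
      have d: "ddiff (T i) ((ddom (T i) ^^ \<kappa>) (BB i)) (dders (T i) (BB i) \<kappa> ?v)"
        using mixed_deriv_slice(2)[where P = "(Om, f)", OF n0 fst_conv ox' dci, where \<kappa> = \<kappa>] \<kappa>(1) unfolding i0[symmetric] by simp
      have "snd (mixed_deriv T k i (Om, f)) x = dders (T i) (BB i) (Suc \<kappa>) ?v (y i)"
        using mixed_deriv_slice(1)[where P = "(Om, f)", OF n0 fst_conv ox', where t = "x i"] xi \<kappa> unfolding i0[symmetric] by (simp only: fun_upd_triv singleton_iff)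
      also have "\<dots> = dder (T i) ((ddom (T i) ^^ \<kappa>) (BB i)) (dders (T i) (BB i) \<kappa> ?v) (y i)" by simp
      also have "\<dots> = (dders (T i) (BB i) \<kappa> ?v \<sigma> - dders (T i) (BB i) \<kappa> ?v (y i)) / (\<sigma> - y i)"
        unfolding \<sigma>_def by (rule dder_scattered[OF d t y(2)])
      also have "\<dots> = lincomb L (\<lambda>p. dders (T i) (BB i) \<kappa> ?v p)" unfolding L_def by (rule lincomb_quotient[symmetric])
      also have "\<dots> = lincomb L (\<lambda>p. snd (mixed_deriv T k' i (Om, f)) (x(i := p)))"
        using mixed_deriv_slice(1)[where P = "(Om, f)", OF n0 fst_conv ox''] k'i(1) unfolding i0[symmetric] lk by (simp only:)
      finally show "snd (mixed_deriv T k i (Om, f)) x = lincomb L (\<lambda>p. snd (mixed_deriv T k' i (Om, f)) (x(i := p)))" .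
    qed
  qed
  \<comment> \<open>The quotient relation, established right after differentiating in variable
    \<open>i\<close>, persists under the derivatives in the later variables.\<close>
  have rel': "line_rel n i {y i} L (mixed_deriv T (k(j := l)) j (Om, f)) (mixed_deriv T (k'(j := l)) j (Om, f))"
  proof (rule line_rel_mixed[OF il(1), of i])
    have "mixed_deriv T (k(j := l)) i (Om, f) = mixed_deriv T k i (Om, f)" "mixed_deriv T (k'(j := l)) i (Om, f) = mixed_deriv T k' i (Om, f)"
      using i by (auto intro!: mixed_deriv_cong)
    then show "line_rel n i {y i} L (mixed_deriv T (k(j := l)) i (Om, f)) (mixed_deriv T (k'(j := l)) i (Om, f))"
      using rel by (simp only:)
    show "diff_chain T (k'(j := l)) j (Om, f)" by (rule CC_facts[OF ad k(2)])
    show "(k(j := l)) q = (k'(j := l)) q" if "i < q" "q \<le> j" for q using that k'i(2)[of q] by auto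
  qed (use i j in auto)
  have "y \<in> fst (mixed_deriv T (k(j := l)) j (Om, f))"
    using y(1) CC_mixed[of l k] by (rule back_subst[where P = "\<lambda>P. y \<in> fst P"])
  note eq = line_relD[OF rel' this singletonI]
  have "snd (CC k l) y = snd (mixed_deriv T (k(j := l)) j (Om, f)) y"
    by (rule arg_cong[where f = "\<lambda>P. snd P y", OF CC_mixed])
  also note eq
  also have "lincomb L (\<lambda>p. snd (mixed_deriv T (k'(j := l)) j (Om, f)) (y(i := p))) = lincomb L (\<lambda>p. snd (CC k' l) (y(i := p)))"
    by (rule arg_cong[where f = "\<lambda>P. lincomb L (\<lambda>p. snd P (y(i := p)))", OF CC_mixed[symmetric]])
  also have "\<dots> = (snd (CC k' l) (y(i := \<sigma>)) - snd (CC k' l) (y(i := y i))) / (\<sigma> - y i)"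
    unfolding L_def by (rule lincomb_quotient)
  finally show "snd (CC k l) y = (snd (CC k' l) (y(i := \<sigma>)) - snd (CC k' l) y) / (\<sigma> - y i)"
    unfolding fun_upd_triv .
qed

end

section \<open>The category argument at a right-dense point and the transfer at a general
  point\<close>

context mixed_zero_data
begin

lemma GG_continuous_line:
  assumes k: "adm k" and i: "i \<in> {1..<j}" and I: "\<And>t. t \<in> {l..r} \<Longrightarrow> y(i := t) \<in> fst (GG k) \<and> right_dense (T i) t"
  shows "continuous_on {l..r} (\<lambda>t. snd (GG k) (y(i := t)))"
  unfolding continuous_on_iff
proof (intro ballI allI impI)
  fix t e :: real assume t: "t \<in> {l..r}" and e: "0 < e"
  have i1: "i \<in> {1..n}" using i j by auto
  have yt: "y(i := t) \<in> fst (GG k)" and rd: "right_dense (T i) ((y(i := t)) i)" using I[OF t] by auto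
  obtain d where d: "d > 0" "\<And>s. (y(i := t))(i := s) \<in> fst (GG k) \<Longrightarrow> \<bar>s - (y(i := t)) i\<bar> < d \<Longrightarrow>
      \<bar>snd (GG k) ((y(i := t))(i := s)) - snd (GG k) (y(i := t))\<bar> < e"
    using rd_continuous_right_dense[OF GG_facts(1)[OF k] yt i1 rd e] by blast
  show "\<exists>d>0. \<forall>t'\<in>{l..r}. dist t' t < d \<longrightarrow> dist (snd (GG k) (y(i := t'))) (snd (GG k) (y(i := t))) < e"
  proof (intro exI[of _ d] conjI ballI impI d(1))
    fix s assume s: "s \<in> {l..r}" "dist s t < d"
    have "\<bar>snd (GG k) (y(i := s)) - snd (GG k) (y(i := t))\<bar> < e"
      using d(2)[of s] I[OF s(1)] s(2) unfolding fun_upd_upd fun_upd_same dist_real_def by blast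
    then show "dist (snd (GG k) (y(i := s))) (snd (GG k) (y(i := t))) < e" unfolding dist_real_def .
  qed
qed

lemma slice_of_f:
  assumes q: "q \<in> Om"
  shows "snd ((delta_deriv T j ^^ l) (Om, f)) (q(j := t)) = dders (T j) (BB j) l (\<lambda>s. f (q(j := s))) t"
    and "delta_differentiable T j ((delta_deriv T j ^^ l) (Om, f)) \<Longrightarrow>
      ddiff (T j) ((ddom (T j) ^^ l) (BB j)) (dders (T j) (BB j) l (\<lambda>s. f (q(j := s))))"
proof -
  have ol: "on_line n j BB q" by (rule PiE_on_line[OF jn(1) q])
  show "snd ((delta_deriv T j ^^ l) (Om, f)) (q(j := t)) = dders (T j) (BB j) l (\<lambda>s. f (q(j := s))) t"
    using delta_deriv_funpow_line[where P = "(Om, f)", OF jn(1) ol fst_conv, of l T t] unfolding snd_conv .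
  show "delta_differentiable T j ((delta_deriv T j ^^ l) (Om, f)) \<Longrightarrow>
      ddiff (T j) ((ddom (T j) ^^ l) (BB j)) (dders (T j) (BB j) l (\<lambda>s. f (q(j := s))))"
    using delta_differentiable_funpow_line[where P = "(Om, f)", OF jn(1) _ ol fst_conv, of T l] unfolding snd_conv .
qed

text \<open>If the derivative of order \<open>l + 1\<close> in \<open>x j\<close> were nonzero at \<open>y\<close>, then on a neighbourhood of \<open>y\<close> the quotient of \<open>GG k\<close> at
  \<open>x j = z\<close> by the monomial \<open>h z\<close> would be bounded below for \<open>z\<close> close to \<open>A\<close>, where closeness depends on the point. Baire category
  makes it uniform on a smaller box, so a functional of the values of \<open>f\<close> there, divided by \<open>h z\<close>, is bounded below,
  whereas it tends to \<open>0\<close> by the zero data of \<open>f\<close>.\<close>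

lemma nice_contradiction:
  assumes k: "adm k" "Suc l < lam j"
    and A: "A \<in> T j" "a j \<le> A" "A < b j" "fwd_jump (T j) A = A"
    and fd: "\<And>i. i \<le> l \<Longrightarrow> delta_differentiable T j ((delta_deriv T j ^^ i) (Om, f))"
    and fz: "\<And>i x. i \<le> Suc l \<Longrightarrow> x \<in> Om \<Longrightarrow> x j = A \<Longrightarrow> snd ((delta_deriv T j ^^ i) (Om, f)) x = 0"
    and gz: "\<And>i y. i \<le> l \<Longrightarrow> y \<in> fst (CC k i) \<Longrightarrow> y j = A \<Longrightarrow> \<forall>q\<in>{1..<j}. y q < b q \<Longrightarrow> snd (CC k i) y = 0"
    and y: "y \<in> fst (CC k (Suc l))" "y j = A" "\<And>i. i \<in> {1..<j} \<Longrightarrow> y i < b i" "\<And>i. i \<in> {1..<j} \<Longrightarrow> nice i (y i)"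
      "\<And>i. i \<in> {1..<j} \<Longrightarrow> fwd_jump (T i) (y i) \<noteq> y i \<Longrightarrow> k i = 1"
    and s: "\<bar>s\<bar> = 1" "0 < \<epsilon>" "\<epsilon> < s * snd (CC k (Suc l)) y"
  shows False
proof -
  have Tj: "closed (T j)" by (rule T[OF jn(1)])
  have bT: "b j \<in> T j" "b j \<in> BB j" "A \<in> BB j" using ab[OF jn(1)] A by auto
  define h where "h z = ts_monomial (T j) (Suc l) z A" for z
  have hpos: "0 < h z" if "z \<in> T j" "A < z" for z unfolding h_def by (rule ts_monomial_pos[OF Tj A(1,4) that])
  have kl: "Suc l \<le> lam j" using k by simp
  have "\<exists>z. z \<in> T j \<and> A < z \<and> z < b j \<and> z < A + 1 / (real m + 1)" for m
    using right_dense_limit[OF Tj A(1,4) bT(1) A(3), of "1 / (real m + 1)"] by (metis divide_pos_pos of_nat_0_le_iff add_nonneg_pos zero_less_one)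
  \<comment> \<open>A sequence instead of all \<open>z\<close> near \<open>A\<close>: the thresholds
    become natural numbers, as the category argument needs countably many.\<close>
  then obtain z where z: "\<And>m. z m \<in> T j" "\<And>m. A < z m" "\<And>m. z m < b j" "\<And>m. z m < A + 1 / (real m + 1)" by metis
  have zlim: "\<exists>N. \<forall>m\<ge>N. z m < A + d" if d: "0 < d" for d
  proof -
    obtain N where N: "1 / (real N + 1) < d" using reals_Archimedean[OF d] by (auto simp: field_simps)
    have "z m < A + d" if "m \<ge> N" for m
    proof -
      have "1 / (real m + 1) \<le> 1 / (real N + 1)" using that by (simp add: field_simps)
      then show ?thesis using z(4)[of m] N by linarith
    qed
    then show ?thesis by blast
  qed
  have zB: "z m \<in> BB j" for m using z(1,2,3)[of m] A by auto
  \<comment> \<open>The category argument runs over the right-dense coordinates only; the scattered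
    ones, where the order is 1, stay fixed at \<open>y\<close>.\<close>
  define S0 where "S0 = {i \<in> {1..<j}. fwd_jump (T i) (y i) = y i}"
  have S0: "i \<in> {1..<j}" "i \<in> {1..n}" "i \<noteq> j" if "i \<in> S0" for i using that j by (auto simp: S0_def)
  have yc: "y i \<in> BB i" "y i \<in> T i" if "i \<in> {1..<j}" for i using CC_coord(2,3)[OF y(1) that] by auto
  have "\<exists>r. y i < r \<and> r < b i \<and> (\<forall>t\<in>{y i..r}. t \<in> T i \<and> fwd_jump (T i) t = t)" if i: "i \<in> S0" for i
  proof -
    obtain r' where r': "y i < r'" "r' < b i" "{y i..r'} \<subseteq> T i"
      using y(4)[OF S0(1)[OF i]] i unfolding nice_def S0_def by blast
    \<comment> \<open>Only half of the interval is kept, so that every point up to \<open>r\<close>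
      has an interval of the time scale on its right and is right-dense.\<close>
    define r where "r = (y i + r') / 2"
    have r: "y i < r" "r < r'" using r' by (auto simp: r_def)
    have "fwd_jump (T i) t = t" if t: "t \<in> {y i..r}" for t
    proof (rule ccontr)
      have tT: "t \<in> T i" using t r r' by auto
      assume "fwd_jump (T i) t \<noteq> t"
      then have g: "t < fwd_jump (T i) t" using fwd_jump_ge[OF T[OF S0(2)[OF i]] tT] by simp
      define u where "u = (t + min r' (fwd_jump (T i) t)) / 2"
      have u: "t < u" "u < r'" "u < fwd_jump (T i) t" using g t r by (auto simp: u_def min_def)
      then have "u \<in> T i" using r'(3) t by auto
      then show False using fwd_jump_gap[OF T[OF S0(2)[OF i]] tT, of u] u by auto
    qed
    then show ?thesis using r r' by (intro exI[of _ r]) auto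
  qed
  then obtain r where r: "\<And>i. i \<in> S0 \<Longrightarrow> y i < r i" "\<And>i. i \<in> S0 \<Longrightarrow> r i < b i"
    "\<And>i t. i \<in> S0 \<Longrightarrow> t \<in> {y i..r i} \<Longrightarrow> t \<in> T i \<and> fwd_jump (T i) t = t" by metis
  have rd: "right_dense (T i) t" and rdom: "\<And>\<kappa>. t \<in> (ddom (T i) ^^ \<kappa>) (BB i)" if "i \<in> S0" "t \<in> {y i..r i}" for i t
  proof -
    have *: "t \<in> T i" "a i \<le> t" "t < b i" "fwd_jump (T i) t = t"
      using r(2)[OF that(1)] r(3)[OF that] yc(1)[OF S0(1)[OF that(1)]] that(2) by auto
    show "right_dense (T i) t" by (rule right_denseI[OF S0(2)[OF that(1)] *(1,3,4)])
    show "t \<in> (ddom (T i) ^^ \<kappa>) (BB i)" for \<kappa> by (rule right_dense_mem_dom[OF S0(2)[OF that(1)] *])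
  qed
  define Q where "Q x \<longleftrightarrow> (\<forall>i\<in>S0. y i \<le> x i \<and> x i \<le> r i) \<and> (\<forall>i. i \<notin> S0 \<longrightarrow> x i = y i)" for x
  have Qy: "Q y" using r(1) by (auto simp: Q_def less_imp_le)
  have Qmem: "x \<in> fst (CC k (Suc l))" if "Q x" for x
    unfolding fst_CC
  proof (rule PiE_I)
    fix i assume i: "i \<in> {1..n}"
    show "x i \<in> mixed_dom T (k(j := Suc l)) j BB i"
    proof (cases "i \<in> S0")
      case True
      then have "x i \<in> {y i..r i}" using that by (auto simp: Q_def)
      from rdom[OF True this] show ?thesis unfolding CC_dom_below[OF S0(1)[OF True]] .
    next
      case False
      then have "x i = y i" using that by (auto simp: Q_def)
      then show ?thesis using PiE_mem[OF y(1)[unfolded fst_CC] i] by (simp only:)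
    qed
  next
    fix i assume i: "i \<notin> {1..n}"
    then have "i \<notin> S0" using S0(2) by blast
    then have "x i = y i" using that by (auto simp: Q_def)
    then show "x i = undefined" using PiE_arb[OF y(1)[unfolded fst_CC] i] by (simp only:)
  qed
  have jS: "j \<notin> S0" using S0(3) by blast
  have Qj: "x j = A" if "Q x" for x using that jS y(2) by (auto simp: Q_def)
  have Qol: "on_line n j (mixed_dom T k (j - 1) BB) x" if "Q x" for x using mem_CC(1)[OF Qmem[OF that]] .
  have Qb: "x i < b i" if "Q x" "i \<in> {1..<j}" for x i
  proof (cases "i \<in> S0")
    case True then show ?thesis using that r(2)[OF True] by (force simp: Q_def)
  next
    case False then show ?thesis using that y(3)[OF that(2)] by (auto simp: Q_def)
  qed
  have QGG: "x(j := t) \<in> fst (GG k)" if "Q x" "t \<in> BB j" for x t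
    unfolding fst_GG on_line_upd[OF jn(1) Qol[OF that(1)]] mixed_dom_j by (rule that(2))
  have Qupd: "Q (x(i := t))" if "Q x" "i \<in> S0" "t \<in> {y i..r i}" for x i t using that by (auto simp: Q_def)
  \<comment> \<open>\<open>U\<close> concerns the derivative at \<open>A\<close> and survives small
    moves to the right. \<open>P N\<close> concerns only the slices at \<open>z m\<close>; it is
    closed in each coordinate because \<open>GG k\<close> is continuous along right-dense
    coordinates.\<close>
  define U where "U x \<longleftrightarrow> \<epsilon> < s * snd (CC k (Suc l)) x" for x
  define P where "P N x \<longleftrightarrow> (\<forall>m\<ge>N. \<epsilon> * h (z m) \<le> s * snd (GG k) (x(j := z m)))" for N x
  have finS: "finite S0" by (simp add: S0_def)
  have box: "\<exists>N. \<exists>p\<in>PiE S0 (\<lambda>_. UNIV :: (rat \<times> rat) set).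
      (\<forall>i\<in>S0. y i \<le> of_rat (fst (p i)) \<and> fst (p i) < snd (p i) \<and> of_rat (snd (p i)) \<le> r i) \<and>
      (\<forall>x. (\<forall>i\<in>S0. of_rat (fst (p i)) \<le> x i \<and> x i \<le> of_rat (snd (p i))) \<and> (\<forall>i. i \<notin> S0 \<longrightarrow> x i = y i) \<longrightarrow> P N x)"
  proof (rule Baire_box[where Q = Q and U = U and S = S0 and ?S0.0 = S0 and ?y0.0 = y and c = y])
    show "Q x \<longleftrightarrow> (\<forall>i\<in>S0. y i \<le> x i \<and> x i \<le> r i) \<and> (\<forall>i. i \<notin> S0 \<longrightarrow> x i = y i)" for x by (rule Q_def)
  next
    fix x i assume x: "Q x" "U x" and i: "i \<in> S0" "x i < r i"
    have xi: "x i \<in> {y i..r i}" using x(1) i by (auto simp: Q_def)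
    define e where "e = s * snd (CC k (Suc l)) x - \<epsilon>"
    have e: "e > 0" using x(2) by (simp add: e_def U_def)
    obtain d where d: "d > 0" "\<And>t. x(i := t) \<in> fst (CC k (Suc l)) \<Longrightarrow> \<bar>t - x i\<bar> < d \<Longrightarrow> \<bar>snd (CC k (Suc l)) (x(i := t)) - snd (CC k (Suc l)) x\<bar> < e"
      using rd_continuous_right_dense[OF CC_facts(1)[OF k(1) kl] Qmem[OF x(1)] S0(2)[OF i(1)] rd[OF i(1) xi] e] by blast
    define u where "u = min (r i) (x i + d / 2)"
    have u: "x i < u" "u \<le> r i" "u < x i + d" using i d(1) by (auto simp: u_def)
    show "\<exists>u>x i. u \<le> r i \<and> (\<forall>t\<in>{x i..u}. U (x(i := t)))"
    proof (intro exI[of _ u] conjI ballI u)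
      fix t assume t: "t \<in> {x i..u}"
      then have "t \<in> {y i..r i}" using xi u by auto
      then have "\<bar>snd (CC k (Suc l)) (x(i := t)) - snd (CC k (Suc l)) x\<bar> < e"
        using t u by (intro d(2) Qmem Qupd[OF x(1) i(1)]) auto
      then have "\<bar>s\<bar> * \<bar>snd (CC k (Suc l)) (x(i := t)) - snd (CC k (Suc l)) x\<bar> < e" using s(1) by (simp only: mult_1)
      then have "\<bar>s * snd (CC k (Suc l)) (x(i := t)) - s * snd (CC k (Suc l)) x\<bar> < e"
        unfolding abs_mult[symmetric] right_diff_distrib .
      then show "U (x(i := t))" unfolding U_def e_def by linarith
    qed
  next
    fix x i N assume x: "Q x" and i: "i \<in> S0"
    have ij: "i \<noteq> j" by (rule S0(3)[OF i])
    have cont: "continuous_on {y i..r i} (\<lambda>t. snd (GG k) (x(i := t, j := z m)))" for m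
    proof -
      have "continuous_on {y i..r i} (\<lambda>t. snd (GG k) ((x(j := z m))(i := t)))"
      proof (rule GG_continuous_line[OF k(1) S0(1)[OF i]])
        fix t assume t: "t \<in> {y i..r i}"
        have "x(i := t, j := z m) \<in> fst (GG k)" by (rule QGG[OF Qupd[OF x i t] zB])
        then show "(x(j := z m))(i := t) \<in> fst (GG k) \<and> right_dense (T i) t"
          using rd[OF i t] unfolding fun_upd_twist[OF ij] by blast
      qed
      then show ?thesis unfolding fun_upd_twist[OF ij] .
    qed
    have "closed {t \<in> {y i..r i}. \<epsilon> * h (z m) \<le> s * snd (GG k) (x(i := t, j := z m))}" for m
      by (rule continuous_on_closed_Collect_le) (auto intro!: continuous_intros cont)
    then have "closed ({y i..r i} \<inter> (\<Inter>m\<in>{N..}. {t \<in> {y i..r i}. \<epsilon> * h (z m) \<le> s * snd (GG k) (x(i := t, j := z m))}))"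
      by (intro closed_Int closed_INT) auto
    also have "{y i..r i} \<inter> (\<Inter>m\<in>{N..}. {t \<in> {y i..r i}. \<epsilon> * h (z m) \<le> s * snd (GG k) (x(i := t, j := z m))}) = {t \<in> {y i..r i}. P N (x(i := t))}"
      unfolding P_def by blast
    finally show "closed {t \<in> {y i..r i}. P N (x(i := t))}" .
  next
    fix x assume x: "Q x" "U x"
    have ol: "on_line n j (mixed_dom T k (j - 1) BB) x" by (rule Qol[OF x(1)])
    have xA: "x(j := A) = x" using Qj[OF x(1)] by (rule fun_upd_idem)
    let ?v = "\<lambda>u. snd (GG k) (x(j := u))"
    have df: "ddiff (T j) ((ddom (T j) ^^ i) (BB j)) (dders (T j) (BB j) i ?v)" if "i < Suc l" for i
      by (rule CC_slice_diff[OF ol k(1)]) (use that k(2) in simp)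
    have sl: "dders (T j) (BB j) i ?v A = snd (CC k i) x" for i
      using CC_slice[OF ol, of i A, symmetric] unfolding xA .
    have cm: "dders (T j) (BB j) i (\<lambda>u. s * ?v u) = (\<lambda>u. s * dders (T j) (BB j) i ?v u)" if "i \<le> Suc l" for i
      by (rule dders_cmult(1)[OF df that])
    have "\<exists>d>0. \<forall>u\<in>T j. A < u \<longrightarrow> u < A + d \<longrightarrow> \<epsilon> * ts_monomial (T j) (Suc l) u A \<le> s * ?v u"
    proof (rule peano_lower_bound[OF Tj A(1,4) down_closed_BB bT(3,2) A(3)])
      show "ddiff (T j) ((ddom (T j) ^^ i) (BB j)) (dders (T j) (BB j) i (\<lambda>u. s * ?v u))" if "i \<le> l" for i
        by (rule dders_cmult(2)[OF df le_imp_less_Suc[OF that]])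
      show "dders (T j) (BB j) i (\<lambda>u. s * ?v u) A = 0" if i: "i \<le> l" for i
      proof -
        have "x(j := A) \<in> fst (CC k i)" 
        proof -
          have o: "on_line n j ((mixed_dom T k (j - 1) BB)(j := (ddom (T j) ^^ i) (BB j))) x" using ol unfolding on_line_fun_upd[OF jn(1)] .
          show ?thesis unfolding fst_CC' on_line_upd[OF jn(1) o] fun_upd_same by (rule right_dense_mem_dom[OF jn(1) A])
        qed
        then have "x \<in> fst (CC k i)" unfolding xA .
        then have "snd (CC k i) x = 0" using gz[OF i] Qj[OF x(1)] Qb[OF x(1)] by blast
        then show ?thesis unfolding cm[OF le_SucI[OF i]] sl by (rule ssubst) (rule mult_zero_right)
      qed
      show "\<epsilon> < dders (T j) (BB j) (Suc l) (\<lambda>u. s * ?v u) A"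
        unfolding cm[OF le_refl] sl using x(2) unfolding U_def .
    qed
    then obtain d where d: "d > 0" "\<And>u. u \<in> T j \<Longrightarrow> A < u \<Longrightarrow> u < A + d \<Longrightarrow> \<epsilon> * h u \<le> s * ?v u" unfolding h_def by blast
    obtain N where "\<forall>m\<ge>N. z m < A + d" using zlim[OF d(1)] by blast
    then show "\<exists>N. P N x" unfolding P_def using d(2) z by (intro exI[of _ N]) blast
  next
    show "U y" unfolding U_def by (rule s(3))
    show "finite S0" "S0 \<subseteq> S0" "Q y" by (rule finS, rule subset_refl, rule Qy)
    show "\<forall>i\<in>S0. y i < r i" using r(1) by blast
  qed
  then obtain N p where p: "\<And>i. i \<in> S0 \<Longrightarrow> y i \<le> of_rat (fst (p i)) \<and> fst (p i) < snd (p i) \<and> of_rat (snd (p i)) \<le> r i"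
      "\<And>x. (\<forall>i\<in>S0. of_rat (fst (p i)) \<le> x i \<and> x i \<le> of_rat (snd (p i))) \<Longrightarrow> (\<forall>i. i \<notin> S0 \<longrightarrow> x i = y i) \<Longrightarrow> P N x"
    by (elim exE bexE conjE) blast
  \<comment> \<open>Intervals with rational ends in the coordinates of \<open>S0\<close>, single
    points in the scattered ones.\<close>
  define C where "C i = (if i \<in> S0 then {of_rat (fst (p i))..of_rat (snd (p i)) :: real} else {y i})" for i
  have yB: "y \<in> Om"
  proof (rule PiE_I)
    fix i assume i: "i \<in> {1..n}"
    have "mixed_dom T (k(j := Suc l)) j BB i \<subseteq> BB i" unfolding mixed_dom_def by (split if_split) (intro conjI impI ddom_funpow_subset subset_refl)
    then show "y i \<in> BB i" using PiE_mem[OF y(1)[unfolded fst_CC] i] by blast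
  qed (use PiE_arb[OF y(1)[unfolded fst_CC]] in blast)
  have cells: "\<forall>i\<in>{1..j - 1}. \<exists>L \<delta>. cell_functional (T i) (BB i) (k i) (C i) L \<delta>"
  proof
    fix i assume "i \<in> {1..j - 1}"
    then have i: "i \<in> {1..<j}" and i1: "i \<in> {1..n}" using j by auto
    show "\<exists>L \<delta>. cell_functional (T i) (BB i) (k i) (C i) L \<delta>"
    proof (cases "i \<in> S0")
      case True
      have sub: "{of_rat (fst (p i))..of_rat (snd (p i))} \<subseteq> {y i..r i}" using p(1)[OF True] by auto
      have "\<exists>L \<delta>. cell_functional (T i) (BB i) (k i) {of_rat (fst (p i))..of_rat (snd (p i))} L \<delta>"
      proof (rule cell_functional_interval[OF T[OF i1] down_closed_BB])
        show lt: "(of_rat (fst (p i)) :: real) < of_rat (snd (p i))" using p(1)[OF True] by (simp add: of_rat_less)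
        show "{of_rat (fst (p i))..of_rat (snd (p i))} \<subseteq> T i" using sub r(3)[OF True] by blast
        show "a i \<le> of_rat (fst (p i))" using p(1)[OF True] yc(1)[OF i] by auto
        show "of_rat (snd (p i)) \<in> BB i" using rdom[OF True, of "of_rat (snd (p i))" 0] sub lt by auto
        show "{of_rat (fst (p i))..of_rat (snd (p i))} \<subseteq> (ddom (T i) ^^ k i) (BB i)" using sub rdom[OF True] by blast
      qed
      then show ?thesis by (simp only: C_def True if_True)
    next
      case False
      then have sc: "fwd_jump (T i) (y i) \<noteq> y i" using i by (auto simp: S0_def)
      have k1: "k i = 1" by (rule y(5)[OF i sc])
      have "y i \<in> ddom (T i) (BB i)" using CC_coord(1)[OF y(1) i] k1 by (simp add: One_nat_def)
      then have "\<exists>L \<delta>. cell_functional (T i) (BB i) 1 {y i} L \<delta>" by (intro cell_functional_scattered[OF T[OF i1] _ _ sc]) auto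
      then show ?thesis using k1 False by (simp only: C_def if_False)
    qed
  qed
  obtain W \<delta> where W: "0 < \<delta>" "\<forall>q\<in>snd ` set W. q \<in> Om"
    "\<forall>u \<epsilon>. diff_chain T k (j - 1) (Om, u) \<longrightarrow>
       (\<forall>x. (\<forall>i\<in>{1..j - 1}. x i \<in> C i) \<longrightarrow> (\<forall>i. i \<notin> {1..j - 1} \<longrightarrow> x i = y i) \<longrightarrow> \<epsilon> \<le> snd (mixed_deriv T k (j - 1) (Om, u)) x)
      \<longrightarrow> \<delta> * \<epsilon> \<le> pt_lincomb W u"
    using box_functional[OF yB jn(2) cells] by (elim exE conjE)
  \<comment> \<open>Freezing \<open>x j\<close> at \<open>z m\<close> commutes with the lower
    derivatives, so \<open>P N\<close> becomes a lower bound for a combination of values of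
    \<open>f\<close>, with the same nodes for every \<open>m \<ge> N\<close>.\<close>
  have lower: "\<delta> * (\<epsilon> * h (z m)) \<le> pt_lincomb W (\<lambda>x. s * f (x(j := z m)))" if m: "m \<ge> N" for m
  proof (rule W(3)[THEN spec, THEN spec, THEN mp, THEN mp], goal_cases)
    define u where "u x = s * f (x(j := z m))" for x
    have jj: "j - 1 < j" using j by simp
    have rel: "line_rel n j (BB j) [(s, z m)] (Om, u) (Om, f)"
      unfolding line_rel_def
    proof (intro exI conjI)
      show "fst (Om, u) = PiE {1..n} BB" "fst (Om, f) = PiE {1..n} BB" by (rule fst_conv)+
      show "snd ` set [(s, z m)] \<subseteq> BB j" using zB[of m] by simp
      show "\<forall>x\<in>PiE {1..n} BB. x j \<in> BB j \<longrightarrow> snd (Om, u) x = lincomb [(s, z m)] (\<lambda>p. snd (Om, f) (x(j := p)))"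
        unfolding snd_conv u_def by simp
    qed simp
    case 1
    show ?case
      using diff_chain_line_rel[where i = j and B = BB and L = "[(s, z m)]", OF jn(1,2) jj fst_conv rel GG_facts(2)[OF k(1)]]
      unfolding u_def .
    case 2
    show ?case
    proof (intro allI impI)
      fix x assume x: "\<forall>i\<in>{1..j - 1}. x i \<in> C i" "\<forall>i. i \<notin> {1..j - 1} \<longrightarrow> x i = y i"
      have xS: "\<forall>i\<in>S0. of_rat (fst (p i)) \<le> x i \<and> x i \<le> of_rat (snd (p i))"
      proof
        fix i assume i: "i \<in> S0"
        then have "i \<in> {1..j - 1}" using S0(1)[OF i] by auto
        then have "x i \<in> C i" using x(1) by blast
        then show "of_rat (fst (p i)) \<le> x i \<and> x i \<le> of_rat (snd (p i))" using i by (simp add: C_def)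
      qed
      have xn: "\<forall>i. i \<notin> S0 \<longrightarrow> x i = y i"
      proof (intro allI impI)
        fix i assume i: "i \<notin> S0"
        show "x i = y i"
        proof (cases "i \<in> {1..j - 1}")
          case True
          then have "x i \<in> C i" using x(1) by blast
          then show ?thesis using i by (simp add: C_def)
        qed (use x(2) in blast)
      qed
      have "P N x" by (rule p(2)[OF xS xn])
      then have ge: "\<epsilon> * h (z m) \<le> s * snd (GG k) (x(j := z m))" using m unfolding P_def by blast
      have Qx: "Q x" unfolding Q_def
      proof (intro conjI ballI xn)
        fix i assume i: "i \<in> S0"
        show "y i \<le> x i" "x i \<le> r i" using p(1)[OF i] bspec[OF xS i] by linarith+
      qed
      have "fst (mixed_deriv T k (j - 1) (Om, u)) = fst (GG k)" unfolding fst_GG by (rule fst_mixed_deriv[OF jn(2) fst_conv])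
      moreover have "x \<in> fst (GG k)" using QGG[OF Qx bT(3)] unfolding fun_upd_idem[where f = x and x = j and y = A, OF Qj[OF Qx]] .
      ultimately have xm: "x \<in> fst (mixed_deriv T k (j - 1) (Om, u))" by (rule ssubst)
      have "line_rel n j (BB j) [(s, z m)] (mixed_deriv T k (j - 1) (Om, u)) (GG k)"
      proof (rule line_rel_mixed[OF jn(1), of 0])
        show "line_rel n j (BB j) [(s, z m)] (mixed_deriv T k 0 (Om, u)) (mixed_deriv T k 0 (Om, f))"
          using rel unfolding mixed_deriv.simps .
        show "diff_chain T k (j - 1) (Om, f)" by (rule GG_facts(2)[OF k(1)])
      qed (use j in auto)
      moreover have "x j \<in> BB j" unfolding Qj[OF Qx] by (rule bT(3))
      ultimately have "snd (mixed_deriv T k (j - 1) (Om, u)) x = lincomb [(s, z m)] (\<lambda>p. snd (GG k) (x(j := p)))"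
        using xm by (intro line_relD)
      then have "\<epsilon> * h (z m) \<le> snd (mixed_deriv T k (j - 1) (Om, u)) x" using ge unfolding lincomb_simps by linarith
      then show "\<epsilon> * h (z m) \<le> snd (mixed_deriv T k (j - 1) (Om, (\<lambda>x. s * f (x(j := z m))))) x" unfolding u_def .
    qed
  qed
  define c where "c = (\<Sum>(c, q)\<leftarrow>W. \<bar>c\<bar>)"
  have c0: "0 \<le> c" unfolding c_def by (intro sum_list_nonneg) auto
  \<comment> \<open>Chosen so that \<open>c * e\<close>, with \<open>c\<close> the sum of the
    absolute coefficients, is at most half of \<open>\<delta> * \<epsilon>\<close>;
    \<open>c + 1\<close> avoids division by 0.\<close>
  define e where "e = \<delta> * \<epsilon> / (2 * (c + 1))"
  have e: "e > 0" unfolding e_def using W(1) s(2) c0 by (intro divide_pos_pos mult_pos_pos) auto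
  have "\<exists>M. \<forall>m\<ge>M. pt_lincomb W (\<lambda>x. s * f (x(j := z m))) \<le> c * (e * h (z m))"
    unfolding c_def
  proof (rule pt_lincomb_eventually_le)
    fix q assume "q \<in> snd ` set W"
    then have q: "q \<in> Om" using W(2) by blast
    have qA: "q(j := A) \<in> Om" unfolding on_line_upd[OF jn(1) PiE_on_line[OF jn(1) q]] by (rule bT(3))
    let ?v = "\<lambda>u. f (q(j := u))"
    have df: "ddiff (T j) ((ddom (T j) ^^ i) (BB j)) (dders (T j) (BB j) i ?v)" if "i < Suc l" for i
      by (rule slice_of_f(2)[OF q fd]) (use that in simp)
    have sl: "dders (T j) (BB j) i ?v A = 0" if "i \<le> Suc l" for i
      using slice_of_f(1)[OF q, of i A] fz[OF that qA fun_upd_same] by (rule trans[OF sym])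
    have cm: "dders (T j) (BB j) i (\<lambda>u. g * ?v u) = (\<lambda>u. g * dders (T j) (BB j) i ?v u)" if "i \<le> Suc l" for i g
      by (rule dders_cmult(1)[OF df that])
    \<comment> \<open>All derivatives of the slice of \<open>f\<close> through order
      \<open>l + 1\<close> vanish at \<open>A\<close>, so the Peano bound holds with the negative
      constant \<open>- e\<close>. Taking \<open>g\<close> as \<open>s\<close> and as
      \<open>- s\<close> bounds the absolute value.\<close>
    have one: "\<exists>M. \<forall>m\<ge>M. - e * h (z m) \<le> g * f (q(j := z m))" for g :: real
    proof -
      have "\<exists>d>0. \<forall>u\<in>T j. A < u \<longrightarrow> u < A + d \<longrightarrow> - e * ts_monomial (T j) (Suc l) u A \<le> g * ?v u"
      proof (rule peano_lower_bound[OF Tj A(1,4) down_closed_BB bT(3,2) A(3)])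
        show "ddiff (T j) ((ddom (T j) ^^ i) (BB j)) (dders (T j) (BB j) i (\<lambda>u. g * ?v u))" if "i \<le> l" for i
          by (rule dders_cmult(2)[OF df le_imp_less_Suc[OF that]])
        have z: "dders (T j) (BB j) i (\<lambda>u. g * ?v u) A = 0" if i: "i \<le> Suc l" for i
          unfolding cm[OF i] sl[OF i] by simp
        show "dders (T j) (BB j) i (\<lambda>u. g * ?v u) A = 0" if "i \<le> l" for i using z[of i] that by simp
        show "- e < dders (T j) (BB j) (Suc l) (\<lambda>u. g * ?v u) A" using z[of "Suc l"] e by linarith
      qed
      then obtain d where d: "d > 0" "\<And>u. u \<in> T j \<Longrightarrow> A < u \<Longrightarrow> u < A + d \<Longrightarrow> - e * h u \<le> g * ?v u" unfolding h_def by blast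
      obtain M where "\<forall>m\<ge>M. z m < A + d" using zlim[OF d(1)] by blast
      then show ?thesis using d(2) z by (intro exI[of _ M]) blast
    qed
    obtain M1 where M1: "\<forall>m\<ge>M1. - e * h (z m) \<le> s * f (q(j := z m))" using one[of s] by blast
    obtain M2 where M2: "\<forall>m\<ge>M2. - e * h (z m) \<le> - s * f (q(j := z m))" using one[of "- s"] by blast
    have "\<bar>s * f (q(j := z m))\<bar> \<le> e * h (z m)" if "m \<ge> max M1 M2" for m
    proof -
      have "- e * h (z m) \<le> s * f (q(j := z m))" "- e * h (z m) \<le> - s * f (q(j := z m))" using M1 M2 that by auto
      then show ?thesis by (simp add: abs_le_iff)
    qed
    then show "\<exists>N. \<forall>m\<ge>N. \<bar>s * f (q(j := z m))\<bar> \<le> e * h (z m)" by blast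
  qed
  then obtain M where M: "\<forall>m\<ge>M. pt_lincomb W (\<lambda>x. s * f (x(j := z m))) \<le> c * (e * h (z m))" by blast
  define m where "m = max M N"
  have hm: "0 < h (z m)" by (rule hpos[OF z(1,2)])
  have "\<delta> * (\<epsilon> * h (z m)) \<le> c * (e * h (z m))" using lower[of m] M by (auto simp: m_def intro: order_trans)
  then have "(\<delta> * \<epsilon>) * h (z m) \<le> (c * e) * h (z m)" by (simp only: mult.assoc)
  then have "\<delta> * \<epsilon> \<le> c * e" using hm by simp
  also have "c * e \<le> (c + 1) * e" using e by simp
  also have "\<dots> = \<delta> * \<epsilon> / 2" using c0 unfolding e_def by (simp add: field_simps)
  finally have "\<delta> * \<epsilon> \<le> \<delta> * \<epsilon> / 2" .
  moreover have "0 < \<delta> * \<epsilon>" using W(1) s(2) by (rule mult_pos_pos)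
  ultimately show False by linarith
qed

text \<open>Two nested inductions. The outer one, on \<open>l\<close>, supplies the zeros of lower
  order in \<open>x j\<close> that the Peano bound presupposes. The inner one, on the total order of
  \<open>k\<close>, uses \<open>scattered_reduce\<close> until every scattered coordinate has order
  1, after which \<open>nice_contradiction\<close> applies.\<close>

lemma zero_at_right_dense:
  assumes A: "A \<in> T j" "a j \<le> A" "A < b j" "fwd_jump (T j) A = A"
    and fd: "\<And>i. Suc i < lam j \<Longrightarrow> delta_differentiable T j ((delta_deriv T j ^^ i) (Om, f))"
  shows "l < lam j \<Longrightarrow>
    (\<And>i x. i \<le> l \<Longrightarrow> x \<in> Om \<Longrightarrow> x j = A \<Longrightarrow> snd ((delta_deriv T j ^^ i) (Om, f)) x = 0) \<Longrightarrow>
    adm k \<Longrightarrow> y \<in> fst (CC k l) \<Longrightarrow> y j = A \<Longrightarrow> \<forall>q\<in>{1..<j}. y q < b q \<Longrightarrow> snd (CC k l) y = 0"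
proof (induction l arbitrary: k y rule: less_induct)
  case (less l)
  note fz = less.prems(2)
  show ?case
  proof (cases l)
    case 0
    have "f x = 0" if "x \<in> Om" "x j = A" for x using fz[OF le0 that] by simp
    from GG_zero[OF less.prems(3) this] less.prems(4,5) show ?thesis unfolding 0 by simp
  next
    case l: (Suc l')
    have gz: "snd (CC k i) y = 0"
      if "i \<le> l'" "adm k" "y \<in> fst (CC k i)" "y j = A" "\<forall>q\<in>{1..<j}. y q < b q" for i k y
    proof (rule less.IH)
      show "i < l" "i < lam j" using that(1) l less.prems(1) by auto
      show "snd ((delta_deriv T j ^^ i') (Om, f)) x = 0" if "i' \<le> i" "x \<in> Om" "x j = A" for i' x
        using fz[of i' x] that \<open>i < l\<close> by linarith
    qed (rule that)+
    have sl: "Suc l' < lam j" using less.prems(1) l by simp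
    have "snd (CC k (Suc l')) y = 0"
      if "adm k" "y \<in> fst (CC k (Suc l'))" "y j = A" "\<forall>q\<in>{1..<j}. y q < b q" for k y
      using that
    proof (induction "sum k {1..<j}" arbitrary: k y rule: less_induct)
      case (less k y)
      show ?case
      proof (rule ccontr)
        assume nz: "snd (CC k (Suc l')) y \<noteq> 0"
        define s where "s = sgn (snd (CC k (Suc l')) y)"
        define \<epsilon> where "\<epsilon> = \<bar>snd (CC k (Suc l')) y\<bar> / 2"
        have s: "\<bar>s\<bar> = 1" "0 < \<epsilon>" using nz by (auto simp: s_def \<epsilon>_def sgn_real_def)
        have gt: "\<epsilon> < s * snd (CC k (Suc l')) y"
        proof -
          have "s * snd (CC k (Suc l')) y = 2 * \<epsilon>" unfolding s_def \<epsilon>_def by (simp add: abs_sgn mult.commute)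
          then show ?thesis using s(2) by linarith
        qed
        have yb: "\<And>i. i \<in> {1..<j} \<Longrightarrow> y i < b i" using less.prems(4) by blast
        obtain y' where y': "y' \<in> fst (CC k (Suc l'))" "y' j = y j" "\<forall>i\<in>{1..<j}. y' i < b i"
          "\<epsilon> < s * snd (CC k (Suc l')) y'" "\<forall>i\<in>{1..<j}. nice i (y' i)"
          using nice_point[OF less.prems(1) less_imp_le[OF sl] less.prems(2) yb gt le_refl] by blast
        have yA: "y' j = A" using y'(2) less.prems(3) by simp
        show False
        proof (cases "\<exists>i\<in>{1..<j}. fwd_jump (T i) (y' i) \<noteq> y' i \<and> k i \<noteq> 1")
          case True
          then obtain i where i: "i \<in> {1..<j}" "fwd_jump (T i) (y' i) \<noteq> y' i" "k i \<noteq> 1" by blast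
          have k2: "2 \<le> k i" using bspec[OF less.prems(1) i(1)] i(3) by linarith
          note red = scattered_reduce[OF less.prems(1) less_imp_le[OF sl] i(1) k2 y'(1) i(2)]
          let ?k = "k(i := k i - 1)" and ?\<sigma> = "fwd_jump (T i) (y' i)"
          have "sum ?k {1..<j} < sum k {1..<j}"
            by (rule sum_strict_mono_ex1) (use i k2 in auto)
          note IH = less.hyps[OF this red(1)]
          have ij: "i \<noteq> j" using i(1) by auto
          have 1: "snd (CC ?k (Suc l')) y' = 0" by (rule IH[OF red(2) yA y'(3)])
          have 2: "snd (CC ?k (Suc l')) (y'(i := ?\<sigma>)) = 0"
          proof (rule IH[OF red(3)])
            show "(y'(i := ?\<sigma>)) j = A" using yA ij by simp
            show "\<forall>q\<in>{1..<j}. (y'(i := ?\<sigma>)) q < b q" using y'(3) red(4) by simp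
          qed
          have "snd (CC k (Suc l')) y' = 0" unfolding red(5) 1 2 by simp
          then have "s * snd (CC k (Suc l')) y' = 0" by (rule ssubst) (rule mult_zero_right)
          then show False using y'(4) s(2) by linarith
        next
          case False
          show False
          proof (rule nice_contradiction[OF less.prems(1) sl A _ _ _ y'(1) yA _ _ _ s y'(4)])
            show "delta_differentiable T j ((delta_deriv T j ^^ i) (Om, f))" if "i \<le> l'" for i
              by (rule fd) (use that sl in linarith)
            show "snd ((delta_deriv T j ^^ i) (Om, f)) x = 0" if "i \<le> Suc l'" "x \<in> Om" "x j = A" for i x
              by (rule fz[OF that(1)[folded l] that(2,3)])
            show "snd (CC k i) y = 0" if "i \<le> l'" "y \<in> fst (CC k i)" "y j = A" "\<forall>q\<in>{1..<j}. y q < b q" for i y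
              by (rule gz[OF that(1) less.prems(1) that(2,3,4)])
          qed (use y'(3,5) False in blast)+
        qed
      qed
    qed
    from this[OF less.prems(3) less.prems(4)[unfolded l] less.prems(5,6)] show ?thesis unfolding l .
  qed
qed

lemma end_not_in_ddom:
  assumes t: "t \<in> T j" "t < fwd_jump (T j) t" "fwd_jump (T j) t \<in> BB j"
  shows "fwd_jump (T j) t = b j \<Longrightarrow> b j \<notin> ddom (T j) (BB j)"
  using fwd_jump_below_end[OF T[OF jn(1)] t(1) _ t(3)] t(2) by fastforce

text \<open>At a right-scattered \<open>A\<close> the zero data move to the next point, losing one
  order, and the induction hypothesis there returns the derivatives at \<open>A\<close> as
  quotients. This repeats at most \<open>l0\<close> times unless a right-dense point is met first.
  The condition at \<open>b j\<close> forces \<open>A < b j\<close> as soon as a derivative of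
  positive order is evaluated at \<open>A\<close>.\<close>

lemma zero_transfer:
  assumes fd: "\<And>i. Suc i < lam j \<Longrightarrow> delta_differentiable T j ((delta_deriv T j ^^ i) (Om, f))"
  shows "l0 \<le> lam j \<Longrightarrow> A \<in> BB j \<Longrightarrow> (A = b j \<longrightarrow> A \<notin> ddom (T j) (BB j)) \<Longrightarrow>
    (\<And>i x. i < l0 \<Longrightarrow> x \<in> Om \<Longrightarrow> x j = A \<Longrightarrow> snd ((delta_deriv T j ^^ i) (Om, f)) x = 0) \<Longrightarrow> l < l0 \<Longrightarrow>
    adm k \<Longrightarrow> y \<in> fst (CC k l) \<Longrightarrow> y j = A \<Longrightarrow> \<forall>q\<in>{1..<j}. y q < b q \<Longrightarrow> snd (CC k l) y = 0"
proof (induction l0 arbitrary: A l k y)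
  case (Suc l0)
  note fz = Suc.prems(4)
  have Tj: "closed (T j)" by (rule T[OF jn(1)])
  have AT: "A \<in> T j" "a j \<le> A" "A \<le> b j" using Suc.prems(2) by auto
  have f0: "f x = 0" if "x \<in> Om" "x j = A" for x using fz[OF zero_less_Suc that] by simp
  have g0: "snd (GG k) y = 0" if "adm k" "y \<in> fst (GG k)" "y j = A" for k y
    by (rule GG_zero[OF that(1) f0 that(2,3)])
  show ?case
  proof (cases "l = 0")
    case True
    have "y \<in> fst (GG k)" using Suc.prems(7) unfolding True by simp
    then have "snd (GG k) y = 0" by (rule g0[where k = k and y = y, OF Suc.prems(6) _ Suc.prems(8)])
    then show ?thesis unfolding True by simp
  next
    case l: False
    have Ad: "A \<in> (ddom (T j) ^^ l) (BB j)" using mem_CC(2)[OF Suc.prems(7)] unfolding Suc.prems(8) .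
    have "(ddom (T j) ^^ l) (BB j) \<subseteq> (ddom (T j) ^^ 1) (BB j)" using l by (intro ddom_funpow_antimono) simp
    then have "A \<in> ddom (T j) (BB j)" using Ad by (auto simp: One_nat_def)
    then have Ab: "A < b j" using Suc.prems(3) AT(3) by (cases "A = b j") auto
    show ?thesis
    proof (cases "fwd_jump (T j) A = A")
      case True
      show ?thesis
      proof (rule zero_at_right_dense[OF AT(1,2) Ab True fd])
        show "l < lam j" using Suc.prems(1,5) by linarith
        show "snd ((delta_deriv T j ^^ i) (Om, f)) x = 0" if "i \<le> l" "x \<in> Om" "x j = A" for i x
          using fz[of i x] that Suc.prems(5) by linarith
      qed (rule Suc.prems | assumption)+
    next
      case False
      define \<sigma> where "\<sigma> = fwd_jump (T j) A"
      have bT: "b j \<in> T j" using ab[OF jn(1)] by blast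
      have \<sigma>: "\<sigma> \<in> BB j" "A < \<sigma>"
        using fwd_jump_in[OF Tj AT(1)] fwd_jump_ge[OF Tj AT(1)] fwd_jump_gap[OF Tj AT(1) bT Ab] False AT(2)
        unfolding \<sigma>_def by auto
      have \<sigma>b: "\<sigma> = b j \<longrightarrow> \<sigma> \<notin> ddom (T j) (BB j)"
        using end_not_in_ddom[OF AT(1)] \<sigma> unfolding \<sigma>_def by metis
      \<comment> \<open>The quotient for order \<open>i + 1\<close> at \<open>A\<close> determines
        the value of order \<open>i\<close> at \<open>\<sigma>\<close>; hence one order fewer is
        available there.\<close>
      have fz': "snd ((delta_deriv T j ^^ i) (Om, f)) x = 0" if i: "i < l0" and x: "x \<in> Om" "x j = \<sigma>" for i x
      proof -
        let ?v = "\<lambda>u. f (x(j := u))"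
        have xA: "x(j := A) \<in> Om" unfolding on_line_upd[OF jn(1) PiE_on_line[OF jn(1) x(1)]] by (rule Suc.prems(2))
        have sl: "snd ((delta_deriv T j ^^ q) (Om, f)) (x(j := t)) = dders (T j) (BB j) q ?v t" for q t
          by (rule slice_of_f(1)[OF x(1)])
        have z: "dders (T j) (BB j) q ?v A = 0" if "q < Suc l0" for q
          using sl[of q A] fz[OF that xA fun_upd_same] by (rule trans[OF sym])
        have "dders (T j) (BB j) i ?v \<sigma> = 0"
        proof (cases "\<sigma> \<in> (ddom (T j) ^^ i) (BB j)")
          case True
          have Ad: "A \<in> ddom (T j) ((ddom (T j) ^^ i) (BB j))"
            by (rule down_closed_ddomI[OF Tj down_closed_ddom_funpow[OF Tj down_closed_BB] AT(1,2) \<sigma>(2) True])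
          have dd: "ddiff (T j) ((ddom (T j) ^^ i) (BB j)) (dders (T j) (BB j) i ?v)"
            by (rule slice_of_f(2)[OF x(1) fd]) (use i Suc.prems(1) in linarith)
          have "dders (T j) (BB j) (Suc i) ?v A = (dders (T j) (BB j) i ?v \<sigma> - dders (T j) (BB j) i ?v A) / (\<sigma> - A)"
            unfolding \<sigma>_def dders.simps by (rule dder_scattered[OF dd Ad False])
          then show ?thesis using z[of "Suc i"] z[of i] i \<sigma>(2) by simp
        next
          case False
          then obtain i' where i': "i = Suc i'" using \<sigma>(1) by (cases i) auto
          \<comment> \<open>Outside its domain a derivative is 0 by definition.\<close>
          show ?thesis using False unfolding i' dders.simps dder_def by simp
        qed
        then have "snd ((delta_deriv T j ^^ i) (Om, f)) (x(j := \<sigma>)) = 0" unfolding sl .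
        then show ?thesis unfolding fun_upd_idem[where f = x and x = j and y = \<sigma>, OF x(2)] .
      qed
      have IH: "snd (CC k i) x = 0"
        if "i < l0" "adm k" "x \<in> fst (CC k i)" "x j = \<sigma>" "\<forall>q\<in>{1..<j}. x q < b q" for i k x
        by (rule Suc.IH[OF _ \<sigma>(1) \<sigma>b fz' that]) (use Suc.prems(1) in simp)
      have ol: "on_line n j (mixed_dom T k (j - 1) BB) y" by (rule mem_CC(1)[OF Suc.prems(7)])
      let ?v = "\<lambda>u. snd (GG k) (y(j := u))"
      have mem: "y(j := t) \<in> fst (CC k i) \<longleftrightarrow> t \<in> (ddom (T j) ^^ i) (BB j)" for i t
      proof -
        have o: "on_line n j ((mixed_dom T k (j - 1) BB)(j := (ddom (T j) ^^ i) (BB j))) y" using ol unfolding on_line_fun_upd[OF jn(1)] .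
        show ?thesis unfolding fst_CC' on_line_upd[OF jn(1) o] fun_upd_same ..
      qed
      \<comment> \<open>Back from \<open>\<sigma>\<close> to \<open>A\<close>: if order
        \<open>q\<close> vanishes at both points, the quotient, which is order \<open>q + 1\<close>
        at \<open>A\<close>, vanishes too.\<close>
      have z: "q \<le> l \<Longrightarrow> dders (T j) (BB j) q ?v A = 0" for q
      proof (induction q)
        case 0
        have "y(j := A) \<in> fst (CC k 0)" unfolding mem using Suc.prems(2) by simp
        then have "y(j := A) \<in> fst (GG k)" by simp
        then have "snd (GG k) (y(j := A)) = 0"
          by (rule g0[where k = k and y = "y(j := A)", OF Suc.prems(6) _ fun_upd_same])
        then show ?case unfolding dders.simps .
      next
        case (Suc q)
        have ql: "q < l0" "Suc q \<le> l" using Suc.prems \<open>l < Suc l0\<close> by linarith+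
        have Aq: "A \<in> ddom (T j) ((ddom (T j) ^^ q) (BB j))"
          using Ad ddom_funpow_antimono[OF ql(2), of "T j" "BB j"] by auto
        have sq: "\<sigma> \<in> (ddom (T j) ^^ q) (BB j)" using Aq unfolding ddom_def \<sigma>_def by blast
        have "snd (CC k q) (y(j := \<sigma>)) = 0"
        proof (rule IH[OF ql(1) \<open>adm k\<close> _ fun_upd_same])
          show "y(j := \<sigma>) \<in> fst (CC k q)" unfolding mem by (rule sq)
          show "\<forall>q\<in>{1..<j}. (y(j := \<sigma>)) q < b q" using \<open>\<forall>q\<in>{1..<j}. y q < b q\<close> by simp
        qed
        then have s0: "dders (T j) (BB j) q ?v \<sigma> = 0" unfolding CC_slice[OF ol] .
        have dd: "ddiff (T j) ((ddom (T j) ^^ q) (BB j)) (dders (T j) (BB j) q ?v)"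
          by (rule CC_slice_diff[OF ol \<open>adm k\<close>]) (use ql(1) \<open>Suc l0 \<le> lam j\<close> in linarith)
        have "dders (T j) (BB j) (Suc q) ?v A = (dders (T j) (BB j) q ?v \<sigma> - dders (T j) (BB j) q ?v A) / (\<sigma> - A)"
          unfolding \<sigma>_def dders.simps by (rule dder_scattered[OF dd Aq False])
        also have "\<dots> = 0" unfolding s0 Suc.IH[OF Suc_leD[OF ql(2)]] by simp
        finally show ?case .
      qed
      have "snd (CC k l) (y(j := A)) = 0" unfolding CC_slice[OF ol] by (rule z[OF le_refl])
      then show ?thesis unfolding fun_upd_idem[where f = y and x = j and y = A, OF Suc.prems(8)] .
    qed
  qed
qed simp

end

section \<open>The integral bound in several variables\<close>

lemma iter_integral_mono:
  "(\<And>t. (\<And>i. i \<notin> set js \<Longrightarrow> t i = y i) \<Longrightarrow> F t \<le> F' t) \<Longrightarrow> iter_integral T a b js F y \<le> iter_integral T a b js F' y"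
proof (induction js arbitrary: y)
  case Nil then show ?case by simp
next
  case (Cons j js)
  show ?case unfolding iter_integral.simps
  proof (rule nn_integral_mono)
    fix s
    show "iter_integral T a b js F (y(j := s)) \<le> iter_integral T a b js F' (y(j := s))"
      by (rule Cons.IH, rule Cons.prems) auto
  qed
qed

lemma iter_integral_start:
  "(\<And>i. i \<notin> set js \<Longrightarrow> y i = y' i) \<Longrightarrow> iter_integral T a b js F y = iter_integral T a b js F y'"
proof (induction js arbitrary: y y')
  case Nil
  then have "y = y'" by auto
  then show ?case by simp
next
  case (Cons j js)
  have "iter_integral T a b js F (y(j := s)) = iter_integral T a b js F (y'(j := s))" for s
    by (rule Cons.IH) (use Cons.prems in auto)
  then show ?case by simp
qed

lemma delta_deriv_off_domain: "x \<notin> fst (delta_deriv T j P) \<Longrightarrow> snd (delta_deriv T j P) x = 0"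
  by (simp add: delta_deriv_def)

lemma mixed_deriv_off_domain:
  assumes "1 \<le> m" "1 \<le> k m" "x \<notin> fst (mixed_deriv T k m P)"
  shows "snd (mixed_deriv T k m P) x = 0"
proof -
  obtain m' k' where m: "m = Suc m'" "k m = Suc k'" using assms(1,2) by (cases m; cases "k m") auto
  have "mixed_deriv T k m P = delta_deriv T m ((delta_deriv T m ^^ k') (mixed_deriv T k m' P))"
    using m by simp
  then show ?thesis using assms(3) delta_deriv_off_domain by metis
qed

context time_box
begin

text \<open>A right-dense \<open>t < b i\<close> has a right neighbourhood inside the domain of
  every order, so the values off the domain do not interfere. At a scattered point there is nothing
  to check within the gap.\<close>

lemma rd_slice_right_cont:
  assumes P: "fst P = PiE {1..n} D" "rd_continuous n T P" and i: "i \<in> {1..n}" and x: "on_line n i D x"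
    and D: "D i = (ddom (T i) ^^ \<kappa>) (BB i)"
  shows "right_cont_on (T i) (a i) (b i) (\<lambda>s. snd P (x(i := s)))"
  unfolding right_cont_on_def
proof (intro ballI impI allI)
  fix t e :: real assume t: "t \<in> T i" "a i \<le> t" "t < b i" and e: "0 < e"
  show "\<exists>d>0. \<forall>s\<in>T i. t < s \<longrightarrow> s < b i \<longrightarrow> s < t + d \<longrightarrow> \<bar>snd P (x(i := s)) - snd P (x(i := t))\<bar> < e"
  proof (cases "fwd_jump (T i) t = t")
    case True
    have mem: "x(i := s) \<in> fst P \<longleftrightarrow> s \<in> (ddom (T i) ^^ \<kappa>) (BB i)" for s
      unfolding P(1) on_line_upd[OF i x] D ..
    have tm: "x(i := t) \<in> fst P" unfolding mem by (rule right_dense_mem_dom[OF i t True])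
    have rd: "right_dense (T i) ((x(i := t)) i)" unfolding fun_upd_same by (rule right_denseI[OF i t(1,3) True])
    obtain d where d: "d > 0" "\<And>s. (x(i := t))(i := s) \<in> fst P \<Longrightarrow> \<bar>s - (x(i := t)) i\<bar> < d \<Longrightarrow> \<bar>snd P ((x(i := t))(i := s)) - snd P (x(i := t))\<bar> < e"
      using rd_continuous_right_dense[OF P(2) tm i rd e] by blast
    obtain r where r: "t < r" "r \<le> b i" "r \<in> (ddom (T i) ^^ \<kappa>) (BB i)" by (rule right_dense_dom[OF i t True])
    show ?thesis
    proof (intro exI[of _ "min d (r - t)"] conjI ballI impI)
      show "0 < min d (r - t)" using d r by simp
      fix s assume s: "s \<in> T i" "t < s" "s < b i" "s < t + min d (r - t)"
      have "s \<in> (ddom (T i) ^^ \<kappa>) (BB i)"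
        by (rule down_closedD(3)[OF down_closed_ddom_funpow[OF T[OF i] down_closed_BB] r(3)]) (use s t in auto)
      then have "x(i := s) \<in> fst P" unfolding mem .
      then show "\<bar>snd P (x(i := s)) - snd P (x(i := t))\<bar> < e"
        using d(2)[of s] s unfolding fun_upd_upd fun_upd_same by auto
    qed
  next
    case False
    show ?thesis
    proof (intro exI[of _ "fwd_jump (T i) t - t"] conjI ballI impI)
      show "0 < fwd_jump (T i) t - t" using False fwd_jump_ge[OF T[OF i] t(1)] by simp
      fix s assume s: "s \<in> T i" "t < s" "s < t + (fwd_jump (T i) t - t)"
      then show "\<bar>snd P (x(i := s)) - snd P (x(i := t))\<bar> < e" using fwd_jump_gap[OF T[OF i] t(1) s(1,2)] by simp
    qed
  qed
qed

end

context rd_box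
begin

text \<open>Taylor's bound in variable \<open>Suc m\<close>, then the induction hypothesis under the
  integral. The factor \<open>c\<close> carries the monomials of the variables already integrated,
  and \<open>y\<close> has integration variables in the lower coordinates and those of
  \<open>x\<close> in the upper ones.\<close>

lemma iter_integral_bound:
  assumes lam: "\<And>i. i \<in> {1..n} \<Longrightarrow> 1 \<le> lam i"
    and fd: "\<And>j i. j \<in> {1..n} \<Longrightarrow> Suc i < lam j \<Longrightarrow> delta_differentiable T j ((delta_deriv T j ^^ i) (Om, f))"
    and fz: "\<And>j i x. j \<in> {1..n} \<Longrightarrow> i < lam j \<Longrightarrow> x \<in> Om \<Longrightarrow> x j = a j \<Longrightarrow> snd ((delta_deriv T j ^^ i) (Om, f)) x = 0"
    and x: "x \<in> Om" "\<And>i. i \<in> {1..n} \<Longrightarrow> x i < b i"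
  shows "m \<le> n \<Longrightarrow> 0 \<le> c \<Longrightarrow> y \<in> Om \<Longrightarrow> (\<And>i. i \<in> {1..n} \<Longrightarrow> y i < b i) \<Longrightarrow> (\<And>i. i \<in> {Suc m..n} \<Longrightarrow> y i = x i) \<Longrightarrow>
    ennreal (c * \<bar>snd (mixed_deriv T lam m (Om, f)) y\<bar>) \<le> iter_integral T a x [Suc m..<Suc n]
      (\<lambda>t. ennreal (c * (\<Prod>i=Suc m..n. ts_monomial (T i) (lam i - 1) (x i) (fwd_jump (T i) (t i)))
          * \<bar>snd (mixed_deriv T lam n (Om, f)) t\<bar>)) y"
proof (induction "n - m" arbitrary: m c y)
  case 0
  then have "m = n" by simp
  then show ?case by simp
next
  case (Suc q)
  define j where "j = Suc m"
  have mn: "m < n" using Suc.hyps(2) by simp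
  then have j: "j \<in> {1..n}" by (simp add: j_def)
  have xj: "x j \<in> BB j" using PiE_mem[OF x(1) j] .
  have yj: "y j = x j" using Suc.prems(5)[of j] mn by (simp add: j_def)
  let ?g = "\<lambda>t. snd (mixed_deriv T lam m (Om, f)) t"
  let ?R = "iter_integral T a x [Suc m..<Suc n]
      (\<lambda>t. ennreal (c * (\<Prod>i=Suc m..n. ts_monomial (T i) (lam i - 1) (x i) (fwd_jump (T i) (t i)))
          * \<bar>snd (mixed_deriv T lam n (Om, f)) t\<bar>)) y"
  show "ennreal (c * \<bar>?g y\<bar>) \<le> ?R"
  proof (cases "y \<in> fst (mixed_deriv T lam m (Om, f))")
    \<comment> \<open>Here the derivative is 0 by definition; \<open>m = 0\<close> is impossible,
      since \<open>y\<close> lies in the box.\<close>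
    case False
    have m1: "1 \<le> m"
    proof (rule ccontr)
      assume "\<not> 1 \<le> m"
      then have "m = 0" by simp
      then show False using False Suc.prems(3) by simp
    qed
    have "?g y = 0" by (rule mixed_deriv_off_domain[OF m1 lam False]) (use m1 mn in simp)
    then show ?thesis by (simp only: abs_zero mult_zero_right ennreal_0 zero_le)
  next
    case True
    have fm: "fst (mixed_deriv T lam m (Om, f)) = PiE {1..n} (mixed_dom T lam m BB)"
      by (rule fst_mixed_deriv[OF _ fst_conv]) (use mn in simp)
    have ol: "on_line n j (mixed_dom T lam m BB) y" by (rule PiE_on_line[OF j True[unfolded fm]])
    have Bj: "mixed_dom T lam m BB j = BB j" by (simp add: mixed_dom_def j_def)
    let ?v = "\<lambda>s. ?g (y(j := s))"
    let ?P = "\<lambda>l. (delta_deriv T j ^^ l) (mixed_deriv T lam m (Om, f))"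
    have sl: "snd (?P l) (y(j := t)) = dders (T j) (BB j) l ?v t" for l t
      using delta_deriv_funpow_line[OF j ol fm, of l T t] unfolding Bj .
    have Pl: "?P l = mixed_deriv T (lam(j := l)) j (Om, f)" for l
    proof -
      have "mixed_deriv T (lam(j := l)) m (Om, f) = mixed_deriv T lam m (Om, f)"
        by (rule mixed_deriv_cong) (simp add: j_def)
      then show ?thesis unfolding j_def mixed_deriv.simps fun_upd_same by (simp only:)
    qed
    have adml: "\<forall>i\<in>{1..j}. 1 \<le> (lam(j := l)) i \<and> (lam(j := l)) i \<le> lam i" if "1 \<le> l" "l \<le> lam j" for l
    proof
      fix i assume "i \<in> {1..j}"
      then have "i \<in> {1..n}" using j by auto
      then show "1 \<le> (lam(j := l)) i \<and> (lam(j := l)) i \<le> lam i" using lam[of i] that by (cases "i = j") auto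
    qed
    have dd: "ddiff (T j) ((ddom (T j) ^^ l) (BB j)) (dders (T j) (BB j) l ?v)" if "l < lam j" for l
    proof -
      have "diff_chain T (lam(j := Suc l)) j (Om, f)" by (rule Crd_facts(2)[OF j adml]) (use that in auto)
      then have "delta_differentiable T j ((delta_deriv T j ^^ l) (mixed_deriv T (lam(j := Suc l)) (j - 1) (Om, f)))"
        unfolding diff_chain_def using j by auto
      also have "mixed_deriv T (lam(j := Suc l)) (j - 1) (Om, f) = mixed_deriv T lam m (Om, f)"
        by (subst mixed_deriv_cong[where k' = lam]) (auto simp: j_def)
      finally have "delta_differentiable T j (?P l)" .
      from delta_differentiable_funpow_line[OF j this ol fm] show ?thesis unfolding Bj .
    qed
    have aB: "a j \<in> BB j" using ab[OF j] by auto
    \<comment> \<open>Off the domain the value is 0 by definition. On it, the zero data are a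
      hypothesis for \<open>m = 0\<close> and come from \<open>zero_transfer\<close> at
      \<open>a j\<close> otherwise.\<close>
    have dz: "dders (T j) (BB j) l ?v (a j) = 0" if l: "l < lam j" for l
    proof (cases "a j \<in> (ddom (T j) ^^ l) (BB j)")
      case False
      then obtain l' where l': "l = Suc l'" using aB by (cases l) auto
      show ?thesis using False unfolding l' dders.simps dder_def by simp
    next
      case in_dom: True
      show ?thesis
      proof (cases "m = 0")
        case True
        have "y(j := a j) \<in> Om" unfolding on_line_upd[OF j PiE_on_line[OF j Suc.prems(3)]] by (rule aB)
        then have "snd ((delta_deriv T j ^^ l) (Om, f)) (y(j := a j)) = 0" by (rule fz[OF j l]) simp
        then have "snd (?P l) (y(j := a j)) = 0" using True by (simp only: mixed_deriv.simps)
        then show ?thesis unfolding sl .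
      next
        case False
        interpret Z: mixed_zero_data n T a b lam f j
          by unfold_locales (use False j in \<open>auto simp: j_def\<close>)
        have jm: "j - 1 = m" by (simp add: j_def)
        have "snd ((delta_deriv T j ^^ l) (mixed_deriv T lam (j - 1) (Om, f))) (y(j := a j)) = 0"
        proof (rule Z.zero_transfer[OF fd[OF j] le_refl aB _ fz[OF j] l])
          show "a j = b j \<longrightarrow> a j \<notin> ddom (T j) (BB j)" using ab[OF j] by simp
          show "\<forall>i\<in>{1..<j}. 1 \<le> lam i \<and> lam i \<le> lam i" using lam j by auto
          have o: "on_line n j ((mixed_dom T lam (j - 1) BB)(j := (ddom (T j) ^^ l) (BB j))) y"
            using ol unfolding on_line_fun_upd[OF j] jm .
          show "y(j := a j) \<in> fst ((delta_deriv T j ^^ l) (mixed_deriv T lam (j - 1) (Om, f)))"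
            unfolding Z.fst_CC' on_line_upd[OF j o] fun_upd_same by (rule in_dom)
          show "(y(j := a j)) j = a j" by (rule fun_upd_same)
          show "\<forall>q\<in>{1..<j}. (y(j := a j)) q < b q" using Suc.prems(4) j by auto
        qed
        then show ?thesis unfolding jm sl .
      qed
    qed
    have rc: "right_cont_on (T j) (a j) (x j) (dders (T j) (BB j) (Suc l) ?v)" if l: "l < lam j" for l
    proof -
      have rdc: "rd_continuous n T (?P (Suc l))" unfolding Pl by (rule Crd_facts(1)[OF j adml]) (use l in auto)
      have o: "on_line n j ((mixed_dom T lam m BB)(j := (ddom (T j) ^^ Suc l) (BB j))) y" using ol unfolding on_line_fun_upd[OF j] .
      have fP: "fst (?P (Suc l)) = PiE {1..n} ((mixed_dom T lam m BB)(j := (ddom (T j) ^^ Suc l) (BB j)))"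
        using fst_delta_deriv_funpow[OF j fm, where T = T and k = "Suc l"] unfolding Bj .
      have "right_cont_on (T j) (a j) (b j) (\<lambda>s. snd (?P (Suc l)) (y(j := s)))"
        by (rule rd_slice_right_cont[OF fP rdc j o fun_upd_same])
      then have "right_cont_on (T j) (a j) (b j) (dders (T j) (BB j) (Suc l) ?v)" unfolding sl .
      then show ?thesis by (rule right_cont_on_mono) (use x(2)[OF j] in auto)
    qed
    have xd: "x j \<in> ddom (T j) (BB j)"
      by (rule down_closed_ddomI[OF T[OF j] down_closed_BB, where t = "b j"]) (use xj x(2)[OF j] ab[OF j] in auto)
    obtain l0 where l0: "lam j = Suc l0" using lam[OF j] by (cases "lam j") auto
    have cm: "dders (T j) (BB j) l (\<lambda>s. c * ?v s) = (\<lambda>s. c * dders (T j) (BB j) l ?v s)" if "l \<le> lam j" for l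
      by (rule dders_cmult(1)[OF dd that])
    have vx: "?v (x j) = ?g y" using yj by (metis fun_upd_triv)
    have "ennreal (c * \<bar>?g y\<bar>) = ennreal \<bar>c * ?v (x j)\<bar>" unfolding vx using Suc.prems(2) by (simp add: abs_mult)
    also have "\<dots> \<le> (\<integral>\<^sup>+s. ennreal (ts_monomial (T j) l0 (x j) (fwd_jump (T j) s) * \<bar>dders (T j) (BB j) (Suc l0) (\<lambda>s. c * ?v s) s\<bar>) \<partial>delta_measure (T j) (a j) (x j))"
    proof (rule taylor_bound[OF T[OF j] _ down_closed_BB xd])
      show "a j \<in> T j" using ab[OF j] by simp
      fix l assume l: "l \<le> l0"
      then have ll: "l < lam j" "l \<le> lam j" "Suc l \<le> lam j" using l0 by auto
      show "ddiff (T j) ((ddom (T j) ^^ l) (BB j)) (dders (T j) (BB j) l (\<lambda>s. c * ?v s))"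
        by (rule dders_cmult(2)[OF dd ll(1)])
      show "dders (T j) (BB j) l (\<lambda>s. c * ?v s) (a j) = 0" unfolding cm[OF ll(2)] dz[OF ll(1)] by simp
      show "right_cont_on (T j) (a j) (x j) (dders (T j) (BB j) (Suc l) (\<lambda>s. c * ?v s))"
        unfolding cm[OF ll(3)] right_cont_on_def
      proof (intro ballI impI allI)
        fix t e :: real assume t: "t \<in> T j" "a j \<le> t" "t < x j" and e: "0 < e"
        have e': "0 < e / (c + 1)" using e Suc.prems(2) by simp
        obtain d where d: "d > 0" "\<And>s. s \<in> T j \<Longrightarrow> t < s \<Longrightarrow> s < x j \<Longrightarrow> s < t + d \<Longrightarrow>
            \<bar>dders (T j) (BB j) (Suc l) ?v s - dders (T j) (BB j) (Suc l) ?v t\<bar> < e / (c + 1)"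
          using right_cont_onD[OF rc[OF ll(1)] t e'] by blast
        have "\<bar>c * A - c * B\<bar> < e" if "\<bar>A - B\<bar> < e / (c + 1)" for A B
        proof -
          have "\<bar>c * A - c * B\<bar> = c * \<bar>A - B\<bar>" using Suc.prems(2) by (simp add: right_diff_distrib[symmetric] abs_mult)
          also have "\<dots> \<le> c * (e / (c + 1))" using that Suc.prems(2) by (intro mult_left_mono) auto
          also have "\<dots> < e" using e Suc.prems(2) by (simp add: field_simps)
          finally show ?thesis .
        qed
        then show "\<exists>d>0. \<forall>s\<in>T j. t < s \<longrightarrow> s < x j \<longrightarrow> s < t + d \<longrightarrow> \<bar>c * dders (T j) (BB j) (Suc l) ?v s - c * dders (T j) (BB j) (Suc l) ?v t\<bar> < e"
          using d by blast
      qed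
    qed
    also have "\<dots> \<le> ?R"
    proof -
      have "[Suc m..<Suc n] = j # [Suc j..<Suc n]" unfolding j_def using mn by (simp add: upt_conv_Cons)
      then have R: "?R = (\<integral>\<^sup>+s. iter_integral T a x [Suc j..<Suc n] (\<lambda>t. ennreal (c * (\<Prod>i=Suc m..n. ts_monomial (T i) (lam i - 1) (x i) (fwd_jump (T i) (t i)))
          * \<bar>snd (mixed_deriv T lam n (Om, f)) t\<bar>)) (y(j := s)) \<partial>delta_measure (T j) (a j) (x j))"
        by (simp only: iter_integral.simps)
      show ?thesis unfolding R
      proof (rule nn_integral_mono)
        fix s assume "s \<in> space (delta_measure (T j) (a j) (x j))"
        then have s: "s \<in> T j" "a j \<le> s" "s < x j" by auto
        define h where "h = ts_monomial (T j) l0 (x j) (fwd_jump (T j) s)"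
        have h0: "0 \<le> h" unfolding h_def
          by (rule ts_monomial_nonneg[OF T[OF j] fwd_jump_in[OF T[OF j] s(1)]])
            (use xj fwd_jump_gap[OF T[OF j] s(1)] s in auto)
        have ml: "Suc l0 \<le> lam j" using l0 by simp
        have "dders (T j) (BB j) (Suc l0) ?v s = snd (mixed_deriv T lam j (Om, f)) (y(j := s))"
          using sl[of "lam j" s] unfolding l0[symmetric] Pl[of "lam j"] fun_upd_triv by (rule sym)
        then have "ennreal (h * \<bar>dders (T j) (BB j) (Suc l0) (\<lambda>s. c * ?v s) s\<bar>) = ennreal ((c * h) * \<bar>snd (mixed_deriv T lam j (Om, f)) (y(j := s))\<bar>)"
          unfolding cm[OF ml] using Suc.prems(2) by (simp only: abs_mult abs_of_nonneg mult.assoc mult.left_commute[of c h])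
        also have "\<dots> \<le> iter_integral T a x [Suc j..<Suc n]
          (\<lambda>t. ennreal ((c * h) * (\<Prod>i=Suc j..n. ts_monomial (T i) (lam i - 1) (x i) (fwd_jump (T i) (t i)))
          * \<bar>snd (mixed_deriv T lam n (Om, f)) t\<bar>)) (y(j := s))"
        proof (rule Suc.hyps(1))
          show "q = n - j" using Suc.hyps(2) by (simp add: j_def)
          show "j \<le> n" using j by simp
          show "0 \<le> c * h" using Suc.prems(2) h0 by simp
          have sB: "s \<in> BB j" using s xj by auto
          show "y(j := s) \<in> Om" unfolding on_line_upd[OF j PiE_on_line[OF j Suc.prems(3)]] by (rule sB)
          show "(y(j := s)) i < b i" if "i \<in> {1..n}" for i
            using Suc.prems(4)[OF that] s x(2)[OF j] by simp
          show "(y(j := s)) i = x i" if "i \<in> {Suc j..n}" for i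
            using Suc.prems(5)[of i] that by (simp add: j_def)
        qed
        also have "\<dots> \<le> iter_integral T a x [Suc j..<Suc n] (\<lambda>t. ennreal (c * (\<Prod>i=Suc m..n. ts_monomial (T i) (lam i - 1) (x i) (fwd_jump (T i) (t i)))
          * \<bar>snd (mixed_deriv T lam n (Om, f)) t\<bar>)) (y(j := s))"
        proof (rule iter_integral_mono)
          fix t :: "nat \<Rightarrow> real" assume "\<And>i. i \<notin> set [Suc j..<Suc n] \<Longrightarrow> t i = (y(j := s)) i"
          from this[of j] have tj: "t j = s" by simp
          have "{Suc m..n} = insert j {Suc j..n}" using mn by (auto simp: j_def)
          then have "(\<Prod>i=Suc m..n. ts_monomial (T i) (lam i - 1) (x i) (fwd_jump (T i) (t i)))
            = h * (\<Prod>i=Suc j..n. ts_monomial (T i) (lam i - 1) (x i) (fwd_jump (T i) (t i)))"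
            by (simp add: tj h_def l0 One_nat_def)
          then show "ennreal (c * h * (\<Prod>i=Suc j..n. ts_monomial (T i) (lam i - 1) (x i) (fwd_jump (T i) (t i))) * \<bar>snd (mixed_deriv T lam n (Om, f)) t\<bar>)
            \<le> ennreal (c * (\<Prod>i=Suc m..n. ts_monomial (T i) (lam i - 1) (x i) (fwd_jump (T i) (t i))) * \<bar>snd (mixed_deriv T lam n (Om, f)) t\<bar>)"
            by (simp only: mult.assoc order_refl)
        qed
        finally show "ennreal (ts_monomial (T j) l0 (x j) (fwd_jump (T j) s) * \<bar>dders (T j) (BB j) (Suc l0) (\<lambda>s. c * ?v s) s\<bar>) \<le> \<dots>"
          unfolding h_def .
      qed
    qed
    finally show ?thesis .
  qed
qed

lemma box_integral_bound:
  assumes lam: "\<And>i. i \<in> {1..n} \<Longrightarrow> 1 \<le> lam i"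
    and fd: "\<And>j i. j \<in> {1..n} \<Longrightarrow> Suc i < lam j \<Longrightarrow> delta_differentiable T j ((delta_deriv T j ^^ i) (Om, f))"
    and fz: "\<And>j i x. j \<in> {1..n} \<Longrightarrow> i < lam j \<Longrightarrow> x \<in> Om \<Longrightarrow> x j = a j \<Longrightarrow> snd ((delta_deriv T j ^^ i) (Om, f)) x = 0"
    and x: "x \<in> Om" "\<And>i. i \<in> {1..n} \<Longrightarrow> x i < b i"
  shows "ennreal \<bar>f x\<bar> \<le> box_integral n T a x (\<lambda>t. ennreal (H_kernel n T lam x t * \<bar>full_deriv n T a b lam f t\<bar>))"
proof -
  have "ennreal \<bar>f x\<bar> = ennreal (1 * \<bar>snd (mixed_deriv T lam 0 (Om, f)) x\<bar>)" by simp
  also have "\<dots> \<le> iter_integral T a x [Suc 0..<Suc n]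
      (\<lambda>t. ennreal (1 * (\<Prod>i=Suc 0..n. ts_monomial (T i) (lam i - 1) (x i) (fwd_jump (T i) (t i)))
          * \<bar>snd (mixed_deriv T lam n (Om, f)) t\<bar>)) x"
    by (rule iter_integral_bound[OF lam fd fz x _ _ x(1)]) (use x in auto)
  also have "\<dots> = iter_integral T a x [Suc 0..<Suc n]
      (\<lambda>t. ennreal (1 * (\<Prod>i=Suc 0..n. ts_monomial (T i) (lam i - 1) (x i) (fwd_jump (T i) (t i)))
          * \<bar>snd (mixed_deriv T lam n (Om, f)) t\<bar>)) (\<lambda>_. undefined)"
  proof (rule iter_integral_start)
    fix i assume "i \<notin> set [Suc 0..<Suc n]"
    then have "i \<notin> {1..n}" by (auto simp: One_nat_def)
    then show "x i = undefined" by (rule PiE_arb[OF x(1)])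
  qed
  also have "\<dots> = box_integral n T a x (\<lambda>t. ennreal (H_kernel n T lam x t * \<bar>full_deriv n T a b lam f t\<bar>))"
    unfolding box_integral_def H_kernel_def full_deriv_def Om_eq mult_1_left One_nat_def[symmetric] ..
  finally show ?thesis .
qed

end

section \<open>Hoelder's inequality and measurability on the box\<close>

text \<open>Hoelder's inequality for the sum and the integral at once, by integrating Young's
  inequality for suitably normalised factors. The normalisation divides by \<open>A\<close> and
  \<open>B\<close>, so the cases where one of them is 0 are treated separately: there the product
  vanishes almost everywhere.\<close>

lemma Hoelder_sum_nn_integral:
  fixes u v :: "'i \<Rightarrow> 'a \<Rightarrow> real"
  assumes I: "finite I" and pq: "1 < p" "1 < q" "1 / p + 1 / q = (1::real)"
    and m[measurable]: "\<And>i. i \<in> I \<Longrightarrow> u i \<in> borel_measurable M" "\<And>i. i \<in> I \<Longrightarrow> v i \<in> borel_measurable M"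
    and nn: "\<And>i x. i \<in> I \<Longrightarrow> x \<in> space M \<Longrightarrow> 0 \<le> u i x" "\<And>i x. i \<in> I \<Longrightarrow> x \<in> space M \<Longrightarrow> 0 \<le> v i x"
    and A: "(\<integral>\<^sup>+x. (\<Sum>i\<in>I. ennreal (u i x powr p)) \<partial>M) \<le> ennreal A" "0 \<le> A"
    and B: "(\<integral>\<^sup>+x. (\<Sum>i\<in>I. ennreal (v i x powr q)) \<partial>M) \<le> ennreal B" "0 \<le> B"
  shows "(\<integral>\<^sup>+x. (\<Sum>i\<in>I. ennreal (u i x * v i x)) \<partial>M) \<le> ennreal (A powr (1 / p) * B powr (1 / q))"
proof -
  have zero: "(\<integral>\<^sup>+x. (\<Sum>i\<in>I. ennreal (u i x * v i x)) \<partial>M) = 0"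
    if w: "(\<integral>\<^sup>+x. (\<Sum>i\<in>I. ennreal (w i x powr r)) \<partial>M) \<le> 0" and wm: "\<And>i. i \<in> I \<Longrightarrow> w i \<in> borel_measurable M"
      and z: "\<And>i x. w i x = 0 \<Longrightarrow> u i x * v i x = 0" for w r
  proof -
    have "(\<lambda>x. \<Sum>i\<in>I. ennreal (w i x powr r)) \<in> borel_measurable M" using wm by measurable
    moreover have "(\<integral>\<^sup>+x. (\<Sum>i\<in>I. ennreal (w i x powr r)) \<partial>M) = 0" using w by simp
    ultimately have "AE x in M. (\<Sum>i\<in>I. ennreal (w i x powr r)) = 0" by (simp only: nn_integral_0_iff_AE)
    then have "AE x in M. (\<Sum>i\<in>I. ennreal (u i x * v i x)) = 0"
    proof (rule AE_mp, intro AE_I2 impI)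
      fix x assume "(\<Sum>i\<in>I. ennreal (w i x powr r)) = 0"
      then have "\<forall>i\<in>I. ennreal (w i x powr r) = 0" unfolding sum_eq_0_iff[OF I] .
      then have "\<forall>i\<in>I. w i x = 0" by (auto simp: ennreal_eq_0_iff powr_eq_0_iff dest: antisym[OF _ powr_ge_zero])
      then have "\<forall>i\<in>I. u i x * v i x = 0" using z by blast
      then show "(\<Sum>i\<in>I. ennreal (u i x * v i x)) = 0" by (intro sum.neutral ballI) (drule (1) bspec, simp only: ennreal_0)
    qed
    then have "(\<integral>\<^sup>+x. (\<Sum>i\<in>I. ennreal (u i x * v i x)) \<partial>M) = (\<integral>\<^sup>+x. 0 \<partial>M)" by (rule nn_integral_cong_AE)
    then show ?thesis by simp
  qed
  consider "A = 0" | "B = 0" | "0 < A" "0 < B" using A(2) B(2) by fastforce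
  then show ?thesis
  proof cases
    case 1
    then show ?thesis using zero[of u p] A m(1) by simp
  next
    case 2
    then show ?thesis using zero[of v q] B m(2) by simp
  next
    case 3
    define C where "C = A powr (1 / p) * B powr (1 / q)"
    \<comment> \<open>The coefficients that arise from applying Young's inequality to
      \<open>x / A powr (1 / p)\<close> and \<open>y / B powr (1 / q)\<close> and multiplying by
      \<open>C\<close>; they satisfy \<open>c1 * A + c2 * B = C\<close>.\<close>
    define c1 c2 where "c1 = C / (p * A)" and "c2 = C / (q * B)"
    have C: "0 < C" using 3 by (simp add: C_def)
    have c: "0 \<le> c1" "0 \<le> c2" using C 3 pq by (auto simp: c1_def c2_def)
    have young: "x * y \<le> c1 * x powr p + c2 * y powr q" if "0 \<le> x" "0 \<le> y" for x y
    proof -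
      let ?a = "A powr (1 / p)" and ?b = "B powr (1 / q)"
      have ab: "0 < ?a" "0 < ?b" using 3 by auto
      have "(x / ?a) * (y / ?b) \<le> (x / ?a) powr p / p + (y / ?b) powr q / q"
        using pq that ab by (intro Youngs_inequality) auto
      also have "(x / ?a) powr p = x powr p / A" using that 3 pq by (simp add: powr_divide powr_powr)
      also have "(y / ?b) powr q = y powr q / B" using that 3 pq by (simp add: powr_divide powr_powr)
      finally have "C * ((x / ?a) * (y / ?b)) \<le> C * (x powr p / A / p + y powr q / B / q)" using C by (intro mult_left_mono) auto
      also have "C * ((x / ?a) * (y / ?b)) = x * y" using ab by (simp add: C_def)
      also have "C * (x powr p / A / p + y powr q / B / q) = c1 * x powr p + c2 * y powr q"
        by (simp add: c1_def c2_def algebra_simps)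
      finally show ?thesis .
    qed
    have "(\<integral>\<^sup>+x. (\<Sum>i\<in>I. ennreal (u i x * v i x)) \<partial>M) \<le>
      (\<integral>\<^sup>+x. ennreal c1 * (\<Sum>i\<in>I. ennreal (u i x powr p)) + ennreal c2 * (\<Sum>i\<in>I. ennreal (v i x powr q)) \<partial>M)"
    proof (rule nn_integral_mono)
      fix x assume x: "x \<in> space M"
      have "(\<Sum>i\<in>I. ennreal (u i x * v i x)) \<le> (\<Sum>i\<in>I. ennreal c1 * ennreal (u i x powr p) + ennreal c2 * ennreal (v i x powr q))"
      proof (rule sum_mono)
        fix i assume i: "i \<in> I"
        have "ennreal (u i x * v i x) \<le> ennreal (c1 * u i x powr p + c2 * v i x powr q)"
          by (intro ennreal_leI young nn i x)
        also have "\<dots> = ennreal c1 * ennreal (u i x powr p) + ennreal c2 * ennreal (v i x powr q)"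
          using c by (simp add: ennreal_mult)
        finally show "ennreal (u i x * v i x) \<le> \<dots>" .
      qed
      then show "(\<Sum>i\<in>I. ennreal (u i x * v i x)) \<le> ennreal c1 * (\<Sum>i\<in>I. ennreal (u i x powr p)) + ennreal c2 * (\<Sum>i\<in>I. ennreal (v i x powr q))"
        by (simp only: sum.distrib sum_distrib_left)
    qed
    also have "\<dots> = ennreal c1 * (\<integral>\<^sup>+x. (\<Sum>i\<in>I. ennreal (u i x powr p)) \<partial>M) + ennreal c2 * (\<integral>\<^sup>+x. (\<Sum>i\<in>I. ennreal (v i x powr q)) \<partial>M)"
    proof -
      have [measurable]: "(\<lambda>x. \<Sum>i\<in>I. ennreal (u i x powr p)) \<in> borel_measurable M"
        "(\<lambda>x. \<Sum>i\<in>I. ennreal (v i x powr q)) \<in> borel_measurable M" by measurable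
      show ?thesis by (subst nn_integral_add, measurable) (subst nn_integral_cmult, measurable, subst nn_integral_cmult, measurable)
    qed
    also have "\<dots> \<le> ennreal c1 * ennreal A + ennreal c2 * ennreal B"
      by (intro add_mono mult_left_mono A B) auto
    also have "\<dots> = ennreal (c1 * A + c2 * B)" using c 3 by (simp add: ennreal_mult)
    also have "c1 * A + c2 * B = C"
    proof -
      have "c1 * A + c2 * B = C * (1 / p + 1 / q)" using 3 by (simp add: c1_def c2_def algebra_simps)
      then show ?thesis using pq by simp
    qed
    finally show ?thesis unfolding C_def .
  qed
qed

text \<open>Variable upper limits become a condition in the integrand, so that one fixed product
  measure serves all \<open>x\<close>. The inequality is strict because the delta measure omits the
  upper end.\<close>

lemma iter_integral_below:
  assumes "distinct js" and T: "\<And>i. i \<in> set js \<Longrightarrow> closed (T i) \<and> a i \<in> T i \<and> b i \<in> T i \<and> x i \<in> T i \<and> a i \<le> x i \<and> x i \<le> b i"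
  shows "iter_integral T a x js F y = iter_integral T a b js (\<lambda>t. if \<forall>i\<in>set js. t i < x i then F t else 0) y"
  using assms
proof (induction js arbitrary: y)
  case (Cons j js)
  note Tj = Cons.prems(2)[of j, simplified]
  have z: "iter_integral T a b js (\<lambda>t. 0) y = 0" for y by (induction js arbitrary: y) auto
  have "iter_integral T a x (j # js) F y = (\<integral>\<^sup>+s. iter_integral T a x js F (y(j := s)) * indicator {a j..<x j} s \<partial>delta_measure (T j) (a j) (b j))"
    unfolding iter_integral.simps using Tj by (intro nn_integral_delta_measure_restrict) auto
  also have "\<dots> = (\<integral>\<^sup>+s. iter_integral T a b js (\<lambda>t. if \<forall>i\<in>set (j # js). t i < x i then F t else 0) (y(j := s)) \<partial>delta_measure (T j) (a j) (b j))"
  proof (rule nn_integral_cong)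
    fix s assume s: "s \<in> space (delta_measure (T j) (a j) (b j))"
    have tj: "t j = s" if "\<And>i. i \<notin> set js \<Longrightarrow> t i = (y(j := s)) i" for t :: "nat \<Rightarrow> real"
      using that[of j] Cons.prems(1) by simp
    show "iter_integral T a x js F (y(j := s)) * indicator {a j..<x j} s =
      iter_integral T a b js (\<lambda>t. if \<forall>i\<in>set (j # js). t i < x i then F t else 0) (y(j := s))"
    proof (cases "s < x j")
      case True
      have "iter_integral T a x js F (y(j := s)) = iter_integral T a b js (\<lambda>t. if \<forall>i\<in>set js. t i < x i then F t else 0) (y(j := s))"
        by (rule Cons.IH) (use Cons.prems in auto)
      also have "\<dots> = iter_integral T a b js (\<lambda>t. if \<forall>i\<in>set (j # js). t i < x i then F t else 0) (y(j := s))"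
        by (intro antisym iter_integral_mono) (use tj True in auto)
      finally show ?thesis using s True by simp
    next
      case False
      have "iter_integral T a b js (\<lambda>t. if \<forall>i\<in>set (j # js). t i < x i then F t else 0) (y(j := s)) = iter_integral T a b js (\<lambda>t. 0) (y(j := s))"
        by (intro antisym iter_integral_mono) (use tj False in auto)
      then show ?thesis using z False by simp
    qed
  qed
  finally show ?case by simp
qed simp

section \<open>The box as a product of finite delta measures\<close>

context time_box
begin

text \<open>The product measure locale quantifies over all indices, so those outside
  \<open>{1..n}\<close> get an empty, hence finite, measure space.\<close>

definition MM :: "nat \<Rightarrow> real measure" where
  "MM i = (if i \<in> {1..n} then delta_measure (T i) (a i) (b i) else count_space {})"

lemma MM_eq: "i \<in> {1..n} \<Longrightarrow> MM i = delta_measure (T i) (a i) (b i)"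
  by (simp add: MM_def)

lemma finite_MM: "finite_measure (MM i)"
proof (cases "i \<in> {1..n}")
  case True
  then show ?thesis unfolding MM_eq[OF True] using T ab by (intro finite_measure_delta_measure) auto
next
  case False then show ?thesis by (auto simp: MM_def intro!: finite_measureI)
qed

sublocale MP: product_sigma_finite MM
  by (rule product_sigma_finite.intro) (rule finite_measure.axioms(1)[OF finite_MM])

lemma space_MM: "i \<in> {1..n} \<Longrightarrow> space (MM i) = T i \<inter> {a i..<b i}"
  by (simp add: MM_eq)

lemma measurable_ident_MM: "i \<in> {1..n} \<Longrightarrow> (\<lambda>t. t) \<in> borel_measurable (MM i)"
  using T ab by (simp add: MM_eq measurable_delta_measure_borel)

lemma measurable_coord: "i \<in> I \<Longrightarrow> i \<in> {1..n} \<Longrightarrow> (\<lambda>x. x i) \<in> borel_measurable (PiM I MM)"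
  using measurable_compose[OF measurable_component_singleton[of i I MM] measurable_ident_MM] by simp

lemma upd_space: "x \<in> space (PiM I MM) \<Longrightarrow> s \<in> space (MM j) \<Longrightarrow> x(j := s) \<in> space (PiM (insert j I) MM)"
  by (auto simp: space_PiM PiE_iff extensional_def)

text \<open>Separate right-continuity gives joint measurability: replacing one coordinate by its
  grid point leaves countably many values of that coordinate, each giving a function of fewer
  variables, and the grid converges from the right.\<close>

lemma measurable_sep_right_cont:
  "finite I \<Longrightarrow> I \<subseteq> {1..n} \<Longrightarrow>
    (\<And>i x. i \<in> I \<Longrightarrow> x \<in> space (PiM I MM) \<Longrightarrow> right_cont_on (T i) (a i) (b i) (\<lambda>s. F (x(i := s)))) \<Longrightarrow>
    F \<in> borel_measurable (PiM I MM)" for F :: "(nat \<Rightarrow> real) \<Rightarrow> real"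
proof (induction I arbitrary: F rule: finite_induct)
  case empty
  show ?case unfolding PiM_empty by simp
next
  case (insert j I)
  have j: "j \<in> {1..n}" "closed (T j)" "a j \<in> T j" "a j < b j" using insert.prems(1) T ab by auto
  let ?M = "PiM (insert j I) MM"
  let ?g = "\<lambda>k m. grid_pt (T j) (a j) (b j) k m"
  have g: "?g k m \<in> space (MM j)" for k m using grid_pt_in[OF j(2,3,4)] by (simp add: space_MM[OF j(1)])
  have xj[measurable]: "(\<lambda>x. x j) \<in> borel_measurable ?M" by (rule measurable_coord) (use j in auto)
  show ?case
  proof (rule borel_measurable_LIMSEQ_real)
    fix x assume x: "x \<in> space ?M"
    then have xjs: "x j \<in> T j" "a j \<le> x j" "x j < b j" using space_MM[OF j(1)] by (auto simp: space_PiM PiE_iff)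
    have rc: "right_cont_on (T j) (a j) (b j) (\<lambda>s. F (x(j := s)))" by (rule insert.prems(2)[OF _ x]) simp
    have "(\<lambda>k. F (x(j := ?g k \<lfloor>(real k + 1) * x j\<rfloor>))) \<longlonglongrightarrow> F (x(j := x j))"
      by (rule grid_pt_limit[where \<phi> = "\<lambda>s. F (x(j := s))", OF j(2) _ xjs])
        (use rc xjs in \<open>auto simp: right_cont_on_def\<close>)
    then show "(\<lambda>k. F (x(j := ?g k \<lfloor>(real k + 1) * x j\<rfloor>))) \<longlonglongrightarrow> F x" by simp
  next
    fix k
    show "(\<lambda>x. F (x(j := ?g k \<lfloor>(real k + 1) * x j\<rfloor>))) \<in> borel_measurable ?M"
    proof (rule measurable_compose_countable[where f = "\<lambda>m x. F (x(j := ?g k m))"])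
      fix m
      let ?F = "\<lambda>y. F (y(j := ?g k m))"
      have Fm: "?F \<in> borel_measurable (PiM I MM)"
      proof (rule insert.IH)
        show "I \<subseteq> {1..n}" using insert.prems(1) by simp
        fix i y assume i: "i \<in> I" and y: "y \<in> space (PiM I MM)"
        have ij: "i \<noteq> j" using i insert.hyps by auto
        have "right_cont_on (T i) (a i) (b i) (\<lambda>s. F ((y(j := ?g k m))(i := s)))"
          by (rule insert.prems(2)[OF _ upd_space[OF y g]]) (use i in simp)
        then show "right_cont_on (T i) (a i) (b i) (\<lambda>s. F (y(i := s, j := ?g k m)))"
          unfolding fun_upd_twist[OF ij] .
      qed
      have "I \<subseteq> insert j I" by auto
      from measurable_compose[OF measurable_restrict_subset[OF this, of MM] Fm]
      have "(\<lambda>x. ?F (restrict x I)) \<in> borel_measurable ?M" .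
      moreover have "(restrict x I)(j := ?g k m) = x(j := ?g k m)" if "x \<in> space ?M" for x
        using that by (auto simp: space_PiM PiE_iff extensional_def restrict_def fun_eq_iff)
      ultimately show "(\<lambda>x. F (x(j := ?g k m))) \<in> borel_measurable ?M"
        by (subst measurable_cong[where g = "\<lambda>x. ?F (restrict x I)"]) auto
    qed measurable
  qed
qed

text \<open>Tonelli's theorem. The free set \<open>I\<close> lets the induction move the coordinates
  of the list one by one into the product; the box is the case where \<open>I\<close> is
  empty.\<close>

lemma iter_integral_PiM:
  "distinct js \<Longrightarrow> set js \<subseteq> {1..n} \<Longrightarrow> finite I \<Longrightarrow> I \<inter> set js = {} \<Longrightarrow> F \<in> borel_measurable (PiM (I \<union> set js) MM) \<Longrightarrow>
    iter_integral T a b js F \<in> borel_measurable (PiM I MM) \<and>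
    (\<integral>\<^sup>+y. iter_integral T a b js F y \<partial>PiM I MM) = (\<integral>\<^sup>+y. F y \<partial>PiM (I \<union> set js) MM)"
proof (induction js arbitrary: I)
  case Nil
  have "iter_integral T a b [] F = F" by (rule ext) simp
  then show ?case using Nil by simp
next
  case (Cons j js)
  have j: "j \<in> {1..n}" "j \<notin> I" using Cons.prems by auto
  let ?G = "iter_integral T a b js F"
  have IH: "?G \<in> borel_measurable (PiM (insert j I) MM)"
    "(\<integral>\<^sup>+y. ?G y \<partial>PiM (insert j I) MM) = (\<integral>\<^sup>+y. F y \<partial>PiM (insert j I \<union> set js) MM)"
    using Cons.IH[of "insert j I"] Cons.prems by auto
  have eq: "iter_integral T a b (j # js) F = (\<lambda>y. \<integral>\<^sup>+s. ?G (y(j := s)) \<partial>MM j)"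
    unfolding MM_eq[OF j(1)] by (rule ext) simp
  have "(\<lambda>(y, s). ?G (y(j := s))) \<in> borel_measurable (PiM I MM \<Otimes>\<^sub>M MM j)"
    using measurable_compose[OF measurable_add_dim IH(1)] by (simp add: case_prod_beta)
  then have "(\<lambda>y. \<integral>\<^sup>+s. ?G (y(j := s)) \<partial>MM j) \<in> borel_measurable (PiM I MM)"
    by (rule sigma_finite_measure.borel_measurable_nn_integral[OF finite_measure.axioms(1)[OF finite_MM]])
  moreover have "(\<integral>\<^sup>+y. (\<integral>\<^sup>+s. ?G (y(j := s)) \<partial>MM j) \<partial>PiM I MM) = (\<integral>\<^sup>+y. ?G y \<partial>PiM (insert j I) MM)"
    by (rule MP.product_nn_integral_insert[symmetric]) (use Cons.prems(3) j IH(1) in auto)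
  moreover have "insert j I \<union> set js = I \<union> set (j # js)" by auto
  ultimately show ?case unfolding eq IH(2) by simp
qed

abbreviation "PM \<equiv> PiM {1..n} MM"

lemma space_PM: "x \<in> space PM \<longleftrightarrow> x \<in> extensional {1..n} \<and> (\<forall>i\<in>{1..n}. x i \<in> T i \<and> a i \<le> x i \<and> x i < b i)"
  by (auto simp: space_PiM PiE_iff space_MM)

lemma box_integral_PM:
  assumes "F \<in> borel_measurable PM"
  shows "box_integral n T a b F = (\<integral>\<^sup>+x. F x \<partial>PM)"
proof -
  have s: "set [1..<Suc n] = {1..n}" by (simp only: set_upt atLeastLessThanSuc_atLeastAtMost)
  have "(\<integral>\<^sup>+y. iter_integral T a b [1..<Suc n] F y \<partial>PiM {} MM) = (\<integral>\<^sup>+x. F x \<partial>PM)"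
    using iter_integral_PiM[of "[1..<Suc n]" "{}" F] assms unfolding s by auto
  moreover have "(\<integral>\<^sup>+y. iter_integral T a b [1..<Suc n] F y \<partial>PiM {} MM) = iter_integral T a b [1..<Suc n] F (\<lambda>_. undefined)"
    unfolding PiM_empty by (subst nn_integral_count_space_finite) auto
  ultimately show ?thesis by (simp only: box_integral_def)
qed

lemma box_integral_below:
  assumes x: "x \<in> space PM"
  shows "box_integral n T a x F = box_integral n T a b (\<lambda>t. if \<forall>i\<in>{1..n}. t i < x i then F t else 0)"
proof -
  have s: "set [1..<Suc n] = {1..n}" by (simp only: set_upt atLeastLessThanSuc_atLeastAtMost)
  show ?thesis unfolding box_integral_def
    by (subst iter_integral_below[where b = b], simp_all only: s)
      (use x T ab in \<open>auto simp: space_PM intro: less_imp_le\<close>)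
qed

text \<open>No measurability is assumed, so it applies to integrands that contain
  \<open>H_kernel\<close> or the functions \<open>f i\<close> themselves.\<close>

lemma box_integral_mono_PM:
  assumes "\<And>x. x \<in> space PM \<Longrightarrow> F x \<le> F' x"
  shows "box_integral n T a b F \<le> box_integral n T a b F'"
proof -
  have s: "set [1..<Suc n] = {1..n}" by (simp only: set_upt atLeastLessThanSuc_atLeastAtMost)
  have "set js \<subseteq> {1..n} \<Longrightarrow> (\<And>t. (\<forall>i\<in>set js. t i \<in> space (MM i)) \<Longrightarrow> (\<forall>i. i \<notin> set js \<longrightarrow> t i = y i) \<Longrightarrow> F t \<le> F' t) \<Longrightarrow>
    iter_integral T a b js F y \<le> iter_integral T a b js F' y" for js y
  proof (induction js arbitrary: y)
    case Nil then show ?case using Nil(2)[of y] by simp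
  next
    case (Cons j js)
    have j: "j \<in> {1..n}" using Cons.prems by simp
    show ?case unfolding iter_integral.simps MM_eq[OF j, symmetric]
    proof (rule nn_integral_mono)
      fix s assume s: "s \<in> space (MM j)"
      show "iter_integral T a b js F (y(j := s)) \<le> iter_integral T a b js F' (y(j := s))"
      proof (rule Cons.IH)
        show "set js \<subseteq> {1..n}" using Cons.prems by simp
        fix t assume t: "\<forall>i\<in>set js. t i \<in> space (MM i)" "\<forall>i. i \<notin> set js \<longrightarrow> t i = (y(j := s)) i"
        show "F t \<le> F' t"
        proof (rule Cons.prems(2))
          show "\<forall>i\<in>set (j # js). t i \<in> space (MM i)"
          proof
            fix i assume i: "i \<in> set (j # js)"
            show "t i \<in> space (MM i)"
            proof (cases "i \<in> set js")
              case False
              then have "i = j" "t i = (y(j := s)) i" using i t(2) by auto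
              then show ?thesis using s by simp
            qed (use t(1) in blast)
          qed
          show "\<forall>i. i \<notin> set (j # js) \<longrightarrow> t i = y i" using t(2) by simp
        qed
      qed
    qed
  qed
  from this[of "[1..<Suc n]" "\<lambda>_. undefined"] show ?thesis unfolding box_integral_def s
    using assms by (auto simp: space_PiM PiE_iff extensional_def)
qed

end

section \<open>Measurability of weights, kernels and integrals over lower boxes\<close>

context time_box
begin

lemma space_PM_Om: "x \<in> space PM \<Longrightarrow> x \<in> Om"
  unfolding space_PM by (auto intro!: PiE_I simp: extensional_def)

lemma measurable_weight:
  assumes "w \<in> weights n T a b"
  shows "w \<in> borel_measurable PM" "x \<in> Om \<Longrightarrow> 0 < w x"
proof -
  have rd: "rd_continuous n T (Om, w)" using assms unfolding weights_def Om_eq by blast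
  show "x \<in> Om \<Longrightarrow> 0 < w x" using assms unfolding weights_def Om_eq by blast
  show "w \<in> borel_measurable PM"
  proof (rule measurable_sep_right_cont)
    fix i x assume i: "i \<in> {1..n}" and x: "x \<in> space PM"
    have "on_line n i BB x" by (rule PiE_on_line[OF i space_PM_Om[OF x]])
    from rd_slice_right_cont[where P = "(Om, w)" and \<kappa> = 0, OF fst_conv rd i this]
    show "right_cont_on (T i) (a i) (b i) (\<lambda>s. w (x(i := s)))" by simp
  qed auto
qed

lemma sigma_finite_PM: "sigma_finite_measure PM"
  by (rule MP.sigma_finite) simp

lemma measurable_below:
  assumes "case_prod K \<in> borel_measurable (PM \<Otimes>\<^sub>M PM)"
  shows "(\<lambda>x. \<integral>\<^sup>+t. (if \<forall>i\<in>{1..n}. t i < x i then K x t else 0) \<partial>PM) \<in> borel_measurable PM"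
proof -
  have c: "(\<lambda>p. fst p i) \<in> borel_measurable (PM \<Otimes>\<^sub>M PM)" "(\<lambda>p. snd p i) \<in> borel_measurable (PM \<Otimes>\<^sub>M PM)"
    if "i \<in> {1..n}" for i
    using measurable_compose[OF measurable_fst measurable_coord[OF that that]]
      measurable_compose[OF measurable_snd measurable_coord[OF that that]] by auto
  have "Measurable.pred (PM \<Otimes>\<^sub>M PM) (\<lambda>p. \<forall>i\<in>{1..n}. snd p i < fst p i)"
  proof (rule pred_intros_finite(3))
    fix i assume "i \<in> {1..n}"
    note [measurable] = c[OF this]
    show "Measurable.pred (PM \<Otimes>\<^sub>M PM) (\<lambda>p. snd p i < fst p i)" by measurable
  qed simp
  then have "(\<lambda>p. if \<forall>i\<in>{1..n}. snd p i < fst p i then case_prod K p else 0) \<in> borel_measurable (PM \<Otimes>\<^sub>M PM)"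
    using assms by measurable
  then have "case_prod (\<lambda>x t. if \<forall>i\<in>{1..n}. t i < x i then K x t else 0) \<in> borel_measurable (PM \<Otimes>\<^sub>M PM)"
    by (simp only: case_prod_unfold)
  then show ?thesis by (rule sigma_finite_measure.borel_measurable_nn_integral[OF sigma_finite_PM])
qed

text \<open>\<open>F'\<close> is a measurable substitute for \<open>F\<close>, and the two have to
  agree only strictly below \<open>x\<close>, where the integral sees them.\<close>

lemma box_integral_below_PM:
  assumes x: "x \<in> space PM" and F: "\<And>t. t \<in> space PM \<Longrightarrow> (\<And>i. i \<in> {1..n} \<Longrightarrow> t i < x i) \<Longrightarrow> F t = F' t"
    and m: "F' \<in> borel_measurable PM"
  shows "box_integral n T a x F = (\<integral>\<^sup>+t. (if \<forall>i\<in>{1..n}. t i < x i then F' t else 0) \<partial>PM)"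
proof -
  have "Measurable.pred PM (\<lambda>t. \<forall>i\<in>{1..n}. t i < x i)"
  proof (rule pred_intros_finite(3))
    fix i assume i: "i \<in> {1..n}"
    note [measurable] = measurable_coord[OF i i]
    show "Measurable.pred PM (\<lambda>t. t i < x i)" by measurable
  qed simp
  then have m': "(\<lambda>t. if \<forall>i\<in>{1..n}. t i < x i then F' t else 0) \<in> borel_measurable PM" using m by measurable
  have "box_integral n T a x F = box_integral n T a b (\<lambda>t. if \<forall>i\<in>{1..n}. t i < x i then F t else 0)"
    by (rule box_integral_below[OF x])
  also have "\<dots> = box_integral n T a b (\<lambda>t. if \<forall>i\<in>{1..n}. t i < x i then F' t else 0)"
  proof -
    have "F t = F' t" if "t \<in> space PM" "\<forall>i\<in>{1..n}. t i < x i" for t using F that by blast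
    then show ?thesis by (intro antisym box_integral_mono_PM) auto
  qed
  also have "\<dots> = (\<integral>\<^sup>+t. (if \<forall>i\<in>{1..n}. t i < x i then F' t else 0) \<partial>PM)" by (rule box_integral_PM[OF m'])
  finally show ?thesis .
qed

text \<open>A nonnegative and jointly measurable substitute for \<open>H_kernel\<close>, equal to it
  whenever \<open>t\<close> is strictly below \<open>x\<close>. Elsewhere the monomials have
  arguments in the wrong order and are not controlled.\<close>

definition HK :: "(nat \<Rightarrow> nat) \<Rightarrow> (nat \<Rightarrow> real) \<Rightarrow> (nat \<Rightarrow> real) \<Rightarrow> real" where
  "HK lam x t = (\<Prod>i=1..n. enn2real (mker (T i) (MM i) (lam i - 1) (x i) (t i)))"

lemma HK_nonneg: "0 \<le> HK lam x t"
  unfolding HK_def by (intro prod_nonneg) simp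

lemma measurable_HK: "(\<lambda>p. HK lam (fst p) (snd p)) \<in> borel_measurable (PM \<Otimes>\<^sub>M PM)"
  unfolding HK_def
proof (rule borel_measurable_prod)
  fix i assume i: "i \<in> {1..n}"
  have "(\<lambda>(r, s). mker (T i) (MM i) (lam i - 1) r s) \<in> borel_measurable (MM i \<Otimes>\<^sub>M MM i)"
    unfolding MM_eq[OF i] using T[OF i] ab[OF i] by (intro measurable_mker) auto
  moreover have "(\<lambda>p. (fst p i, snd p i)) \<in> measurable (PM \<Otimes>\<^sub>M PM) (MM i \<Otimes>\<^sub>M MM i)"
    by (intro measurable_Pair measurable_compose[OF measurable_fst measurable_component_singleton[OF i]]
        measurable_compose[OF measurable_snd measurable_component_singleton[OF i]])
  ultimately have "(\<lambda>p. mker (T i) (MM i) (lam i - 1) (fst p i) (snd p i)) \<in> borel_measurable (PM \<Otimes>\<^sub>M PM)"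
    using measurable_compose[of "\<lambda>p. (fst p i, snd p i)"] by fastforce
  then show "(\<lambda>p. enn2real (mker (T i) (MM i) (lam i - 1) (fst p i) (snd p i))) \<in> borel_measurable (PM \<Otimes>\<^sub>M PM)"
    by measurable
qed

lemma H_kernel_eq_HK:
  assumes x: "x \<in> space PM" and t: "t \<in> space PM" "\<And>i. i \<in> {1..n} \<Longrightarrow> t i < x i"
  shows "H_kernel n T lam x t = HK lam x t"
  unfolding H_kernel_def HK_def
proof (rule prod.cong)
  fix i assume i: "i \<in> {1..n}"
  have xi: "x i \<in> T i" "x i < b i" and ti: "t i \<in> T i" "a i \<le> t i"
    using x t(1) i unfolding space_PM by auto
  have ft: "fwd_jump (T i) (t i) \<in> T i" "fwd_jump (T i) (t i) \<le> x i"
    using fwd_jump_in[OF T[OF i] ti(1)] fwd_jump_gap[OF T[OF i] ti(1) xi(1) t(2)[OF i]] by auto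
  have "ennreal (ts_monomial (T i) (lam i - 1) (x i) (fwd_jump (T i) (t i))) = mker (T i) (MM i) (lam i - 1) (x i) (t i)"
    unfolding MM_eq[OF i] using ab[OF i] xi ti ft by (intro ennreal_ts_monomial_eq_mker T[OF i]) auto
  moreover have "0 \<le> ts_monomial (T i) (lam i - 1) (x i) (fwd_jump (T i) (t i))"
    by (rule ts_monomial_nonneg[OF T[OF i] ft(1) xi(1) ft(2)])
  ultimately show "ts_monomial (T i) (lam i - 1) (x i) (fwd_jump (T i) (t i)) = enn2real (mker (T i) (MM i) (lam i - 1) (x i) (t i))"
    by (metis enn2real_ennreal)
qed simp

lemma measurable_HK_section:
  assumes "x \<in> space PM"
  shows "HK lam x \<in> borel_measurable PM"
  using measurable_compose[OF measurable_Pair1'[OF assms] measurable_HK] by simp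

lemma box_integral_kernel_PM:
  fixes lam :: "nat \<Rightarrow> nat" and q :: real
  assumes W: "W \<in> borel_measurable PM"
  defines "V \<equiv> (\<lambda>x. box_integral n T a x (\<lambda>t. ennreal (H_kernel n T lam x t powr q * W t)))"
  shows "V \<in> borel_measurable PM"
    and "x \<in> space PM \<Longrightarrow> V x = (\<integral>\<^sup>+t. (if \<forall>i\<in>{1..n}. t i < x i then ennreal (HK lam x t powr q * W t) else 0) \<partial>PM)"
proof -
  show eq: "V x = (\<integral>\<^sup>+t. (if \<forall>i\<in>{1..n}. t i < x i then ennreal (HK lam x t powr q * W t) else 0) \<partial>PM)"
    if x: "x \<in> space PM" for x
    unfolding V_def
  proof (rule box_integral_below_PM[OF x])
    note [measurable] = W measurable_HK_section[OF x, of lam]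
    show "(\<lambda>t. ennreal (HK lam x t powr q * W t)) \<in> borel_measurable PM" by measurable
    fix t assume "t \<in> space PM" "\<And>i. i \<in> {1..n} \<Longrightarrow> t i < x i"
    from H_kernel_eq_HK[OF x this] show "ennreal (H_kernel n T lam x t powr q * W t) = ennreal (HK lam x t powr q * W t)"
      by (simp only:)
  qed
  have "(\<lambda>p. ennreal (HK lam (fst p) (snd p) powr q * W (snd p))) \<in> borel_measurable (PM \<Otimes>\<^sub>M PM)"
    using measurable_HK[of lam] measurable_compose[OF measurable_snd W] by measurable
  then have "case_prod (\<lambda>x t. ennreal (HK lam x t powr q * W t)) \<in> borel_measurable (PM \<Otimes>\<^sub>M PM)"
    by (simp only: case_prod_unfold)
  from measurable_below[OF this] show "V \<in> borel_measurable PM"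
    by (subst measurable_cong[OF eq])
qed

lemma box_integral_density_PM:
  assumes W: "W \<in> borel_measurable PM"
  defines "Y \<equiv> (\<lambda>x. box_integral n T a x W)"
  shows "Y \<in> borel_measurable PM"
    and "x \<in> space PM \<Longrightarrow> Y x = (\<integral>\<^sup>+t. (if \<forall>i\<in>{1..n}. t i < x i then W t else 0) \<partial>PM)"
proof -
  show eq: "Y x = (\<integral>\<^sup>+t. (if \<forall>i\<in>{1..n}. t i < x i then W t else 0) \<partial>PM)" if x: "x \<in> space PM" for x
    unfolding Y_def by (rule box_integral_below_PM[OF x _ W]) simp
  have "(\<lambda>p. W (snd p)) \<in> borel_measurable (PM \<Otimes>\<^sub>M PM)" by (rule measurable_compose[OF measurable_snd W])
  then have "case_prod (\<lambda>x t. W t) \<in> borel_measurable (PM \<Otimes>\<^sub>M PM)"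
    by (simp only: case_prod_unfold)
  from measurable_below[OF this] show "Y \<in> borel_measurable PM"
    by (subst measurable_cong[OF eq])
qed

end

section \<open>The pointwise bound of a function by its kernel integral\<close>

context rd_box
begin

lemma measurable_full_deriv:
  assumes n: "1 \<le> n" and lam: "\<And>i. i \<in> {1..n} \<Longrightarrow> 1 \<le> lam i"
  shows "full_deriv n T a b lam f \<in> borel_measurable PM"
  unfolding full_deriv_def Om_eq
proof (rule measurable_sep_right_cont)
  fix i x assume i: "i \<in> {1..n}" and x: "x \<in> space PM"
  let ?P = "mixed_deriv T lam n (Om, f)"
  have nn: "n \<in> {1..n}" using n by simp
  have fP: "fst ?P = PiE {1..n} (mixed_dom T lam n BB)" by (rule fst_mixed_deriv[OF le_refl fst_conv])
  have rd: "rd_continuous n T ?P" by (rule Crd_facts(1)[OF nn]) (use lam in auto)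
  show "right_cont_on (T i) (a i) (b i) (\<lambda>s. snd ?P (x(i := s)))"
  proof (cases "on_line n i (mixed_dom T lam n BB) x")
    case True
    show ?thesis by (rule rd_slice_right_cont[OF fP rd i True, of "lam i"]) (use i in \<open>simp add: mixed_dom_def\<close>)
  next
    case False
    have "snd ?P (x(i := s)) = 0" for s
    proof (rule mixed_deriv_off_domain[where m = n and k = lam, OF n lam[OF nn]])
      show "x(i := s) \<notin> fst ?P"
      proof
        assume "x(i := s) \<in> fst ?P"
        then have "on_line n i (mixed_dom T lam n BB) (x(i := s))" unfolding fP by (rule PiE_on_line[OF i])
        then show False using False unfolding on_line_fun_upd(2)[OF i] by blast
      qed
    qed
    then show ?thesis by (auto simp: right_cont_on_def intro: exI[of _ 1])
  qed
qed auto

text \<open>The kernel bound followed by Hoelder's inequality, in which the weight is distributed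
  over the two factors. The index set \<open>{()}\<close> turns the inequality for sums into the one
  for a single product.\<close>

lemma pointwise_bound:
  fixes p :: real and \<tau> :: "(nat \<Rightarrow> real) \<Rightarrow> real"
  defines "D \<equiv> full_deriv n T a b lam f"
  defines "V \<equiv> (\<lambda>x. box_integral n T a x (\<lambda>t. ennreal (H_kernel n T lam x t powr (p / (p - 1)) * \<tau> t powr (1 / (1 - p)))))"
    and "Y \<equiv> (\<lambda>x. box_integral n T a x (\<lambda>t. ennreal (\<bar>D t\<bar> powr p * \<tau> t)))"
  assumes n: "1 \<le> n" and lam: "\<And>i. i \<in> {1..n} \<Longrightarrow> 1 \<le> lam i" and p: "1 < p"
    and fd: "\<And>j i. j \<in> {1..n} \<Longrightarrow> Suc i < lam j \<Longrightarrow> delta_differentiable T j ((delta_deriv T j ^^ i) (Om, f))"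
    and fz: "\<And>j i x. j \<in> {1..n} \<Longrightarrow> i < lam j \<Longrightarrow> x \<in> Om \<Longrightarrow> x j = a j \<Longrightarrow> snd ((delta_deriv T j ^^ i) (Om, f)) x = 0"
    and \<tau>: "\<tau> \<in> weights n T a b"
    and x: "x \<in> space PM" and fin: "V x < \<infinity>" "Y x < \<infinity>"
  shows "\<bar>f x\<bar> \<le> enn2real (Y x) powr (1 / p) * enn2real (V x) powr ((p - 1) / p)"
proof -
  define q where "q = p / (p - 1)"
  have q: "1 < q" "1 / q = (p - 1) / p" "1 / q + 1 / p = 1" using p by (auto simp: q_def field_simps)
  note [measurable] = measurable_weight(1)[OF \<tau>] measurable_full_deriv[OF n lam, folded D_def] measurable_HK_section[OF x, of lam]
  have \<tau>pos: "0 < \<tau> t" if "t \<in> space PM" for t by (rule measurable_weight(2)[OF \<tau> space_PM_Om[OF that]])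
  define L where "L t \<longleftrightarrow> (\<forall>i\<in>{1..n}. t i < x i)" for t
  have Lm[measurable]: "Measurable.pred PM L"
    unfolding L_def
  proof (rule pred_intros_finite(3))
    fix i assume i: "i \<in> {1..n}"
    note [measurable] = measurable_coord[OF i i]
    show "Measurable.pred PM (\<lambda>t. t i < x i)" by measurable
  qed simp
  have Vx: "V x = (\<integral>\<^sup>+t. (if L t then ennreal (HK lam x t powr q * \<tau> t powr (1 / (1 - p))) else 0) \<partial>PM)"
    unfolding V_def L_def q_def by (rule box_integral_kernel_PM(2)[OF _ x]) measurable
  have Yx: "Y x = (\<integral>\<^sup>+t. (if L t then ennreal (\<bar>D t\<bar> powr p * \<tau> t) else 0) \<partial>PM)"
    unfolding Y_def L_def by (rule box_integral_density_PM(2)[OF _ x]) measurable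
  \<comment> \<open>As \<open>- q / p = 1 / (1 - p)\<close>, these powers of the weight make
    \<open>u t powr q\<close> the integrand of \<open>V\<close> and \<open>v t powr p\<close> that
    of \<open>Y\<close>, while they cancel in \<open>u t * v t\<close>.\<close>
  define u v where "u t = (if L t then HK lam x t * \<tau> t powr (- 1 / p) else 0)"
    and "v t = (if L t then \<bar>D t\<bar> * \<tau> t powr (1 / p) else 0)" for t
  have um[measurable]: "u \<in> borel_measurable PM" "v \<in> borel_measurable PM" unfolding u_def v_def by measurable
  have xb: "x \<in> Om" "\<And>i. i \<in> {1..n} \<Longrightarrow> x i < b i" using space_PM_Om[OF x] x unfolding space_PM by auto
  have "ennreal \<bar>f x\<bar> \<le> box_integral n T a x (\<lambda>t. ennreal (H_kernel n T lam x t * \<bar>D t\<bar>))"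
    unfolding D_def by (rule box_integral_bound[OF lam fd fz xb])
  also have "\<dots> = (\<integral>\<^sup>+t. (if \<forall>i\<in>{1..n}. t i < x i then ennreal (HK lam x t * \<bar>D t\<bar>) else 0) \<partial>PM)"
  proof (rule box_integral_below_PM[OF x])
    fix t assume "t \<in> space PM" "\<And>i. i \<in> {1..n} \<Longrightarrow> t i < x i"
    from H_kernel_eq_HK[OF x this] show "ennreal (H_kernel n T lam x t * \<bar>D t\<bar>) = ennreal (HK lam x t * \<bar>D t\<bar>)"
      by (simp only:)
  qed measurable
  also have "\<dots> = (\<integral>\<^sup>+t. (\<Sum>i\<in>{()}. ennreal (u t * v t)) \<partial>PM)"
  proof (rule nn_integral_cong)
    fix t assume t: "t \<in> space PM"
    have "\<tau> t powr (- 1 / p) * \<tau> t powr (1 / p) = 1" using \<tau>pos[OF t] by (simp add: powr_add[symmetric])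
    then have "HK lam x t * \<tau> t powr (- 1 / p) * (\<bar>D t\<bar> * \<tau> t powr (1 / p)) = HK lam x t * \<bar>D t\<bar>"
      by (metis mult.assoc mult.commute mult_1)
    then have "u t * v t = (if L t then HK lam x t * \<bar>D t\<bar> else 0)" by (simp only: u_def v_def mult_zero_left split: if_split) blast
    then show "(if \<forall>i\<in>{1..n}. t i < x i then ennreal (HK lam x t * \<bar>D t\<bar>) else 0) = (\<Sum>i\<in>{()}. ennreal (u t * v t))"
      unfolding L_def[symmetric] by simp
  qed
  also have "\<dots> \<le> ennreal (enn2real (V x) powr (1 / q) * enn2real (Y x) powr (1 / p))"
  proof (rule Hoelder_sum_nn_integral[OF _ q(1) p q(3)])
    show "(\<integral>\<^sup>+t. (\<Sum>i\<in>{()}. ennreal (u t powr q)) \<partial>PM) \<le> ennreal (enn2real (V x))"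
    proof -
      have "(\<integral>\<^sup>+t. (\<Sum>i\<in>{()}. ennreal (u t powr q)) \<partial>PM) = V x"
        unfolding Vx
      proof (rule nn_integral_cong)
        fix t assume t: "t \<in> space PM"
        have "- 1 / p * q = 1 / (1 - p)" using p by (simp add: q_def divide_simps)
        then have "(HK lam x t * \<tau> t powr (- 1 / p)) powr q = HK lam x t powr q * \<tau> t powr (1 / (1 - p))"
          using \<tau>pos[OF t] HK_nonneg[of lam x t] by (simp add: powr_mult powr_powr)
        then show "(\<Sum>i\<in>{()}. ennreal (u t powr q)) = (if L t then ennreal (HK lam x t powr q * \<tau> t powr (1 / (1 - p))) else 0)"
          by (simp add: u_def)
      qed
      then show ?thesis using fin(1) by simp
    qed
    show "(\<integral>\<^sup>+t. (\<Sum>i\<in>{()}. ennreal (v t powr p)) \<partial>PM) \<le> ennreal (enn2real (Y x))"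
    proof -
      have "(\<integral>\<^sup>+t. (\<Sum>i\<in>{()}. ennreal (v t powr p)) \<partial>PM) = Y x"
        unfolding Yx
      proof (rule nn_integral_cong)
        fix t assume t: "t \<in> space PM"
        have "(\<bar>D t\<bar> * \<tau> t powr (1 / p)) powr p = \<bar>D t\<bar> powr p * \<tau> t"
          using \<tau>pos[OF t] p by (simp add: powr_mult powr_powr)
        then show "(\<Sum>i\<in>{()}. ennreal (v t powr p)) = (if L t then ennreal (\<bar>D t\<bar> powr p * \<tau> t) else 0)"
          by (simp add: v_def)
      qed
      then show ?thesis using fin(2) by simp
    qed
  qed (use um HK_nonneg in \<open>auto simp: u_def v_def\<close>)
  finally have "\<bar>f x\<bar> \<le> enn2real (V x) powr (1 / q) * enn2real (Y x) powr (1 / p)"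
    by (subst (asm) ennreal_le_iff) auto
  then show ?thesis unfolding q(2) by (simp only: mult.commute)
qed

end

section \<open>The class of functions \<open>G\<close>\<close>

definition fin_box :: "ereal \<Rightarrow> (real ^ 'm) set" where
  "fin_box R = {x. \<forall>i. 0 \<le> x $ i \<and> ereal (x $ i) < R}"

lemma fin_box_subset: "fin_box R \<subseteq> open_cube R"
proof
  fix x :: "real ^ 'm" assume x: "x \<in> fin_box R"
  have "- R < ereal (x $ i)" for i
  proof -
    have "0 \<le> ereal (x $ i)" "ereal (x $ i) < R" using x by (auto simp: fin_box_def)
    then have "0 < R" by (rule le_less_trans)
    then have "- R < 0" by (simp add: ereal_uminus_less_reorder)
    then show ?thesis using \<open>0 \<le> ereal (x $ i)\<close> by (rule less_le_trans)
  qed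
  then show "x \<in> open_cube R" using x by (auto simp: fin_box_def open_cube_def)
qed

text \<open>Condition (iii) of the class is about points with positive coordinates; since the partial derivatives are
  continuous it extends to nonnegative ones.\<close>

lemma G_class_pderiv:
  fixes G :: "real ^ 'm::finite \<Rightarrow> real"
  assumes G: "G \<in> G_class R" and pq: "1 < p" "1 < q" "1 / p + 1 / q = 1"
    and x: "x \<in> fin_box R" and y: "y \<in> fin_box R" and z: "z \<in> fin_box R"
    and le: "\<And>i. x $ i \<le> (y $ i) powr (1 / p) * (z $ i) powr (1 / q)"
  shows "0 \<le> pderiv_at i G x" "pderiv_at i G x \<le> pderiv_at i G y powr (1 / p) * pderiv_at i G z powr (1 / q)"
proof -
  define e where "e k = 1 / (real k + 1)" for k
  have e: "0 < e k" for k by (simp add: e_def)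
  have e0: "e \<longlonglongrightarrow> 0" unfolding e_def using LIMSEQ_inverse_real_of_nat by (simp add: inverse_eq_divide add.commute)
  \<comment> \<open>Raising \<open>x\<close> by a maximum preserves the hypothesis: the old
    inequality survives the enlargement of \<open>y\<close> and \<open>z\<close>, and
    \<open>e k\<close> is the product of its own powers with exponents \<open>1 / p\<close> and
    \<open>1 / q\<close>.\<close>
  define X where "X k = (\<chi> i. max (x $ i) (e k))" for k
  define Y where "Y k = (\<chi> i. y $ i + e k)" for k
  define Z where "Z k = (\<chi> i. z $ i + e k)" for k
  have XL: "X \<longlonglongrightarrow> x"
  proof (rule vec_tendstoI)
    fix i
    have "(\<lambda>k. max (x $ i) (e k)) \<longlonglongrightarrow> max (x $ i) 0" by (intro tendsto_intros e0)
    moreover have "max (x $ i) 0 = x $ i" using x by (simp add: fin_box_def max_absorb1)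
    ultimately show "(\<lambda>k. X k $ i) \<longlonglongrightarrow> x $ i" by (simp only: X_def vec_lambda_beta)
  qed
  have YL: "Y \<longlonglongrightarrow> y" and ZL: "Z \<longlonglongrightarrow> z"
  proof -
    have "(\<lambda>k. w $ i + e k) \<longlonglongrightarrow> w $ i" for w :: "real ^ 'm" and i
      using tendsto_add[OF tendsto_const e0, of "w $ i"] by simp
    then show "Y \<longlonglongrightarrow> y" "Z \<longlonglongrightarrow> z" by (intro vec_tendstoI; simp add: Y_def Z_def)+
  qed
  have ev: "eventually (\<lambda>k. \<forall>i. ereal (w $ i + e k) < R) sequentially" if w: "w \<in> fin_box R" for w :: "real ^ 'm"
  proof (rule eventually_all_finite)
    fix i
    have "((\<lambda>k. ereal (w $ i + e k)) \<longlongrightarrow> ereal (w $ i)) sequentially"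
      using tendsto_add[OF tendsto_const e0, of "w $ i"] by simp
    moreover have "ereal (w $ i) < R" using w by (simp add: fin_box_def)
    ultimately show "eventually (\<lambda>k. ereal (w $ i + e k) < R) sequentially" by (rule order_tendstoD(2))
  qed
  have e_ev: "eventually (\<lambda>k. X k \<in> fin_box R \<and> Y k \<in> fin_box R \<and> Z k \<in> fin_box R \<and> (0 \<le> pderiv_at i G (X k) \<and>
      pderiv_at i G (X k) \<le> pderiv_at i G (Y k) powr (1 / p) * pderiv_at i G (Z k) powr (1 / q))) sequentially" for i
    using ev[OF x] ev[OF y] ev[OF z]
  proof eventually_elim
    case (elim k)
    have X: "0 < X k $ i \<and> ereal (X k $ i) < R" for i
    proof -
      have "X k $ i \<le> x $ i + e k" using x e[of k] by (simp add: X_def fin_box_def)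
      then have "ereal (X k $ i) \<le> ereal (x $ i + e k)" by simp
      also have "\<dots> < R" using elim(1) by blast
      finally show ?thesis using e[of k] by (simp add: X_def)
    qed
    have Y: "0 < Y k $ i \<and> ereal (Y k $ i) < R" for i
      using elim(2) e[of k] y by (simp add: Y_def fin_box_def add_nonneg_pos)
    have Z: "0 < Z k $ i \<and> ereal (Z k $ i) < R" for i
      using elim(3) e[of k] z by (simp add: Z_def fin_box_def add_nonneg_pos)
    have XYZ: "X k $ i \<le> (Y k $ i) powr (1 / p) * (Z k $ i) powr (1 / q)" for i
    proof -
      have nn: "0 \<le> y $ i" "0 \<le> z $ i" using y z by (auto simp: fin_box_def)
      have "e k = e k powr (1 / p) * e k powr (1 / q)" using pq e[of k] by (simp add: powr_add[symmetric])
      also have "\<dots> \<le> (Y k $ i) powr (1 / p) * (Z k $ i) powr (1 / q)"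
        using nn e[of k] pq by (intro mult_mono powr_mono2) (auto simp: Y_def Z_def)
      finally have 1: "e k \<le> (Y k $ i) powr (1 / p) * (Z k $ i) powr (1 / q)" .
      have "(y $ i) powr (1 / p) * (z $ i) powr (1 / q) \<le> (Y k $ i) powr (1 / p) * (Z k $ i) powr (1 / q)"
        using nn e[of k] pq by (intro mult_mono powr_mono2) (auto simp: Y_def Z_def)
      with le[of i] have "x $ i \<le> (Y k $ i) powr (1 / p) * (Z k $ i) powr (1 / q)" by simp
      then show ?thesis using 1 by (simp add: X_def)
    qed
    have "0 \<le> pderiv_at i G (X k) \<and> pderiv_at i G (X k) \<le> pderiv_at i G (Y k) powr (1 / p) * pderiv_at i G (Z k) powr (1 / q)"
      using G pq X Y Z XYZ unfolding G_class_def by blast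
    then show ?case using X Y Z by (auto simp: fin_box_def intro: less_imp_le)
  qed
  have cont: "continuous_on (open_cube R) (pderiv_at i G)" using G by (simp add: G_class_def C1_on_cube_def)
  have L: "(\<lambda>k. pderiv_at i G (W k)) \<longlonglongrightarrow> pderiv_at i G w"
    if "W \<longlonglongrightarrow> w" "w \<in> fin_box R" "eventually (\<lambda>k. W k \<in> fin_box R) sequentially" for W w
    using continuous_on_tendsto_compose[OF cont that(1)] that(2,3) fin_box_subset
    by (metis (mono_tags, lifting) eventually_mono subset_iff)
  have XL': "(\<lambda>k. pderiv_at i G (X k)) \<longlonglongrightarrow> pderiv_at i G x"
    by (rule L[OF XL x]) (use e_ev[of i] in \<open>rule eventually_mono, simp\<close>)
  have YL': "(\<lambda>k. pderiv_at i G (Y k)) \<longlonglongrightarrow> pderiv_at i G y"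
    by (rule L[OF YL y]) (use e_ev[of i] in \<open>rule eventually_mono, simp\<close>)
  have ZL': "(\<lambda>k. pderiv_at i G (Z k)) \<longlonglongrightarrow> pderiv_at i G z"
    by (rule L[OF ZL z]) (use e_ev[of i] in \<open>rule eventually_mono, simp\<close>)
  show nn: "0 \<le> pderiv_at i G x"
    by (rule tendsto_lowerbound[OF XL']) (use e_ev[of i] in \<open>rule eventually_mono, simp\<close>, simp)
  \<comment> \<open>The limit of \<open>powr\<close> at a base that may be 0 requires eventually
    nonnegative bases; condition (iii) with all three points equal provides this.\<close>
  have nnY: "eventually (\<lambda>k. 0 \<le> pderiv_at i G (W k)) sequentially" 
    if W: "eventually (\<lambda>k. (\<forall>i. 0 < W k $ i \<and> ereal (W k $ i) < R)) sequentially" for W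
    using W
  proof eventually_elim
    case (elim k)
    have "W k $ i = W k $ i powr (1 / p) * W k $ i powr (1 / q)" for i
      using spec[OF elim, of i] pq by (simp add: powr_add[symmetric])
    then have "\<forall>i. 0 < W k $ i \<and> ereal (W k $ i) < R \<and> 0 < W k $ i \<and> ereal (W k $ i) < R \<and> 0 < W k $ i \<and> ereal (W k $ i) < R \<and>
        W k $ i \<le> W k $ i powr (1 / p) * W k $ i powr (1 / q)"
      using elim by (metis order_refl)
    then show ?case using G pq unfolding G_class_def by blast
  qed
  have "eventually (\<lambda>k. (\<forall>i. 0 < Y k $ i \<and> ereal (Y k $ i) < R)) sequentially"
    using ev[OF y] by eventually_elim (use y e in \<open>simp add: Y_def fin_box_def add_nonneg_pos\<close>)
  note Yn = nnY[OF this]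
  have "eventually (\<lambda>k. (\<forall>i. 0 < Z k $ i \<and> ereal (Z k $ i) < R)) sequentially"
    using ev[OF z] by eventually_elim (use z e in \<open>simp add: Z_def fin_box_def add_nonneg_pos\<close>)
  note Zn = nnY[OF this]
  have "(\<lambda>k. pderiv_at i G (Y k) powr (1 / p) * pderiv_at i G (Z k) powr (1 / q)) \<longlonglongrightarrow> pderiv_at i G y powr (1 / p) * pderiv_at i G z powr (1 / q)"
    using pq Yn Zn by (intro tendsto_mult tendsto_powr' YL' ZL' tendsto_const disjI2 conjI) auto
  then show "pderiv_at i G x \<le> pderiv_at i G y powr (1 / p) * pderiv_at i G z powr (1 / q)"
    by (rule tendsto_le[OF sequentially_bot _ XL']) (use e_ev[of i] in \<open>rule eventually_mono, simp\<close>)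
qed

text \<open>Condition (iii) with exponents 2 and 2 and both points on the right equal to
  \<open>y\<close>: the product of square roots is then \<open>y\<close> itself.\<close>

lemma G_class_pderiv_mono:
  fixes G :: "real ^ 'm::finite \<Rightarrow> real"
  assumes G: "G \<in> G_class R" and x: "x \<in> fin_box R" and y: "y \<in> fin_box R" and le: "\<And>i. x $ i \<le> y $ i"
  shows "0 \<le> pderiv_at i G x" "pderiv_at i G x \<le> pderiv_at i G y"
proof -
  have h: "w powr (1 / 2) * w powr (1 / 2) = w" if "0 \<le> w" for w :: real
    using that by (simp add: powr_half_sqrt)
  have ynn: "0 \<le> y $ i" for i using y by (simp add: fin_box_def)
  have l: "x $ i \<le> y $ i powr (1 / 2) * y $ i powr (1 / 2)" for i using le h[OF ynn] by simp
  have l2: "y $ i \<le> y $ i powr (1 / 2) * y $ i powr (1 / 2)" for i using h[OF ynn] by simp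
  show "0 \<le> pderiv_at i G x" by (rule G_class_pderiv(1)[OF G _ _ _ x y y l]) auto
  have y0: "0 \<le> pderiv_at i G y" by (rule G_class_pderiv(1)[OF G _ _ _ y y y l2]) auto
  have "pderiv_at i G x \<le> pderiv_at i G y powr (1 / 2) * pderiv_at i G y powr (1 / 2)"
    by (rule G_class_pderiv(2)[OF G _ _ _ x y y l]) auto
  then show "pderiv_at i G x \<le> pderiv_at i G y" unfolding h[OF y0] .
qed

text \<open>The coordinates are raised from \<open>u\<close> to \<open>v\<close> one at a time. Each
  increment is, by the mean value theorem, a partial derivative at a point above \<open>u\<close>,
  hence at least the one at \<open>u\<close>.\<close>

lemma G_class_increment:
  fixes G :: "real ^ 'm::finite \<Rightarrow> real"
  assumes G: "G \<in> G_class R" and u: "u \<in> fin_box R" and v: "v \<in> fin_box R" and le: "\<And>i. u $ i \<le> v $ i"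
  shows "(\<Sum>i\<in>UNIV. pderiv_at i G u * (v $ i - u $ i)) \<le> G v - G u"
proof -
  define w where "w S = (\<chi> i. if i \<in> S then v $ i else u $ i)" for S
  have fin: "w S \<in> fin_box R" for S using u v by (auto simp: w_def fin_box_def)
  have "(\<Sum>i\<in>S. pderiv_at i G u * (v $ i - u $ i)) \<le> G (w S) - G u" for S
  proof (induction S rule: infinite_finite_induct)
    case empty
    have "w {} = u" by (simp add: w_def vec_eq_iff)
    then show ?case by simp
  next
    case (insert k S)
    let ?g = "coord_line G k (w S)"
    let ?p = "\<lambda>s. \<chi> i. if i = k then s else w S $ i"
    have pfin: "?p s \<in> fin_box R" if "u $ k \<le> s" "s \<le> v $ k" for s
    proof -
      have "ereal s \<le> ereal (v $ k)" using that by simp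
      also have "\<dots> < R" using v by (simp add: fin_box_def)
      finally have "ereal s < R" .
      moreover have "0 \<le> s" using that u by (auto simp: fin_box_def intro: order_trans)
      ultimately show ?thesis using fin[of S] by (auto simp: fin_box_def)
    qed
    have line: "coord_line G k (?p s) = ?g" for s
      by (rule ext) (simp add: coord_line_def, rule arg_cong[where f = G], simp add: vec_eq_iff)
    have D: "(?g has_real_derivative pderiv_at k G (?p s)) (at s)" if "u $ k \<le> s" "s \<le> v $ k" for s
    proof -
      have "coord_line G k (?p s) field_differentiable at ((?p s) $ k)"
        using G pfin[OF that] fin_box_subset unfolding G_class_def C1_on_cube_def by blast
      then show ?thesis unfolding line pderiv_at_def using field_differentiable_derivI by fastforce
    qed
    have gv: "?g (v $ k) = G (w (insert k S))" "?g (u $ k) = G (w S)"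
      unfolding coord_line_def using insert.hyps by (auto simp: w_def vec_eq_iff intro!: arg_cong[where f = G])
    have "pderiv_at k G u * (v $ k - u $ k) \<le> ?g (v $ k) - ?g (u $ k)"
    proof (cases "u $ k = v $ k")
      case False
      then have lt: "u $ k < v $ k" using le[of k] by simp
      obtain s where s: "u $ k < s" "s < v $ k" "?g (v $ k) - ?g (u $ k) = (v $ k - u $ k) * pderiv_at k G (?p s)"
        using MVT2[OF lt, of ?g "\<lambda>s. pderiv_at k G (?p s)"] D by auto
      have "pderiv_at k G u \<le> pderiv_at k G (?p s)"
      proof (rule G_class_pderiv_mono(2)[OF G u pfin])
        show "u $ i \<le> ?p s $ i" for i using s le[of i] by (simp add: w_def)
      qed (use s in auto)
      then have "pderiv_at k G u * (v $ k - u $ k) \<le> pderiv_at k G (?p s) * (v $ k - u $ k)"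
        using lt by (intro mult_right_mono) auto
      then show ?thesis using s(3) by (simp add: mult.commute)
    qed simp
    then show ?case using insert unfolding gv by simp
  qed simp
  from this[of UNIV] show ?thesis by (simp add: w_def)
qed

text \<open>A substitute for the chain rule \<open>(G \<circ> y)' \<ge> \<Sum>\<^sub>i D\<^sub>i G(y) y\<^sub>i'\<close>: on each cell of a partition the increment
  of \<open>G \<circ> y\<close> dominates the integral with \<open>D\<^sub>i G\<close> frozen at the left end, and Fatou's lemma removes the partition.\<close>

lemma G_class_integral_le:
  fixes G :: "real ^ 'm::finite \<Rightarrow> real" and \<pi> :: "'a \<Rightarrow> real" and \<phi> :: "'m \<Rightarrow> 'a \<Rightarrow> real"
  assumes G: "G \<in> G_class R" and \<pi>[measurable]: "\<pi> \<in> borel_measurable M"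
    and ab: "a < b" "\<And>x. x \<in> space M \<Longrightarrow> a \<le> \<pi> x \<and> \<pi> x < b"
    and \<phi>[measurable]: "\<And>i. \<phi> i \<in> borel_measurable M" and nn: "\<And>i x. x \<in> space M \<Longrightarrow> 0 \<le> \<phi> i x"
    and fin: "\<And>i. (\<integral>\<^sup>+x. ennreal (\<phi> i x) \<partial>M) < \<infinity>"
    and U: "(\<chi> i. enn2real (\<integral>\<^sup>+x. ennreal (\<phi> i x) \<partial>M)) \<in> fin_box R"
  defines "y \<equiv> (\<lambda>s. \<chi> i. enn2real (\<integral>\<^sup>+x. ennreal (\<phi> i x) * indicator {..<s} (\<pi> x) \<partial>M))"
  shows "(\<integral>\<^sup>+x. (\<Sum>i\<in>UNIV. ennreal (pderiv_at i G (y (\<pi> x)) * \<phi> i x)) \<partial>M)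
    \<le> ennreal (G (\<chi> i. enn2real (\<integral>\<^sup>+x. ennreal (\<phi> i x) \<partial>M)))"
proof -
  define J where "J i s = (\<integral>\<^sup>+x. ennreal (\<phi> i x) * indicator {..<s} (\<pi> x) \<partial>M)" for i s
  define U' where "U' i = (\<integral>\<^sup>+x. ennreal (\<phi> i x) \<partial>M)" for i
  have yJ: "y s $ i = enn2real (J i s)" for s i by (simp add: y_def J_def)
  have JU: "J i s \<le> U' i" for i s
    unfolding J_def U'_def by (intro nn_integral_mono) (simp split: split_indicator)
  have U'fin: "U' i < \<infinity>" for i unfolding U'_def by (rule fin)
  have Jfin: "J i s < \<infinity>" for i s using JU U'fin by (rule le_less_trans)
  have Jadd: "J i t = J i s + (\<integral>\<^sup>+x. ennreal (\<phi> i x) * indicator {s..<t} (\<pi> x) \<partial>M)" if "s \<le> t" for i s t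
    unfolding J_def
    by (subst nn_integral_add[symmetric]) (use that in \<open>auto intro!: nn_integral_cong split: split_indicator\<close>)
  have diff: "(\<integral>\<^sup>+x. ennreal (\<phi> i x) * indicator {s..<t} (\<pi> x) \<partial>M) = ennreal (y t $ i - y s $ i)"
    and ymono: "y s $ i \<le> y t $ i" if "s \<le> t" for i s t
  proof -
    let ?I = "\<integral>\<^sup>+x. ennreal (\<phi> i x) * indicator {s..<t} (\<pi> x) \<partial>M"
    have "?I \<le> J i t" unfolding Jadd[OF that] by simp
    then have If: "?I < \<infinity>" using Jfin by (rule le_less_trans)
    have e: "y t $ i = y s $ i + enn2real ?I"
      unfolding yJ Jadd[OF that] using If Jfin[of i s] by (intro enn2real_plus) auto
    then show "y s $ i \<le> y t $ i" by simp
    show "?I = ennreal (y t $ i - y s $ i)" unfolding e using If by simp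
  qed
  have yfin: "y s \<in> fin_box R" for s
  proof -
    have "ereal (y s $ i) < R" for i
    proof -
      have "enn2real (J i s) \<le> enn2real (U' i)" using JU U'fin by (intro enn2real_mono) auto
      then have "ereal (y s $ i) \<le> ereal (enn2real (U' i))" by (simp add: yJ)
      also have "\<dots> < R" using U by (simp add: fin_box_def U'_def)
      finally show ?thesis .
    qed
    then show ?thesis by (simp add: fin_box_def yJ)
  qed
  have ya: "y a = 0"
  proof -
    have "J i a = (\<integral>\<^sup>+x. 0 \<partial>M)" for i
      unfolding J_def using ab(2) by (intro nn_integral_cong) (auto simp: not_less split: split_indicator)
    then show ?thesis by (simp add: vec_eq_iff yJ)
  qed
  have yb: "y b = (\<chi> i. enn2real (U' i))"
  proof -
    have "J i b = U' i" for i
      unfolding J_def U'_def using ab(2) by (intro nn_integral_cong) (auto split: split_indicator)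
    then show ?thesis by (simp add: vec_eq_iff yJ)
  qed
  have Dnn: "0 \<le> pderiv_at i G (y s)" for i s
    by (rule G_class_pderiv_mono(1)[OF G yfin yfin order_refl])
  have G0: "G 0 = 0" using G by (simp add: G_class_def)
  define w where "w = b - a"
  have w: "w > 0" using ab by (simp add: w_def)
  define c where "c N k = a + real k * w / (real N + 1)" for N k :: nat
  \<comment> \<open>The index of the cell that contains \<open>\<pi> x\<close> among
    \<open>N + 1\<close> cells of equal length; \<open>c N (\<kappa> N x)\<close> is its left
    end.\<close>
  define \<kappa> where "\<kappa> N x = nat \<lfloor>(\<pi> x - a) * (real N + 1) / w\<rfloor>" for N x
  have cmono: "c N k \<le> c N l" if "k \<le> l" for N k l
    unfolding c_def using that w by (intro add_left_mono divide_right_mono mult_right_mono) auto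
  have \<kappa>: "c N k \<le> \<pi> x \<and> \<pi> x < c N (Suc k) \<longleftrightarrow> k = \<kappa> N x" if x: "x \<in> space M" for N k x
  proof -
    let ?r = "(\<pi> x - a) * (real N + 1) / w"
    have r0: "0 \<le> ?r" using ab(2)[OF x] w by simp
    have "c N k \<le> \<pi> x \<longleftrightarrow> real k \<le> ?r" using w by (simp add: c_def field_simps)
    moreover have "\<pi> x < c N (Suc k) \<longleftrightarrow> ?r < real k + 1" using w by (simp add: c_def field_simps)
    moreover have "real k \<le> ?r \<and> ?r < real k + 1 \<longleftrightarrow> k = nat \<lfloor>?r\<rfloor>" using r0 by linarith
    ultimately show ?thesis by (simp add: \<kappa>_def)
  qed
  have cb: "c N (Suc N) = b" for N
  proof -
    have "real (Suc N) * w / (real N + 1) = w" by (simp add: add.commute add_nonneg_eq_0_iff)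
    then show ?thesis unfolding c_def by (simp only: w_def)
  qed
  have \<kappa>N: "\<kappa> N x < Suc N" if x: "x \<in> space M" for N x
  proof (rule ccontr)
    assume "\<not> \<kappa> N x < Suc N"
    then have "c N (Suc N) \<le> c N (\<kappa> N x)" by (intro cmono) simp
    then show False unfolding cb using \<kappa>[OF x, of N "\<kappa> N x"] ab(2)[OF x] by auto
  qed
  have "(\<lambda>x. \<kappa> N x) \<in> measurable M (count_space UNIV)" for N unfolding \<kappa>_def by measurable
  then have Dm[measurable]: "(\<lambda>x. pderiv_at i G (y (c N (\<kappa> N x)))) \<in> borel_measurable M" for i N
    by (rule measurable_compose) simp
  have bound: "(\<integral>\<^sup>+x. (\<Sum>i\<in>UNIV. ennreal (pderiv_at i G (y (c N (\<kappa> N x))) * \<phi> i x)) \<partial>M) \<le> ennreal (G (y b))" for N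
  proof -
    have "(\<integral>\<^sup>+x. (\<Sum>i\<in>UNIV. ennreal (pderiv_at i G (y (c N (\<kappa> N x))) * \<phi> i x)) \<partial>M) =
      (\<integral>\<^sup>+x. (\<Sum>k<Suc N. \<Sum>i\<in>UNIV. ennreal (pderiv_at i G (y (c N k))) * (ennreal (\<phi> i x) * indicator {c N k..<c N (Suc k)} (\<pi> x))) \<partial>M)"
    proof (rule nn_integral_cong)
      fix x assume x: "x \<in> space M"
      have "(\<Sum>k<Suc N. \<Sum>i\<in>UNIV. ennreal (pderiv_at i G (y (c N k))) * (ennreal (\<phi> i x) * indicator {c N k..<c N (Suc k)} (\<pi> x))) =
        (\<Sum>k<Suc N. if k = \<kappa> N x then (\<Sum>i\<in>UNIV. ennreal (pderiv_at i G (y (c N k)) * \<phi> i x)) else 0)"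
      proof (rule sum.cong)
        fix k
        have "indicator {c N k..<c N (Suc k)} (\<pi> x) = (if k = \<kappa> N x then 1 else 0 :: ennreal)"
          using \<kappa>[OF x, of N k] by (auto simp: indicator_def)
        then show "(\<Sum>i\<in>UNIV. ennreal (pderiv_at i G (y (c N k))) * (ennreal (\<phi> i x) * indicator {c N k..<c N (Suc k)} (\<pi> x))) =
          (if k = \<kappa> N x then (\<Sum>i\<in>UNIV. ennreal (pderiv_at i G (y (c N k)) * \<phi> i x)) else 0)"
          using Dnn nn[OF x] by (auto simp: ennreal_mult simp del: sum_ennreal)
      qed simp
      also have "\<dots> = (\<Sum>i\<in>UNIV. ennreal (pderiv_at i G (y (c N (\<kappa> N x))) * \<phi> i x))"
        by (subst sum.delta) (use \<kappa>N[OF x, of N] in auto)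
      finally show "(\<Sum>i\<in>UNIV. ennreal (pderiv_at i G (y (c N (\<kappa> N x))) * \<phi> i x)) =
        (\<Sum>k<Suc N. \<Sum>i\<in>UNIV. ennreal (pderiv_at i G (y (c N k))) * (ennreal (\<phi> i x) * indicator {c N k..<c N (Suc k)} (\<pi> x)))" by (rule sym)
    qed
    also have "\<dots> = (\<Sum>k<Suc N. \<Sum>i\<in>UNIV. ennreal (pderiv_at i G (y (c N k))) * (\<integral>\<^sup>+x. ennreal (\<phi> i x) * indicator {c N k..<c N (Suc k)} (\<pi> x) \<partial>M))"
    proof -
      have im[measurable]: "(\<lambda>x. ennreal (\<phi> i x) * indicator {r..<s} (\<pi> x)) \<in> borel_measurable M" for i r s by measurable
      show ?thesis
        by (subst nn_integral_sum, measurable, intro sum.cong refl, subst nn_integral_sum, measurable, intro sum.cong refl nn_integral_cmult im)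
    qed
    also have "\<dots> = (\<Sum>k<Suc N. \<Sum>i\<in>UNIV. ennreal (pderiv_at i G (y (c N k)) * (y (c N (Suc k)) $ i - y (c N k) $ i)))"
    proof (intro sum.cong refl)
      fix k i
      have cc: "c N k \<le> c N (Suc k)" by (rule cmono) simp
      show "ennreal (pderiv_at i G (y (c N k))) * (\<integral>\<^sup>+x. ennreal (\<phi> i x) * indicator {c N k..<c N (Suc k)} (\<pi> x) \<partial>M) =
        ennreal (pderiv_at i G (y (c N k)) * (y (c N (Suc k)) $ i - y (c N k) $ i))"
        unfolding diff[OF cc] using Dnn ymono[OF cc, of i] by (simp add: ennreal_mult)
    qed
    also have "\<dots> = ennreal (\<Sum>k<Suc N. \<Sum>i\<in>UNIV. pderiv_at i G (y (c N k)) * (y (c N (Suc k)) $ i - y (c N k) $ i))"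
    proof -
      have "0 \<le> pderiv_at i G (y (c N k)) * (y (c N (Suc k)) $ i - y (c N k) $ i)" for i k
        using Dnn ymono[OF cmono[of k "Suc k" N], of i] by simp
      then show ?thesis by (simp add: sum_nonneg del: sum.lessThan_Suc)
    qed
    also have "\<dots> \<le> ennreal (\<Sum>k<Suc N. G (y (c N (Suc k))) - G (y (c N k)))"
      by (intro ennreal_leI sum_mono G_class_increment[OF G yfin yfin] ymono cmono) simp
    also have "(\<Sum>k<Suc N. G (y (c N (Suc k))) - G (y (c N k))) = G (y (c N (Suc N))) - G (y (c N 0))"
      by (rule sum_lessThan_telescope)
    also have "\<dots> = G (y b)"
    proof -
      have "c N 0 = a" by (simp add: c_def)
      then show ?thesis by (simp only: cb ya G0 diff_zero)
    qed
    finally show ?thesis .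
  qed
  have lim: "(\<lambda>N. \<Sum>i\<in>UNIV. ennreal (pderiv_at i G (y (c N (\<kappa> N x))) * \<phi> i x)) \<longlonglongrightarrow> (\<Sum>i\<in>UNIV. ennreal (pderiv_at i G (y (\<pi> x)) * \<phi> i x))"
    if x: "x \<in> space M" for x
  proof -
    define r where "r N = c N (\<kappa> N x)" for N
    have r: "r N \<le> \<pi> x" "\<pi> x - w / (real N + 1) < r N" for N
    proof -
      have 1: "c N (\<kappa> N x) \<le> \<pi> x" "\<pi> x < c N (Suc (\<kappa> N x))" using \<kappa>[OF x, of N "\<kappa> N x"] by auto
      have "c N (Suc (\<kappa> N x)) = c N (\<kappa> N x) + w / (real N + 1)" by (simp add: c_def add_divide_distrib distrib_right)
      then show "r N \<le> \<pi> x" "\<pi> x - w / (real N + 1) < r N" using 1 unfolding r_def by linarith+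
    qed
    have rlim: "r \<longlonglongrightarrow> \<pi> x"
    proof (rule tendsto_sandwich)
      have "(\<lambda>N. w * (1 / (real N + 1))) \<longlonglongrightarrow> w * 0"
        using LIMSEQ_inverse_real_of_nat by (intro tendsto_mult tendsto_const) (simp add: inverse_eq_divide add.commute)
      then have "(\<lambda>N. \<pi> x - w * (1 / (real N + 1))) \<longlonglongrightarrow> \<pi> x - w * 0" by (intro tendsto_diff tendsto_const)
      then show "(\<lambda>N. \<pi> x - w / (real N + 1)) \<longlonglongrightarrow> \<pi> x" by simp
      show "\<forall>\<^sub>F N in sequentially. \<pi> x - w / (real N + 1) \<le> r N" using r(2) by (intro always_eventually allI less_imp_le)
      show "\<forall>\<^sub>F N in sequentially. r N \<le> \<pi> x" using r(1) by (intro always_eventually allI)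
    qed (rule tendsto_const)
    \<comment> \<open>The strict bound in \<open>{..<s}\<close> makes \<open>J i\<close>
      left-continuous, and left continuity is what counts, as the left ends \<open>r N\<close>
      approach \<open>\<pi> x\<close> from below.\<close>
    have "(\<lambda>N. J i (r N)) \<longlonglongrightarrow> J i (\<pi> x)" for i
      unfolding J_def
    proof (rule nn_integral_dominated_convergence[where w = "\<lambda>x. ennreal (\<phi> i x)"])
      show "AE x' in M. (\<lambda>N. ennreal (\<phi> i x') * indicator {..<r N} (\<pi> x')) \<longlonglongrightarrow> ennreal (\<phi> i x') * indicator {..<\<pi> x} (\<pi> x')"
      proof (rule AE_I2)
        fix x'
        have "eventually (\<lambda>N. indicator {..<r N} (\<pi> x') = (indicator {..<\<pi> x} (\<pi> x') :: ennreal)) sequentially"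
        proof (cases "\<pi> x' < \<pi> x")
          case True
          have "eventually (\<lambda>N. \<pi> x' < r N) sequentially" by (rule order_tendstoD(1)[OF rlim True])
          then show ?thesis by eventually_elim (use True in simp)
        next
          case False
          then have "\<not> \<pi> x' < r N" for N using r(1)[of N] by linarith
          then show ?thesis using False by simp
        qed
        then have "eventually (\<lambda>N. ennreal (\<phi> i x') * indicator {..<r N} (\<pi> x') = ennreal (\<phi> i x') * indicator {..<\<pi> x} (\<pi> x')) sequentially"
          by eventually_elim simp
        then show "(\<lambda>N. ennreal (\<phi> i x') * indicator {..<r N} (\<pi> x')) \<longlonglongrightarrow> ennreal (\<phi> i x') * indicator {..<\<pi> x} (\<pi> x')"
          by (rule tendsto_eventually)
      qed
    qed (use fin in \<open>auto split: split_indicator\<close>)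
    then have "(\<lambda>N. y (r N) $ i) \<longlonglongrightarrow> y (\<pi> x) $ i" for i
      unfolding yJ using Jfin[of i "\<pi> x"] by (intro tendsto_enn2real) auto
    then have yl: "(\<lambda>N. y (r N)) \<longlonglongrightarrow> y (\<pi> x)" by (rule vec_tendstoI)
    have "(\<lambda>N. pderiv_at i G (y (r N))) \<longlonglongrightarrow> pderiv_at i G (y (\<pi> x))" for i
    proof (rule continuous_on_tendsto_compose[OF _ yl])
      show "continuous_on (open_cube R) (pderiv_at i G)" using G by (simp add: G_class_def C1_on_cube_def)
      have oc: "y s \<in> open_cube R" for s by (rule subsetD[OF fin_box_subset yfin])
      show "y (\<pi> x) \<in> open_cube R" by (rule oc)
      show "\<forall>\<^sub>F N in sequentially. y (r N) \<in> open_cube R" by (intro always_eventually allI oc)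
    qed
    then show ?thesis unfolding r_def[symmetric] by (intro tendsto_sum tendsto_ennrealI tendsto_mult tendsto_const)
  qed
  have "(\<integral>\<^sup>+x. (\<Sum>i\<in>UNIV. ennreal (pderiv_at i G (y (\<pi> x)) * \<phi> i x)) \<partial>M) =
    (\<integral>\<^sup>+x. liminf (\<lambda>N. \<Sum>i\<in>UNIV. ennreal (pderiv_at i G (y (c N (\<kappa> N x))) * \<phi> i x)) \<partial>M)"
    by (intro nn_integral_cong lim_imp_Liminf[symmetric] lim) simp
  also have "\<dots> \<le> liminf (\<lambda>N. \<integral>\<^sup>+x. (\<Sum>i\<in>UNIV. ennreal (pderiv_at i G (y (c N (\<kappa> N x))) * \<phi> i x)) \<partial>M)"
    by (rule nn_integral_liminf) measurable
  also have "\<dots> \<le> liminf (\<lambda>N. ennreal (G (y b)))" by (intro Liminf_mono always_eventually allI bound)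
  also have "\<dots> = ennreal (G (y b))" by (simp add: Liminf_const)
  finally show ?thesis unfolding yb U'_def .
qed

lemma measurable_pderiv:
  fixes G :: "real ^ 'm::finite \<Rightarrow> real"
  assumes G: "G \<in> G_class R" and g: "\<And>k. g k \<in> borel_measurable M"
    and fin: "\<And>x. x \<in> space M \<Longrightarrow> (\<chi> k. g k x) \<in> fin_box R"
  shows "(\<lambda>x. pderiv_at i G (\<chi> k. g k x)) \<in> borel_measurable M"
proof -
  have "(\<lambda>x. (\<chi> k. g k x) \<bullet> e) \<in> borel_measurable M" if "e \<in> Basis" for e
    using that g by (auto simp: Basis_vec_def inner_axis)
  then have "(\<lambda>x. \<chi> k. g k x) \<in> borel_measurable M" by (subst borel_measurable_euclidean_space) auto
  then have "(\<lambda>x. \<chi> k. g k x) \<in> measurable M (restrict_space borel (open_cube R))"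
    by (intro measurable_restrict_space2) (use fin fin_box_subset in blast)+
  moreover have "pderiv_at i G \<in> borel_measurable (restrict_space borel (open_cube R))"
    by (rule borel_measurable_continuous_on_restrict) (use G in \<open>simp add: G_class_def C1_on_cube_def\<close>)
  ultimately show ?thesis by (rule measurable_compose)
qed

section \<open>Assembly of the inequality\<close>

lemma funpow_bwd_jump_le: "(bwd_jump T ^^ k) t \<le> t"
proof (induction k)
  case (Suc k)
  have "bwd_jump T s \<le> s" for s unfolding bwd_jump_def by (simp, intro impI cSup_least) auto
  from this[of "(bwd_jump T ^^ k) t"] Suc show ?case by simp
qed simp

lemma enn2ereal_less_fin:
  assumes "enn2ereal v < R"
  shows "v < \<infinity>" "ereal (enn2real v) < R"
proof -
  have "enn2ereal v \<noteq> \<infinity>" using assms by auto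
  then have "v \<noteq> top" by auto
  then show "v < \<infinity>" by (simp add: less_top)
  then have "ennreal (enn2real v) = v" by simp
  then have "enn2ereal v = ereal (enn2real v)" by (metis enn2ereal_ennreal enn2real_nonneg)
  then show "ereal (enn2real v) < R" using assms by simp
qed

theorem theorem3p3:
  fixes n :: nat
    and T :: "nat \<Rightarrow> real set"
    and lam :: "nat \<Rightarrow> nat"
    and a b :: "nat \<Rightarrow> real"
    and \<alpha> \<beta> :: real
    and R :: ereal
    and G :: "real ^ 'm::finite \<Rightarrow> real"
    and \<omega> \<tau> f :: "'m \<Rightarrow> (nat \<Rightarrow> real) \<Rightarrow> real"
  defines "\<Omega> \<equiv> ts_box n T a b"
    and "D \<equiv> (\<lambda>i. full_deriv n T a b lam (f i))"
    and "U \<equiv> (\<lambda>i. box_integral n T a b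
                  (\<lambda>x. ennreal (\<bar>full_deriv n T a b lam (f i) x\<bar> powr (\<alpha> + \<beta>) * \<tau> i x)))"
    and "V \<equiv> (\<lambda>i x. box_integral n T a x
                  (\<lambda>t. ennreal (H_kernel n T lam x t powr ((\<alpha> + \<beta>) / (\<alpha> + \<beta> - 1))
                                 * \<tau> i t powr (1 / (1 - \<alpha> - \<beta>)))))"
  defines "I\<^sub>K \<equiv> box_integral n T a b
                  (\<lambda>x. \<Sum>i\<in>UNIV. ennreal
                     (pderiv_at i G (\<chi> k. enn2real (V k x)) powr (\<alpha> * (\<alpha> + \<beta> - 1) / \<beta>)
                        * \<omega> i x powr ((\<alpha> + \<beta>) / \<beta>) * \<tau> i x powr (- (\<alpha> / \<beta>))))"
  defines "K \<equiv> enn2real I\<^sub>K powr (\<beta> / (\<alpha> + \<beta>))"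
  assumes "1 \<le> n"
    and "\<forall>j\<in>{1..n}. time_scale (T j)"
    and "\<forall>j\<in>{1..n}. 1 \<le> lam j"
    and "a \<in> ts_prod n T" and "b \<in> ts_prod n T"
    and "\<forall>j\<in>{1..n}. a j < (bwd_jump (T j) ^^ (lam j - 1)) (b j)"
    and "0 < \<alpha>" and "0 < \<beta>" and "1 < \<alpha> + \<beta>"
    and "0 < R"
    and "G \<in> G_class R"
    and "\<forall>i. \<omega> i \<in> weights n T a b"
    and "\<forall>i. \<tau> i \<in> weights n T a b"
    and "\<forall>i. \<forall>x\<in>\<Omega>. - R < ereal (f i x) \<and> ereal (f i x) < R"
    and "\<forall>i. enn2ereal (U i) < R"
    and "\<forall>i. f i \<in> Lp_class n T a b lam (\<alpha> + \<beta>) (\<tau> i)"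
    and "\<forall>i. \<forall>x\<in>\<Omega>. enn2ereal (V i x) < R"
    and "I\<^sub>K < \<infinity>"
  shows "box_integral n T a b
           (\<lambda>x. \<Sum>i\<in>UNIV. ennreal
              (pderiv_at i G (\<chi> k. \<bar>f k x\<bar>) powr \<alpha> * \<bar>D i x\<bar> powr \<alpha> * \<omega> i x))
         \<le> ennreal (K * G (\<chi> i. enn2real (U i)) powr (\<alpha> / (\<alpha> + \<beta>)))"
proof -
  define p q where "p = \<alpha> + \<beta>" and "q = p / (p - 1)"
  note n = assms(7) and G = assms(17)
  have \<alpha>\<beta>: "0 < \<alpha>" "0 < \<beta>" and p1: "1 < p" and lam: "\<And>i. i \<in> {1..n} \<Longrightarrow> 1 \<le> lam i"
    and \<omega>: "\<And>i. \<omega> i \<in> weights n T a b" and \<tau>: "\<And>i. \<tau> i \<in> weights n T a b"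
    and Lp: "\<And>i. f i \<in> Lp_class n T a b lam p (\<tau> i)"
    using assms(9,13,14,15,18,19,22) by (auto simp: p_def)
  have pq: "1 < q" "1 / p + 1 / q = 1" "(p - 1) / p = 1 / q" using p1 by (auto simp: q_def field_simps)
  interpret B: time_box n T a b
  proof
    fix i assume i: "i \<in> {1..n}"
    show "closed (T i)" using assms(8) i by (simp add: time_scale_def)
    have "a i < b i" using assms(12) i funpow_bwd_jump_le[where T = "T i" and k = "lam i - 1" and t = "b i"] by force
    then show "a i \<in> T i \<and> b i \<in> T i \<and> a i < b i" using assms(10,11) i by (auto simp: ts_prod_def PiE_iff)
  qed
  have rdf: "rd_box n T a b lam (f i)" for i
    using Lp[of i] B.time_box_axioms by (simp add: rd_box_def rd_box_axioms_def Lp_class_def)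
  have fd: "delta_differentiable T j ((delta_deriv T j ^^ k) (B.Om, f i))"
    if "j \<in> {1..n}" "Suc k < lam j" for i j k
    using Lp[of i] that unfolding Lp_class_def B.Om_eq by blast
  have fz: "snd ((delta_deriv T j ^^ k) (B.Om, f i)) x = 0"
    if "j \<in> {1..n}" "k < lam j" "x \<in> B.Om" "x j = a j" for i j k x
    using Lp[of i] that unfolding Lp_class_def B.Om_eq by blast
  define \<Phi> where "\<Phi> i t = \<bar>D i t\<bar> powr p * \<tau> i t" for i t
  define Y where "Y i x = box_integral n T a x (\<lambda>t. ennreal (\<Phi> i t))" for i x
  define DV where "DV i x = pderiv_at i G (\<chi> k. enn2real (V k x))" for i x
  define DY where "DY i x = pderiv_at i G (\<chi> k. enn2real (Y k x))" for i x
  have V': "V i = (\<lambda>x. box_integral n T a x (\<lambda>t. ennreal (H_kernel n T lam x t powr (p / (p - 1)) * \<tau> i t powr (1 / (1 - p)))))" for i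
    unfolding V_def p_def by (simp only: diff_diff_eq)
  have \<tau>pos: "0 < \<tau> i x" and \<omega>pos: "0 < \<omega> i x" if "x \<in> space B.PM" for i x
    using B.measurable_weight(2)[OF \<tau> B.space_PM_Om[OF that]] B.measurable_weight(2)[OF \<omega> B.space_PM_Om[OF that]] by auto
  have Dm[measurable]: "D i \<in> borel_measurable B.PM" for i
    unfolding D_def by (rule rd_box.measurable_full_deriv[OF rdf n lam])
  have [measurable]: "\<tau> i \<in> borel_measurable B.PM" "\<omega> i \<in> borel_measurable B.PM" for i
    by (rule B.measurable_weight(1)[OF \<tau>], rule B.measurable_weight(1)[OF \<omega>])
  have \<Phi>m[measurable]: "\<Phi> i \<in> borel_measurable B.PM" for i unfolding \<Phi>_def by measurable
  have \<Phi>nn: "0 \<le> \<Phi> i x" if "x \<in> space B.PM" for i x unfolding \<Phi>_def using \<tau>pos[OF that, of i] by simp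
  have Vm[measurable]: "V i \<in> borel_measurable B.PM" for i
    unfolding V' by (rule B.box_integral_kernel_PM(1)) measurable
  have Ym[measurable]: "Y i \<in> borel_measurable B.PM" for i
    unfolding Y_def by (rule B.box_integral_density_PM(1)) measurable
  have Yx: "Y i x = (\<integral>\<^sup>+t. (if \<forall>j\<in>{1..n}. t j < x j then ennreal (\<Phi> i t) else 0) \<partial>B.PM)"
    if "x \<in> space B.PM" for i x
    unfolding Y_def by (rule B.box_integral_density_PM(2)[OF _ that]) measurable
  have UI: "U i = (\<integral>\<^sup>+t. ennreal (\<Phi> i t) \<partial>B.PM)" for i
    unfolding U_def p_def[symmetric] \<Phi>_def D_def
    by (rule B.box_integral_PM) (use \<Phi>m[of i] in \<open>simp add: \<Phi>_def[abs_def] D_def\<close>)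
  have Ufin: "U i < \<infinity>" "ereal (enn2real (U i)) < R" for i using enn2ereal_less_fin assms(21) by blast+
  \<comment> \<open>Used for the integrals \<open>Y\<close> over lower boxes and for those over
    half-spaces: whatever \<open>U i\<close> dominates is finite and stays in the domain of
    \<open>G\<close>.\<close>
  have below_U: "Z < \<infinity> \<and> ereal (enn2real Z) < R" if "Z \<le> U i" for Z i
  proof -
    have "enn2real Z \<le> enn2real (U i)" using that Ufin(1)[of i] by (intro enn2real_mono) auto
    then have "ereal (enn2real Z) < R" using le_less_trans[OF _ Ufin(2)[of i]] by simp
    then show ?thesis using le_less_trans[OF that Ufin(1)] by simp
  qed
  have YU: "Y i x \<le> U i" if "x \<in> space B.PM" for i x
    unfolding Yx[OF that] UI by (intro nn_integral_mono) simp
  have Vfin: "V i x < \<infinity>" "ereal (enn2real (V i x)) < R" if "x \<in> space B.PM" for i x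
    using enn2ereal_less_fin assms(23) B.space_PM_Om[OF that] unfolding \<Omega>_def B.Om_eq by blast+
  have yf: "(\<chi> k. enn2real (Y k x)) \<in> fin_box R" and vf: "(\<chi> k. enn2real (V k x)) \<in> fin_box R"
    and ff: "(\<chi> k. \<bar>f k x\<bar>) \<in> fin_box R" if x: "x \<in> space B.PM" for x
  proof -
    show "(\<chi> k. enn2real (Y k x)) \<in> fin_box R" "(\<chi> k. enn2real (V k x)) \<in> fin_box R"
      using below_U[OF YU[OF x]] Vfin(2)[OF x] by (auto simp: fin_box_def)
    have "ereal \<bar>f k x\<bar> < R" for k
    proof -
      have "- R < ereal (f k x)" "ereal (f k x) < R"
        using assms(20) B.space_PM_Om[OF x] unfolding \<Omega>_def B.Om_eq by auto
      then have "ereal (- f k x) < R" by (simp add: ereal_uminus_less_reorder flip: uminus_ereal.simps(1))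
      then show ?thesis using \<open>ereal (f k x) < R\<close> by (auto simp: abs_if)
    qed
    then show "(\<chi> k. \<bar>f k x\<bar>) \<in> fin_box R" by (auto simp: fin_box_def)
  qed
  have uf: "(\<chi> i. enn2real (U i)) \<in> fin_box R" using Ufin by (simp add: fin_box_def)
  have fb: "\<bar>f i x\<bar> \<le> enn2real (Y i x) powr (1 / p) * enn2real (V i x) powr (1 / q)" if x: "x \<in> space B.PM" for i x
  proof -
    have "Y i x < \<infinity>" using below_U[OF YU[OF x]] by blast
    then show ?thesis
      unfolding Y_def V' \<Phi>_def D_def pq(3)[symmetric]
      by (intro rd_box.pointwise_bound[OF rdf n lam p1 fd fz \<tau> x]) (use Vfin(1)[OF x, of i] in \<open>simp_all add: V'\<close>)
  qed
  have DVm[measurable]: "DV i \<in> borel_measurable B.PM" and DYm[measurable]: "DY i \<in> borel_measurable B.PM" for i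
    unfolding DV_def DY_def by (intro measurable_pderiv[OF G _ vf] measurable_pderiv[OF G _ yf]; measurable)+
  have nn: "0 \<le> DV i x" "0 \<le> DY i x" if "x \<in> space B.PM" for i x
    unfolding DV_def DY_def
    by (rule G_class_pderiv_mono(1)[OF G vf[OF that] vf[OF that] order_refl],
        rule G_class_pderiv_mono(1)[OF G yf[OF that] yf[OF that] order_refl])
  have pd: "0 \<le> pderiv_at i G (\<chi> k. \<bar>f k x\<bar>)"
    "pderiv_at i G (\<chi> k. \<bar>f k x\<bar>) \<le> DY i x powr (1 / p) * DV i x powr (1 / q)" if x: "x \<in> space B.PM" for i x
    unfolding DV_def DY_def
    by (rule G_class_pderiv[OF G p1 pq(1,2) ff[OF x] yf[OF x] vf[OF x]]; use fb[OF x] in simp)+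
  \<comment> \<open>The splitting is dictated by the exponents \<open>p / \<beta>\<close> and
    \<open>p / \<alpha>\<close>: \<open>u i x powr (p / \<beta>)\<close> has to be the integrand of
    \<open>I\<^sub>K\<close>, and \<open>v i x powr (p / \<alpha>)\<close> has to be
    \<open>DY i x * \<Phi> i x\<close>. The powers of the weight cancel in the product.\<close>
  define u where "u i x = DV i x powr (\<alpha> / q) * \<omega> i x * \<tau> i x powr (- (\<alpha> / p))" for i x
  define v where "v i x = (DY i x * \<Phi> i x) powr (\<alpha> / p)" for i x
  have um[measurable]: "u i \<in> borel_measurable B.PM" "v i \<in> borel_measurable B.PM" for i
    unfolding u_def v_def by measurable
  have uv: "pderiv_at i G (\<chi> k. \<bar>f k x\<bar>) powr \<alpha> * \<bar>D i x\<bar> powr \<alpha> * \<omega> i x \<le> u i x * v i x" if x: "x \<in> space B.PM" for i x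
  proof -
    have t: "\<tau> i x powr (- (\<alpha> / p)) * \<tau> i x powr (\<alpha> / p) = 1"
      using \<tau>pos[OF x, of i] by (simp add: powr_add[symmetric])
    have "pderiv_at i G (\<chi> k. \<bar>f k x\<bar>) powr \<alpha> \<le> (DY i x powr (1 / p) * DV i x powr (1 / q)) powr \<alpha>"
      using pd[OF x] \<alpha>\<beta> by (intro powr_mono2) auto
    also have "\<dots> = DY i x powr (\<alpha> / p) * DV i x powr (\<alpha> / q)" by (simp add: powr_mult powr_powr)
    finally have "pderiv_at i G (\<chi> k. \<bar>f k x\<bar>) powr \<alpha> * (\<bar>D i x\<bar> powr \<alpha> * \<omega> i x) \<le>
      DY i x powr (\<alpha> / p) * DV i x powr (\<alpha> / q) * (\<bar>D i x\<bar> powr \<alpha> * \<omega> i x)"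
      using \<omega>pos[OF x, of i] by (intro mult_right_mono) auto
    also have "\<dots> = DY i x powr (\<alpha> / p) * DV i x powr (\<alpha> / q) * (\<bar>D i x\<bar> powr \<alpha> * \<omega> i x) * (\<tau> i x powr (- (\<alpha> / p)) * \<tau> i x powr (\<alpha> / p))"
      unfolding t by simp
    also have "\<dots> = u i x * v i x"
      using nn[OF x] \<tau>pos[OF x, of i] p1 by (simp add: u_def v_def \<Phi>_def powr_mult powr_powr mult_ac)
    finally show ?thesis by (simp only: mult.assoc)
  qed
  \<comment> \<open>Passing to the measurable majorant first avoids any measurability question about
    \<open>f\<close>.\<close>
  have "box_integral n T a b (\<lambda>x. \<Sum>i\<in>UNIV. ennreal
      (pderiv_at i G (\<chi> k. \<bar>f k x\<bar>) powr \<alpha> * \<bar>D i x\<bar> powr \<alpha> * \<omega> i x)) \<le>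
    box_integral n T a b (\<lambda>x. \<Sum>i\<in>UNIV. ennreal (u i x * v i x))"
    by (intro B.box_integral_mono_PM sum_mono ennreal_leI uv)
  also have "\<dots> = (\<integral>\<^sup>+x. (\<Sum>i\<in>UNIV. ennreal (u i x * v i x)) \<partial>B.PM)"
    by (rule B.box_integral_PM) measurable
  also have "\<dots> \<le> ennreal (enn2real I\<^sub>K powr (1 / (p / \<beta>)) * G (\<chi> i. enn2real (U i)) powr (1 / (p / \<alpha>)))"
  proof (rule Hoelder_sum_nn_integral)
    show "1 < p / \<beta>" "1 < p / \<alpha>" using \<alpha>\<beta> by (auto simp: p_def)
    show "1 / (p / \<beta>) + 1 / (p / \<alpha>) = 1" using \<alpha>\<beta> by (simp add: p_def divide_simps)
    show "0 \<le> u i x" if "x \<in> space B.PM" for i x using \<omega>pos[OF that, of i] by (simp add: u_def)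
    show "0 \<le> v i x" for i x by (simp add: v_def)
    have "(\<integral>\<^sup>+x. (\<Sum>i\<in>UNIV. ennreal (u i x powr (p / \<beta>))) \<partial>B.PM) = I\<^sub>K"
    proof -
      have e: "\<alpha> / q * (p / \<beta>) = \<alpha> * (p - 1) / \<beta>" using p1 \<alpha>\<beta> by (simp add: q_def field_simps)
      have e2: "- (\<alpha> / p) * (p / \<beta>) = - (\<alpha> / \<beta>)" using p1 by simp
      have "I\<^sub>K = (\<integral>\<^sup>+x. (\<Sum>i\<in>UNIV. ennreal (DV i x powr (\<alpha> * (p - 1) / \<beta>) * \<omega> i x powr (p / \<beta>) * \<tau> i x powr (- (\<alpha> / \<beta>)))) \<partial>B.PM)"
        unfolding I\<^sub>K_def p_def[symmetric] DV_def[symmetric] by (rule B.box_integral_PM) measurable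
      also have "\<dots> = (\<integral>\<^sup>+x. (\<Sum>i\<in>UNIV. ennreal (u i x powr (p / \<beta>))) \<partial>B.PM)"
      proof (intro nn_integral_cong sum.cong refl arg_cong[where f = ennreal])
        fix x i assume x: "x \<in> space B.PM"
        show "DV i x powr (\<alpha> * (p - 1) / \<beta>) * \<omega> i x powr (p / \<beta>) * \<tau> i x powr (- (\<alpha> / \<beta>)) = u i x powr (p / \<beta>)"
          unfolding u_def e[symmetric] e2[symmetric] powr_powr[symmetric]
          using \<omega>pos[OF x, of i] by (simp only: powr_mult powr_ge_zero mult_nonneg_nonneg less_imp_le)
      qed
      finally show ?thesis by (rule sym)
    qed
    then show "(\<integral>\<^sup>+x. (\<Sum>i\<in>UNIV. ennreal (u i x powr (p / \<beta>))) \<partial>B.PM) \<le> ennreal (enn2real I\<^sub>K)"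
      using assms(24) by simp
    show "(\<integral>\<^sup>+x. (\<Sum>i\<in>UNIV. ennreal (v i x powr (p / \<alpha>))) \<partial>B.PM) \<le> ennreal (G (\<chi> i. enn2real (U i)))"
    proof -
      have one: "1 \<in> {1..n}" using n by simp
      have x1: "(\<lambda>x. x 1) \<in> borel_measurable B.PM" by (rule B.measurable_coord[OF one one])
      \<comment> \<open>The half-space below \<open>s\<close> in the first coordinate contains every
        lower box with \<open>x 1 = s\<close>, and the coordinate \<open>x 1\<close> is the
        parameter of \<open>G_class_integral_le\<close>.\<close>
      define y where "y s = (\<chi> i. enn2real (\<integral>\<^sup>+t. ennreal (\<Phi> i t) * indicator {..<s} (t 1) \<partial>B.PM))" for s
      have yU: "(\<integral>\<^sup>+t. ennreal (\<Phi> i t) * indicator {..<s} (t 1) \<partial>B.PM) \<le> U i" for s i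
        unfolding UI by (intro nn_integral_mono) (simp split: split_indicator)
      have yfin: "y s \<in> fin_box R" for s using below_U[OF yU] by (auto simp: fin_box_def y_def)
      have "(\<integral>\<^sup>+x. (\<Sum>i\<in>UNIV. ennreal (v i x powr (p / \<alpha>))) \<partial>B.PM) \<le> (\<integral>\<^sup>+x. (\<Sum>i\<in>UNIV. ennreal (pderiv_at i G (y (x 1)) * \<Phi> i x)) \<partial>B.PM)"
      proof (intro nn_integral_mono sum_mono ennreal_leI)
        fix x i assume x: "x \<in> space B.PM"
        have "v i x powr (p / \<alpha>) = DY i x * \<Phi> i x"
          using nn[OF x] \<Phi>nn[OF x] p1 \<alpha>\<beta> by (simp add: v_def powr_powr)
        also have "\<dots> \<le> pderiv_at i G (y (x 1)) * \<Phi> i x"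
          unfolding DY_def
        proof (intro mult_right_mono \<Phi>nn[OF x] G_class_pderiv_mono(2)[OF G yf[OF x] yfin])
          fix k
          have "Y k x \<le> (\<integral>\<^sup>+t. ennreal (\<Phi> k t) * indicator {..<x 1} (t 1) \<partial>B.PM)"
            unfolding Yx[OF x] using one by (intro nn_integral_mono) (auto split: split_indicator)
          then show "(\<chi> k. enn2real (Y k x)) $ k \<le> y (x 1) $ k"
            using below_U[OF yU[of k "x 1"]] unfolding y_def by (simp add: enn2real_mono)
        qed
        finally show "v i x powr (p / \<alpha>) \<le> pderiv_at i G (y (x 1)) * \<Phi> i x" .
      qed
      also have "\<dots> \<le> ennreal (G (\<chi> i. enn2real (U i)))"
        unfolding y_def UI
      proof (rule G_class_integral_le[OF G x1])
        show "a 1 < b 1" using B.ab[OF one] by blast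
        show "a 1 \<le> x 1 \<and> x 1 < b 1" if "x \<in> space B.PM" for x using that one unfolding B.space_PM by blast
        show "(\<integral>\<^sup>+x. ennreal (\<Phi> i x) \<partial>B.PM) < \<infinity>" for i using Ufin(1) unfolding UI .
        show "(\<chi> i. enn2real (\<integral>\<^sup>+x. ennreal (\<Phi> i x) \<partial>B.PM)) \<in> fin_box R" using uf unfolding UI .
      qed (use \<Phi>m \<Phi>nn in auto)
      finally show ?thesis .
    qed
    \<comment> \<open>The Hoelder lemma asks for a nonnegative bound; \<open>G\<close> at
      \<open>U\<close> is one, because it is an increment from \<open>G 0 = 0\<close> with
      nonnegative partial derivatives.\<close>
    have z: "(0 :: real ^ 'm) \<in> fin_box R" using assms(16) by (simp add: fin_box_def zero_ereal_def)
    have unn: "0 \<le> (\<chi> i. enn2real (U i)) $ i" for i by simp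
    have "0 \<le> (\<Sum>i\<in>UNIV. pderiv_at i G 0 * ((\<chi> i. enn2real (U i)) $ i - 0 $ i))"
      using G_class_pderiv_mono(1)[OF G z z order_refl] by (intro sum_nonneg mult_nonneg_nonneg) auto
    also have "\<dots> \<le> G (\<chi> i. enn2real (U i)) - G 0" by (rule G_class_increment[OF G z uf]) simp
    finally show "0 \<le> G (\<chi> i. enn2real (U i))" using G by (simp add: G_class_def)
  qed (use um in auto)
  finally show ?thesis unfolding K_def p_def by simp
qed

end
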